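(* (Join extension theorem) Suppose $f:X\to Y$ is $M$-connected, and let $P:Y\to\mathcal{U}$ be a family of $(M\ast N)$-local types for some type $N$. Then precomposition by $f$, i.e. $$\lambda s.\,s\circ f:\Big(\prod_{y:Y}P(y)\Big)\to\Big(\prod_{x:X}P(f(x))\Big),$$ is an $N$-local map.
   Context: Setting: Martin-Löf type theory with function extensionality and a univalent universe $\mathcal{U}$ closed under the usual type formers and homotopy pushouts; types are in $\mathcal{U}$. The join $M\ast N$ of types is the pushout of the projections $M\leftarrow M\times N\to N$. A type $A$ is $M$-local if the map $\lambda a.\lambda x.\,a:A\to(M\to A)$ is an equivalence. A map is $M$-local if all of its homotopy fibers are $M$-local. A type $A$ is $M$-connected if every $M$-local type is $A$-local; a map is $M$-connected if all of its homotopy fibers are $M$-connected. *)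

theory Defs
  imports Main
begin

text \<open>
  Martin-Loef type theory with function extensionality and a univalent universe that is closed
  under \<Pi>, \<Sigma>, identity types, 0, 1, +, the natural numbers and homotopy pushouts, as a deductive
  system on raw de Bruijn terms. A statement of type theory is a type, and to prove it is to
  exhibit a term of that type.

  \<^item> Types are the terms \<open>A\<close> with \<open>\<Gamma> \<turnstile> A \<Ztypecolon> \<T>\<close>. Here \<open>\<T>\<close> only marks the judgement ``is a type'':
    it has no type itself and nothing can be quantified over it. The small types are the terms
    of the universe \<open>\<U>\<close>, which is a type and is a universe a la Russell.
  \<^item> The system has judgemental \<eta> for \<Pi> but not for \<Sigma>. Pushouts are higher inductive types
    whose eliminator computes judgementally on points and up to a path on \<open>Glue\<close>.
  \<^item> The constructors carry enough annotations to determine their type up to conversion.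
\<close>

section \<open>Raw terms and substitution\<close>

datatype level = Small | Large

datatype tm =
    Var nat
  | Univ level
  | Pi tm tm | Lam tm tm | App tm tm
  | Sig tm tm | Dpair tm tm tm tm | SigInd tm tm tm
  | Idt tm tm tm | Refl tm tm | J tm tm tm tm
  | EmptyT | EmptyInd tm tm
  | UnitT | Star | UnitInd tm tm tm
  | SumT tm tm | Cinl tm tm tm | Cinr tm tm tm | SumInd tm tm tm tm
  | NatT | Zero | Succ tm | NatInd tm tm tm tm
  | Push tm tm tm tm tm
  | PInl tm tm tm tm tm tm | PInr tm tm tm tm tm tm | Glue tm tm tm tm tm tm
  | PushInd tm tm tm tm tm
  | PushComp tm tm tm tm tm tm tm tm tm tm
  | Funext tm tm tm tm
  | Ua tm tm

abbreviation \<U> :: tm where "\<U> \<equiv> Univ Small"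
abbreviation \<T> :: tm where "\<T> \<equiv> Univ Large"

definition up_ren :: "(nat \<Rightarrow> nat) \<Rightarrow> nat \<Rightarrow> nat" where
  "up_ren r = case_nat 0 (\<lambda>n. Suc (r n))"

text \<open>
  Binding structure: the second argument of \<open>Pi\<close>, \<open>Lam\<close>, \<open>Sig\<close> and \<open>Dpair\<close> binds one variable.
  All motives bind the eliminated element, the motive of \<open>J\<close> binds the free endpoint and the path.
  The branches of \<open>SigInd\<close> (both components), \<open>SumInd\<close>, \<open>NatInd\<close> (predecessor and induction
  hypothesis) and \<open>PushInd\<close>, \<open>PushComp\<close> (points of the three vertices of the span) bind too.
\<close>

primrec ren :: "(nat \<Rightarrow> nat) \<Rightarrow> tm \<Rightarrow> tm" where
  "ren r (Var n) = Var (r n)"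
| "ren r (Univ s) = Univ s"
| "ren r (Pi A B) = Pi (ren r A) (ren (up_ren r) B)"
| "ren r (Lam A b) = Lam (ren r A) (ren (up_ren r) b)"
| "ren r (App f a) = App (ren r f) (ren r a)"
| "ren r (Sig A B) = Sig (ren r A) (ren (up_ren r) B)"
| "ren r (Dpair A B a b) = Dpair (ren r A) (ren (up_ren r) B) (ren r a) (ren r b)"
| "ren r (SigInd P d p) = SigInd (ren (up_ren r) P) (ren (up_ren (up_ren r)) d) (ren r p)"
| "ren r (Idt A a b) = Idt (ren r A) (ren r a) (ren r b)"
| "ren r (Refl A a) = Refl (ren r A) (ren r a)"
| "ren r (J P d b p) = J (ren (up_ren (up_ren r)) P) (ren r d) (ren r b) (ren r p)"
| "ren r EmptyT = EmptyT"
| "ren r (EmptyInd P z) = EmptyInd (ren (up_ren r) P) (ren r z)"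
| "ren r UnitT = UnitT"
| "ren r Star = Star"
| "ren r (UnitInd P d z) = UnitInd (ren (up_ren r) P) (ren r d) (ren r z)"
| "ren r (SumT A B) = SumT (ren r A) (ren r B)"
| "ren r (Cinl A B a) = Cinl (ren r A) (ren r B) (ren r a)"
| "ren r (Cinr A B b) = Cinr (ren r A) (ren r B) (ren r b)"
| "ren r (SumInd P c d z) =
     SumInd (ren (up_ren r) P) (ren (up_ren r) c) (ren (up_ren r) d) (ren r z)"
| "ren r NatT = NatT"
| "ren r Zero = Zero"
| "ren r (Succ n) = Succ (ren r n)"
| "ren r (NatInd P c d n) =
     NatInd (ren (up_ren r) P) (ren r c) (ren (up_ren (up_ren r)) d) (ren r n)"
| "ren r (Push C A B f g) = Push (ren r C) (ren r A) (ren r B) (ren r f) (ren r g)"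
| "ren r (PInl C A B f g a) =
     PInl (ren r C) (ren r A) (ren r B) (ren r f) (ren r g) (ren r a)"
| "ren r (PInr C A B f g b) =
     PInr (ren r C) (ren r A) (ren r B) (ren r f) (ren r g) (ren r b)"
| "ren r (Glue C A B f g c) =
     Glue (ren r C) (ren r A) (ren r B) (ren r f) (ren r g) (ren r c)"
| "ren r (PushInd P u v w z) =
     PushInd (ren (up_ren r) P) (ren (up_ren r) u) (ren (up_ren r) v) (ren (up_ren r) w) (ren r z)"
| "ren r (PushComp C A B f g P u v w c) =
     PushComp (ren r C) (ren r A) (ren r B) (ren r f) (ren r g)
       (ren (up_ren r) P) (ren (up_ren r) u) (ren (up_ren r) v) (ren (up_ren r) w) (ren r c)"
| "ren r (Funext A B f g) = Funext (ren r A) (ren (up_ren r) B) (ren r f) (ren r g)"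
| "ren r (Ua A B) = Ua (ren r A) (ren r B)"

abbreviation shift :: "nat \<Rightarrow> tm \<Rightarrow> tm" where
  "shift k \<equiv> ren (\<lambda>n. n + k)"

text \<open>Shifts the free variables of a term that has one bound variable.\<close>

abbreviation shift1 :: "nat \<Rightarrow> tm \<Rightarrow> tm" where
  "shift1 k \<equiv> ren (up_ren (\<lambda>n. n + k))"

definition up :: "(nat \<Rightarrow> tm) \<Rightarrow> nat \<Rightarrow> tm" where
  "up s = case_nat (Var 0) (\<lambda>n. shift 1 (s n))"

primrec subst :: "(nat \<Rightarrow> tm) \<Rightarrow> tm \<Rightarrow> tm" where
  "subst s (Var n) = s n"
| "subst s (Univ l) = Univ l"
| "subst s (Pi A B) = Pi (subst s A) (subst (up s) B)"
| "subst s (Lam A b) = Lam (subst s A) (subst (up s) b)"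
| "subst s (App f a) = App (subst s f) (subst s a)"
| "subst s (Sig A B) = Sig (subst s A) (subst (up s) B)"
| "subst s (Dpair A B a b) = Dpair (subst s A) (subst (up s) B) (subst s a) (subst s b)"
| "subst s (SigInd P d p) = SigInd (subst (up s) P) (subst (up (up s)) d) (subst s p)"
| "subst s (Idt A a b) = Idt (subst s A) (subst s a) (subst s b)"
| "subst s (Refl A a) = Refl (subst s A) (subst s a)"
| "subst s (J P d b p) = J (subst (up (up s)) P) (subst s d) (subst s b) (subst s p)"
| "subst s EmptyT = EmptyT"
| "subst s (EmptyInd P z) = EmptyInd (subst (up s) P) (subst s z)"
| "subst s UnitT = UnitT"
| "subst s Star = Star"
| "subst s (UnitInd P d z) = UnitInd (subst (up s) P) (subst s d) (subst s z)"
| "subst s (SumT A B) = SumT (subst s A) (subst s B)"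
| "subst s (Cinl A B a) = Cinl (subst s A) (subst s B) (subst s a)"
| "subst s (Cinr A B b) = Cinr (subst s A) (subst s B) (subst s b)"
| "subst s (SumInd P c d z) =
     SumInd (subst (up s) P) (subst (up s) c) (subst (up s) d) (subst s z)"
| "subst s NatT = NatT"
| "subst s Zero = Zero"
| "subst s (Succ n) = Succ (subst s n)"
| "subst s (NatInd P c d n) =
     NatInd (subst (up s) P) (subst s c) (subst (up (up s)) d) (subst s n)"
| "subst s (Push C A B f g) =
     Push (subst s C) (subst s A) (subst s B) (subst s f) (subst s g)"
| "subst s (PInl C A B f g a) =
     PInl (subst s C) (subst s A) (subst s B) (subst s f) (subst s g) (subst s a)"
| "subst s (PInr C A B f g b) =
     PInr (subst s C) (subst s A) (subst s B) (subst s f) (subst s g) (subst s b)"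
| "subst s (Glue C A B f g c) =
     Glue (subst s C) (subst s A) (subst s B) (subst s f) (subst s g) (subst s c)"
| "subst s (PushInd P u v w z) =
     PushInd (subst (up s) P) (subst (up s) u) (subst (up s) v) (subst (up s) w) (subst s z)"
| "subst s (PushComp C A B f g P u v w c) =
     PushComp (subst s C) (subst s A) (subst s B) (subst s f) (subst s g)
       (subst (up s) P) (subst (up s) u) (subst (up s) v) (subst (up s) w) (subst s c)"
| "subst s (Funext A B f g) = Funext (subst s A) (subst (up s) B) (subst s f) (subst s g)"
| "subst s (Ua A B) = Ua (subst s A) (subst s B)"

text \<open>
  \<open>inst k t a\<close> replaces variable \<open>0\<close> of \<open>t\<close> by \<open>a\<close>, where \<open>a\<close> lives in a context with \<open>k\<close>
  additional variables. \<open>inst2 t a b\<close> replaces variable \<open>1\<close> by \<open>a\<close> and variable \<open>0\<close> by \<open>b\<close>.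
\<close>

definition inst :: "nat \<Rightarrow> tm \<Rightarrow> tm \<Rightarrow> tm" where
  "inst k t a = subst (case_nat a (\<lambda>n. Var (n + k))) t"

definition inst2 :: "tm \<Rightarrow> tm \<Rightarrow> tm \<Rightarrow> tm" where
  "inst2 t a b = subst (case_nat b (case_nat a Var)) t"


section \<open>Basic constructions inside type theory\<close>

text \<open>
  These are operations on raw terms. All arguments live in the ambient context, except that
  families (\<open>P\<close>, the \<open>B\<close> of \<open>happly\<close>) and the dependent function \<open>d\<close> of \<open>apd\<close> have one bound
  variable.
\<close>

definition arr :: "tm \<Rightarrow> tm \<Rightarrow> tm" where
  "arr A B = Pi A (shift 1 B)"

definition times :: "tm \<Rightarrow> tm \<Rightarrow> tm" where
  "times A B = Sig A (shift 1 B)"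

definition pair :: "tm \<Rightarrow> tm \<Rightarrow> tm \<Rightarrow> tm \<Rightarrow> tm" where
  "pair A B a b = Dpair A (shift 1 B) a b"

definition proj1 :: "tm \<Rightarrow> tm \<Rightarrow> tm" where
  "proj1 A B = Lam (times A B) (SigInd (shift 2 A) (Var 1) (Var 0))"

definition proj2 :: "tm \<Rightarrow> tm \<Rightarrow> tm" where
  "proj2 A B = Lam (times A B) (SigInd (shift 2 B) (Var 0) (Var 0))"

text \<open>The transport of \<open>u : P a\<close> along \<open>p : a = b\<close>.\<close>

definition transport :: "tm \<Rightarrow> tm \<Rightarrow> tm \<Rightarrow> tm \<Rightarrow> tm" where
  "transport P u b p = J (shift 1 P) u b p"

definition apd :: "tm \<Rightarrow> tm \<Rightarrow> tm \<Rightarrow> tm \<Rightarrow> tm \<Rightarrow> tm" where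
  "apd P d a b p =
     J (Idt (inst 2 P (Var 1))
            (transport (shift1 2 P) (shift 2 (inst 0 d a)) (Var 1) (Var 0))
            (inst 2 d (Var 1)))
       (Refl (inst 0 P a) (inst 0 d a)) b p"

text \<open>Equivalences are the maps with a section and a retraction.\<close>

definition has_section :: "tm \<Rightarrow> tm \<Rightarrow> tm \<Rightarrow> tm" where
  "has_section A B f =
     Sig (arr B A)
       (Pi (shift 1 B) (Idt (shift 2 B) (App (shift 2 f) (App (Var 1) (Var 0))) (Var 0)))"

definition has_retraction :: "tm \<Rightarrow> tm \<Rightarrow> tm \<Rightarrow> tm" where
  "has_retraction A B f =
     Sig (arr B A)
       (Pi (shift 1 A) (Idt (shift 2 A) (App (Var 1) (App (shift 2 f) (Var 0))) (Var 0)))"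

definition is_equiv :: "tm \<Rightarrow> tm \<Rightarrow> tm \<Rightarrow> tm" where
  "is_equiv A B f = times (has_section A B f) (has_retraction A B f)"

definition equiv :: "tm \<Rightarrow> tm \<Rightarrow> tm" where
  "equiv A B = Sig (arr A B) (is_equiv (shift 1 A) (shift 1 B) (Var 0))"

definition id_fun :: "tm \<Rightarrow> tm" where
  "id_fun A = Lam A (Var 0)"

definition id_equiv :: "tm \<Rightarrow> tm" where
  "id_equiv A =
     (let sec = Pi (shift 1 A)
                  (Idt (shift 2 A) (App (id_fun (shift 2 A)) (App (Var 1) (Var 0))) (Var 0));
          ret = Pi (shift 1 A)
                  (Idt (shift 2 A) (App (Var 1) (App (id_fun (shift 2 A)) (Var 0))) (Var 0));
          h = Lam A (Refl (shift 1 A) (Var 0))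
      in Dpair (arr A A) (is_equiv (shift 1 A) (shift 1 A) (Var 0)) (id_fun A)
           (pair (has_section A A (id_fun A)) (has_retraction A A (id_fun A))
             (Dpair (arr A A) sec (id_fun A) h)
             (Dpair (arr A A) ret (id_fun A) h)))"

text \<open>The canonical maps \<open>f = g \<rightarrow> (\<Pi>x:A. f x = g x)\<close> and \<open>A = B \<rightarrow> A \<simeq> B\<close>.\<close>

definition htpy :: "tm \<Rightarrow> tm \<Rightarrow> tm \<Rightarrow> tm \<Rightarrow> tm" where
  "htpy A B f g = Pi A (Idt B (App (shift 1 f) (Var 0)) (App (shift 1 g) (Var 0)))"

definition happly :: "tm \<Rightarrow> tm \<Rightarrow> tm \<Rightarrow> tm \<Rightarrow> tm" where
  "happly A B f g =
     Lam (Idt (Pi A B) f g)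
       (J (htpy (shift 3 A) (shift1 3 B) (shift 3 f) (Var 1))
          (Lam (shift 1 A) (Refl (shift1 1 B) (App (shift 2 f) (Var 0))))
          (shift 1 g) (Var 0))"

definition id_to_equiv :: "tm \<Rightarrow> tm \<Rightarrow> tm" where
  "id_to_equiv A B =
     Lam (Idt \<U> A B)
       (J (equiv (shift 3 A) (Var 1)) (id_equiv (shift 1 A)) (shift 1 B) (Var 0))"

text \<open>
  For the pushout of \<open>f : C \<rightarrow> A\<close> and \<open>g : C \<rightarrow> B\<close> and a family \<open>P\<close> over it, the type of the glue
  datum over \<open>c : C\<close> of the eliminator: the transport of \<open>u (f c)\<close> along \<open>glue c\<close> equals \<open>v (g c)\<close>.
\<close>

definition glue_datum :: "tm \<Rightarrow> tm \<Rightarrow> tm \<Rightarrow> tm \<Rightarrow> tm \<Rightarrow> tm \<Rightarrow> tm \<Rightarrow> tm \<Rightarrow> tm \<Rightarrow> tm" where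
  "glue_datum C A B f g P u v c =
     Idt (inst 0 P (PInr C A B f g (App g c)))
       (transport P (inst 0 u (App f c)) (PInr C A B f g (App g c)) (Glue C A B f g c))
       (inst 0 v (App g c))"


section \<open>Judgements\<close>

text \<open>
  Contexts list the types of the variables, innermost variable first. The redundant typing
  premises of the equality rules only serve to make the metatheory more convenient.
\<close>

inductive
  wf_ctx :: "tm list \<Rightarrow> bool"
    ("_ \<turnstile> ctx" [60] 60) and
  has_type :: "tm list \<Rightarrow> tm \<Rightarrow> tm \<Rightarrow> bool"
    ("_ \<turnstile> _ \<Ztypecolon> _" [60, 60, 60] 60) and
  jeq :: "tm list \<Rightarrow> tm \<Rightarrow> tm \<Rightarrow> tm \<Rightarrow> bool"
    ("_ \<turnstile> _ \<doteq> _ \<Ztypecolon> _" [60, 60, 60, 60] 60)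
where
\<comment> \<open>contexts, variables, universe, conversion\<close>
  ctx_Nil: "[] \<turnstile> ctx"
| ctx_Cons: "\<lbrakk>\<Gamma> \<turnstile> ctx; \<Gamma> \<turnstile> A \<Ztypecolon> \<T>\<rbrakk> \<Longrightarrow> A # \<Gamma> \<turnstile> ctx"
| t_Var: "\<lbrakk>\<Gamma> \<turnstile> ctx; n < length \<Gamma>\<rbrakk> \<Longrightarrow> \<Gamma> \<turnstile> Var n \<Ztypecolon> shift (Suc n) (\<Gamma> ! n)"
| t_Univ: "\<Gamma> \<turnstile> ctx \<Longrightarrow> \<Gamma> \<turnstile> \<U> \<Ztypecolon> \<T>"
| t_El: "\<Gamma> \<turnstile> A \<Ztypecolon> \<U> \<Longrightarrow> \<Gamma> \<turnstile> A \<Ztypecolon> \<T>"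
| t_conv: "\<lbrakk>\<Gamma> \<turnstile> a \<Ztypecolon> A; \<Gamma> \<turnstile> A \<doteq> B \<Ztypecolon> \<T>\<rbrakk> \<Longrightarrow> \<Gamma> \<turnstile> a \<Ztypecolon> B"
| e_refl: "\<Gamma> \<turnstile> a \<Ztypecolon> A \<Longrightarrow> \<Gamma> \<turnstile> a \<doteq> a \<Ztypecolon> A"
| e_sym: "\<Gamma> \<turnstile> a \<doteq> b \<Ztypecolon> A \<Longrightarrow> \<Gamma> \<turnstile> b \<doteq> a \<Ztypecolon> A"
| e_trans: "\<lbrakk>\<Gamma> \<turnstile> a \<doteq> b \<Ztypecolon> A; \<Gamma> \<turnstile> b \<doteq> c \<Ztypecolon> A\<rbrakk> \<Longrightarrow> \<Gamma> \<turnstile> a \<doteq> c \<Ztypecolon> A"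
| e_El: "\<Gamma> \<turnstile> A \<doteq> B \<Ztypecolon> \<U> \<Longrightarrow> \<Gamma> \<turnstile> A \<doteq> B \<Ztypecolon> \<T>"
| e_conv: "\<lbrakk>\<Gamma> \<turnstile> a \<doteq> b \<Ztypecolon> A; \<Gamma> \<turnstile> A \<doteq> B \<Ztypecolon> \<T>\<rbrakk> \<Longrightarrow> \<Gamma> \<turnstile> a \<doteq> b \<Ztypecolon> B"

\<comment> \<open>dependent functions\<close>
| t_Pi: "\<lbrakk>\<Gamma> \<turnstile> A \<Ztypecolon> Univ l; A # \<Gamma> \<turnstile> B \<Ztypecolon> Univ l\<rbrakk> \<Longrightarrow> \<Gamma> \<turnstile> Pi A B \<Ztypecolon> Univ l"
| t_Lam: "\<lbrakk>\<Gamma> \<turnstile> A \<Ztypecolon> \<T>; A # \<Gamma> \<turnstile> B \<Ztypecolon> \<T>; A # \<Gamma> \<turnstile> b \<Ztypecolon> B\<rbrakk> \<Longrightarrow> \<Gamma> \<turnstile> Lam A b \<Ztypecolon> Pi A B"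
| t_App: "\<lbrakk>\<Gamma> \<turnstile> A \<Ztypecolon> \<T>; A # \<Gamma> \<turnstile> B \<Ztypecolon> \<T>; \<Gamma> \<turnstile> f \<Ztypecolon> Pi A B; \<Gamma> \<turnstile> a \<Ztypecolon> A\<rbrakk>
    \<Longrightarrow> \<Gamma> \<turnstile> App f a \<Ztypecolon> inst 0 B a"
| e_Pi: "\<lbrakk>\<Gamma> \<turnstile> A \<Ztypecolon> Univ l; \<Gamma> \<turnstile> A \<doteq> A' \<Ztypecolon> Univ l; A # \<Gamma> \<turnstile> B \<doteq> B' \<Ztypecolon> Univ l\<rbrakk>
    \<Longrightarrow> \<Gamma> \<turnstile> Pi A B \<doteq> Pi A' B' \<Ztypecolon> Univ l"
| e_Lam: "\<lbrakk>\<Gamma> \<turnstile> A \<Ztypecolon> \<T>; A # \<Gamma> \<turnstile> B \<Ztypecolon> \<T>; \<Gamma> \<turnstile> A \<doteq> A' \<Ztypecolon> \<T>; A # \<Gamma> \<turnstile> b \<doteq> b' \<Ztypecolon> B\<rbrakk>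
    \<Longrightarrow> \<Gamma> \<turnstile> Lam A b \<doteq> Lam A' b' \<Ztypecolon> Pi A B"
| e_App: "\<lbrakk>\<Gamma> \<turnstile> A \<Ztypecolon> \<T>; A # \<Gamma> \<turnstile> B \<Ztypecolon> \<T>; \<Gamma> \<turnstile> f \<doteq> f' \<Ztypecolon> Pi A B; \<Gamma> \<turnstile> a \<doteq> a' \<Ztypecolon> A\<rbrakk>
    \<Longrightarrow> \<Gamma> \<turnstile> App f a \<doteq> App f' a' \<Ztypecolon> inst 0 B a"
| e_beta: "\<lbrakk>\<Gamma> \<turnstile> A \<Ztypecolon> \<T>; A # \<Gamma> \<turnstile> B \<Ztypecolon> \<T>; A # \<Gamma> \<turnstile> b \<Ztypecolon> B; \<Gamma> \<turnstile> a \<Ztypecolon> A\<rbrakk>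
    \<Longrightarrow> \<Gamma> \<turnstile> App (Lam A b) a \<doteq> inst 0 b a \<Ztypecolon> inst 0 B a"
| e_eta: "\<lbrakk>\<Gamma> \<turnstile> A \<Ztypecolon> \<T>; A # \<Gamma> \<turnstile> B \<Ztypecolon> \<T>; \<Gamma> \<turnstile> f \<Ztypecolon> Pi A B\<rbrakk>
    \<Longrightarrow> \<Gamma> \<turnstile> f \<doteq> Lam A (App (shift 1 f) (Var 0)) \<Ztypecolon> Pi A B"

\<comment> \<open>dependent pairs\<close>
| t_Sig: "\<lbrakk>\<Gamma> \<turnstile> A \<Ztypecolon> Univ l; A # \<Gamma> \<turnstile> B \<Ztypecolon> Univ l\<rbrakk> \<Longrightarrow> \<Gamma> \<turnstile> Sig A B \<Ztypecolon> Univ l"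
| t_Dpair: "\<lbrakk>\<Gamma> \<turnstile> A \<Ztypecolon> \<T>; A # \<Gamma> \<turnstile> B \<Ztypecolon> \<T>; \<Gamma> \<turnstile> a \<Ztypecolon> A; \<Gamma> \<turnstile> b \<Ztypecolon> inst 0 B a\<rbrakk>
    \<Longrightarrow> \<Gamma> \<turnstile> Dpair A B a b \<Ztypecolon> Sig A B"
| t_SigInd: "\<lbrakk>\<Gamma> \<turnstile> A \<Ztypecolon> \<T>; A # \<Gamma> \<turnstile> B \<Ztypecolon> \<T>; Sig A B # \<Gamma> \<turnstile> P \<Ztypecolon> \<T>;
      B # A # \<Gamma> \<turnstile> d \<Ztypecolon> inst 2 P (Dpair (shift 2 A) (shift1 2 B) (Var 1) (Var 0));
      \<Gamma> \<turnstile> p \<Ztypecolon> Sig A B\<rbrakk>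
    \<Longrightarrow> \<Gamma> \<turnstile> SigInd P d p \<Ztypecolon> inst 0 P p"
| e_Sig: "\<lbrakk>\<Gamma> \<turnstile> A \<Ztypecolon> Univ l; \<Gamma> \<turnstile> A \<doteq> A' \<Ztypecolon> Univ l; A # \<Gamma> \<turnstile> B \<doteq> B' \<Ztypecolon> Univ l\<rbrakk>
    \<Longrightarrow> \<Gamma> \<turnstile> Sig A B \<doteq> Sig A' B' \<Ztypecolon> Univ l"
| e_Dpair: "\<lbrakk>\<Gamma> \<turnstile> A \<Ztypecolon> \<T>; A # \<Gamma> \<turnstile> B \<Ztypecolon> \<T>; \<Gamma> \<turnstile> A \<doteq> A' \<Ztypecolon> \<T>; A # \<Gamma> \<turnstile> B \<doteq> B' \<Ztypecolon> \<T>;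
      \<Gamma> \<turnstile> a \<doteq> a' \<Ztypecolon> A; \<Gamma> \<turnstile> b \<doteq> b' \<Ztypecolon> inst 0 B a\<rbrakk>
    \<Longrightarrow> \<Gamma> \<turnstile> Dpair A B a b \<doteq> Dpair A' B' a' b' \<Ztypecolon> Sig A B"
| e_SigInd: "\<lbrakk>\<Gamma> \<turnstile> A \<Ztypecolon> \<T>; A # \<Gamma> \<turnstile> B \<Ztypecolon> \<T>; Sig A B # \<Gamma> \<turnstile> P \<Ztypecolon> \<T>; Sig A B # \<Gamma> \<turnstile> P \<doteq> P' \<Ztypecolon> \<T>;
      B # A # \<Gamma> \<turnstile> d \<doteq> d' \<Ztypecolon> inst 2 P (Dpair (shift 2 A) (shift1 2 B) (Var 1) (Var 0));
      \<Gamma> \<turnstile> p \<doteq> p' \<Ztypecolon> Sig A B\<rbrakk>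
    \<Longrightarrow> \<Gamma> \<turnstile> SigInd P d p \<doteq> SigInd P' d' p' \<Ztypecolon> inst 0 P p"
| e_SigInd_Dpair: "\<lbrakk>\<Gamma> \<turnstile> A \<Ztypecolon> \<T>; A # \<Gamma> \<turnstile> B \<Ztypecolon> \<T>; Sig A B # \<Gamma> \<turnstile> P \<Ztypecolon> \<T>;
      B # A # \<Gamma> \<turnstile> d \<Ztypecolon> inst 2 P (Dpair (shift 2 A) (shift1 2 B) (Var 1) (Var 0));
      \<Gamma> \<turnstile> a \<Ztypecolon> A; \<Gamma> \<turnstile> b \<Ztypecolon> inst 0 B a\<rbrakk>
    \<Longrightarrow> \<Gamma> \<turnstile> SigInd P d (Dpair A B a b) \<doteq> inst2 d a b \<Ztypecolon> inst 0 P (Dpair A B a b)"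

\<comment> \<open>identity types, with based path induction\<close>
| t_Idt: "\<lbrakk>\<Gamma> \<turnstile> A \<Ztypecolon> Univ l; \<Gamma> \<turnstile> a \<Ztypecolon> A; \<Gamma> \<turnstile> b \<Ztypecolon> A\<rbrakk> \<Longrightarrow> \<Gamma> \<turnstile> Idt A a b \<Ztypecolon> Univ l"
| t_Refl: "\<lbrakk>\<Gamma> \<turnstile> A \<Ztypecolon> \<T>; \<Gamma> \<turnstile> a \<Ztypecolon> A\<rbrakk> \<Longrightarrow> \<Gamma> \<turnstile> Refl A a \<Ztypecolon> Idt A a a"
| t_J: "\<lbrakk>\<Gamma> \<turnstile> A \<Ztypecolon> \<T>; \<Gamma> \<turnstile> a \<Ztypecolon> A; Idt (shift 1 A) (shift 1 a) (Var 0) # A # \<Gamma> \<turnstile> P \<Ztypecolon> \<T>;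
      \<Gamma> \<turnstile> d \<Ztypecolon> inst2 P a (Refl A a); \<Gamma> \<turnstile> b \<Ztypecolon> A; \<Gamma> \<turnstile> p \<Ztypecolon> Idt A a b\<rbrakk>
    \<Longrightarrow> \<Gamma> \<turnstile> J P d b p \<Ztypecolon> inst2 P b p"
| e_Idt: "\<lbrakk>\<Gamma> \<turnstile> A \<doteq> A' \<Ztypecolon> Univ l; \<Gamma> \<turnstile> a \<doteq> a' \<Ztypecolon> A; \<Gamma> \<turnstile> b \<doteq> b' \<Ztypecolon> A\<rbrakk>
    \<Longrightarrow> \<Gamma> \<turnstile> Idt A a b \<doteq> Idt A' a' b' \<Ztypecolon> Univ l"
| e_Refl: "\<lbrakk>\<Gamma> \<turnstile> A \<doteq> A' \<Ztypecolon> \<T>; \<Gamma> \<turnstile> a \<doteq> a' \<Ztypecolon> A\<rbrakk> \<Longrightarrow> \<Gamma> \<turnstile> Refl A a \<doteq> Refl A' a' \<Ztypecolon> Idt A a a"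
| e_J: "\<lbrakk>\<Gamma> \<turnstile> A \<Ztypecolon> \<T>; \<Gamma> \<turnstile> a \<Ztypecolon> A; Idt (shift 1 A) (shift 1 a) (Var 0) # A # \<Gamma> \<turnstile> P \<Ztypecolon> \<T>;
      Idt (shift 1 A) (shift 1 a) (Var 0) # A # \<Gamma> \<turnstile> P \<doteq> P' \<Ztypecolon> \<T>;
      \<Gamma> \<turnstile> d \<doteq> d' \<Ztypecolon> inst2 P a (Refl A a); \<Gamma> \<turnstile> b \<doteq> b' \<Ztypecolon> A; \<Gamma> \<turnstile> p \<doteq> p' \<Ztypecolon> Idt A a b\<rbrakk>
    \<Longrightarrow> \<Gamma> \<turnstile> J P d b p \<doteq> J P' d' b' p' \<Ztypecolon> inst2 P b p"
| e_J_Refl: "\<lbrakk>\<Gamma> \<turnstile> A \<Ztypecolon> \<T>; \<Gamma> \<turnstile> a \<Ztypecolon> A; Idt (shift 1 A) (shift 1 a) (Var 0) # A # \<Gamma> \<turnstile> P \<Ztypecolon> \<T>;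
      \<Gamma> \<turnstile> d \<Ztypecolon> inst2 P a (Refl A a)\<rbrakk>
    \<Longrightarrow> \<Gamma> \<turnstile> J P d a (Refl A a) \<doteq> d \<Ztypecolon> inst2 P a (Refl A a)"

\<comment> \<open>empty type\<close>
| t_EmptyT: "\<Gamma> \<turnstile> ctx \<Longrightarrow> \<Gamma> \<turnstile> EmptyT \<Ztypecolon> \<U>"
| t_EmptyInd: "\<lbrakk>EmptyT # \<Gamma> \<turnstile> P \<Ztypecolon> \<T>; \<Gamma> \<turnstile> z \<Ztypecolon> EmptyT\<rbrakk> \<Longrightarrow> \<Gamma> \<turnstile> EmptyInd P z \<Ztypecolon> inst 0 P z"
| e_EmptyInd: "\<lbrakk>EmptyT # \<Gamma> \<turnstile> P \<doteq> P' \<Ztypecolon> \<T>; \<Gamma> \<turnstile> z \<doteq> z' \<Ztypecolon> EmptyT\<rbrakk>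
    \<Longrightarrow> \<Gamma> \<turnstile> EmptyInd P z \<doteq> EmptyInd P' z' \<Ztypecolon> inst 0 P z"

\<comment> \<open>unit type\<close>
| t_UnitT: "\<Gamma> \<turnstile> ctx \<Longrightarrow> \<Gamma> \<turnstile> UnitT \<Ztypecolon> \<U>"
| t_Star: "\<Gamma> \<turnstile> ctx \<Longrightarrow> \<Gamma> \<turnstile> Star \<Ztypecolon> UnitT"
| t_UnitInd: "\<lbrakk>UnitT # \<Gamma> \<turnstile> P \<Ztypecolon> \<T>; \<Gamma> \<turnstile> d \<Ztypecolon> inst 0 P Star; \<Gamma> \<turnstile> z \<Ztypecolon> UnitT\<rbrakk>
    \<Longrightarrow> \<Gamma> \<turnstile> UnitInd P d z \<Ztypecolon> inst 0 P z"
| e_UnitInd: "\<lbrakk>UnitT # \<Gamma> \<turnstile> P \<Ztypecolon> \<T>; UnitT # \<Gamma> \<turnstile> P \<doteq> P' \<Ztypecolon> \<T>; \<Gamma> \<turnstile> d \<doteq> d' \<Ztypecolon> inst 0 P Star;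
      \<Gamma> \<turnstile> z \<doteq> z' \<Ztypecolon> UnitT\<rbrakk>
    \<Longrightarrow> \<Gamma> \<turnstile> UnitInd P d z \<doteq> UnitInd P' d' z' \<Ztypecolon> inst 0 P z"
| e_UnitInd_Star: "\<lbrakk>UnitT # \<Gamma> \<turnstile> P \<Ztypecolon> \<T>; \<Gamma> \<turnstile> d \<Ztypecolon> inst 0 P Star\<rbrakk>
    \<Longrightarrow> \<Gamma> \<turnstile> UnitInd P d Star \<doteq> d \<Ztypecolon> inst 0 P Star"

\<comment> \<open>coproducts\<close>
| t_SumT: "\<lbrakk>\<Gamma> \<turnstile> A \<Ztypecolon> Univ l; \<Gamma> \<turnstile> B \<Ztypecolon> Univ l\<rbrakk> \<Longrightarrow> \<Gamma> \<turnstile> SumT A B \<Ztypecolon> Univ l"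
| t_Cinl: "\<lbrakk>\<Gamma> \<turnstile> A \<Ztypecolon> \<T>; \<Gamma> \<turnstile> B \<Ztypecolon> \<T>; \<Gamma> \<turnstile> a \<Ztypecolon> A\<rbrakk> \<Longrightarrow> \<Gamma> \<turnstile> Cinl A B a \<Ztypecolon> SumT A B"
| t_Cinr: "\<lbrakk>\<Gamma> \<turnstile> A \<Ztypecolon> \<T>; \<Gamma> \<turnstile> B \<Ztypecolon> \<T>; \<Gamma> \<turnstile> b \<Ztypecolon> B\<rbrakk> \<Longrightarrow> \<Gamma> \<turnstile> Cinr A B b \<Ztypecolon> SumT A B"
| t_SumInd: "\<lbrakk>\<Gamma> \<turnstile> A \<Ztypecolon> \<T>; \<Gamma> \<turnstile> B \<Ztypecolon> \<T>; SumT A B # \<Gamma> \<turnstile> P \<Ztypecolon> \<T>;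
      A # \<Gamma> \<turnstile> c \<Ztypecolon> inst 1 P (Cinl (shift 1 A) (shift 1 B) (Var 0));
      B # \<Gamma> \<turnstile> d \<Ztypecolon> inst 1 P (Cinr (shift 1 A) (shift 1 B) (Var 0));
      \<Gamma> \<turnstile> z \<Ztypecolon> SumT A B\<rbrakk>
    \<Longrightarrow> \<Gamma> \<turnstile> SumInd P c d z \<Ztypecolon> inst 0 P z"
| e_SumT: "\<lbrakk>\<Gamma> \<turnstile> A \<doteq> A' \<Ztypecolon> Univ l; \<Gamma> \<turnstile> B \<doteq> B' \<Ztypecolon> Univ l\<rbrakk> \<Longrightarrow> \<Gamma> \<turnstile> SumT A B \<doteq> SumT A' B' \<Ztypecolon> Univ l"
| e_Cinl: "\<lbrakk>\<Gamma> \<turnstile> A \<doteq> A' \<Ztypecolon> \<T>; \<Gamma> \<turnstile> B \<doteq> B' \<Ztypecolon> \<T>; \<Gamma> \<turnstile> a \<doteq> a' \<Ztypecolon> A\<rbrakk>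
    \<Longrightarrow> \<Gamma> \<turnstile> Cinl A B a \<doteq> Cinl A' B' a' \<Ztypecolon> SumT A B"
| e_Cinr: "\<lbrakk>\<Gamma> \<turnstile> A \<doteq> A' \<Ztypecolon> \<T>; \<Gamma> \<turnstile> B \<doteq> B' \<Ztypecolon> \<T>; \<Gamma> \<turnstile> b \<doteq> b' \<Ztypecolon> B\<rbrakk>
    \<Longrightarrow> \<Gamma> \<turnstile> Cinr A B b \<doteq> Cinr A' B' b' \<Ztypecolon> SumT A B"
| e_SumInd: "\<lbrakk>\<Gamma> \<turnstile> A \<Ztypecolon> \<T>; \<Gamma> \<turnstile> B \<Ztypecolon> \<T>; SumT A B # \<Gamma> \<turnstile> P \<Ztypecolon> \<T>; SumT A B # \<Gamma> \<turnstile> P \<doteq> P' \<Ztypecolon> \<T>;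
      A # \<Gamma> \<turnstile> c \<doteq> c' \<Ztypecolon> inst 1 P (Cinl (shift 1 A) (shift 1 B) (Var 0));
      B # \<Gamma> \<turnstile> d \<doteq> d' \<Ztypecolon> inst 1 P (Cinr (shift 1 A) (shift 1 B) (Var 0));
      \<Gamma> \<turnstile> z \<doteq> z' \<Ztypecolon> SumT A B\<rbrakk>
    \<Longrightarrow> \<Gamma> \<turnstile> SumInd P c d z \<doteq> SumInd P' c' d' z' \<Ztypecolon> inst 0 P z"
| e_SumInd_Cinl: "\<lbrakk>\<Gamma> \<turnstile> A \<Ztypecolon> \<T>; \<Gamma> \<turnstile> B \<Ztypecolon> \<T>; SumT A B # \<Gamma> \<turnstile> P \<Ztypecolon> \<T>;
      A # \<Gamma> \<turnstile> c \<Ztypecolon> inst 1 P (Cinl (shift 1 A) (shift 1 B) (Var 0));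
      B # \<Gamma> \<turnstile> d \<Ztypecolon> inst 1 P (Cinr (shift 1 A) (shift 1 B) (Var 0));
      \<Gamma> \<turnstile> a \<Ztypecolon> A\<rbrakk>
    \<Longrightarrow> \<Gamma> \<turnstile> SumInd P c d (Cinl A B a) \<doteq> inst 0 c a \<Ztypecolon> inst 0 P (Cinl A B a)"
| e_SumInd_Cinr: "\<lbrakk>\<Gamma> \<turnstile> A \<Ztypecolon> \<T>; \<Gamma> \<turnstile> B \<Ztypecolon> \<T>; SumT A B # \<Gamma> \<turnstile> P \<Ztypecolon> \<T>;
      A # \<Gamma> \<turnstile> c \<Ztypecolon> inst 1 P (Cinl (shift 1 A) (shift 1 B) (Var 0));
      B # \<Gamma> \<turnstile> d \<Ztypecolon> inst 1 P (Cinr (shift 1 A) (shift 1 B) (Var 0));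
      \<Gamma> \<turnstile> b \<Ztypecolon> B\<rbrakk>
    \<Longrightarrow> \<Gamma> \<turnstile> SumInd P c d (Cinr A B b) \<doteq> inst 0 d b \<Ztypecolon> inst 0 P (Cinr A B b)"

\<comment> \<open>natural numbers\<close>
| t_NatT: "\<Gamma> \<turnstile> ctx \<Longrightarrow> \<Gamma> \<turnstile> NatT \<Ztypecolon> \<U>"
| t_Zero: "\<Gamma> \<turnstile> ctx \<Longrightarrow> \<Gamma> \<turnstile> Zero \<Ztypecolon> NatT"
| t_Succ: "\<Gamma> \<turnstile> n \<Ztypecolon> NatT \<Longrightarrow> \<Gamma> \<turnstile> Succ n \<Ztypecolon> NatT"
| t_NatInd: "\<lbrakk>NatT # \<Gamma> \<turnstile> P \<Ztypecolon> \<T>; \<Gamma> \<turnstile> c \<Ztypecolon> inst 0 P Zero;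
      P # NatT # \<Gamma> \<turnstile> d \<Ztypecolon> inst 2 P (Succ (Var 1)); \<Gamma> \<turnstile> n \<Ztypecolon> NatT\<rbrakk>
    \<Longrightarrow> \<Gamma> \<turnstile> NatInd P c d n \<Ztypecolon> inst 0 P n"
| e_Succ: "\<Gamma> \<turnstile> n \<doteq> n' \<Ztypecolon> NatT \<Longrightarrow> \<Gamma> \<turnstile> Succ n \<doteq> Succ n' \<Ztypecolon> NatT"
| e_NatInd: "\<lbrakk>NatT # \<Gamma> \<turnstile> P \<Ztypecolon> \<T>; NatT # \<Gamma> \<turnstile> P \<doteq> P' \<Ztypecolon> \<T>; \<Gamma> \<turnstile> c \<doteq> c' \<Ztypecolon> inst 0 P Zero;
      P # NatT # \<Gamma> \<turnstile> d \<doteq> d' \<Ztypecolon> inst 2 P (Succ (Var 1)); \<Gamma> \<turnstile> n \<doteq> n' \<Ztypecolon> NatT\<rbrakk>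
    \<Longrightarrow> \<Gamma> \<turnstile> NatInd P c d n \<doteq> NatInd P' c' d' n' \<Ztypecolon> inst 0 P n"
| e_NatInd_Zero: "\<lbrakk>NatT # \<Gamma> \<turnstile> P \<Ztypecolon> \<T>; \<Gamma> \<turnstile> c \<Ztypecolon> inst 0 P Zero;
      P # NatT # \<Gamma> \<turnstile> d \<Ztypecolon> inst 2 P (Succ (Var 1))\<rbrakk>
    \<Longrightarrow> \<Gamma> \<turnstile> NatInd P c d Zero \<doteq> c \<Ztypecolon> inst 0 P Zero"
| e_NatInd_Succ: "\<lbrakk>NatT # \<Gamma> \<turnstile> P \<Ztypecolon> \<T>; \<Gamma> \<turnstile> c \<Ztypecolon> inst 0 P Zero;
      P # NatT # \<Gamma> \<turnstile> d \<Ztypecolon> inst 2 P (Succ (Var 1)); \<Gamma> \<turnstile> n \<Ztypecolon> NatT\<rbrakk>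
    \<Longrightarrow> \<Gamma> \<turnstile> NatInd P c d (Succ n) \<doteq> inst2 d n (NatInd P c d n) \<Ztypecolon> inst 0 P (Succ n)"

\<comment> \<open>homotopy pushouts\<close>
| t_Push: "\<lbrakk>\<Gamma> \<turnstile> C \<Ztypecolon> \<U>; \<Gamma> \<turnstile> A \<Ztypecolon> \<U>; \<Gamma> \<turnstile> B \<Ztypecolon> \<U>; \<Gamma> \<turnstile> f \<Ztypecolon> arr C A; \<Gamma> \<turnstile> g \<Ztypecolon> arr C B\<rbrakk>
    \<Longrightarrow> \<Gamma> \<turnstile> Push C A B f g \<Ztypecolon> \<U>"
| t_PInl: "\<lbrakk>\<Gamma> \<turnstile> C \<Ztypecolon> \<U>; \<Gamma> \<turnstile> A \<Ztypecolon> \<U>; \<Gamma> \<turnstile> B \<Ztypecolon> \<U>; \<Gamma> \<turnstile> f \<Ztypecolon> arr C A; \<Gamma> \<turnstile> g \<Ztypecolon> arr C B;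
      \<Gamma> \<turnstile> a \<Ztypecolon> A\<rbrakk>
    \<Longrightarrow> \<Gamma> \<turnstile> PInl C A B f g a \<Ztypecolon> Push C A B f g"
| t_PInr: "\<lbrakk>\<Gamma> \<turnstile> C \<Ztypecolon> \<U>; \<Gamma> \<turnstile> A \<Ztypecolon> \<U>; \<Gamma> \<turnstile> B \<Ztypecolon> \<U>; \<Gamma> \<turnstile> f \<Ztypecolon> arr C A; \<Gamma> \<turnstile> g \<Ztypecolon> arr C B;
      \<Gamma> \<turnstile> b \<Ztypecolon> B\<rbrakk>
    \<Longrightarrow> \<Gamma> \<turnstile> PInr C A B f g b \<Ztypecolon> Push C A B f g"
| t_Glue: "\<lbrakk>\<Gamma> \<turnstile> C \<Ztypecolon> \<U>; \<Gamma> \<turnstile> A \<Ztypecolon> \<U>; \<Gamma> \<turnstile> B \<Ztypecolon> \<U>; \<Gamma> \<turnstile> f \<Ztypecolon> arr C A; \<Gamma> \<turnstile> g \<Ztypecolon> arr C B;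
      \<Gamma> \<turnstile> c \<Ztypecolon> C\<rbrakk>
    \<Longrightarrow> \<Gamma> \<turnstile> Glue C A B f g c \<Ztypecolon> 
          Idt (Push C A B f g) (PInl C A B f g (App f c)) (PInr C A B f g (App g c))"
| t_PushInd: "\<lbrakk>\<Gamma> \<turnstile> C \<Ztypecolon> \<U>; \<Gamma> \<turnstile> A \<Ztypecolon> \<U>; \<Gamma> \<turnstile> B \<Ztypecolon> \<U>; \<Gamma> \<turnstile> f \<Ztypecolon> arr C A; \<Gamma> \<turnstile> g \<Ztypecolon> arr C B;
      Push C A B f g # \<Gamma> \<turnstile> P \<Ztypecolon> \<T>;
      A # \<Gamma> \<turnstile> u \<Ztypecolon> inst 1 P (PInl (shift 1 C) (shift 1 A) (shift 1 B) (shift 1 f) (shift 1 g) (Var 0));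
      B # \<Gamma> \<turnstile> v \<Ztypecolon> inst 1 P (PInr (shift 1 C) (shift 1 A) (shift 1 B) (shift 1 f) (shift 1 g) (Var 0));
      C # \<Gamma> \<turnstile> w \<Ztypecolon> glue_datum (shift 1 C) (shift 1 A) (shift 1 B) (shift 1 f) (shift 1 g)
          (shift1 1 P) (shift1 1 u) (shift1 1 v) (Var 0);
      \<Gamma> \<turnstile> z \<Ztypecolon> Push C A B f g\<rbrakk>
    \<Longrightarrow> \<Gamma> \<turnstile> PushInd P u v w z \<Ztypecolon> inst 0 P z"
| t_PushComp: "\<lbrakk>\<Gamma> \<turnstile> C \<Ztypecolon> \<U>; \<Gamma> \<turnstile> A \<Ztypecolon> \<U>; \<Gamma> \<turnstile> B \<Ztypecolon> \<U>; \<Gamma> \<turnstile> f \<Ztypecolon> arr C A; \<Gamma> \<turnstile> g \<Ztypecolon> arr C B;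
      Push C A B f g # \<Gamma> \<turnstile> P \<Ztypecolon> \<T>;
      A # \<Gamma> \<turnstile> u \<Ztypecolon> inst 1 P (PInl (shift 1 C) (shift 1 A) (shift 1 B) (shift 1 f) (shift 1 g) (Var 0));
      B # \<Gamma> \<turnstile> v \<Ztypecolon> inst 1 P (PInr (shift 1 C) (shift 1 A) (shift 1 B) (shift 1 f) (shift 1 g) (Var 0));
      C # \<Gamma> \<turnstile> w \<Ztypecolon> glue_datum (shift 1 C) (shift 1 A) (shift 1 B) (shift 1 f) (shift 1 g)
          (shift1 1 P) (shift1 1 u) (shift1 1 v) (Var 0);
      \<Gamma> \<turnstile> c \<Ztypecolon> C\<rbrakk>
    \<Longrightarrow> \<Gamma> \<turnstile> PushComp C A B f g P u v w c \<Ztypecolon> 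
          Idt (glue_datum C A B f g P u v c)
            (apd P (PushInd (shift1 1 P) (shift1 1 u) (shift1 1 v) (shift1 1 w) (Var 0))
              (PInl C A B f g (App f c)) (PInr C A B f g (App g c)) (Glue C A B f g c))
            (inst 0 w c)"
| e_Push: "\<lbrakk>\<Gamma> \<turnstile> C \<Ztypecolon> \<U>; \<Gamma> \<turnstile> A \<Ztypecolon> \<U>; \<Gamma> \<turnstile> B \<Ztypecolon> \<U>; \<Gamma> \<turnstile> f \<Ztypecolon> arr C A; \<Gamma> \<turnstile> g \<Ztypecolon> arr C B;
      \<Gamma> \<turnstile> C \<doteq> C' \<Ztypecolon> \<U>; \<Gamma> \<turnstile> A \<doteq> A' \<Ztypecolon> \<U>; \<Gamma> \<turnstile> B \<doteq> B' \<Ztypecolon> \<U>; \<Gamma> \<turnstile> f \<doteq> f' \<Ztypecolon> arr C A; \<Gamma> \<turnstile> g \<doteq> g' \<Ztypecolon> arr C B\<rbrakk>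
    \<Longrightarrow> \<Gamma> \<turnstile> Push C A B f g \<doteq> Push C' A' B' f' g' \<Ztypecolon> \<U>"
| e_PInl: "\<lbrakk>\<Gamma> \<turnstile> C \<Ztypecolon> \<U>; \<Gamma> \<turnstile> A \<Ztypecolon> \<U>; \<Gamma> \<turnstile> B \<Ztypecolon> \<U>; \<Gamma> \<turnstile> f \<Ztypecolon> arr C A; \<Gamma> \<turnstile> g \<Ztypecolon> arr C B;
      \<Gamma> \<turnstile> C \<doteq> C' \<Ztypecolon> \<U>; \<Gamma> \<turnstile> A \<doteq> A' \<Ztypecolon> \<U>; \<Gamma> \<turnstile> B \<doteq> B' \<Ztypecolon> \<U>; \<Gamma> \<turnstile> f \<doteq> f' \<Ztypecolon> arr C A; \<Gamma> \<turnstile> g \<doteq> g' \<Ztypecolon> arr C B;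
      \<Gamma> \<turnstile> a \<doteq> a' \<Ztypecolon> A\<rbrakk>
    \<Longrightarrow> \<Gamma> \<turnstile> PInl C A B f g a \<doteq> PInl C' A' B' f' g' a' \<Ztypecolon> Push C A B f g"
| e_PInr: "\<lbrakk>\<Gamma> \<turnstile> C \<Ztypecolon> \<U>; \<Gamma> \<turnstile> A \<Ztypecolon> \<U>; \<Gamma> \<turnstile> B \<Ztypecolon> \<U>; \<Gamma> \<turnstile> f \<Ztypecolon> arr C A; \<Gamma> \<turnstile> g \<Ztypecolon> arr C B;
      \<Gamma> \<turnstile> C \<doteq> C' \<Ztypecolon> \<U>; \<Gamma> \<turnstile> A \<doteq> A' \<Ztypecolon> \<U>; \<Gamma> \<turnstile> B \<doteq> B' \<Ztypecolon> \<U>; \<Gamma> \<turnstile> f \<doteq> f' \<Ztypecolon> arr C A; \<Gamma> \<turnstile> g \<doteq> g' \<Ztypecolon> arr C B;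
      \<Gamma> \<turnstile> b \<doteq> b' \<Ztypecolon> B\<rbrakk>
    \<Longrightarrow> \<Gamma> \<turnstile> PInr C A B f g b \<doteq> PInr C' A' B' f' g' b' \<Ztypecolon> Push C A B f g"
| e_Glue: "\<lbrakk>\<Gamma> \<turnstile> C \<Ztypecolon> \<U>; \<Gamma> \<turnstile> A \<Ztypecolon> \<U>; \<Gamma> \<turnstile> B \<Ztypecolon> \<U>; \<Gamma> \<turnstile> f \<Ztypecolon> arr C A; \<Gamma> \<turnstile> g \<Ztypecolon> arr C B;
      \<Gamma> \<turnstile> C \<doteq> C' \<Ztypecolon> \<U>; \<Gamma> \<turnstile> A \<doteq> A' \<Ztypecolon> \<U>; \<Gamma> \<turnstile> B \<doteq> B' \<Ztypecolon> \<U>; \<Gamma> \<turnstile> f \<doteq> f' \<Ztypecolon> arr C A; \<Gamma> \<turnstile> g \<doteq> g' \<Ztypecolon> arr C B;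
      \<Gamma> \<turnstile> c \<doteq> c' \<Ztypecolon> C\<rbrakk>
    \<Longrightarrow> \<Gamma> \<turnstile> Glue C A B f g c \<doteq> Glue C' A' B' f' g' c' \<Ztypecolon> 
          Idt (Push C A B f g) (PInl C A B f g (App f c)) (PInr C A B f g (App g c))"
| e_PushInd: "\<lbrakk>\<Gamma> \<turnstile> C \<Ztypecolon> \<U>; \<Gamma> \<turnstile> A \<Ztypecolon> \<U>; \<Gamma> \<turnstile> B \<Ztypecolon> \<U>; \<Gamma> \<turnstile> f \<Ztypecolon> arr C A; \<Gamma> \<turnstile> g \<Ztypecolon> arr C B;
      Push C A B f g # \<Gamma> \<turnstile> P \<Ztypecolon> \<T>; Push C A B f g # \<Gamma> \<turnstile> P \<doteq> P' \<Ztypecolon> \<T>;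
      A # \<Gamma> \<turnstile> u \<Ztypecolon> inst 1 P (PInl (shift 1 C) (shift 1 A) (shift 1 B) (shift 1 f) (shift 1 g) (Var 0)); 
      A # \<Gamma> \<turnstile> u \<doteq> u' \<Ztypecolon> inst 1 P (PInl (shift 1 C) (shift 1 A) (shift 1 B) (shift 1 f) (shift 1 g) (Var 0));
      B # \<Gamma> \<turnstile> v \<Ztypecolon> inst 1 P (PInr (shift 1 C) (shift 1 A) (shift 1 B) (shift 1 f) (shift 1 g) (Var 0)); 
      B # \<Gamma> \<turnstile> v \<doteq> v' \<Ztypecolon> inst 1 P (PInr (shift 1 C) (shift 1 A) (shift 1 B) (shift 1 f) (shift 1 g) (Var 0));
      C # \<Gamma> \<turnstile> w \<doteq> w' \<Ztypecolon> glue_datum (shift 1 C) (shift 1 A) (shift 1 B) (shift 1 f) (shift 1 g)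
          (shift1 1 P) (shift1 1 u) (shift1 1 v) (Var 0);
      \<Gamma> \<turnstile> z \<doteq> z' \<Ztypecolon> Push C A B f g\<rbrakk>
    \<Longrightarrow> \<Gamma> \<turnstile> PushInd P u v w z \<doteq> PushInd P' u' v' w' z' \<Ztypecolon> inst 0 P z"
| e_PushComp: "\<lbrakk>\<Gamma> \<turnstile> C \<Ztypecolon> \<U>; \<Gamma> \<turnstile> A \<Ztypecolon> \<U>; \<Gamma> \<turnstile> B \<Ztypecolon> \<U>; \<Gamma> \<turnstile> f \<Ztypecolon> arr C A; \<Gamma> \<turnstile> g \<Ztypecolon> arr C B;
      \<Gamma> \<turnstile> C \<doteq> C' \<Ztypecolon> \<U>; \<Gamma> \<turnstile> A \<doteq> A' \<Ztypecolon> \<U>; \<Gamma> \<turnstile> B \<doteq> B' \<Ztypecolon> \<U>; \<Gamma> \<turnstile> f \<doteq> f' \<Ztypecolon> arr C A; \<Gamma> \<turnstile> g \<doteq> g' \<Ztypecolon> arr C B;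
      Push C A B f g # \<Gamma> \<turnstile> P \<Ztypecolon> \<T>; Push C A B f g # \<Gamma> \<turnstile> P \<doteq> P' \<Ztypecolon> \<T>;
      A # \<Gamma> \<turnstile> u \<Ztypecolon> inst 1 P (PInl (shift 1 C) (shift 1 A) (shift 1 B) (shift 1 f) (shift 1 g) (Var 0)); 
      A # \<Gamma> \<turnstile> u \<doteq> u' \<Ztypecolon> inst 1 P (PInl (shift 1 C) (shift 1 A) (shift 1 B) (shift 1 f) (shift 1 g) (Var 0));
      B # \<Gamma> \<turnstile> v \<Ztypecolon> inst 1 P (PInr (shift 1 C) (shift 1 A) (shift 1 B) (shift 1 f) (shift 1 g) (Var 0)); 
      B # \<Gamma> \<turnstile> v \<doteq> v' \<Ztypecolon> inst 1 P (PInr (shift 1 C) (shift 1 A) (shift 1 B) (shift 1 f) (shift 1 g) (Var 0));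
      C # \<Gamma> \<turnstile> w \<doteq> w' \<Ztypecolon> glue_datum (shift 1 C) (shift 1 A) (shift 1 B) (shift 1 f) (shift 1 g)
          (shift1 1 P) (shift1 1 u) (shift1 1 v) (Var 0);
      \<Gamma> \<turnstile> c \<doteq> c' \<Ztypecolon> C\<rbrakk>
    \<Longrightarrow> \<Gamma> \<turnstile> PushComp C A B f g P u v w c \<doteq> PushComp C' A' B' f' g' P' u' v' w' c' \<Ztypecolon> 
          Idt (glue_datum C A B f g P u v c)
            (apd P (PushInd (shift1 1 P) (shift1 1 u) (shift1 1 v) (shift1 1 w) (Var 0))
              (PInl C A B f g (App f c)) (PInr C A B f g (App g c)) (Glue C A B f g c))
            (inst 0 w c)"
| e_PushInd_PInl: "\<lbrakk>\<Gamma> \<turnstile> C \<Ztypecolon> \<U>; \<Gamma> \<turnstile> A \<Ztypecolon> \<U>; \<Gamma> \<turnstile> B \<Ztypecolon> \<U>; \<Gamma> \<turnstile> f \<Ztypecolon> arr C A; \<Gamma> \<turnstile> g \<Ztypecolon> arr C B;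
      Push C A B f g # \<Gamma> \<turnstile> P \<Ztypecolon> \<T>;
      A # \<Gamma> \<turnstile> u \<Ztypecolon> inst 1 P (PInl (shift 1 C) (shift 1 A) (shift 1 B) (shift 1 f) (shift 1 g) (Var 0));
      B # \<Gamma> \<turnstile> v \<Ztypecolon> inst 1 P (PInr (shift 1 C) (shift 1 A) (shift 1 B) (shift 1 f) (shift 1 g) (Var 0));
      C # \<Gamma> \<turnstile> w \<Ztypecolon> glue_datum (shift 1 C) (shift 1 A) (shift 1 B) (shift 1 f) (shift 1 g)
          (shift1 1 P) (shift1 1 u) (shift1 1 v) (Var 0);
      \<Gamma> \<turnstile> a \<Ztypecolon> A\<rbrakk>
    \<Longrightarrow> \<Gamma> \<turnstile> PushInd P u v w (PInl C A B f g a) \<doteq> inst 0 u a \<Ztypecolon> inst 0 P (PInl C A B f g a)"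
| e_PushInd_PInr: "\<lbrakk>\<Gamma> \<turnstile> C \<Ztypecolon> \<U>; \<Gamma> \<turnstile> A \<Ztypecolon> \<U>; \<Gamma> \<turnstile> B \<Ztypecolon> \<U>; \<Gamma> \<turnstile> f \<Ztypecolon> arr C A; \<Gamma> \<turnstile> g \<Ztypecolon> arr C B;
      Push C A B f g # \<Gamma> \<turnstile> P \<Ztypecolon> \<T>;
      A # \<Gamma> \<turnstile> u \<Ztypecolon> inst 1 P (PInl (shift 1 C) (shift 1 A) (shift 1 B) (shift 1 f) (shift 1 g) (Var 0));
      B # \<Gamma> \<turnstile> v \<Ztypecolon> inst 1 P (PInr (shift 1 C) (shift 1 A) (shift 1 B) (shift 1 f) (shift 1 g) (Var 0));
      C # \<Gamma> \<turnstile> w \<Ztypecolon> glue_datum (shift 1 C) (shift 1 A) (shift 1 B) (shift 1 f) (shift 1 g)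
          (shift1 1 P) (shift1 1 u) (shift1 1 v) (Var 0);
      \<Gamma> \<turnstile> b \<Ztypecolon> B\<rbrakk>
    \<Longrightarrow> \<Gamma> \<turnstile> PushInd P u v w (PInr C A B f g b) \<doteq> inst 0 v b \<Ztypecolon> inst 0 P (PInr C A B f g b)"

\<comment> \<open>function extensionality for all types, univalence for \<open>\<U>\<close>\<close>
| t_Funext: "\<lbrakk>\<Gamma> \<turnstile> A \<Ztypecolon> \<T>; A # \<Gamma> \<turnstile> B \<Ztypecolon> \<T>;
      \<Gamma> \<turnstile> f \<Ztypecolon> Pi A B; \<Gamma> \<turnstile> g \<Ztypecolon> Pi A B\<rbrakk>
    \<Longrightarrow> \<Gamma> \<turnstile> Funext A B f g \<Ztypecolon> is_equiv (Idt (Pi A B) f g) (htpy A B f g) (happly A B f g)"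
| t_Ua: "\<lbrakk>\<Gamma> \<turnstile> A \<Ztypecolon> \<U>; \<Gamma> \<turnstile> B \<Ztypecolon> \<U>\<rbrakk>
    \<Longrightarrow> \<Gamma> \<turnstile> Ua A B \<Ztypecolon> is_equiv (Idt \<U> A B) (equiv A B) (id_to_equiv A B)"
| e_Funext: "\<lbrakk>\<Gamma> \<turnstile> A \<Ztypecolon> \<T>; A # \<Gamma> \<turnstile> B \<Ztypecolon> \<T>;
      \<Gamma> \<turnstile> A \<doteq> A' \<Ztypecolon> \<T>; A # \<Gamma> \<turnstile> B \<doteq> B' \<Ztypecolon> \<T>;
      \<Gamma> \<turnstile> f \<doteq> f' \<Ztypecolon> Pi A B; \<Gamma> \<turnstile> g \<doteq> g' \<Ztypecolon> Pi A B\<rbrakk>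
    \<Longrightarrow> \<Gamma> \<turnstile> Funext A B f g \<doteq> Funext A' B' f' g' \<Ztypecolon> is_equiv (Idt (Pi A B) f g) (htpy A B f g) (happly A B f g)"
| e_Ua: "\<lbrakk>\<Gamma> \<turnstile> A \<doteq> A' \<Ztypecolon> \<U>; \<Gamma> \<turnstile> B \<doteq> B' \<Ztypecolon> \<U>\<rbrakk>
    \<Longrightarrow> \<Gamma> \<turnstile> Ua A B \<doteq> Ua A' B' \<Ztypecolon> is_equiv (Idt \<U> A B) (equiv A B) (id_to_equiv A B)"


section \<open>Joins, locality and connectedness\<close>

definition join :: "tm \<Rightarrow> tm \<Rightarrow> tm" where
  "join M N = Push (times M N) M N (proj1 M N) (proj2 M N)"

text \<open>The fibre of \<open>f : A \<rightarrow> B\<close> over \<open>b : B\<close>.\<close>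

definition fib :: "tm \<Rightarrow> tm \<Rightarrow> tm \<Rightarrow> tm \<Rightarrow> tm" where
  "fib A B f b = Sig A (Idt (shift 1 B) (App (shift 1 f) (Var 0)) (shift 1 b))"

text \<open>\<open>A\<close> is \<open>M\<close>-local.\<close>

definition is_local :: "tm \<Rightarrow> tm \<Rightarrow> tm" where
  "is_local M A = is_equiv A (arr M A) (Lam A (Lam (shift 1 M) (Var 1)))"

text \<open>\<open>f : A \<rightarrow> B\<close> is \<open>M\<close>-local.\<close>

definition is_local_map :: "tm \<Rightarrow> tm \<Rightarrow> tm \<Rightarrow> tm \<Rightarrow> tm" where
  "is_local_map M A B f =
     Pi B (is_local (shift 1 M) (fib (shift 1 A) (shift 1 B) (shift 1 f) (Var 0)))"

text \<open>\<open>A\<close> is \<open>M\<close>-connected: \<open>\<Pi>T:\<U>. T\<close> is \<open>M\<close>-local \<open>\<rightarrow> T\<close> is \<open>A\<close>-local. This is a large type.\<close>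

definition is_connected :: "tm \<Rightarrow> tm \<Rightarrow> tm" where
  "is_connected M A =
     Pi \<U> (arr (is_local (shift 1 M) (Var 0)) (is_local (shift 1 A) (Var 0)))"

text \<open>\<open>f : A \<rightarrow> B\<close> is \<open>M\<close>-connected.\<close>

definition is_connected_map :: "tm \<Rightarrow> tm \<Rightarrow> tm \<Rightarrow> tm \<Rightarrow> tm" where
  "is_connected_map M A B f =
     Pi B (is_connected (shift 1 M) (fib (shift 1 A) (shift 1 B) (shift 1 f) (Var 0)))"

text \<open>
  For \<open>P : Y \<rightarrow> \<U>\<close>: the types \<open>\<Pi>y:Y. P y\<close> and \<open>\<Pi>x:X. P (f x)\<close>, and precomposition by
  \<open>f : X \<rightarrow> Y\<close> as a map from the first to the second.
\<close>

definition sections :: "tm \<Rightarrow> tm \<Rightarrow> tm" where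
  "sections Y P = Pi Y (App (shift 1 P) (Var 0))"

definition sections_along :: "tm \<Rightarrow> tm \<Rightarrow> tm \<Rightarrow> tm" where
  "sections_along X f P = Pi X (App (shift 1 P) (App (shift 1 f) (Var 0)))"

definition precomp :: "tm \<Rightarrow> tm \<Rightarrow> tm \<Rightarrow> tm \<Rightarrow> tm" where
  "precomp X Y f P =
     Lam (sections Y P) (Lam (shift 1 X) (App (Var 1) (App (shift 2 f) (Var 0))))"

text \<open>\<open>P : Y \<rightarrow> \<U>\<close> is a family of \<open>M\<close>-local types.\<close>

definition is_local_family :: "tm \<Rightarrow> tm \<Rightarrow> tm \<Rightarrow> tm" where
  "is_local_family M Y P = Pi Y (is_local (shift 1 M) (App (shift 1 P) (Var 0)))"

end

theory Submission
  imports Defs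
begin

text \<open>
  The fibre of precomposition by \<open>f\<close> over \<open>s : \<Pi>x. P (f x)\<close> consists of the extensions of \<open>s\<close> along \<open>f\<close>.
  Let \<open>t\<^sub>n\<close>, with homotopies \<open>w\<^sub>n x : t\<^sub>n (f x) = s x\<close>, be such extensions for \<open>n : N\<close>. The universal property of
  the join shows that the type \<open>C y\<close> of all \<open>b : P y\<close> together with paths \<open>t\<^sub>n y = b\<close> for \<open>n : N\<close> is \<open>M\<close>-local,
  because \<open>P y\<close> is \<open>(M * N)\<close>-local. As \<open>f\<close> is \<open>M\<close>-connected, the section \<open>x \<mapsto> (s x, \<lambda>n. w\<^sub>n x)\<close> of \<open>C \<circ> f\<close>
  extends to a section of \<open>C\<close>, that is, to an extension of \<open>s\<close> to which all \<open>t\<^sub>n\<close> are equal. The same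
  argument for the identity types of \<open>P\<close>, which are again \<open>(M * N)\<close>-local, shows that two extensions are
  equal if they are equal under the hypothesis \<open>n : N\<close>. For an arbitrary type these two properties
  amount to being \<open>N\<close>-local.
\<close>

text \<open>The homotopies \<open>w\<^sub>n\<close> shape the proof. Extensions of \<open>s\<close>
  are equal only through a homotopy of sections that respects their homotopies to \<open>s\<close>.
  A bare path \<open>t\<^sub>n y = b\<close> is therefore not enough: along \<open>f\<close> it has
  to be \<open>w\<^sub>n x\<close> followed by the path \<open>s x = b\<close>. This compatibility
  is an equality in \<open>C (f x)\<close>, which is why \<open>C y\<close> contains the paths. The
  glue paths of the join enter when \<open>C y\<close> is shown to be local: a map
  \<open>M \<rightarrow> C y\<close> is a map \<open>g : M \<rightarrow> P y\<close> with paths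
  \<open>t\<^sub>n y = g m\<close>, that is, a map on the join that is prescribed on
  \<open>N\<close>.

  Uniqueness is a case of existence: an equality between extensions \<open>(t, w)\<close> and
  \<open>(t', w')\<close> is an extension along \<open>f\<close> of the section
  \<open>x \<mapsto> w x \<cdot> (w' x)\<inverse>\<close> of the family \<open>t y = t' y\<close>.

  A hypothesis \<open>n : N\<close> is realised as a further variable of the context. Hence the
  lemmas are stated in arbitrary contexts, and computation rules are recorded for all extensions of
  the context. Equality inside type theory is the existence of a path term, and raw terms are
  compared by rewriting.\<close>

notation App (infixl "$" 100)

abbreviation "v0 \<equiv> Var 0"
abbreviation "v1 \<equiv> Var 1"
abbreviation "v2 \<equiv> Var 2"
abbreviation "v3 \<equiv> Var 3"
abbreviation "v4 \<equiv> Var 4"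

section \<open>The calculus of renamings and substitutions on raw terms\<close>

lemma up_ren_simps [simp]: "up_ren r 0 = 0" "up_ren r (Suc n) = Suc (r n)"
  by (simp_all add: up_ren_def)

lemma up_simps [simp]: "up s 0 = v0" "up s (Suc n) = shift 1 (s n)"
  by (simp_all add: up_def)

lemma up_ren_comp: "up_ren r \<circ> up_ren s = up_ren (r \<circ> s)"
  by (rule ext) (simp add: up_ren_def split: nat.split)

text \<open>Of the four composition laws, the one for two substitutions needs both mixed laws at
  binders, because \<open>up\<close> shifts by a renaming. The law for a renaming after a
  substitution needs the present one for the same reason.\<close>

lemma ren_ren: "ren r (ren s t) = ren (r \<circ> s) t"
  by (induction t arbitrary: r s) (simp_all add: up_ren_comp)

lemma up_up_ren: "up s \<circ> up_ren r = up (s \<circ> r)"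
  by (rule ext) (simp add: up_def up_ren_def split: nat.split)

lemma subst_ren: "subst s (ren r t) = subst (s \<circ> r) t"
  by (induction t arbitrary: r s) (simp_all add: up_up_ren)

lemma ren_up: "ren (up_ren r) \<circ> up s = up (ren r \<circ> s)"
  by (rule ext) (simp add: up_def ren_ren comp_def split: nat.split)

lemma ren_subst: "ren r (subst s t) = subst (ren r \<circ> s) t"
  by (induction t arbitrary: r s) (simp_all add: ren_up)

lemma up_subst: "subst (up s) \<circ> up u = up (subst s \<circ> u)"
  by (rule ext) (simp add: up_def subst_ren ren_subst comp_def split: nat.split)

lemma subst_subst: "subst s (subst u t) = subst (subst s \<circ> u) t"
  by (induction t arbitrary: s u) (simp_all add: up_subst)

lemma up_Var: "up (Var \<circ> r) = Var \<circ> up_ren r"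
  by (rule ext) (simp add: up_def up_ren_def split: nat.split)

lemma ren_eq_subst: "ren r t = subst (Var \<circ> r) t"
  by (induction t arbitrary: r) (simp_all add: up_Var)

lemma up_Var_id [simp]: "up Var = Var"
  by (rule ext) (simp add: up_def split: nat.split)

lemma subst_Var [simp]: "subst Var t = t"
  by (induction t) simp_all

lemma subst_cong: "(\<And>n. s n = u n) \<Longrightarrow> subst s t = subst u t"
  by (metis ext)

lemma case_nat_add [simp]:
  "case_nat a f (n + numeral k) = f (n + pred_numeral k)"
  "case_nat a f (Suc n) = f n"
  by (simp_all add: numeral_eq_Suc)

lemma up_add [simp]:
  "up s (n + numeral k) = shift 1 (s (n + pred_numeral k))"
  "up s (numeral k) = shift 1 (s (pred_numeral k))"
  "up_ren r (n + numeral k) = Suc (r (n + pred_numeral k))"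
  "up_ren r (numeral k) = Suc (r (pred_numeral k))"
  by (simp_all add: numeral_eq_Suc)

text \<open>Rewriting with these equations collapses every composite of renamings and substitutions
  into a single substitution. An identity between composites is then a pointwise check on indices,
  which \<open>subst_cong\<close> leaves as a goal.\<close>

lemmas subst_algebra = ren_eq_subst subst_subst comp_def

text \<open>In the induction over derivations the substituted conclusion of a rule must be
  recognised as a conclusion of the same rule. This and the following commutation laws cover all
  operations on terms that occur in the rules. The copies with \<open>Suc 0\<close> are for the
  simplifier, which rewrites \<open>1\<close> to that form.\<close>

lemma subst_inst:
  "subst s (inst 0 t a) = inst 0 (subst (up s) t) (subst s a)"
  "subst (up s) (inst 1 t a) = inst 1 (subst (up s) t) (subst (up s) a)"
  "subst (up s) (inst (Suc 0) t a) = inst (Suc 0) (subst (up s) t) (subst (up s) a)"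
  "subst (up (up s)) (inst 2 t a) = inst 2 (subst (up s) t) (subst (up (up s)) a)"
  "subst s (inst2 t a b) = inst2 (subst (up (up s)) t) (subst s a) (subst s b)"
  by (auto simp: inst_def inst2_def subst_algebra up_def intro!: subst_cong split: nat.split)

lemma subst_shift:
  "subst (up s) (shift (Suc 0) t) = shift (Suc 0) (subst s t)"
  "subst (up s) (shift 1 t) = shift 1 (subst s t)"
  "subst (up (up s)) (shift 2 t) = shift 2 (subst s t)"
  "subst (up (up (up s))) (shift 3 t) = shift 3 (subst s t)"
  "subst (up (up s)) (shift1 1 t) = shift1 1 (subst (up s) t)"
  "subst (up (up s)) (shift1 (Suc 0) t) = shift1 (Suc 0) (subst (up s) t)"
  "subst (up (up (up s))) (shift1 2 t) = shift1 2 (subst (up s) t)"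
  "subst (up (up (up (up s)))) (shift1 3 t) = shift1 3 (subst (up s) t)"
  by (auto simp: subst_algebra up_def up_ren_def intro!: subst_cong split: nat.split)

lemmas subst_shift_simps = subst_shift[simplified]

lemma subst_defs:
  "subst s (arr A B) = arr (subst s A) (subst s B)"
  "subst s (times A B) = times (subst s A) (subst s B)"
  "subst s (pair A B a b) = pair (subst s A) (subst s B) (subst s a) (subst s b)"
  "subst s (proj1 A B) = proj1 (subst s A) (subst s B)"
  "subst s (proj2 A B) = proj2 (subst s A) (subst s B)"
  "subst s (transport P a b p) = transport (subst (up s) P) (subst s a) (subst s b) (subst s p)"
  by (simp_all add: arr_def times_def pair_def proj1_def proj2_def transport_def subst_shift_simps)

lemma subst_apd: "subst s (apd P d a b p) = apd (subst (up s) P) (subst (up s) d) (subst s a) (subst s b) (subst s p)"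
  by (simp add: apd_def subst_shift_simps subst_inst subst_defs)
lemma subst_equiv_defs:
  "subst s (has_section A B f) = has_section (subst s A) (subst s B) (subst s f)"
  "subst s (has_retraction A B f) = has_retraction (subst s A) (subst s B) (subst s f)"
  "subst s (is_equiv A B f) = is_equiv (subst s A) (subst s B) (subst s f)"
  "subst s (equiv A B) = equiv (subst s A) (subst s B)"
  "subst s (id_fun A) = id_fun (subst s A)"
  "subst s (id_equiv A) = id_equiv (subst s A)"
  "subst s (htpy A C f g) = htpy (subst s A) (subst (up s) C) (subst s f) (subst s g)"
  "subst s (happly A C f g) = happly (subst s A) (subst (up s) C) (subst s f) (subst s g)"
  "subst s (id_to_equiv A B) = id_to_equiv (subst s A) (subst s B)"
  by (simp_all add: has_section_def has_retraction_def is_equiv_def equiv_def id_fun_def Let_def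
     id_equiv_def htpy_def happly_def id_to_equiv_def subst_defs subst_shift_simps)
lemma subst_glue_datum:
  "subst s (glue_datum C A B f g P u v c) = glue_datum (subst s C) (subst s A) (subst s B) (subst s f) (subst s g)
     (subst (up s) P) (subst (up s) u) (subst (up s) v) (subst s c)"
  by (simp add: glue_datum_def subst_inst subst_defs)

lemmas subst_comm = subst_inst subst_shift subst_shift_simps subst_defs subst_apd subst_equiv_defs subst_glue_datum

section \<open>Stability of the judgements under substitution\<close>

lemmas formation = t_Univ t_El t_Sig t_SumT t_Push t_EmptyT t_UnitT t_NatT

lemma Univ_imp_type: "\<Gamma> \<turnstile> A \<Ztypecolon> Univ l \<Longrightarrow> \<Gamma> \<turnstile> A \<Ztypecolon> \<T>"
  by (cases l) (auto intro: t_El)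

text \<open>
  The class \<open>S\<close> is first taken to consist of renamings: this gives weakening, which is needed to see
  that typed substitutions are closed under binders and so may take the place of \<open>S\<close> as well.
\<close>

lemma substitution:
  assumes S_ctx: "\<And>\<Delta> s \<Gamma>. S \<Delta> s \<Gamma> \<Longrightarrow> \<Delta> \<turnstile> ctx"
    and S_var: "\<And>\<Delta> s \<Gamma> n. S \<Delta> s \<Gamma> \<Longrightarrow> n < length \<Gamma> \<Longrightarrow> \<Delta> \<turnstile> s n \<Ztypecolon> subst s (shift (Suc n) (\<Gamma> ! n))"
    and S_up: "\<And>\<Delta> s \<Gamma> A A'. S \<Delta> s \<Gamma> \<Longrightarrow> A' = subst s A \<Longrightarrow> \<Delta> \<turnstile> A' \<Ztypecolon> \<T> \<Longrightarrow> S (A' # \<Delta>) (up s) (A # \<Gamma>)"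
    and S_wk: "\<And>\<Delta> s \<Gamma> B. S \<Delta> s \<Gamma> \<Longrightarrow> \<Delta> \<turnstile> B \<Ztypecolon> \<T> \<Longrightarrow> S (B # \<Delta>) (\<lambda>n. ren Suc (s n)) \<Gamma>"
  shows "\<Gamma> \<turnstile> ctx \<Longrightarrow> True"
    and substitution_has_type: "\<Gamma> \<turnstile> t \<Ztypecolon> A \<Longrightarrow> S \<Delta> s \<Gamma> \<Longrightarrow> A' = subst s A \<Longrightarrow> \<Delta> \<turnstile> subst s t \<Ztypecolon> A'"
    and substitution_jeq: "\<Gamma> \<turnstile> t \<doteq> u \<Ztypecolon> A \<Longrightarrow> S \<Delta> s \<Gamma> \<Longrightarrow> A' = subst s A \<Longrightarrow> \<Delta> \<turnstile> subst s t \<doteq> subst s u \<Ztypecolon> A'"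
proof (induction arbitrary: and \<Delta> s A' and \<Delta> s A' rule: wf_ctx_has_type_jeq.inducts)
  case ctx_Nil show ?case by simp
next
  case ctx_Cons show ?case by simp
next
  case t_Var show ?case unfolding t_Var.prems subst.simps by (rule S_var[OF t_Var.prems(1) t_Var.hyps(2)])
next
  case t_Univ show ?case unfolding t_Univ.prems subst.simps subst_comm
    by (rule wf_ctx_has_type_jeq.t_Univ) (auto intro!: t_Univ.IH t_Univ.prems S_up S_ctx[OF t_Univ.prems(1)] simp: subst_comm intro: formation)
next
  case t_El show ?case unfolding t_El.prems subst.simps subst_comm
    by (rule wf_ctx_has_type_jeq.t_El) (auto intro!: t_El.IH t_El.prems S_up S_ctx[OF t_El.prems(1)] simp: subst_comm intro: formation)
next
  case t_conv show ?case unfolding t_conv.prems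
    by (rule wf_ctx_has_type_jeq.t_conv[OF t_conv.IH(1)[OF t_conv.prems(1) refl] t_conv.IH(2)[OF t_conv.prems(1)]]) simp
next
  case e_refl show ?case unfolding e_refl.prems subst.simps subst_comm
    by (rule wf_ctx_has_type_jeq.e_refl) (auto intro!: e_refl.IH e_refl.prems S_up S_ctx[OF e_refl.prems(1)] simp: subst_comm intro: formation)
next
  case e_sym show ?case unfolding e_sym.prems subst.simps subst_comm
    by (rule wf_ctx_has_type_jeq.e_sym) (auto intro!: e_sym.IH e_sym.prems S_up S_ctx[OF e_sym.prems(1)] simp: subst_comm intro: formation)
next
  case (e_trans _ _ b) show ?case unfolding e_trans.prems subst.simps subst_comm
    by (rule wf_ctx_has_type_jeq.e_trans[where b="subst s b"]) (auto intro!: e_trans.IH e_trans.prems S_up S_ctx[OF e_trans.prems(1)] simp: subst_comm intro: formation)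
next
  case e_El show ?case unfolding e_El.prems subst.simps subst_comm
    by (rule wf_ctx_has_type_jeq.e_El) (auto intro!: e_El.IH e_El.prems S_up S_ctx[OF e_El.prems(1)] simp: subst_comm intro: formation)
next
  case e_conv show ?case unfolding e_conv.prems
    by (rule wf_ctx_has_type_jeq.e_conv[OF e_conv.IH(1)[OF e_conv.prems(1) refl] e_conv.IH(2)[OF e_conv.prems(1)]]) simp
next
  case (t_Pi _ _ l) show ?case unfolding t_Pi.prems subst.simps subst_comm
    by (rule wf_ctx_has_type_jeq.t_Pi)
      (fastforce intro: t_Pi.IH t_Pi.prems S_up Univ_imp_type[where l=l])+
next
  case t_Lam show ?case unfolding t_Lam.prems subst.simps subst_comm
    by (rule wf_ctx_has_type_jeq.t_Lam) (auto intro!: t_Lam.IH t_Lam.prems S_up S_ctx[OF t_Lam.prems(1)] simp: subst_comm intro: formation)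
next
  case (t_App _ A) show ?case unfolding t_App.prems subst.simps subst_comm
    by (rule wf_ctx_has_type_jeq.t_App[where A="subst s A"]) (auto intro!: t_App.IH t_App.prems S_up S_ctx[OF t_App.prems(1)] simp: subst_comm intro: formation)
next
  case (e_Pi _ _ l) show ?case unfolding e_Pi.prems subst.simps subst_comm
    by (rule wf_ctx_has_type_jeq.e_Pi)
      (fastforce intro: e_Pi.IH e_Pi.prems S_up Univ_imp_type[where l=l])+
next
  case e_Lam show ?case unfolding e_Lam.prems subst.simps subst_comm
    by (rule wf_ctx_has_type_jeq.e_Lam) (auto intro!: e_Lam.IH e_Lam.prems S_up S_ctx[OF e_Lam.prems(1)] simp: subst_comm intro: formation)
next
  case (e_App _ A) show ?case unfolding e_App.prems subst.simps subst_comm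
    by (rule wf_ctx_has_type_jeq.e_App[where A="subst s A"]) (auto intro!: e_App.IH e_App.prems S_up S_ctx[OF e_App.prems(1)] simp: subst_comm intro: formation)
next
  case e_beta show ?case unfolding e_beta.prems subst.simps subst_comm
    by (rule wf_ctx_has_type_jeq.e_beta) (auto intro!: e_beta.IH e_beta.prems S_up S_ctx[OF e_beta.prems(1)] simp: subst_comm intro: formation)
next
  case e_eta show ?case unfolding e_eta.prems subst.simps subst_comm up_simps
    by (rule wf_ctx_has_type_jeq.e_eta) (auto intro!: e_eta.IH e_eta.prems S_up S_ctx[OF e_eta.prems(1)] simp: subst_comm intro: formation)
next
  case (t_Sig _ _ l) show ?case unfolding t_Sig.prems subst.simps subst_comm
    by (rule wf_ctx_has_type_jeq.t_Sig)
      (fastforce intro: t_Sig.IH t_Sig.prems S_up Univ_imp_type[where l=l])+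
next
  case t_Dpair show ?case unfolding t_Dpair.prems subst.simps subst_comm
    by (rule wf_ctx_has_type_jeq.t_Dpair) (auto intro!: t_Dpair.IH t_Dpair.prems S_up S_ctx[OF t_Dpair.prems(1)] simp: subst_comm intro: formation)
next
  case (t_SigInd _ A B) show ?case unfolding t_SigInd.prems subst.simps subst_comm
    by (rule wf_ctx_has_type_jeq.t_SigInd[where A="subst s A" and B="subst (up s) B"]) (auto intro!: t_SigInd.IH t_SigInd.prems S_up S_ctx[OF t_SigInd.prems(1)] simp: subst_comm intro: formation)
next
  case (e_Sig _ _ l) show ?case unfolding e_Sig.prems subst.simps subst_comm
    by (rule wf_ctx_has_type_jeq.e_Sig)
      (fastforce intro: e_Sig.IH e_Sig.prems S_up Univ_imp_type[where l=l])+
next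
  case e_Dpair show ?case unfolding e_Dpair.prems subst.simps subst_comm
    by (rule wf_ctx_has_type_jeq.e_Dpair) (auto intro!: e_Dpair.IH e_Dpair.prems S_up S_ctx[OF e_Dpair.prems(1)] simp: subst_comm intro: formation)
next
  case (e_SigInd _ A B) show ?case unfolding e_SigInd.prems subst.simps subst_comm
    by (rule wf_ctx_has_type_jeq.e_SigInd[where A="subst s A" and B="subst (up s) B"]) (auto intro!: e_SigInd.IH e_SigInd.prems S_up S_ctx[OF e_SigInd.prems(1)] simp: subst_comm intro: formation)
next
  case e_SigInd_Dpair show ?case unfolding e_SigInd_Dpair.prems subst.simps subst_comm
    by (rule wf_ctx_has_type_jeq.e_SigInd_Dpair) (auto intro!: e_SigInd_Dpair.IH e_SigInd_Dpair.prems S_up S_ctx[OF e_SigInd_Dpair.prems(1)] simp: subst_comm intro: formation)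
next
  case t_Idt show ?case unfolding t_Idt.prems subst.simps subst_comm
    by (rule wf_ctx_has_type_jeq.t_Idt) (auto intro!: t_Idt.IH t_Idt.prems S_up S_ctx[OF t_Idt.prems(1)] simp: subst_comm intro: formation)
next
  case t_Refl show ?case unfolding t_Refl.prems subst.simps subst_comm
    by (rule wf_ctx_has_type_jeq.t_Refl) (auto intro!: t_Refl.IH t_Refl.prems S_up S_ctx[OF t_Refl.prems(1)] simp: subst_comm intro: formation)
next
  case (t_J \<Gamma> A a P d b p)
  have A: "\<Delta> \<turnstile> subst s A \<Ztypecolon> \<T>" by (rule t_J.IH(1)[OF t_J.prems(1)]) simp
  \<comment> \<open>To pass the substitution under the two variables of the motive, the type of the
    path variable must be known to be a type. The rule \<open>t_J\<close> has no premise for it, so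
    it is built from the induction hypotheses at the weakened substitution; this is the purpose of
    the closure property \<open>S_wk\<close>.\<close>
  note W = S_wk[OF t_J.prems(1) A]
  have "subst s A # \<Delta> \<turnstile> Idt (ren Suc (subst s A)) (ren Suc (subst s a)) v0 \<Ztypecolon> \<T>"
  proof (rule t_Idt)
    show "subst s A # \<Delta> \<turnstile> ren Suc (subst s A) \<Ztypecolon> \<T>"
      using t_J.IH(1)[OF W] by (simp add: ren_subst comp_def)
    show "subst s A # \<Delta> \<turnstile> ren Suc (subst s a) \<Ztypecolon> ren Suc (subst s A)"
      using t_J.IH(2)[OF W] by (simp add: ren_subst comp_def)
    show "subst s A # \<Delta> \<turnstile> v0 \<Ztypecolon> ren Suc (subst s A)"
      using t_Var[of "subst s A # \<Delta>" 0] ctx_Cons[OF S_ctx[OF t_J.prems(1)] A] by simp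
  qed
  then show ?case unfolding t_J.prems subst.simps subst_comm
    by (intro wf_ctx_has_type_jeq.t_J[where A="subst s A" and a="subst s a"])
      (auto intro!: t_J.IH t_J.prems S_up A simp: subst_comm)
next
  case e_Idt show ?case unfolding e_Idt.prems subst.simps subst_comm
    by (rule wf_ctx_has_type_jeq.e_Idt) (auto intro!: e_Idt.IH e_Idt.prems S_up S_ctx[OF e_Idt.prems(1)] simp: subst_comm intro: formation)
next
  case e_Refl show ?case unfolding e_Refl.prems subst.simps subst_comm
    by (rule wf_ctx_has_type_jeq.e_Refl) (auto intro!: e_Refl.IH e_Refl.prems S_up S_ctx[OF e_Refl.prems(1)] simp: subst_comm intro: formation)
next
  case (e_J \<Gamma> A a)
  have A: "\<Delta> \<turnstile> subst s A \<Ztypecolon> \<T>" by (rule e_J.IH(1)[OF e_J.prems(1)]) simp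
  note W = S_wk[OF e_J.prems(1) A]
  have "subst s A # \<Delta> \<turnstile> Idt (ren Suc (subst s A)) (ren Suc (subst s a)) v0 \<Ztypecolon> \<T>"
  proof (rule t_Idt)
    show "subst s A # \<Delta> \<turnstile> ren Suc (subst s A) \<Ztypecolon> \<T>"
      using e_J.IH(1)[OF W] by (simp add: ren_subst comp_def)
    show "subst s A # \<Delta> \<turnstile> ren Suc (subst s a) \<Ztypecolon> ren Suc (subst s A)"
      using e_J.IH(2)[OF W] by (simp add: ren_subst comp_def)
    show "subst s A # \<Delta> \<turnstile> v0 \<Ztypecolon> ren Suc (subst s A)"
      using t_Var[of "subst s A # \<Delta>" 0] ctx_Cons[OF S_ctx[OF e_J.prems(1)] A] by simp
  qed
  then show ?case unfolding e_J.prems subst.simps subst_comm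
    by (intro wf_ctx_has_type_jeq.e_J[where A="subst s A" and a="subst s a"])
      (auto intro!: e_J.IH e_J.prems S_up A simp: subst_comm)
next
  case (e_J_Refl \<Gamma> A a)
  have A: "\<Delta> \<turnstile> subst s A \<Ztypecolon> \<T>" by (rule e_J_Refl.IH(1)[OF e_J_Refl.prems(1)]) simp
  note W = S_wk[OF e_J_Refl.prems(1) A]
  have "subst s A # \<Delta> \<turnstile> Idt (ren Suc (subst s A)) (ren Suc (subst s a)) v0 \<Ztypecolon> \<T>"
  proof (rule t_Idt)
    show "subst s A # \<Delta> \<turnstile> ren Suc (subst s A) \<Ztypecolon> \<T>"
      using e_J_Refl.IH(1)[OF W] by (simp add: ren_subst comp_def)
    show "subst s A # \<Delta> \<turnstile> ren Suc (subst s a) \<Ztypecolon> ren Suc (subst s A)"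
      using e_J_Refl.IH(2)[OF W] by (simp add: ren_subst comp_def)
    show "subst s A # \<Delta> \<turnstile> v0 \<Ztypecolon> ren Suc (subst s A)"
      using t_Var[of "subst s A # \<Delta>" 0] ctx_Cons[OF S_ctx[OF e_J_Refl.prems(1)] A] by simp
  qed
  then show ?case unfolding e_J_Refl.prems subst.simps subst_comm
    by (intro wf_ctx_has_type_jeq.e_J_Refl)
      (auto intro!: e_J_Refl.IH e_J_Refl.prems S_up A simp: subst_comm)
next
  case t_EmptyT show ?case unfolding t_EmptyT.prems subst.simps subst_comm
    by (rule wf_ctx_has_type_jeq.t_EmptyT) (auto intro!: t_EmptyT.IH t_EmptyT.prems S_up S_ctx[OF t_EmptyT.prems(1)] simp: subst_comm intro: formation)
next
  case t_EmptyInd show ?case unfolding t_EmptyInd.prems subst.simps subst_comm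
    by (rule wf_ctx_has_type_jeq.t_EmptyInd) (auto intro!: t_EmptyInd.IH t_EmptyInd.prems S_up S_ctx[OF t_EmptyInd.prems(1)] simp: subst_comm intro: formation)
next
  case e_EmptyInd show ?case unfolding e_EmptyInd.prems subst.simps subst_comm
    by (rule wf_ctx_has_type_jeq.e_EmptyInd) (auto intro!: e_EmptyInd.IH e_EmptyInd.prems S_up S_ctx[OF e_EmptyInd.prems(1)] simp: subst_comm intro: formation)
next
  case t_UnitT show ?case unfolding t_UnitT.prems subst.simps subst_comm
    by (rule wf_ctx_has_type_jeq.t_UnitT) (auto intro!: t_UnitT.IH t_UnitT.prems S_up S_ctx[OF t_UnitT.prems(1)] simp: subst_comm intro: formation)
next
  case t_Star show ?case unfolding t_Star.prems subst.simps subst_comm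
    by (rule wf_ctx_has_type_jeq.t_Star) (auto intro!: t_Star.IH t_Star.prems S_up S_ctx[OF t_Star.prems(1)] simp: subst_comm intro: formation)
next
  case t_UnitInd show ?case unfolding t_UnitInd.prems subst.simps subst_comm
    by (rule wf_ctx_has_type_jeq.t_UnitInd) (auto intro!: t_UnitInd.IH t_UnitInd.prems S_up S_ctx[OF t_UnitInd.prems(1)] simp: subst_comm intro: formation)
next
  case e_UnitInd show ?case unfolding e_UnitInd.prems subst.simps subst_comm
    by (rule wf_ctx_has_type_jeq.e_UnitInd) (auto intro!: e_UnitInd.IH e_UnitInd.prems S_up S_ctx[OF e_UnitInd.prems(1)] simp: subst_comm intro: formation)
next
  case e_UnitInd_Star show ?case unfolding e_UnitInd_Star.prems subst.simps subst_comm
    by (rule wf_ctx_has_type_jeq.e_UnitInd_Star) (auto intro!: e_UnitInd_Star.IH e_UnitInd_Star.prems S_up S_ctx[OF e_UnitInd_Star.prems(1)] simp: subst_comm intro: formation)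
next
  case t_SumT show ?case unfolding t_SumT.prems subst.simps subst_comm
    by (rule wf_ctx_has_type_jeq.t_SumT) (auto intro!: t_SumT.IH t_SumT.prems S_up S_ctx[OF t_SumT.prems(1)] simp: subst_comm intro: formation)
next
  case t_Cinl show ?case unfolding t_Cinl.prems subst.simps subst_comm
    by (rule wf_ctx_has_type_jeq.t_Cinl) (auto intro!: t_Cinl.IH t_Cinl.prems S_up S_ctx[OF t_Cinl.prems(1)] simp: subst_comm intro: formation)
next
  case t_Cinr show ?case unfolding t_Cinr.prems subst.simps subst_comm
    by (rule wf_ctx_has_type_jeq.t_Cinr) (auto intro!: t_Cinr.IH t_Cinr.prems S_up S_ctx[OF t_Cinr.prems(1)] simp: subst_comm intro: formation)
next
  case (t_SumInd _ A B) show ?case unfolding t_SumInd.prems subst.simps subst_comm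
    by (rule wf_ctx_has_type_jeq.t_SumInd[where A="subst s A" and B="subst s B"]) (auto intro!: t_SumInd.IH t_SumInd.prems S_up S_ctx[OF t_SumInd.prems(1)] simp: subst_comm intro: formation)
next
  case e_SumT show ?case unfolding e_SumT.prems subst.simps subst_comm
    by (rule wf_ctx_has_type_jeq.e_SumT) (auto intro!: e_SumT.IH e_SumT.prems S_up S_ctx[OF e_SumT.prems(1)] simp: subst_comm intro: formation)
next
  case e_Cinl show ?case unfolding e_Cinl.prems subst.simps subst_comm
    by (rule wf_ctx_has_type_jeq.e_Cinl) (auto intro!: e_Cinl.IH e_Cinl.prems S_up S_ctx[OF e_Cinl.prems(1)] simp: subst_comm intro: formation)
next
  case e_Cinr show ?case unfolding e_Cinr.prems subst.simps subst_comm
    by (rule wf_ctx_has_type_jeq.e_Cinr) (auto intro!: e_Cinr.IH e_Cinr.prems S_up S_ctx[OF e_Cinr.prems(1)] simp: subst_comm intro: formation)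
next
  case (e_SumInd _ A B) show ?case unfolding e_SumInd.prems subst.simps subst_comm
    by (rule wf_ctx_has_type_jeq.e_SumInd[where A="subst s A" and B="subst s B"]) (auto intro!: e_SumInd.IH e_SumInd.prems S_up S_ctx[OF e_SumInd.prems(1)] simp: subst_comm intro: formation)
next
  case e_SumInd_Cinl show ?case unfolding e_SumInd_Cinl.prems subst.simps subst_comm
    by (rule wf_ctx_has_type_jeq.e_SumInd_Cinl) (auto intro!: e_SumInd_Cinl.IH e_SumInd_Cinl.prems S_up S_ctx[OF e_SumInd_Cinl.prems(1)] simp: subst_comm intro: formation)
next
  case e_SumInd_Cinr show ?case unfolding e_SumInd_Cinr.prems subst.simps subst_comm
    by (rule wf_ctx_has_type_jeq.e_SumInd_Cinr) (auto intro!: e_SumInd_Cinr.IH e_SumInd_Cinr.prems S_up S_ctx[OF e_SumInd_Cinr.prems(1)] simp: subst_comm intro: formation)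
next
  case t_NatT show ?case unfolding t_NatT.prems subst.simps subst_comm
    by (rule wf_ctx_has_type_jeq.t_NatT) (auto intro!: t_NatT.IH t_NatT.prems S_up S_ctx[OF t_NatT.prems(1)] simp: subst_comm intro: formation)
next
  case t_Zero show ?case unfolding t_Zero.prems subst.simps subst_comm
    by (rule wf_ctx_has_type_jeq.t_Zero) (auto intro!: t_Zero.IH t_Zero.prems S_up S_ctx[OF t_Zero.prems(1)] simp: subst_comm intro: formation)
next
  case t_Succ show ?case unfolding t_Succ.prems subst.simps subst_comm
    by (rule wf_ctx_has_type_jeq.t_Succ) (auto intro!: t_Succ.IH t_Succ.prems S_up S_ctx[OF t_Succ.prems(1)] simp: subst_comm intro: formation)
next
  case t_NatInd show ?case unfolding t_NatInd.prems subst.simps subst_comm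
    by (rule wf_ctx_has_type_jeq.t_NatInd) (auto intro!: t_NatInd.IH t_NatInd.prems S_up S_ctx[OF t_NatInd.prems(1)] simp: subst_comm intro: formation)
next
  case e_Succ show ?case unfolding e_Succ.prems subst.simps subst_comm
    by (rule wf_ctx_has_type_jeq.e_Succ) (auto intro!: e_Succ.IH e_Succ.prems S_up S_ctx[OF e_Succ.prems(1)] simp: subst_comm intro: formation)
next
  case e_NatInd show ?case unfolding e_NatInd.prems subst.simps subst_comm
    by (rule wf_ctx_has_type_jeq.e_NatInd) (auto intro!: e_NatInd.IH e_NatInd.prems S_up S_ctx[OF e_NatInd.prems(1)] simp: subst_comm intro: formation)
next
  case e_NatInd_Zero show ?case unfolding e_NatInd_Zero.prems subst.simps subst_comm
    by (rule wf_ctx_has_type_jeq.e_NatInd_Zero) (auto intro!: e_NatInd_Zero.IH e_NatInd_Zero.prems S_up S_ctx[OF e_NatInd_Zero.prems(1)] simp: subst_comm intro: formation)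
next
  case e_NatInd_Succ show ?case unfolding e_NatInd_Succ.prems subst.simps subst_comm
    by (rule wf_ctx_has_type_jeq.e_NatInd_Succ) (auto intro!: e_NatInd_Succ.IH e_NatInd_Succ.prems S_up S_ctx[OF e_NatInd_Succ.prems(1)] simp: subst_comm intro: formation)
next
  case t_Push show ?case unfolding t_Push.prems subst.simps subst_comm
    by (rule wf_ctx_has_type_jeq.t_Push) (auto intro!: t_Push.IH t_Push.prems S_up[OF _ _ t_El] t_Push S_ctx[OF t_Push.prems(1)] simp: subst_comm intro: formation)
next
  case t_PInl show ?case unfolding t_PInl.prems subst.simps subst_comm
    by (rule wf_ctx_has_type_jeq.t_PInl) (auto intro!: t_PInl.IH t_PInl.prems S_up[OF _ _ t_El] t_Push S_ctx[OF t_PInl.prems(1)] simp: subst_comm intro: formation)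
next
  case t_PInr show ?case unfolding t_PInr.prems subst.simps subst_comm
    by (rule wf_ctx_has_type_jeq.t_PInr) (auto intro!: t_PInr.IH t_PInr.prems S_up[OF _ _ t_El] t_Push S_ctx[OF t_PInr.prems(1)] simp: subst_comm intro: formation)
next
  case t_Glue show ?case unfolding t_Glue.prems subst.simps subst_comm
    by (rule wf_ctx_has_type_jeq.t_Glue) (auto intro!: t_Glue.IH t_Glue.prems S_up[OF _ _ t_El] t_Push S_ctx[OF t_Glue.prems(1)] simp: subst_comm intro: formation)
next
  case (t_PushInd _ C A B f g) show ?case unfolding t_PushInd.prems subst.simps subst_comm
    by (rule wf_ctx_has_type_jeq.t_PushInd[where C="subst s C" and A="subst s A" and B="subst s B" and f="subst s f" and g="subst s g"]) (auto intro!: t_PushInd.IH t_PushInd.prems S_up[OF _ _ t_El] t_Push S_ctx[OF t_PushInd.prems(1)] simp: subst_comm intro: formation)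
next
  case t_PushComp show ?case unfolding t_PushComp.prems subst.simps subst_comm up_simps
    by (rule wf_ctx_has_type_jeq.t_PushComp) (auto intro!: t_PushComp.IH t_PushComp.prems S_up[OF _ _ t_El] t_Push S_ctx[OF t_PushComp.prems(1)] simp: subst_comm intro: formation)
next
  case e_Push show ?case unfolding e_Push.prems subst.simps subst_comm
    by (rule wf_ctx_has_type_jeq.e_Push) (auto intro!: e_Push.IH e_Push.prems S_up[OF _ _ t_El] t_Push S_ctx[OF e_Push.prems(1)] simp: subst_comm intro: formation)
next
  case e_PInl show ?case unfolding e_PInl.prems subst.simps subst_comm
    by (rule wf_ctx_has_type_jeq.e_PInl) (auto intro!: e_PInl.IH e_PInl.prems S_up[OF _ _ t_El] t_Push S_ctx[OF e_PInl.prems(1)] simp: subst_comm intro: formation)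
next
  case e_PInr show ?case unfolding e_PInr.prems subst.simps subst_comm
    by (rule wf_ctx_has_type_jeq.e_PInr) (auto intro!: e_PInr.IH e_PInr.prems S_up[OF _ _ t_El] t_Push S_ctx[OF e_PInr.prems(1)] simp: subst_comm intro: formation)
next
  case e_Glue show ?case unfolding e_Glue.prems subst.simps subst_comm
    by (rule wf_ctx_has_type_jeq.e_Glue) (auto intro!: e_Glue.IH e_Glue.prems S_up[OF _ _ t_El] t_Push S_ctx[OF e_Glue.prems(1)] simp: subst_comm intro: formation)
next
  case (e_PushInd _ C A B f g) show ?case unfolding e_PushInd.prems subst.simps subst_comm
    by (rule wf_ctx_has_type_jeq.e_PushInd[where C="subst s C" and A="subst s A" and B="subst s B" and f="subst s f" and g="subst s g"]) (auto intro!: e_PushInd.IH e_PushInd.prems S_up[OF _ _ t_El] t_Push S_ctx[OF e_PushInd.prems(1)] simp: subst_comm intro: formation)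
next
  case e_PushComp show ?case unfolding e_PushComp.prems subst.simps subst_comm up_simps
    by (rule wf_ctx_has_type_jeq.e_PushComp) (auto intro!: e_PushComp.IH e_PushComp.prems S_up[OF _ _ t_El] t_Push S_ctx[OF e_PushComp.prems(1)] simp: subst_comm intro: formation)
next
  case e_PushInd_PInl show ?case unfolding e_PushInd_PInl.prems subst.simps subst_comm
    by (rule wf_ctx_has_type_jeq.e_PushInd_PInl) (auto intro!: e_PushInd_PInl.IH e_PushInd_PInl.prems S_up[OF _ _ t_El] t_Push S_ctx[OF e_PushInd_PInl.prems(1)] simp: subst_comm intro: formation)
next
  case e_PushInd_PInr show ?case unfolding e_PushInd_PInr.prems subst.simps subst_comm
    by (rule wf_ctx_has_type_jeq.e_PushInd_PInr) (auto intro!: e_PushInd_PInr.IH e_PushInd_PInr.prems S_up[OF _ _ t_El] t_Push S_ctx[OF e_PushInd_PInr.prems(1)] simp: subst_comm intro: formation)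
next
  case t_Funext show ?case unfolding t_Funext.prems subst.simps subst_comm
    by (rule wf_ctx_has_type_jeq.t_Funext) (auto intro!: t_Funext.IH t_Funext.prems S_up S_ctx[OF t_Funext.prems(1)] simp: subst_comm intro: formation)
next
  case t_Ua show ?case unfolding t_Ua.prems subst.simps subst_comm
    by (rule wf_ctx_has_type_jeq.t_Ua) (auto intro!: t_Ua.IH t_Ua.prems S_up S_ctx[OF t_Ua.prems(1)] simp: subst_comm intro: formation)
next
  case e_Funext show ?case unfolding e_Funext.prems subst.simps subst_comm
    by (rule wf_ctx_has_type_jeq.e_Funext) (auto intro!: e_Funext.IH e_Funext.prems S_up S_ctx[OF e_Funext.prems(1)] simp: subst_comm intro: formation)
next
  case e_Ua show ?case unfolding e_Ua.prems subst.simps subst_comm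
    by (rule wf_ctx_has_type_jeq.e_Ua) (auto intro!: e_Ua.IH e_Ua.prems S_up S_ctx[OF e_Ua.prems(1)] simp: subst_comm intro: formation)
qed

section \<open>Renamings and typed substitutions between contexts\<close>

definition sub :: "tm list \<Rightarrow> (nat \<Rightarrow> tm) \<Rightarrow> tm list \<Rightarrow> bool" where
  "sub \<Delta> s \<Gamma> \<longleftrightarrow> \<Delta> \<turnstile> ctx \<and> (\<forall>n < length \<Gamma>. \<Delta> \<turnstile> s n \<Ztypecolon> subst s (shift (Suc n) (\<Gamma> ! n)))"

text \<open>The type of each variable has to be carried to the type of its image literally, as an
  equation between raw terms. The images are then typed by \<open>t_Var\<close> alone, so no
  weakening lemma is presupposed.\<close>

definition rsub :: "tm list \<Rightarrow> (nat \<Rightarrow> tm) \<Rightarrow> tm list \<Rightarrow> bool" where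
  "rsub \<Delta> s \<Gamma> \<longleftrightarrow> \<Delta> \<turnstile> ctx \<and> (\<exists>r. s = Var \<circ> r \<and> (\<forall>n < length \<Gamma>. r n < length \<Delta> \<and>
     subst s (shift (Suc n) (\<Gamma> ! n)) = shift (Suc (r n)) (\<Delta> ! r n)))"

lemma shift_Suc: "shift (Suc (Suc n)) t = shift 1 (shift (Suc n) t)"
  by (simp add: ren_ren comp_def)

lemma rsub_up: "rsub \<Delta> s \<Gamma> \<Longrightarrow> A' = subst s A \<Longrightarrow> \<Delta> \<turnstile> A' \<Ztypecolon> \<T> \<Longrightarrow> rsub (A' # \<Delta>) (up s) (A # \<Gamma>)"
  unfolding rsub_def
proof (elim conjE exE, intro conjI exI)
  fix r assume *: "\<Delta> \<turnstile> ctx" "A' = subst s A" "\<Delta> \<turnstile> A' \<Ztypecolon> \<T>"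
    and s: "s = Var \<circ> r" and r: "\<forall>n<length \<Gamma>. r n < length \<Delta> \<and>
         subst s (shift (Suc n) (\<Gamma> ! n)) = shift (Suc (r n)) (\<Delta> ! r n)"
  show "A' # \<Delta> \<turnstile> ctx" using * by (simp add: ctx_Cons)
  show "up s = Var \<circ> up_ren r" using s by (simp add: up_Var)
  show "\<forall>n<length (A # \<Gamma>). up_ren r n < length (A' # \<Delta>) \<and>
    subst (up s) (shift (Suc n) ((A # \<Gamma>) ! n)) = shift (Suc (up_ren r n)) ((A' # \<Delta>) ! up_ren r n)"
  proof (intro allI impI)
    fix n assume n: "n < length (A # \<Gamma>)"
    show "up_ren r n < length (A' # \<Delta>) \<and>
      subst (up s) (shift (Suc n) ((A # \<Gamma>) ! n)) = shift (Suc (up_ren r n)) ((A' # \<Delta>) ! up_ren r n)"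
    proof (cases n)
      case 0 then show ?thesis using * by (simp add: subst_comm)
    next
      case (Suc m)
      then have "subst s (shift (Suc m) (\<Gamma> ! m)) = shift (Suc (r m)) (\<Delta> ! r m)" "r m < length \<Delta>"
        using n r by auto
      then show ?thesis unfolding Suc up_ren_simps nth_Cons_Suc shift_Suc subst_comm by simp
    qed
  qed
qed

lemma rsub_wk: "rsub \<Delta> s \<Gamma> \<Longrightarrow> \<Delta> \<turnstile> B \<Ztypecolon> \<T> \<Longrightarrow> rsub (B # \<Delta>) (\<lambda>n. ren Suc (s n)) \<Gamma>"
  unfolding rsub_def
proof (elim conjE exE, intro conjI exI)
  fix r assume *: "\<Delta> \<turnstile> ctx" "\<Delta> \<turnstile> B \<Ztypecolon> \<T>"
    and s: "s = Var \<circ> r" and r: "\<forall>n<length \<Gamma>. r n < length \<Delta> \<and>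
         subst s (shift (Suc n) (\<Gamma> ! n)) = shift (Suc (r n)) (\<Delta> ! r n)"
  show "B # \<Delta> \<turnstile> ctx" using * by (simp add: ctx_Cons)
  show "(\<lambda>n. ren Suc (s n)) = Var \<circ> (\<lambda>n. Suc (r n))" using s by auto
  have e: "subst (\<lambda>n. ren Suc (s n)) t = shift 1 (subst s t)" for t
    by (simp add: ren_subst comp_def)
  show "\<forall>n<length \<Gamma>. Suc (r n) < length (B # \<Delta>) \<and>
    subst (\<lambda>n. ren Suc (s n)) (shift (Suc n) (\<Gamma> ! n)) = shift (Suc (Suc (r n))) ((B # \<Delta>) ! Suc (r n))"
    unfolding e shift_Suc using r by auto
qed

lemma rsub_has_type: "\<Gamma> \<turnstile> t \<Ztypecolon> A \<Longrightarrow> rsub \<Delta> s \<Gamma> \<Longrightarrow> \<Delta> \<turnstile> subst s t \<Ztypecolon> subst s A"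
  and rsub_jeq: "\<Gamma> \<turnstile> t \<doteq> u \<Ztypecolon> A \<Longrightarrow> rsub \<Delta> s \<Gamma> \<Longrightarrow> \<Delta> \<turnstile> subst s t \<doteq> subst s u \<Ztypecolon> subst s A"
proof -
  have 1: "rsub \<Delta> s \<Gamma> \<Longrightarrow> \<Delta> \<turnstile> ctx" for \<Delta> s \<Gamma> by (simp add: rsub_def)
  have 2: "rsub \<Delta> s \<Gamma> \<Longrightarrow> n < length \<Gamma> \<Longrightarrow> \<Delta> \<turnstile> s n \<Ztypecolon> subst s (shift (Suc n) (\<Gamma> ! n))" for \<Delta> s \<Gamma> n
    unfolding rsub_def by (metis comp_apply t_Var)
  show "\<Gamma> \<turnstile> t \<Ztypecolon> A \<Longrightarrow> rsub \<Delta> s \<Gamma> \<Longrightarrow> \<Delta> \<turnstile> subst s t \<Ztypecolon> subst s A"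
    by (erule substitution_has_type[where S=rsub, rotated 4]) (blast intro: 1 2 rsub_up rsub_wk)+
  show "\<Gamma> \<turnstile> t \<doteq> u \<Ztypecolon> A \<Longrightarrow> rsub \<Delta> s \<Gamma> \<Longrightarrow> \<Delta> \<turnstile> subst s t \<doteq> subst s u \<Ztypecolon> subst s A"
    by (erule substitution_jeq[where S=rsub, rotated 4]) (blast intro: 1 2 rsub_up rsub_wk)+
qed

lemma rsub_shift:
  assumes "\<Delta> \<turnstile> ctx" "drop k \<Delta> = \<Gamma>" "k \<le> length \<Delta>"
  shows "rsub \<Delta> (Var \<circ> (\<lambda>n. n + k)) \<Gamma>"
  unfolding rsub_def
proof (intro conjI exI allI impI)
  fix n assume n: "n < length \<Gamma>"
  then show "n + k < length \<Delta>" using assms by auto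
  have "\<Gamma> ! n = \<Delta> ! (n + k)" using assms n by (auto simp: add.commute)
  then show "subst (Var \<circ> (\<lambda>n. n + k)) (shift (Suc n) (\<Gamma> ! n)) = shift (Suc (n + k)) (\<Delta> ! (n + k))"
    by (auto simp: subst_algebra intro!: subst_cong)
qed (use assms in simp_all)

lemma weaken1: "\<Gamma> \<turnstile> t \<Ztypecolon> A \<Longrightarrow> \<Gamma> \<turnstile> ctx \<Longrightarrow> \<Gamma> \<turnstile> B \<Ztypecolon> \<T> \<Longrightarrow> B # \<Gamma> \<turnstile> shift 1 t \<Ztypecolon> shift 1 A"
  using rsub_has_type[OF _ rsub_shift[of "B # \<Gamma>" 1 \<Gamma>]] ctx_Cons by (simp add: ren_eq_subst[of Suc] comp_def)

lemma sub_up: "sub \<Delta> s \<Gamma> \<Longrightarrow> A' = subst s A \<Longrightarrow> \<Delta> \<turnstile> A' \<Ztypecolon> \<T> \<Longrightarrow> sub (A' # \<Delta>) (up s) (A # \<Gamma>)"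
proof -
  assume *: "sub \<Delta> s \<Gamma>" "A' = subst s A" "\<Delta> \<turnstile> A' \<Ztypecolon> \<T>"
  then have c: "\<Delta> \<turnstile> ctx" "A' # \<Delta> \<turnstile> ctx" by (simp_all add: sub_def ctx_Cons)
  show ?thesis unfolding sub_def
  proof (intro conjI allI impI)
    fix n assume n: "n < length (A # \<Gamma>)"
    show "A' # \<Delta> \<turnstile> up s n \<Ztypecolon> subst (up s) (shift (Suc n) ((A # \<Gamma>) ! n))"
    proof (cases n)
      case 0 then show ?thesis using t_Var[OF c(2), of 0] *(2) by (simp add: subst_comm)
    next
      case (Suc m)
      then have "\<Delta> \<turnstile> s m \<Ztypecolon> subst s (shift (Suc m) (\<Gamma> ! m))" using n * by (auto simp: sub_def)
      from weaken1[OF this c(1) *(3)] show ?thesis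
        unfolding Suc up_simps nth_Cons_Suc shift_Suc subst_comm by simp
    qed
  qed (rule c)
qed

lemma sub_wk: "sub \<Delta> s \<Gamma> \<Longrightarrow> \<Delta> \<turnstile> B \<Ztypecolon> \<T> \<Longrightarrow> sub (B # \<Delta>) (\<lambda>n. ren Suc (s n)) \<Gamma>"
proof -
  have e: "subst (\<lambda>n. ren Suc (s n)) t = shift 1 (subst s t)" for t
    by (simp add: ren_subst comp_def)
  assume "sub \<Delta> s \<Gamma>" "\<Delta> \<turnstile> B \<Ztypecolon> \<T>"
  then show ?thesis unfolding sub_def e using weaken1 by (auto simp: ctx_Cons)
qed

lemma sub_has_type: "\<Gamma> \<turnstile> t \<Ztypecolon> A \<Longrightarrow> sub \<Delta> s \<Gamma> \<Longrightarrow> \<Delta> \<turnstile> subst s t \<Ztypecolon> subst s A"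
  and sub_jeq: "\<Gamma> \<turnstile> t \<doteq> u \<Ztypecolon> A \<Longrightarrow> sub \<Delta> s \<Gamma> \<Longrightarrow> \<Delta> \<turnstile> subst s t \<doteq> subst s u \<Ztypecolon> subst s A"
proof -
  have 1: "sub \<Delta> s \<Gamma> \<Longrightarrow> \<Delta> \<turnstile> ctx" for \<Delta> s \<Gamma> by (simp add: sub_def)
  have 2: "sub \<Delta> s \<Gamma> \<Longrightarrow> n < length \<Gamma> \<Longrightarrow> \<Delta> \<turnstile> s n \<Ztypecolon> subst s (shift (Suc n) (\<Gamma> ! n))" for \<Delta> s \<Gamma> n
    unfolding sub_def by blast
  show "\<Gamma> \<turnstile> t \<Ztypecolon> A \<Longrightarrow> sub \<Delta> s \<Gamma> \<Longrightarrow> \<Delta> \<turnstile> subst s t \<Ztypecolon> subst s A"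
    by (erule substitution_has_type[where S=sub, rotated 4]) (blast intro: 1 2 sub_up sub_wk)+
  show "\<Gamma> \<turnstile> t \<doteq> u \<Ztypecolon> A \<Longrightarrow> sub \<Delta> s \<Gamma> \<Longrightarrow> \<Delta> \<turnstile> subst s t \<doteq> subst s u \<Ztypecolon> subst s A"
    by (erule substitution_jeq[where S=sub, rotated 4]) (blast intro: 1 2 sub_up sub_wk)+
qed

lemma typing_ctx: "\<Gamma> \<turnstile> ctx \<Longrightarrow> (case \<Gamma> of [] \<Rightarrow> True | A # \<Gamma>' \<Rightarrow> \<Gamma>' \<turnstile> ctx \<and> \<Gamma>' \<turnstile> A \<Ztypecolon> \<T>)"
  "\<Gamma> \<turnstile> t \<Ztypecolon> A \<Longrightarrow> \<Gamma> \<turnstile> ctx" "\<Gamma> \<turnstile> t \<doteq> u \<Ztypecolon> A \<Longrightarrow> \<Gamma> \<turnstile> ctx"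
  by (induction rule: wf_ctx_has_type_jeq.inducts) (auto intro: ctx_Nil)

lemma ctx_ConsD: "A # \<Gamma> \<turnstile> ctx \<Longrightarrow> \<Gamma> \<turnstile> A \<Ztypecolon> \<T>" "A # \<Gamma> \<turnstile> ctx \<Longrightarrow> \<Gamma> \<turnstile> ctx"
  using typing_ctx(1)[of "A # \<Gamma>"] by auto

text \<open>From here on, numbers of shifted variables stay in the form \<open>1\<close>,
  \<open>2\<close> and \<open>j + 1\<close>. Turning them into successors would keep the normal
  forms of \<open>lift\<close> and \<open>ins\<close> from matching.\<close>

declare One_nat_def [simp del] add_2_eq_Suc [simp del] add_2_eq_Suc' [simp del]

section \<open>Weakening and instantiation\<close>

text \<open>The number \<open>j\<close> of protected inner variables makes weakening closed under
  binders: it passes a binder by raising \<open>j\<close>. So it can be pushed to the variables by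
  rewriting alone.\<close>

definition lift :: "nat \<Rightarrow> nat \<Rightarrow> tm \<Rightarrow> tm" where
  "lift j k = ren (\<lambda>n. if n < j then n else n + k)"

text \<open>The term \<open>a\<close> already lives behind the \<open>k\<close> new variables of the
  target context and is weakened only by the \<open>j\<close> bound ones. With \<open>k = 0\<close>
  this is plain instantiation; a positive \<open>k\<close> instantiates a family inside a larger
  context in one operation.\<close>

definition ins :: "nat \<Rightarrow> nat \<Rightarrow> tm \<Rightarrow> tm \<Rightarrow> tm" where
  "ins j k t a = subst (\<lambda>n. if n < j then Var n else if n = j then lift 0 j a else Var (n - 1 + k)) t"

abbreviation lift1 ("_\<up>" [1000] 1000) where "t\<up> \<equiv> lift 0 1 t"

abbreviation lift2 ("_\<Up>" [1000] 1000) where "t\<Up> \<equiv> lift 0 2 t"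

lemma shift_lift: "shift k t = lift 0 k t"
  by (simp add: lift_def)

lemma shift1_lift: "shift1 k t = lift 1 k t"
  by (auto simp: lift_def up_ren_def split: nat.split intro!: arg_cong[of _ _ "\<lambda>r. ren r t"] ext)

lemma up_ren_lift: "up_ren (\<lambda>n. if n < j then n else n + k) = (\<lambda>n. if n < j + 1 then n else n + k)"
  by (rule ext) (simp add: up_ren_def One_nat_def split: nat.split)

lemma up_ins:
  "up (\<lambda>n. if n < j then Var n else if n = j then lift 0 j a else Var (n - 1 + k)) =
   (\<lambda>n. if n < j + 1 then Var n else if n = j + 1 then lift 0 (j + 1) a else Var (n - 1 + k))"
  by (rule ext) (auto simp: up_def lift_def ren_ren comp_def One_nat_def split: nat.split)

lemma inst_ins: "inst k t a = ins 0 k t a"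
  by (auto simp: inst_def ins_def lift_def subst_algebra intro!: subst_cong split: nat.split)

lemma inst2_ins: "inst2 t a b = ins 0 0 (ins 1 0 t a) b"
  by (auto simp: inst2_def ins_def lift_def subst_algebra intro!: subst_cong split: nat.split)

lemma lift_simps [simp]:
  "lift j k (Var n) = Var (if n < j then n else n + k)"
  "lift j k (Univ l) = Univ l"
  "lift j k (Pi A B) = Pi (lift j k A) (lift (j + 1) k B)"
  "lift j k (Lam A b) = Lam (lift j k A) (lift (j + 1) k b)"
  "lift j k (f $ a) = (lift j k f) $ (lift j k a)"
  "lift j k (Sig A B) = Sig (lift j k A) (lift (j + 1) k B)"
  "lift j k (Dpair A B a b) = Dpair (lift j k A) (lift (j + 1) k B) (lift j k a) (lift j k b)"
  "lift j k (SigInd P d p) = SigInd (lift (j + 1) k P) (lift (j + 1 + 1) k d) (lift j k p)"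
  "lift j k (Idt A a b) = Idt (lift j k A) (lift j k a) (lift j k b)"
  "lift j k (Refl A a) = Refl (lift j k A) (lift j k a)"
  "lift j k (J P d b p) = J (lift (j + 1 + 1) k P) (lift j k d) (lift j k b) (lift j k p)"
  "lift j k (Push C A B f g) = Push (lift j k C) (lift j k A) (lift j k B) (lift j k f) (lift j k g)"
  "lift j k (PInl C A B f g a) = PInl (lift j k C) (lift j k A) (lift j k B) (lift j k f) (lift j k g) (lift j k a)"
  "lift j k (PInr C A B f g a) = PInr (lift j k C) (lift j k A) (lift j k B) (lift j k f) (lift j k g) (lift j k a)"
  "lift j k (Glue C A B f g a) = Glue (lift j k C) (lift j k A) (lift j k B) (lift j k f) (lift j k g) (lift j k a)"
  by (simp_all add: lift_def up_ren_lift)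

lemma ins_simps [simp]:
  "ins j k (Var n) x = (if n < j then Var n else if n = j then lift 0 j x else Var (n - 1 + k))"
  "ins j k (Univ l) x = Univ l"
  "ins j k (Pi A B) x = Pi (ins j k A x) (ins (j + 1) k B x)"
  "ins j k (Lam A b) x = Lam (ins j k A x) (ins (j + 1) k b x)"
  "ins j k (f $ a) x = (ins j k f x) $ (ins j k a x)"
  "ins j k (Sig A B) x = Sig (ins j k A x) (ins (j + 1) k B x)"
  "ins j k (Dpair A B a b) x = Dpair (ins j k A x) (ins (j + 1) k B x) (ins j k a x) (ins j k b x)"
  "ins j k (SigInd P d p) x = SigInd (ins (j + 1) k P x) (ins (j + 1 + 1) k d x) (ins j k p x)"
  "ins j k (Idt A a b) x = Idt (ins j k A x) (ins j k a x) (ins j k b x)"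
  "ins j k (Refl A a) x = Refl (ins j k A x) (ins j k a x)"
  "ins j k (J P d b p) x = J (ins (j + 1 + 1) k P x) (ins j k d x) (ins j k b x) (ins j k p x)"
  "ins j k (Push C A B f g) x = Push (ins j k C x) (ins j k A x) (ins j k B x) (ins j k f x) (ins j k g x)"
  "ins j k (PInl C A B f g a) x = PInl (ins j k C x) (ins j k A x) (ins j k B x) (ins j k f x) (ins j k g x) (ins j k a x)"
  "ins j k (PInr C A B f g a) x = PInr (ins j k C x) (ins j k A x) (ins j k B x) (ins j k f x) (ins j k g x) (ins j k a x)"
  "ins j k (Glue C A B f g a) x = Glue (ins j k C x) (ins j k A x) (ins j k B x) (ins j k f x) (ins j k g x) (ins j k a x)"
  by (simp_all only: ins_def subst.simps up_ins)

lemma lift_0 [simp]: "lift j 0 t = t"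
  by (auto simp: lift_def subst_algebra intro: trans[OF subst_cong subst_Var])

text \<open>The side conditions of the commutation laws separate two cases. Either the affected
  position falls into the block of fresh variables, and the operation only changes the size of the
  block, or it lies beyond the block, and the operation moves inside.\<close>

lemma lift_lift [simp]: "j \<le> i \<Longrightarrow> lift j k (lift 0 i t) = lift 0 (i + k) t"
  by (auto simp: lift_def subst_algebra intro!: subst_cong)

lemma lift_lift' [simp]: "i < j \<Longrightarrow> 0 < i \<Longrightarrow> lift j k (lift 0 i t) = lift 0 i (lift (j - i) k t)"
  by (auto simp: lift_def subst_algebra intro!: subst_cong)

lemma ins_lift [simp]: "j < i \<Longrightarrow> ins j k (lift 0 i t) x = lift 0 (i - 1 + k) t"
  by (auto simp: lift_def ins_def subst_algebra intro!: subst_cong)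

lemma ins_lift' [simp]: "i \<le> j \<Longrightarrow> 0 < i \<Longrightarrow> ins j k (lift 0 i t) x = lift 0 i (ins (j - i) k t x)"
  by (auto simp: lift_def ins_def subst_algebra intro!: subst_cong)

lemma lift_ins [simp]: "j \<le> m \<Longrightarrow> lift j i (ins 0 m t x) = ins 0 (m + i) t (lift j i x)"
  by (auto simp: lift_def ins_def subst_algebra intro!: subst_cong)

lemma ins_ins [simp]: "j < m \<Longrightarrow> ins j k (ins 0 m t x) a = ins 0 (m - 1 + k) t (ins j k x a)"
  by (auto simp: lift_def ins_def subst_algebra intro!: subst_cong)

text \<open>
  A term with a distinguished variable is kept in one of the forms \<open>lift 0 k t\<close> and \<open>ins 0 k t a\<close>
  with \<open>a \<noteq> Var (k - 1)\<close>.
\<close>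

lemma ins_Var [simp]: "m = k + 1 \<Longrightarrow> ins 0 m t (Var k) = lift 0 k t"
  by (auto simp: lift_def ins_def subst_algebra One_nat_def intro!: subst_cong)

lemma lift_1 [simp]: "0 < k \<Longrightarrow> lift 1 k t = ins 0 (k + 1) t v0"
  by (auto simp: lift_def ins_def subst_algebra One_nat_def intro!: subst_cong)

lemma nat1_simps [simp]: "(x # xs) ! 1 = xs ! 0" "1 < Suc n \<longleftrightarrow> 0 < n"
  by (simp_all add: One_nat_def)

lemma lift_ty:
  assumes "\<Gamma> \<turnstile> t \<Ztypecolon> A" "\<Delta> \<turnstile> ctx" "k \<le> length \<Delta>" "drop k \<Delta> = \<Gamma>"
  shows "\<Delta> \<turnstile> lift 0 k t \<Ztypecolon> lift 0 k A"
  using rsub_has_type[OF assms(1) rsub_shift[OF assms(2,4,3)]]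
  by (simp add: lift_def ren_eq_subst)

lemma lift_jeq:
  assumes "\<Gamma> \<turnstile> t \<doteq> u \<Ztypecolon> A" "\<Delta> \<turnstile> ctx" "k \<le> length \<Delta>" "drop k \<Delta> = \<Gamma>"
  shows "\<Delta> \<turnstile> lift 0 k t \<doteq> lift 0 k u \<Ztypecolon> lift 0 k A"
  using rsub_jeq[OF assms(1) rsub_shift[OF assms(2,4,3)]]
  by (simp add: lift_def ren_eq_subst)

lemma sub_inst:
  assumes "\<Delta> \<turnstile> ctx" "k \<le> length \<Delta>" "drop k \<Delta> = \<Gamma>" "\<Delta> \<turnstile> a \<Ztypecolon> lift 0 k A"
  shows "sub \<Delta> (case_nat a (\<lambda>n. Var (n + k))) (A # \<Gamma>)"
  unfolding sub_def
proof (intro conjI allI impI)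
  fix n assume n: "n < length (A # \<Gamma>)"
  show "\<Delta> \<turnstile> case_nat a (\<lambda>n. Var (n + k)) n \<Ztypecolon>
    subst (case_nat a (\<lambda>n. Var (n + k))) (shift (Suc n) ((A # \<Gamma>) ! n))"
  proof (cases n)
    case 0 then show ?thesis using assms(4) by (simp add: lift_def subst_algebra)
  next
    case (Suc m)
    have "subst (case_nat a (\<lambda>n. Var (n + k))) (shift (Suc (Suc m)) t) = shift (Suc (m + k)) t" for t
      by (auto simp: subst_algebra intro!: subst_cong)
    moreover have "\<Gamma> ! m = \<Delta> ! (m + k)" "m + k < length \<Delta>" using assms n Suc by (auto simp: add.commute)
    ultimately show ?thesis using t_Var[OF assms(1), of "m + k"] Suc by simp
  qed
qed (rule assms)

lemma ins_ty:
  assumes "A # \<Gamma> \<turnstile> t \<Ztypecolon> B" "\<Delta> \<turnstile> ctx" "k \<le> length \<Delta>" "drop k \<Delta> = \<Gamma>" "\<Delta> \<turnstile> a \<Ztypecolon> lift 0 k A"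
  shows "\<Delta> \<turnstile> ins 0 k t a \<Ztypecolon> ins 0 k B a"
  using sub_has_type[OF assms(1) sub_inst[OF assms(2-)]] by (simp add: inst_ins[symmetric] inst_def)

lemma ins_jeq:
  assumes "A # \<Gamma> \<turnstile> t \<doteq> u \<Ztypecolon> B" "\<Delta> \<turnstile> ctx" "k \<le> length \<Delta>" "drop k \<Delta> = \<Gamma>" "\<Delta> \<turnstile> a \<Ztypecolon> lift 0 k A"
  shows "\<Delta> \<turnstile> ins 0 k t a \<doteq> ins 0 k u a \<Ztypecolon> ins 0 k B a"
  using sub_jeq[OF assms(1) sub_inst[OF assms(2-)]] by (simp add: inst_ins[symmetric] inst_def)

text \<open>A raw \<open>Pi\<close> can be typed only by its formation rule, by \<open>t_El\<close>
  or by conversion, and the last two keep the term. Inversion recovers the premises of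
  \<open>t_App\<close> from the typing of the function type.\<close>

lemma Pi_inv': "\<Gamma> \<turnstile> t \<Ztypecolon> C \<Longrightarrow> t = Pi A B \<Longrightarrow> \<Gamma> \<turnstile> A \<Ztypecolon> \<T> \<and> A # \<Gamma> \<turnstile> B \<Ztypecolon> \<T>"
  by (induction rule: wf_ctx_has_type_jeq.inducts(2)[where ?P1.0="\<lambda>_. True" and ?P3.0="\<lambda>_ _ _ _. True"])
    (auto intro: Univ_imp_type)

lemma Pi_inv: assumes "\<Gamma> \<turnstile> Pi A B \<Ztypecolon> C" shows "\<Gamma> \<turnstile> A \<Ztypecolon> \<T>" "A # \<Gamma> \<turnstile> B \<Ztypecolon> \<T>"
  using Pi_inv'[OF assms refl] by auto

lemma drop_1_Cons [simp]: "drop 1 (x # xs) = xs"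
  by (simp add: One_nat_def)

lemma one_le_Suc [simp]: "1 \<le> Suc n" by (simp add: One_nat_def)

lemma Suc_0_eq [simp]: "Suc 0 = 1"
  by (simp add: One_nat_def)

text \<open>
  The typing rules below are conditional rewrite rules: with them the simplifier acts as a type
  checker, comparing types after pushing \<open>lift\<close> and \<open>ins\<close> to the variables.
\<close>

lemma ctx_ConsI [simp]: "\<Gamma> \<turnstile> A \<Ztypecolon> \<T> \<Longrightarrow> A # \<Gamma> \<turnstile> ctx"
  by (simp add: ctx_Cons typing_ctx(2))

lemma ty_Univ: "\<Gamma> \<turnstile> A \<Ztypecolon> \<U> \<Longrightarrow> \<Gamma> \<turnstile> A \<Ztypecolon> Univ l"
  by (cases l) (auto intro: t_El)

lemma ty_simps [simp]:
  "\<Gamma> \<turnstile> ctx \<Longrightarrow> n < length \<Gamma> \<Longrightarrow> T = lift 0 (n + 1) (\<Gamma> ! n) \<Longrightarrow> \<Gamma> \<turnstile> Var n \<Ztypecolon> T"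
  "\<Gamma> \<turnstile> ctx \<Longrightarrow> \<Gamma> \<turnstile> \<U> \<Ztypecolon> \<T>"
  "\<Gamma> \<turnstile> A \<Ztypecolon> Univ l \<Longrightarrow> (A # \<Gamma> \<turnstile> ctx \<Longrightarrow> A # \<Gamma> \<turnstile> B \<Ztypecolon> Univ l) \<Longrightarrow> \<Gamma> \<turnstile> Pi A B \<Ztypecolon> Univ l"
  "\<Gamma> \<turnstile> A \<Ztypecolon> Univ l \<Longrightarrow> (A # \<Gamma> \<turnstile> ctx \<Longrightarrow> A # \<Gamma> \<turnstile> B \<Ztypecolon> Univ l) \<Longrightarrow> \<Gamma> \<turnstile> Sig A B \<Ztypecolon> Univ l"
  "\<Gamma> \<turnstile> A \<Ztypecolon> Univ l \<Longrightarrow> \<Gamma> \<turnstile> a \<Ztypecolon> A \<Longrightarrow> \<Gamma> \<turnstile> b \<Ztypecolon> A \<Longrightarrow> \<Gamma> \<turnstile> Idt A a b \<Ztypecolon> Univ l"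
  "A = A' \<Longrightarrow> \<Gamma> \<turnstile> A \<Ztypecolon> \<T> \<Longrightarrow> (A # \<Gamma> \<turnstile> ctx \<Longrightarrow> A # \<Gamma> \<turnstile> B \<Ztypecolon> \<T>) \<Longrightarrow> (A # \<Gamma> \<turnstile> ctx \<Longrightarrow> A # \<Gamma> \<turnstile> b \<Ztypecolon> B) \<Longrightarrow>
     \<Gamma> \<turnstile> Lam A b \<Ztypecolon> Pi A' B"
  "T = Sig A B \<Longrightarrow> \<Gamma> \<turnstile> A \<Ztypecolon> \<T> \<Longrightarrow> (A # \<Gamma> \<turnstile> ctx \<Longrightarrow> A # \<Gamma> \<turnstile> B \<Ztypecolon> \<T>) \<Longrightarrow> \<Gamma> \<turnstile> a \<Ztypecolon> A \<Longrightarrow>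
     \<Gamma> \<turnstile> b \<Ztypecolon> ins 0 0 B a \<Longrightarrow> \<Gamma> \<turnstile> Dpair A B a b \<Ztypecolon> T"
  "T = Idt A a a \<Longrightarrow> \<Gamma> \<turnstile> A \<Ztypecolon> \<T> \<Longrightarrow> \<Gamma> \<turnstile> a \<Ztypecolon> A \<Longrightarrow> \<Gamma> \<turnstile> Refl A a \<Ztypecolon> T"
  using t_Var[of \<Gamma> n, unfolded shift_lift] Univ_imp_type[of \<Gamma> A l]
  by (auto simp: One_nat_def simp del: Suc_0_eq intro: t_Univ t_Pi t_Sig t_Idt t_Lam t_Dpair t_Refl simp flip: inst_ins)

text \<open>This and its variants are the forms in which hypotheses are handed to the simplifier.
  Each supplies the hypothesis together with its weakened or instantiated copies in every extension
  of the context, where the extension is recognised by \<open>drop\<close>.\<close>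

lemma tyD:
  assumes "\<Gamma> \<turnstile> A \<Ztypecolon> \<U>"
  shows "\<Gamma> \<turnstile> A \<Ztypecolon> Univ l"
    and "\<Delta> \<turnstile> ctx \<Longrightarrow> k \<le> length \<Delta> \<Longrightarrow> drop k \<Delta> = \<Gamma> \<Longrightarrow> \<Delta> \<turnstile> lift 0 k A \<Ztypecolon> Univ l"
  using assms lift_ty[OF assms, of \<Delta> k] by (auto intro: ty_Univ)

lemma tmD:
  assumes "\<Gamma> \<turnstile> t \<Ztypecolon> A"
  shows "\<Gamma> \<turnstile> t \<Ztypecolon> A"
    and "\<Delta> \<turnstile> ctx \<Longrightarrow> k \<le> length \<Delta> \<Longrightarrow> drop k \<Delta> = \<Gamma> \<Longrightarrow> T = lift 0 k A \<Longrightarrow> \<Delta> \<turnstile> lift 0 k t \<Ztypecolon> T"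
  using assms lift_ty[OF assms, of \<Delta> k] by auto

lemma tyD1:
  assumes "A # \<Gamma> \<turnstile> B \<Ztypecolon> \<U>"
  shows "A # \<Gamma> \<turnstile> B \<Ztypecolon> Univ l"
    and "\<Delta> \<turnstile> ctx \<Longrightarrow> k \<le> length \<Delta> \<Longrightarrow> drop k \<Delta> = \<Gamma> \<Longrightarrow> \<Delta> \<turnstile> a \<Ztypecolon> lift 0 k A \<Longrightarrow> \<Delta> \<turnstile> ins 0 k B a \<Ztypecolon> Univ l"
    and "\<Delta> \<turnstile> ctx \<Longrightarrow> k \<le> length \<Delta> \<Longrightarrow> drop k \<Delta> = A # \<Gamma> \<Longrightarrow> \<Delta> \<turnstile> lift 0 k B \<Ztypecolon> Univ l"
  using assms ins_ty[OF assms, of \<Delta> k] lift_ty[OF assms, of \<Delta> k] by (auto intro: ty_Univ)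

lemma tmD1:
  assumes "A # \<Gamma> \<turnstile> t \<Ztypecolon> B"
  shows "A # \<Gamma> \<turnstile> t \<Ztypecolon> B"
    and "\<Delta> \<turnstile> ctx \<Longrightarrow> k \<le> length \<Delta> \<Longrightarrow> drop k \<Delta> = \<Gamma> \<Longrightarrow> \<Delta> \<turnstile> a \<Ztypecolon> lift 0 k A \<Longrightarrow> T = ins 0 k B a \<Longrightarrow>
      \<Delta> \<turnstile> ins 0 k t a \<Ztypecolon> T"
    and "\<Delta> \<turnstile> ctx \<Longrightarrow> k \<le> length \<Delta> \<Longrightarrow> drop k \<Delta> = A # \<Gamma> \<Longrightarrow> T = lift 0 k B \<Longrightarrow> \<Delta> \<turnstile> lift 0 k t \<Ztypecolon> T"
  using assms ins_ty[OF assms, of \<Delta> k] lift_ty[OF assms, of \<Delta> k] by auto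

lemma App_ty:
  assumes "\<Gamma> \<turnstile> f \<Ztypecolon> Pi A B" "\<Gamma> \<turnstile> Pi A B \<Ztypecolon> \<T>" "\<Gamma> \<turnstile> a \<Ztypecolon> A"
  shows "\<Gamma> \<turnstile> f $ a \<Ztypecolon> ins 0 0 B a"
  using t_App[OF Pi_inv[OF assms(2)] assms(1,3)] by (simp add: inst_ins)

text \<open>The domain of a function cannot be read off an application by rewriting. Each function
  in scope therefore brings its own typing rules for its applications.\<close>

lemma funD:
  assumes "\<Gamma> \<turnstile> f \<Ztypecolon> Pi A B" "\<Gamma> \<turnstile> Pi A B \<Ztypecolon> \<T>"
  shows "\<Gamma> \<turnstile> f \<Ztypecolon> Pi A B"
    and "\<Delta> \<turnstile> ctx \<Longrightarrow> k \<le> length \<Delta> \<Longrightarrow> drop k \<Delta> = \<Gamma> \<Longrightarrow> T = lift 0 k (Pi A B) \<Longrightarrow> \<Delta> \<turnstile> lift 0 k f \<Ztypecolon> T"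
    and "\<Gamma> \<turnstile> a \<Ztypecolon> A \<Longrightarrow> T = ins 0 0 B a \<Longrightarrow> \<Gamma> \<turnstile> f $ a \<Ztypecolon> T"
    and "\<Delta> \<turnstile> ctx \<Longrightarrow> k \<le> length \<Delta> \<Longrightarrow> drop k \<Delta> = \<Gamma> \<Longrightarrow> \<Delta> \<turnstile> a \<Ztypecolon> lift 0 k A \<Longrightarrow>
       T = ins 0 0 (lift 1 k B) a \<Longrightarrow> \<Delta> \<turnstile> (lift 0 k f) $ a \<Ztypecolon> T"
  using assms lift_ty[OF assms(1), of \<Delta> k] lift_ty[OF assms(2), of \<Delta> k] by (auto intro!: App_ty simp del: lift_1)

lemma funD1:
  assumes "N # \<Gamma> \<turnstile> f \<Ztypecolon> Pi A B" "N # \<Gamma> \<turnstile> Pi A B \<Ztypecolon> \<T>"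
  shows "\<Delta> \<turnstile> ctx \<Longrightarrow> k \<le> length \<Delta> \<Longrightarrow> drop k \<Delta> = \<Gamma> \<Longrightarrow> \<Delta> \<turnstile> n \<Ztypecolon> lift 0 k N \<Longrightarrow> T = ins 0 k (Pi A B) n \<Longrightarrow> \<Delta> \<turnstile> ins 0 k f n \<Ztypecolon> T"
    and "\<Delta> \<turnstile> ctx \<Longrightarrow> k \<le> length \<Delta> \<Longrightarrow> drop k \<Delta> = \<Gamma> \<Longrightarrow> \<Delta> \<turnstile> n \<Ztypecolon> lift 0 k N \<Longrightarrow> \<Delta> \<turnstile> a \<Ztypecolon> ins 0 k A n \<Longrightarrow>
       T = ins 0 0 (ins 1 k B n) a \<Longrightarrow> \<Delta> \<turnstile> (ins 0 k f n) $ a \<Ztypecolon> T"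
  using assms ins_ty[OF assms(1), of \<Delta> k n] ins_ty[OF assms(2), of \<Delta> k n] by (auto intro!: App_ty)

lemma inh_J:
  assumes "\<Gamma> \<turnstile> A \<Ztypecolon> \<T>" "\<Gamma> \<turnstile> a \<Ztypecolon> A" "\<Gamma> \<turnstile> b \<Ztypecolon> A" "\<Gamma> \<turnstile> p \<Ztypecolon> Idt A a b"
    and "Idt A\<up> a\<up> v0 # A # \<Gamma> \<turnstile> ctx \<Longrightarrow>
      Idt A\<up> a\<up> v0 # A # \<Gamma> \<turnstile> P \<Ztypecolon> \<T>"
    and "\<exists>d. \<Gamma> \<turnstile> d \<Ztypecolon> ins 0 0 (ins 1 0 P a) (Refl A a)"
  shows "\<exists>d. \<Gamma> \<turnstile> d \<Ztypecolon> ins 0 0 (ins 1 0 P b) p"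
proof -
  note [simp] = tmD[OF assms(2)] lift_ty[OF assms(1)] assms(1)
  have "\<Gamma> \<turnstile> ctx" using typing_ctx(2) assms(1) .
  then have "Idt A\<up> a\<up> v0 # A # \<Gamma> \<turnstile> ctx"
    using lift_ty[OF assms(1), of "A # \<Gamma>" 1] by simp
  then show ?thesis using t_J[OF assms(1,2) _ _ assms(3,4), of P] assms(5,6)
    unfolding inst2_ins shift_lift by blast
qed

section \<open>Propositional equality\<close>

text \<open>Many steps need a path only up to its existence, so the path term is hidden. The typings
  of the type and of both ends are part of the notion, which spares an inversion of identity types
  at each use.\<close>

definition peq :: "tm list \<Rightarrow> tm \<Rightarrow> tm \<Rightarrow> tm \<Rightarrow> bool" where
  "peq \<Gamma> A a b \<longleftrightarrow> \<Gamma> \<turnstile> A \<Ztypecolon> \<U> \<and> \<Gamma> \<turnstile> a \<Ztypecolon> A \<and> \<Gamma> \<turnstile> b \<Ztypecolon> A \<and> (\<exists>p. \<Gamma> \<turnstile> p \<Ztypecolon> Idt A a b)"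

definition jeqs :: "tm list \<Rightarrow> tm \<Rightarrow> tm \<Rightarrow> tm \<Rightarrow> bool" where
  "jeqs \<Gamma> A a b \<longleftrightarrow> \<Gamma> \<turnstile> A \<Ztypecolon> \<U> \<and> \<Gamma> \<turnstile> a \<Ztypecolon> A \<and> \<Gamma> \<turnstile> b \<Ztypecolon> A \<and> \<Gamma> \<turnstile> a \<doteq> b \<Ztypecolon> A"

lemma peqD: "peq \<Gamma> A a b \<Longrightarrow> \<Gamma> \<turnstile> A \<Ztypecolon> \<U>" "peq \<Gamma> A a b \<Longrightarrow> \<Gamma> \<turnstile> a \<Ztypecolon> A" "peq \<Gamma> A a b \<Longrightarrow> \<Gamma> \<turnstile> b \<Ztypecolon> A"
  "peq \<Gamma> A a b \<Longrightarrow> \<exists>p. \<Gamma> \<turnstile> p \<Ztypecolon> Idt A a b"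
  by (simp_all add: peq_def)

lemma lift_binders [simp]: "lift (j + 1) k t\<up> = (lift j k t)\<up>"
  "lift (j + 1 + 1) k t\<Up> = (lift j k t)\<Up>"
  by (auto simp: lift_def subst_algebra intro!: subst_cong)

lemma ins_binders [simp]: "ins (j + 1) k t\<up> x = (ins j k t x)\<up>"
  "ins (j + 1 + 1) k t\<Up> x = (ins j k t x)\<Up>"
  by simp_all

text \<open>\<open>trR\<close> with \<open>q\<close> and \<open>p\<close> plays the role of the composite of \<open>q\<close> and \<open>p\<close>, \<open>trL\<close> that of \<open>p\<inverse> \<cdot> q\<close>.\<close>

definition trR :: "tm \<Rightarrow> tm \<Rightarrow> tm \<Rightarrow> tm \<Rightarrow> tm \<Rightarrow> tm \<Rightarrow> tm" where
  "trR A c a q b p = J (Idt A\<Up> c\<Up> v1) q b p"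

definition trL :: "tm \<Rightarrow> tm \<Rightarrow> tm \<Rightarrow> tm \<Rightarrow> tm \<Rightarrow> tm \<Rightarrow> tm" where
  "trL A c a q b p = J (Idt A\<Up> v1 c\<Up>) q b p"

definition ap :: "tm \<Rightarrow> tm \<Rightarrow> tm \<Rightarrow> tm \<Rightarrow> tm \<Rightarrow> tm \<Rightarrow> tm" where
  "ap A B f a b p = J (Idt B\<Up> (f\<Up> $ a\<Up>) (f\<Up> $ v1))
     (Refl B (f $ a)) b p"

text \<open>This is \<open>happly\<close> at a single argument, by induction on the path alone: no
  abstraction over the argument stands between the path and its value.\<close>

definition hap :: "tm \<Rightarrow> tm \<Rightarrow> tm \<Rightarrow> tm \<Rightarrow> tm \<Rightarrow> tm \<Rightarrow> tm" where
  "hap A B f g p a = J (Idt (ins 0 0 B a)\<Up> (f\<Up> $ a\<Up>) (v1 $ a\<Up>))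
     (Refl (ins 0 0 B a) (f $ a)) g p"

abbreviation pinv :: "tm \<Rightarrow> tm \<Rightarrow> tm \<Rightarrow> tm \<Rightarrow> tm" where
  "pinv A a b p \<equiv> trL A a a (Refl A a) b p"

lemma trR_trL_simps [simp]:
  "lift j k (trR A c a q b p) = trR (lift j k A) (lift j k c) (lift j k a) (lift j k q) (lift j k b) (lift j k p)"
  "lift j k (trL A c a q b p) = trL (lift j k A) (lift j k c) (lift j k a) (lift j k q) (lift j k b) (lift j k p)"
  "ins j k (trR A c a q b p) x = trR (ins j k A x) (ins j k c x) (ins j k a x) (ins j k q x) (ins j k b x) (ins j k p x)"
  "ins j k (trL A c a q b p) x = trL (ins j k A x) (ins j k c x) (ins j k a x) (ins j k q x) (ins j k b x) (ins j k p x)"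
  "lift j k (ap A B f a b p) = ap (lift j k A) (lift j k B) (lift j k f) (lift j k a) (lift j k b) (lift j k p)"
  "ins j k (ap A B f a b p) x = ap (ins j k A x) (ins j k B x) (ins j k f x) (ins j k a x) (ins j k b x) (ins j k p x)"
  by (simp_all add: trR_def trL_def ap_def)

lemma lift_ins_gen: "lift (m + j) k (ins 0 m B a) = ins 0 m (lift (j + 1) k B) (lift (m + j) k a)"
  by (auto simp: lift_def ins_def subst_algebra intro!: subst_cong)

lemma ins_ins_gen: "ins (m + j) k (ins 0 m B a) x = ins 0 m (ins (j + 1) k B x) (ins (m + j) k a x)"
  by (auto simp: lift_def ins_def subst_algebra intro!: subst_cong)

lemma lift_ins2: "lift (j + 1 + 1) k (ins 0 2 B a) = ins 0 2 (lift (j + 1) k B) (lift (j + 1 + 1) k a)"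
  by (auto simp: lift_def ins_def subst_algebra intro!: subst_cong)

lemma ins_ins2: "ins (j + 1 + 1) k (ins 0 2 B a) x = ins 0 2 (ins (j + 1) k B x) (ins (j + 1 + 1) k a x)"
  by (auto simp: lift_def ins_def subst_algebra intro!: subst_cong)

lemma hap_simps [simp]:
  "lift j k (hap A B f g p a) = hap (lift j k A) (lift (j + 1) k B) (lift j k f) (lift j k g) (lift j k p) (lift j k a)"
  "ins j k (hap A B f g p a) x = hap (ins j k A x) (ins (j + 1) k B x) (ins j k f x) (ins j k g x) (ins j k p x) (ins j k a x)"
  using lift_ins_gen[of 0 j k B a] ins_ins_gen[of 0 j k B a x]
  by (simp_all add: hap_def lift_ins2 ins_ins2)

text \<open>This is needed for motives of \<open>J\<close>, whose second variable has a type that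
  depends on the first. The first instantiation is therefore carried under a binder by
  \<open>sub_up\<close> before the second one is made.\<close>

lemma ins2_ty:
  assumes "C # A # \<Gamma> \<turnstile> t \<Ztypecolon> T" "\<Gamma> \<turnstile> b \<Ztypecolon> A" "\<Gamma> \<turnstile> p \<Ztypecolon> ins 0 0 C b"
  shows "\<Gamma> \<turnstile> ins 0 0 (ins 1 0 t b) p \<Ztypecolon> ins 0 0 (ins 1 0 T b) p"
proof -
  have c: "\<Gamma> \<turnstile> ctx" "A # \<Gamma> \<turnstile> C \<Ztypecolon> \<T>"
    by (rule typing_ctx(2)[OF assms(2)], rule ctx_ConsD(1)[OF typing_ctx(2)[OF assms(1)]])
  have s: "sub \<Gamma> (case_nat b (\<lambda>n. Var (n + 0))) (A # \<Gamma>)"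
    by (rule sub_inst[OF c(1)]) (simp_all add: assms(2))
  have e: "ins 0 0 t b = subst (case_nat b (\<lambda>n. Var (n + 0))) t" for t
    by (simp add: inst_def flip: inst_ins)
  have C: "\<Gamma> \<turnstile> ins 0 0 C b \<Ztypecolon> \<T>" using ins_ty[OF c(2) c(1), of 0 b] assms(2) by simp
  have "sub (ins 0 0 C b # \<Gamma>) (up (case_nat b (\<lambda>n. Var (n + 0)))) (C # A # \<Gamma>)"
    by (rule sub_up[OF s e C])
  moreover have "ins 1 0 t b = subst (up (case_nat b (\<lambda>n. Var (n + 0)))) t" for t
    by (auto simp: ins_def up_def lift_def One_nat_def simp del: Suc_0_eq intro!: subst_cong split: nat.split)
  ultimately have "ins 0 0 C b # \<Gamma> \<turnstile> ins 1 0 t b \<Ztypecolon> ins 1 0 T b"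
    using sub_has_type[OF assms(1)] by simp
  from ins_ty[OF this c(1), of 0 p] assms(3) show ?thesis by simp
qed

lemma J_ty:
  assumes "\<Gamma> \<turnstile> A \<Ztypecolon> \<T>" "\<Gamma> \<turnstile> a \<Ztypecolon> A" "\<Gamma> \<turnstile> b \<Ztypecolon> A" "\<Gamma> \<turnstile> p \<Ztypecolon> Idt A a b"
    and "Idt A\<up> a\<up> v0 # A # \<Gamma> \<turnstile> ctx \<Longrightarrow>
      Idt A\<up> a\<up> v0 # A # \<Gamma> \<turnstile> P \<Ztypecolon> \<T>"
    and "\<Gamma> \<turnstile> d \<Ztypecolon> ins 0 0 (ins 1 0 P a) (Refl A a)"
  shows "\<Gamma> \<turnstile> J P d b p \<Ztypecolon> ins 0 0 (ins 1 0 P b) p"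
    and "\<Gamma> \<turnstile> J P d a (Refl A a) \<doteq> d \<Ztypecolon> ins 0 0 (ins 1 0 P a) (Refl A a)"
proof -
  note [simp] = tmD[OF assms(2)] lift_ty[OF assms(1)] assms(1)
  have "\<Gamma> \<turnstile> ctx" using typing_ctx(2) assms(1) .
  then have "Idt A\<up> a\<up> v0 # A # \<Gamma> \<turnstile> ctx"
    using lift_ty[OF assms(1), of "A # \<Gamma>" 1] by simp
  then show "\<Gamma> \<turnstile> J P d b p \<Ztypecolon> ins 0 0 (ins 1 0 P b) p"
    and "\<Gamma> \<turnstile> J P d a (Refl A a) \<doteq> d \<Ztypecolon> ins 0 0 (ins 1 0 P a) (Refl A a)"
    using t_J[OF assms(1,2) _ _ assms(3,4), of P] e_J_Refl[OF assms(1,2), of P] assms(5,6)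
    unfolding inst2_ins shift_lift by blast+
qed

lemma peq_jeq: "jeqs \<Gamma> A a b \<Longrightarrow> peq \<Gamma> A a b"
proof -
  assume "jeqs \<Gamma> A a b"
  then have *: "\<Gamma> \<turnstile> A \<Ztypecolon> \<U>" "\<Gamma> \<turnstile> a \<Ztypecolon> A" "\<Gamma> \<turnstile> b \<Ztypecolon> A" "\<Gamma> \<turnstile> a \<doteq> b \<Ztypecolon> A" by (auto simp: jeqs_def)
  have "\<Gamma> \<turnstile> Idt A a a \<doteq> Idt A a b \<Ztypecolon> \<T>"
    using * by (intro e_Idt e_refl t_El)
  then have "\<Gamma> \<turnstile> Refl A a \<Ztypecolon> Idt A a b" using * by (intro t_conv[OF t_Refl]) (auto intro: t_El)
  then show ?thesis using * by (auto simp: peq_def)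
qed

lemma jeqs_sym: "jeqs \<Gamma> A a b \<Longrightarrow> jeqs \<Gamma> A b a"
  by (auto simp: jeqs_def intro: e_sym)

lemma peq_refl: "\<Gamma> \<turnstile> A \<Ztypecolon> \<U> \<Longrightarrow> \<Gamma> \<turnstile> a \<Ztypecolon> A \<Longrightarrow> peq \<Gamma> A a a"
  by (auto simp: peq_def intro!: t_Refl t_El)

text \<open>Path induction with an identity type as motive: an equation whose sides and type may
  depend on the end point and on the path needs to be checked at reflexivity only.\<close>

lemma peq_J:
  assumes "\<Gamma> \<turnstile> A \<Ztypecolon> \<U>" "\<Gamma> \<turnstile> a \<Ztypecolon> A" "\<Gamma> \<turnstile> b \<Ztypecolon> A" "\<Gamma> \<turnstile> p \<Ztypecolon> Idt A a b"
    and "Idt A\<up> a\<up> v0 # A # \<Gamma> \<turnstile> ctx \<Longrightarrow>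
      Idt A\<up> a\<up> v0 # A # \<Gamma> \<turnstile> T \<Ztypecolon> \<U> \<and>
      Idt A\<up> a\<up> v0 # A # \<Gamma> \<turnstile> l \<Ztypecolon> T \<and>
      Idt A\<up> a\<up> v0 # A # \<Gamma> \<turnstile> r \<Ztypecolon> T"
    and "peq \<Gamma> (ins 0 0 (ins 1 0 T a) (Refl A a)) (ins 0 0 (ins 1 0 l a) (Refl A a)) (ins 0 0 (ins 1 0 r a) (Refl A a))"
  shows "peq \<Gamma> (ins 0 0 (ins 1 0 T b) p) (ins 0 0 (ins 1 0 l b) p) (ins 0 0 (ins 1 0 r b) p)"
proof -
  note [simp] = tyD[OF assms(1)] tmD[OF assms(2)] typing_ctx(2)[OF assms(1)]
  let ?\<Delta> = "Idt A\<up> a\<up> v0 # A # \<Gamma>"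
  have c: "?\<Delta> \<turnstile> ctx" by simp
  have "\<exists>d. \<Gamma> \<turnstile> d \<Ztypecolon> ins 0 0 (ins 1 0 (Idt T l r) b) p"
    by (rule inh_J[OF ty_Univ[OF assms(1)] assms(2-4)])
      (use assms(5,6) in \<open>auto simp: peq_def intro: ty_Univ\<close>)
  moreover have "\<Gamma> \<turnstile> ins 0 0 (ins 1 0 T b) p \<Ztypecolon> \<U>"
    "\<Gamma> \<turnstile> ins 0 0 (ins 1 0 l b) p \<Ztypecolon> ins 0 0 (ins 1 0 T b) p"
    "\<Gamma> \<turnstile> ins 0 0 (ins 1 0 r b) p \<Ztypecolon> ins 0 0 (ins 1 0 T b) p"
    using assms(5)[OF c] ins2_ty[of "Idt A\<up> a\<up> v0" A \<Gamma> _ _ b p] assms(3,4)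
    by force+
  ultimately show ?thesis unfolding peq_def by simp
qed

lemma trR_ty:
  assumes [simp]: "\<Gamma> \<turnstile> A \<Ztypecolon> \<U>" "\<Gamma> \<turnstile> c \<Ztypecolon> A" "\<Gamma> \<turnstile> a \<Ztypecolon> A" "\<Gamma> \<turnstile> q \<Ztypecolon> Idt A c a"
  shows "\<Gamma> \<turnstile> b \<Ztypecolon> A \<Longrightarrow> \<Gamma> \<turnstile> p \<Ztypecolon> Idt A a b \<Longrightarrow> T = Idt A c b \<Longrightarrow> \<Gamma> \<turnstile> trR A c a q b p \<Ztypecolon> T"
    and "peq \<Gamma> (Idt A c a) (trR A c a q a (Refl A a)) q"
proof -
  note [simp] = tyD[OF assms(1)] tmD[OF assms(2)] tmD[OF assms(3)] typing_ctx(2)[OF assms(1)]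
  note J = J_ty[where P="Idt A\<Up> c\<Up> v1" and d=q and A=A and \<Gamma>=\<Gamma> and a=a]
  show 1: "\<Gamma> \<turnstile> b \<Ztypecolon> A \<Longrightarrow> \<Gamma> \<turnstile> p \<Ztypecolon> Idt A a b \<Longrightarrow> T = Idt A c b \<Longrightarrow> \<Gamma> \<turnstile> trR A c a q b p \<Ztypecolon> T" for b p T
    using J(1)[of b p] by (simp add: trR_def)
  show "peq \<Gamma> (Idt A c a) (trR A c a q a (Refl A a)) q"
    using J(2)[of a "Refl A a"] 1[of a "Refl A a"] by (intro peq_jeq) (simp add: jeqs_def trR_def)
qed

lemma trL_ty:
  assumes [simp]: "\<Gamma> \<turnstile> A \<Ztypecolon> \<U>" "\<Gamma> \<turnstile> c \<Ztypecolon> A" "\<Gamma> \<turnstile> a \<Ztypecolon> A" "\<Gamma> \<turnstile> q \<Ztypecolon> Idt A a c"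
  shows "\<Gamma> \<turnstile> b \<Ztypecolon> A \<Longrightarrow> \<Gamma> \<turnstile> p \<Ztypecolon> Idt A a b \<Longrightarrow> T = Idt A b c \<Longrightarrow> \<Gamma> \<turnstile> trL A c a q b p \<Ztypecolon> T"
    and "peq \<Gamma> (Idt A a c) (trL A c a q a (Refl A a)) q"
proof -
  note [simp] = tyD[OF assms(1)] tmD[OF assms(2)] tmD[OF assms(3)] typing_ctx(2)[OF assms(1)]
  note J = J_ty[where P="Idt A\<Up> v1 c\<Up>" and d=q and A=A and \<Gamma>=\<Gamma> and a=a]
  show 1: "\<Gamma> \<turnstile> b \<Ztypecolon> A \<Longrightarrow> \<Gamma> \<turnstile> p \<Ztypecolon> Idt A a b \<Longrightarrow> T = Idt A b c \<Longrightarrow> \<Gamma> \<turnstile> trL A c a q b p \<Ztypecolon> T" for b p T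
    using J(1)[of b p] by (simp add: trL_def)
  show "peq \<Gamma> (Idt A a c) (trL A c a q a (Refl A a)) q"
    using J(2)[of a "Refl A a"] 1[of a "Refl A a"] by (intro peq_jeq) (simp add: jeqs_def trL_def)
qed

lemma Pi_arg_type: "\<Gamma> \<turnstile> A \<Ztypecolon> \<U> \<Longrightarrow> \<Gamma> \<turnstile> B \<Ztypecolon> \<U> \<Longrightarrow> \<Gamma> \<turnstile> Pi A B\<up> \<Ztypecolon> \<T>"
  using tyD[of \<Gamma> A] tyD[of \<Gamma> B] typing_ctx(2)[of \<Gamma> A] by simp

lemma ap_ty:
  assumes [simp]: "\<Gamma> \<turnstile> A \<Ztypecolon> \<U>" "\<Gamma> \<turnstile> B \<Ztypecolon> \<U>" "\<Gamma> \<turnstile> f \<Ztypecolon> Pi A B\<up>" "\<Gamma> \<turnstile> a \<Ztypecolon> A"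
  shows "\<Gamma> \<turnstile> b \<Ztypecolon> A \<Longrightarrow> \<Gamma> \<turnstile> p \<Ztypecolon> Idt A a b \<Longrightarrow> T = Idt B (f $ a) (f $ b) \<Longrightarrow> \<Gamma> \<turnstile> ap A B f a b p \<Ztypecolon> T"
    and "peq \<Gamma> (Idt B (f $ a) (f $ a)) (ap A B f a a (Refl A a)) (Refl B (f $ a))"
proof -
  note [simp] = tyD[OF assms(1)] tyD[OF assms(2)] tmD[OF assms(4)] typing_ctx(2)[OF assms(1)]
    funD[OF assms(3) Pi_arg_type[OF assms(1,2)]]
  note J = J_ty[where P="Idt B\<Up> (f\<Up> $ a\<Up>) (f\<Up> $ v1)" and
     d="Refl B (f $ a)" and A=A and \<Gamma>=\<Gamma> and a=a]
  show 1: "\<Gamma> \<turnstile> b \<Ztypecolon> A \<Longrightarrow> \<Gamma> \<turnstile> p \<Ztypecolon> Idt A a b \<Longrightarrow> T = Idt B (f $ a) (f $ b) \<Longrightarrow> \<Gamma> \<turnstile> ap A B f a b p \<Ztypecolon> T" for b p T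
    using J(1)[of b p] by (simp add: ap_def)
  show "peq \<Gamma> (Idt B (f $ a) (f $ a)) (ap A B f a a (Refl A a)) (Refl B (f $ a))"
    using J(2)[of a "Refl A a"] 1[of a "Refl A a"] by (intro peq_jeq) (simp add: jeqs_def ap_def)
qed

lemma hap_ty:
  assumes [simp]: "\<Gamma> \<turnstile> A \<Ztypecolon> \<U>" "A # \<Gamma> \<turnstile> B \<Ztypecolon> \<U>" "\<Gamma> \<turnstile> f \<Ztypecolon> Pi A B" "\<Gamma> \<turnstile> a \<Ztypecolon> A"
  shows "\<Gamma> \<turnstile> g \<Ztypecolon> Pi A B \<Longrightarrow> \<Gamma> \<turnstile> p \<Ztypecolon> Idt (Pi A B) f g \<Longrightarrow> T = Idt (ins 0 0 B a) (f $ a) (g $ a) \<Longrightarrow>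
      \<Gamma> \<turnstile> hap A B f g p a \<Ztypecolon> T"
    and "peq \<Gamma> (Idt (ins 0 0 B a) (f $ a) (f $ a)) (hap A B f f (Refl (Pi A B) f) a) (Refl (ins 0 0 B a) (f $ a))"
proof -
  note [simp] = tyD[OF assms(1)] tyD1[OF assms(2)] tmD[OF assms(4)] typing_ctx(2)[OF assms(1)]
  have P: "\<Gamma> \<turnstile> Pi A B \<Ztypecolon> \<U>" "\<Gamma> \<turnstile> Pi A B \<Ztypecolon> \<T>" by simp_all
  note [simp] = funD[OF assms(3) P(2)] tyD[OF P(1)]
  let ?\<Delta> = "Idt (Pi A B)\<up> f\<up> v0 # Pi A B # \<Gamma>"
  let ?P = "Idt (ins 0 0 B a)\<Up> (f\<Up> $ a\<Up>) (v1 $ a\<Up>)"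
  have Ba: "\<Gamma> \<turnstile> ins 0 0 B a \<Ztypecolon> \<U>" by simp
  have fa: "\<Gamma> \<turnstile> f $ a \<Ztypecolon> ins 0 0 B a" by (rule App_ty[OF assms(3) P(2) assms(4)])
  have PT: "?\<Delta> \<turnstile> ?P \<Ztypecolon> \<T>" if C: "?\<Delta> \<turnstile> ctx"
  proof -
    have e: "(ins 0 0 B a)\<Up> = ins 0 0 (lift 1 2 B) a\<Up>"
      using lift_ins_gen[of 0 0 2 B a] by (simp only: add_0_left add_0_right)
    have "?\<Delta> \<turnstile> (Pi A B)\<Up> \<Ztypecolon> \<T>"
      by (rule tyD(2)[OF P(1) C]) simp_all
    moreover have "?\<Delta> \<turnstile> v1 \<Ztypecolon> (Pi A B)\<Up>" using C by (intro ty_simps) simp_all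
    moreover have a: "?\<Delta> \<turnstile> a\<Up> \<Ztypecolon> A\<Up>" using C by (intro tmD(2)[OF assms(4)]) simp_all
    ultimately have 1: "?\<Delta> \<turnstile> v1 $ a\<Up> \<Ztypecolon> (ins 0 0 B a)\<Up>"
      unfolding e by (intro App_ty[where A="A\<Up>"]) simp_all
    have 2: "?\<Delta> \<turnstile> (f $ a)\<Up> \<Ztypecolon> (ins 0 0 B a)\<Up>"
      by (rule tmD(2)[OF fa C]) simp_all
    have 3: "?\<Delta> \<turnstile> (ins 0 0 B a)\<Up> \<Ztypecolon> \<T>" by (rule tyD(2)[OF Ba C]) simp_all
    show ?thesis using t_Idt[OF 3 _ 1] 2 by simp
  qed
  have e: "ins 0 0 (ins 1 0 t\<Up> g) p = t" for t g p by simp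
  have e2: "ins 0 0 (ins 1 0 ?P g) p = Idt (ins 0 0 B a) (f $ a) (g $ a)" for g p
    by (simp only: ins_simps e) simp
  note J = J_ty[OF P(2) assms(3) _ _ PT, of _ _ "Refl (ins 0 0 B a) (f $ a)", unfolded e2]
  show 1: "\<Gamma> \<turnstile> g \<Ztypecolon> Pi A B \<Longrightarrow> \<Gamma> \<turnstile> p \<Ztypecolon> Idt (Pi A B) f g \<Longrightarrow> T = Idt (ins 0 0 B a) (f $ a) (g $ a) \<Longrightarrow>
      \<Gamma> \<turnstile> hap A B f g p a \<Ztypecolon> T" for g p T
    using J(1)[of g p] t_Refl[OF ty_Univ[OF Ba] fa] unfolding hap_def by simp
  show "peq \<Gamma> (Idt (ins 0 0 B a) (f $ a) (f $ a)) (hap A B f f (Refl (Pi A B) f) a) (Refl (ins 0 0 B a) (f $ a))"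
    using J(2)[of f "Refl (Pi A B) f"] 1[of f "Refl (Pi A B) f"] t_Refl[OF ty_Univ[OF Ba] fa] t_Refl[OF P(2) assms(3)] Ba fa assms(3)
    unfolding hap_def by (intro peq_jeq) (simp add: jeqs_def)
qed

declare trR_ty(1) [simp] trL_ty(1) [simp] ap_ty(1) [simp] hap_ty(1) [simp]

lemma peqI: "\<Gamma> \<turnstile> A \<Ztypecolon> \<U> \<Longrightarrow> \<Gamma> \<turnstile> a \<Ztypecolon> A \<Longrightarrow> \<Gamma> \<turnstile> b \<Ztypecolon> A \<Longrightarrow> \<Gamma> \<turnstile> p \<Ztypecolon> Idt A a b \<Longrightarrow> peq \<Gamma> A a b"
  by (auto simp: peq_def)

lemma peq_sym: "peq \<Gamma> A a b \<Longrightarrow> peq \<Gamma> A b a"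
proof -
  assume p: "peq \<Gamma> A a b"
  note [simp] = peqD(1-3)[OF p] tyD(1)[OF peqD(1)[OF p]]
  obtain p where [simp]: "\<Gamma> \<turnstile> p \<Ztypecolon> Idt A a b" using peqD(4)[OF p] ..
  show ?thesis by (rule peqI[where p="pinv A a b p"]) simp_all
qed

lemma peq_trans [trans]: "peq \<Gamma> A a b \<Longrightarrow> peq \<Gamma> A b c \<Longrightarrow> peq \<Gamma> A a c"
proof -
  assume p: "peq \<Gamma> A a b" and q: "peq \<Gamma> A b c"
  note [simp] = peqD(1-3)[OF p] peqD(1-3)[OF q] tyD(1)[OF peqD(1)[OF p]]
  obtain p where [simp]: "\<Gamma> \<turnstile> p \<Ztypecolon> Idt A a b" using peqD(4)[OF p] ..
  obtain q where [simp]: "\<Gamma> \<turnstile> q \<Ztypecolon> Idt A b c" using peqD(4)[OF q] ..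
  show ?thesis by (rule peqI[where p="trR A a b p c q"]) simp_all
qed

lemma peq_cong:
  assumes t: "A # \<Gamma> \<turnstile> t \<Ztypecolon> B\<up>" and B: "\<Gamma> \<turnstile> B \<Ztypecolon> \<U>" and p: "peq \<Gamma> A a b"
  shows "peq \<Gamma> B (ins 0 0 t a) (ins 0 0 t b)"
proof -
  note [simp] = tyD[OF B] tyD[OF peqD(1)[OF p]] tmD[OF peqD(2)[OF p]] tmD[OF peqD(3)[OF p]] tmD1[OF t]
    typing_ctx(2)[OF B]
  obtain p where [simp]: "\<Gamma> \<turnstile> p \<Ztypecolon> Idt A a b" using peqD(4)[OF p] ..
  show ?thesis
    using peq_J[of \<Gamma> A a b p "B\<Up>" "ins 0 2 t a\<Up>" "ins 0 2 t v1"]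
    by (simp add: peq_refl)
qed

lemma trR_cong:
  assumes "\<Gamma> \<turnstile> A \<Ztypecolon> \<U>" "\<Gamma> \<turnstile> c \<Ztypecolon> A" "\<Gamma> \<turnstile> a \<Ztypecolon> A" "\<Gamma> \<turnstile> b \<Ztypecolon> A"
    and q: "peq \<Gamma> (Idt A c a) q q'" and p: "peq \<Gamma> (Idt A a b) p p'"
  shows "peq \<Gamma> (Idt A c b) (trR A c a q b p) (trR A c a q' b p')"
proof -
  note [simp] = assms(1-4) assms(1-4)[THEN tmD(2)] tyD[OF assms(1)] typing_ctx(2)[OF assms(1)]
     tmD[OF peqD(2)[OF p]] tmD[OF peqD(3)[OF p]] tmD[OF peqD(2)[OF q]] tmD[OF peqD(3)[OF q]]
  have "peq \<Gamma> (Idt A c b) (trR A c a q b p) (trR A c a q' b p)"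
    using peq_cong[of "Idt A c a" \<Gamma> "trR A\<up> c\<up> a\<up> v0 b\<up> p\<up>" "Idt A c b" q q'] q
    by simp
  also have "peq \<Gamma> (Idt A c b) \<dots> (trR A c a q' b p')"
    using peq_cong[of "Idt A a b" \<Gamma> "trR A\<up> c\<up> a\<up> q'\<up> b\<up> v0" "Idt A c b" p p'] p
    by simp
  finally show ?thesis .
qed

lemma trL_cong:
  assumes "\<Gamma> \<turnstile> A \<Ztypecolon> \<U>" "\<Gamma> \<turnstile> c \<Ztypecolon> A" "\<Gamma> \<turnstile> a \<Ztypecolon> A" "\<Gamma> \<turnstile> b \<Ztypecolon> A"
    and q: "peq \<Gamma> (Idt A a c) q q'" and p: "peq \<Gamma> (Idt A a b) p p'"
  shows "peq \<Gamma> (Idt A b c) (trL A c a q b p) (trL A c a q' b p')"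
proof -
  note [simp] = assms(1-4) assms(1-4)[THEN tmD(2)] tyD[OF assms(1)] typing_ctx(2)[OF assms(1)]
     tmD[OF peqD(2)[OF p]] tmD[OF peqD(3)[OF p]] tmD[OF peqD(2)[OF q]] tmD[OF peqD(3)[OF q]]
  have "peq \<Gamma> (Idt A b c) (trL A c a q b p) (trL A c a q' b p)"
    using peq_cong[of "Idt A a c" \<Gamma> "trL A\<up> c\<up> a\<up> v0 b\<up> p\<up>" "Idt A b c" q q'] q
    by simp
  also have "peq \<Gamma> (Idt A b c) \<dots> (trL A c a q' b p')"
    using peq_cong[of "Idt A a b" \<Gamma> "trL A\<up> c\<up> a\<up> q'\<up> b\<up> v0" "Idt A b c" p p'] p
    by simp
  finally show ?thesis .
qed

section \<open>Groupoid laws for \<open>trR\<close> and \<open>trL\<close>, each by induction on one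
  path\<close>

lemma trR_Refl_left:
  assumes "\<Gamma> \<turnstile> A \<Ztypecolon> \<U>" "\<Gamma> \<turnstile> a \<Ztypecolon> A" "\<Gamma> \<turnstile> b \<Ztypecolon> A" "\<Gamma> \<turnstile> p \<Ztypecolon> Idt A a b"
  shows "peq \<Gamma> (Idt A a b) (trR A a a (Refl A a) b p) p"
proof -
  note [simp] = assms assms[THEN tmD(2)] tyD[OF assms(1)] typing_ctx(2)[OF assms(1)]
  show ?thesis
    using peq_J[of \<Gamma> A a b p "Idt A\<Up> a\<Up> v1"
      "trR A\<Up> a\<Up> a\<Up> (Refl A a)\<Up> v1 v0" "v0"]
    by (simp add: trR_ty(2))
qed

lemma trL_self:
  assumes "\<Gamma> \<turnstile> A \<Ztypecolon> \<U>" "\<Gamma> \<turnstile> a \<Ztypecolon> A" "\<Gamma> \<turnstile> b \<Ztypecolon> A" "\<Gamma> \<turnstile> p \<Ztypecolon> Idt A a b"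
  shows "peq \<Gamma> (Idt A b b) (trL A b a p b p) (Refl A b)"
proof -
  note [simp] = assms assms[THEN tmD(2)] tyD[OF assms(1)] typing_ctx(2)[OF assms(1)]
  show ?thesis
    using peq_J[of \<Gamma> A a b p "Idt A\<Up> v1 v1"
      "trL A\<Up> v1 a\<Up> v0 v1 v0" "Refl A\<Up> v1"]
    by (simp add: trL_ty(2))
qed

lemma trR_trL:
  assumes "\<Gamma> \<turnstile> A \<Ztypecolon> \<U>" "\<Gamma> \<turnstile> c \<Ztypecolon> A" "\<Gamma> \<turnstile> a \<Ztypecolon> A" "\<Gamma> \<turnstile> b \<Ztypecolon> A"
    "\<Gamma> \<turnstile> q \<Ztypecolon> Idt A c a" "\<Gamma> \<turnstile> q' \<Ztypecolon> Idt A c b"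
  shows "peq \<Gamma> (Idt A c b) (trR A c a q b (trL A b c q' a q)) q'"
proof -
  note [simp] = assms assms[THEN tmD(2)] tyD[OF assms(1)] typing_ctx(2)[OF assms(1)]
  have "peq \<Gamma> (Idt A c b) (trR A c c (Refl A c) b (trL A b c q' c (Refl A c))) (trR A c c (Refl A c) b q')"
    by (intro trR_cong trL_ty(2) peq_refl) simp_all
  also have "peq \<Gamma> (Idt A c b) \<dots> q'" by (simp add: trR_Refl_left)
  finally show ?thesis
    using peq_J[of \<Gamma> A c a q "Idt A\<Up> c\<Up> b\<Up>"
      "trR A\<Up> c\<Up> v1 v0 b\<Up> (trL A\<Up> b\<Up> c\<Up> q'\<Up> v1 v0)"
      "q'\<Up>"]
    by simp
qed

lemma trL_trR:
  assumes "\<Gamma> \<turnstile> A \<Ztypecolon> \<U>" "\<Gamma> \<turnstile> c \<Ztypecolon> A" "\<Gamma> \<turnstile> a \<Ztypecolon> A" "\<Gamma> \<turnstile> b \<Ztypecolon> A"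
    "\<Gamma> \<turnstile> q \<Ztypecolon> Idt A c a" "\<Gamma> \<turnstile> p \<Ztypecolon> Idt A a b"
  shows "peq \<Gamma> (Idt A a b) (trL A b c (trR A c a q b p) a q) p"
proof -
  note [simp] = assms assms[THEN tmD(2)] tyD[OF assms(1)] typing_ctx(2)[OF assms(1)]
  have "peq \<Gamma> (Idt A a a) (trL A a c (trR A c a q a (Refl A a)) a q) (trL A a c q a q)"
    by (intro trL_cong trR_ty(2) peq_refl) simp_all
  also have "peq \<Gamma> (Idt A a a) \<dots> (Refl A a)" by (simp add: trL_self)
  finally show ?thesis
    using peq_J[of \<Gamma> A a b p "Idt A\<Up> a\<Up> v1"
      "trL A\<Up> v1 c\<Up> (trR A\<Up> c\<Up> a\<Up> q\<Up> v1 v0) a\<Up> q\<Up>"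
      "v0"]
    by simp
qed

text \<open>In path notation this is \<open>(w \<cdot> a)\<inverse> \<cdot> w = a\<inverse>\<close>.
  With it the homotopies of a newly built extension are compared with those of the given
  ones.\<close>

lemma trL_trR_inv:
  assumes "\<Gamma> \<turnstile> A \<Ztypecolon> \<U>" "\<Gamma> \<turnstile> u \<Ztypecolon> A" "\<Gamma> \<turnstile> v \<Ztypecolon> A" "\<Gamma> \<turnstile> z \<Ztypecolon> A"
    "\<Gamma> \<turnstile> w \<Ztypecolon> Idt A u v" "\<Gamma> \<turnstile> a \<Ztypecolon> Idt A v z"
  shows "peq \<Gamma> (Idt A z v) (trL A v u w z (trR A u v w z a)) (pinv A v z a)"
proof -
  note [simp] = assms assms[THEN tmD(2)] tyD[OF assms(1)] typing_ctx(2)[OF assms(1)]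
  have "peq \<Gamma> (Idt A v v) (trL A v u w v (trR A u v w v (Refl A v))) (trL A v u w v w)"
    by (intro trL_cong trR_ty(2) peq_refl) simp_all
  also have "peq \<Gamma> (Idt A v v) \<dots> (Refl A v)" by (simp add: trL_self)
  also have "peq \<Gamma> (Idt A v v) \<dots> (pinv A v v (Refl A v))" by (intro peq_sym[OF trL_ty(2)]) simp_all
  finally show ?thesis
    using peq_J[of \<Gamma> A v z a "Idt A\<Up> v1 v\<Up>"
      "trL A\<Up> v\<Up> u\<Up> w\<Up> v1 (trR A\<Up> u\<Up> v\<Up> w\<Up> v1 v0)"
      "pinv A\<Up> v\<Up> v1 v0"]
    by simp
qed

lemma pinv_pinv:
  assumes "\<Gamma> \<turnstile> A \<Ztypecolon> \<U>" "\<Gamma> \<turnstile> a \<Ztypecolon> A" "\<Gamma> \<turnstile> b \<Ztypecolon> A" "\<Gamma> \<turnstile> p \<Ztypecolon> Idt A a b"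
  shows "peq \<Gamma> (Idt A a b) (pinv A b a (pinv A a b p)) p"
proof -
  note [simp] = assms assms[THEN tmD(2)] tyD[OF assms(1)] typing_ctx(2)[OF assms(1)]
  have "peq \<Gamma> (Idt A a a) (pinv A a a (pinv A a a (Refl A a))) (pinv A a a (Refl A a))"
    by (intro trL_cong trL_ty(2) peq_refl) simp_all
  also have "peq \<Gamma> (Idt A a a) \<dots> (Refl A a)" by (intro trL_ty(2)) simp_all
  finally show ?thesis
    using peq_J[of \<Gamma> A a b p "Idt A\<Up> a\<Up> v1"
      "pinv A\<Up> v1 a\<Up> (pinv A\<Up> a\<Up> v1 v0)" "v0"]
    by simp
qed

text \<open>In path notation this is \<open>r = v \<cdot> (r\<inverse> \<cdot> v)\<inverse>\<close>.
  It recovers a path between two sections from its effect on the homotopies to a common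
  section.\<close>

lemma eq_trR_inv_trL:
  assumes "\<Gamma> \<turnstile> A \<Ztypecolon> \<U>" "\<Gamma> \<turnstile> u \<Ztypecolon> A" "\<Gamma> \<turnstile> u' \<Ztypecolon> A" "\<Gamma> \<turnstile> z \<Ztypecolon> A"
    "\<Gamma> \<turnstile> r \<Ztypecolon> Idt A u u'" "\<Gamma> \<turnstile> v \<Ztypecolon> Idt A u z"
  shows "peq \<Gamma> (Idt A u u') r (trR A u z v u' (pinv A u' z (trL A z u v u' r)))"
proof -
  note [simp] = assms assms[THEN tmD(2)] tyD[OF assms(1)] typing_ctx(2)[OF assms(1)]
  have "peq \<Gamma> (Idt A u u) (trR A u u (Refl A u) u (pinv A u u (Refl A u))) (trR A u u (Refl A u) u (Refl A u))"
    by (intro trR_cong trL_ty(2) peq_refl) simp_all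
  also have "peq \<Gamma> (Idt A u u) \<dots> (Refl A u)" by (intro trR_ty(2)) simp_all
  finally have 1: "peq \<Gamma> (Idt A u u) (Refl A u) (trR A u z v u (pinv A u z v))"
    using peq_J[of \<Gamma> A u z v "Idt A\<Up> u\<Up> u\<Up>" "Refl A\<Up> u\<Up>"
      "trR A\<Up> u\<Up> v1 v0 u\<Up> (pinv A\<Up> u\<Up> v1 v0)"]
    by (simp add: peq_sym)
  have "peq \<Gamma> (Idt A u u) (trR A u z v u (pinv A u z (trL A z u v u (Refl A u)))) (trR A u z v u (pinv A u z v))"
    by (intro trR_cong trL_cong trL_ty(2) peq_refl) simp_all
  from peq_trans[OF 1 peq_sym[OF this]] show ?thesis
    using peq_J[of \<Gamma> A u u' r "Idt A\<Up> u\<Up> v1" "v0"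
      "trR A\<Up> u\<Up> z\<Up> v\<Up> v1
        (pinv A\<Up> v1 z\<Up> (trL A\<Up> z\<Up> u\<Up> v\<Up> v1 v0))"]
    by simp
qed

text \<open>The rules state congruence for the term formers and not for substitution. A beta
  expansion turns the instance \<open>ins 0 0 B a\<close> into an application, where
  \<open>e_App\<close> replaces the argument.\<close>

lemma jeq_cong_type:
  assumes t: "A # \<Gamma> \<turnstile> B \<Ztypecolon> \<U>" and a: "\<Gamma> \<turnstile> a \<Ztypecolon> A" "\<Gamma> \<turnstile> a' \<Ztypecolon> A" "\<Gamma> \<turnstile> a \<doteq> a' \<Ztypecolon> A"
  shows "\<Gamma> \<turnstile> ins 0 0 B a \<doteq> ins 0 0 B a' \<Ztypecolon> \<U>"
proof -
  have A: "\<Gamma> \<turnstile> A \<Ztypecolon> \<T>" using typing_ctx(2)[OF t] ctx_ConsD(1) by blast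
  have U: "A # \<Gamma> \<turnstile> \<U> \<Ztypecolon> \<T>" by (simp add: typing_ctx(2)[OF t])
  have "\<Gamma> \<turnstile> (Lam A B) $ a \<doteq> ins 0 0 B a \<Ztypecolon> \<U>"
    using e_beta[OF A U t a(1)] by (simp add: inst_ins)
  moreover have "\<Gamma> \<turnstile> (Lam A B) $ a \<doteq> (Lam A B) $ a' \<Ztypecolon> \<U>"
    using e_App[OF A U e_refl[OF t_Lam[OF A U t]] a(3)] by (simp add: inst_ins)
  moreover have "\<Gamma> \<turnstile> (Lam A B) $ a' \<doteq> ins 0 0 B a' \<Ztypecolon> \<U>"
    using e_beta[OF A U t a(2)] by (simp add: inst_ins)
  ultimately show ?thesis by (meson e_sym e_trans)
qed

lemma jeq_cong:
  assumes t: "A # \<Gamma> \<turnstile> t \<Ztypecolon> B" and B: "A # \<Gamma> \<turnstile> B \<Ztypecolon> \<U>"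
    and a: "\<Gamma> \<turnstile> a \<Ztypecolon> A" "\<Gamma> \<turnstile> a' \<Ztypecolon> A" "\<Gamma> \<turnstile> a \<doteq> a' \<Ztypecolon> A"
  shows "\<Gamma> \<turnstile> ins 0 0 t a \<doteq> ins 0 0 t a' \<Ztypecolon> ins 0 0 B a"
proof -
  have A: "\<Gamma> \<turnstile> A \<Ztypecolon> \<T>" using typing_ctx(2)[OF t] ctx_ConsD(1) by blast
  note B' = t_El[OF B]
  have "\<Gamma> \<turnstile> (Lam A t) $ a \<doteq> ins 0 0 t a \<Ztypecolon> ins 0 0 B a"
    using e_beta[OF A B' t a(1)] by (simp add: inst_ins)
  moreover have "\<Gamma> \<turnstile> (Lam A t) $ a \<doteq> (Lam A t) $ a' \<Ztypecolon> ins 0 0 B a"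
    using e_App[OF A B' e_refl[OF t_Lam[OF A B' t]] a(3)] by (simp add: inst_ins)
  moreover have "\<Gamma> \<turnstile> (Lam A t) $ a' \<doteq> ins 0 0 t a' \<Ztypecolon> ins 0 0 B a"
    using e_conv[OF e_beta[OF A B' t a(2)] e_sym[OF e_El[OF jeq_cong_type[OF B a]], folded inst_ins]] by (simp add: inst_ins)
  ultimately show ?thesis by (meson e_sym e_trans)
qed

section \<open>Dependent pairs\<close>

definition dfst :: "tm \<Rightarrow> tm \<Rightarrow> tm" where
  "dfst A p = SigInd A\<up> v1 p"

definition dsnd :: "tm \<Rightarrow> tm \<Rightarrow> tm \<Rightarrow> tm" where
  "dsnd A B p = SigInd (ins 0 1 B (dfst A\<up> v0)) v0 p"

lemma lift_ins1: "lift (j + 1) k (ins 0 1 B a) = ins 0 1 (lift (j + 1) k B) (lift (j + 1) k a)"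
  by (auto simp: lift_def ins_def subst_algebra intro!: subst_cong)

lemma ins_ins1: "ins (j + 1) k (ins 0 1 B a) x = ins 0 1 (ins (j + 1) k B x) (ins (j + 1) k a x)"
  by (auto simp: lift_def ins_def subst_algebra intro!: subst_cong)

lemma proj_simps [simp]:
  "lift j k (dfst A p) = dfst (lift j k A) (lift j k p)"
  "ins j k (dfst A p) x = dfst (ins j k A x) (ins j k p x)"
  "lift j k (dsnd A B p) = dsnd (lift j k A) (lift (j + 1) k B) (lift j k p)"
  "ins j k (dsnd A B p) x = dsnd (ins j k A x) (ins (j + 1) k B x) (ins j k p x)"
proof -
  show 1: "lift j k (dfst A p) = dfst (lift j k A) (lift j k p)"
    "ins j k (dfst A p) x = dfst (ins j k A x) (ins j k p x)" for j k A p x by (simp_all add: dfst_def)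
  show "lift j k (dsnd A B p) = dsnd (lift j k A) (lift (j + 1) k B) (lift j k p)"
    "ins j k (dsnd A B p) x = dsnd (ins j k A x) (ins (j + 1) k B x) (ins j k p x)"
    by (simp_all add: dsnd_def 1 lift_ins1 ins_ins1)
qed

lemma fst_ty:
  assumes "\<Gamma> \<turnstile> A \<Ztypecolon> \<U>" "A # \<Gamma> \<turnstile> B \<Ztypecolon> \<U>"
  shows "\<Gamma> \<turnstile> p \<Ztypecolon> Sig A B \<Longrightarrow> \<Gamma> \<turnstile> dfst A p \<Ztypecolon> A"
    and "\<Gamma> \<turnstile> a \<Ztypecolon> A \<Longrightarrow> \<Gamma> \<turnstile> b \<Ztypecolon> ins 0 0 B a \<Longrightarrow> \<Gamma> \<turnstile> dfst A (Dpair A B a b) \<doteq> a \<Ztypecolon> A"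
proof -
  note [simp] = tyD[OF assms(1)] tyD1[OF assms(2)] typing_ctx(2)[OF assms(1)]
  have P: "Sig A B # \<Gamma> \<turnstile> A\<up> \<Ztypecolon> \<T>" "B # A # \<Gamma> \<turnstile> v1 \<Ztypecolon> ins 0 2 A\<up> t" for t
    by simp_all
  note AB = ty_Univ[OF assms(1)] ty_Univ[OF assms(2)]
  show "\<Gamma> \<turnstile> p \<Ztypecolon> Sig A B \<Longrightarrow> \<Gamma> \<turnstile> dfst A p \<Ztypecolon> A"
    using t_SigInd[OF AB P(1) P(2)[folded inst_ins], of p] by (simp add: dfst_def inst_ins)
  show "\<Gamma> \<turnstile> a \<Ztypecolon> A \<Longrightarrow> \<Gamma> \<turnstile> b \<Ztypecolon> ins 0 0 B a \<Longrightarrow> \<Gamma> \<turnstile> dfst A (Dpair A B a b) \<doteq> a \<Ztypecolon> A"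
    using e_SigInd_Dpair[OF AB P(1) P(2)[folded inst_ins], of a b] by (simp add: dfst_def inst_ins inst2_ins)
qed

lemma snd_ty:
  assumes "\<Gamma> \<turnstile> A \<Ztypecolon> \<U>" "A # \<Gamma> \<turnstile> B \<Ztypecolon> \<U>"
  shows "\<Gamma> \<turnstile> p \<Ztypecolon> Sig A B \<Longrightarrow> \<Gamma> \<turnstile> dsnd A B p \<Ztypecolon> ins 0 0 B (dfst A p)"
    and "\<Gamma> \<turnstile> a \<Ztypecolon> A \<Longrightarrow> \<Gamma> \<turnstile> b \<Ztypecolon> ins 0 0 B a \<Longrightarrow> \<Gamma> \<turnstile> dsnd A B (Dpair A B a b) \<doteq> b \<Ztypecolon> ins 0 0 B (dfst A (Dpair A B a b))"
proof -
  note [simp] = tyD[OF assms(1)] tyD1[OF assms(2)] typing_ctx(2)[OF assms(1)]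
  note AB = ty_Univ[OF assms(1)] ty_Univ[OF assms(2)]
  let ?P = "ins 0 1 B (dfst A\<up> v0)"
  let ?p = "Dpair A\<Up> (lift 1 2 B) v1 v0"
  have "Sig A B # \<Gamma> \<turnstile> dfst A\<up> v0 \<Ztypecolon> A\<up>"
    by (rule fst_ty(1)[where B="lift 1 1 B"]) simp_all
  then have P: "Sig A B # \<Gamma> \<turnstile> ?P \<Ztypecolon> \<T>" by simp
  have f: "B # A # \<Gamma> \<turnstile> dfst A\<Up> ?p \<Ztypecolon> A\<Up>" "B # A # \<Gamma> \<turnstile> dfst A\<Up> ?p \<doteq> v1 \<Ztypecolon> A\<Up>"
    by (rule fst_ty(1)[where B="lift 1 2 B"] fst_ty(2); simp)+
  \<comment> \<open>The second variable has type \<open>B\<close> at the first component, while the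
    motive asks for \<open>B\<close> at the first projection of the pair. The two agree
    judgementally and not literally, so the branch has to be converted.\<close>
  have "B # A # \<Gamma> \<turnstile> ins 0 2 B (dfst A\<Up> ?p) \<doteq> ins 0 2 B v1 \<Ztypecolon> \<U>"
    using jeq_cong_type[of "A\<Up>" "B # A # \<Gamma>" "lift 1 2 B", OF _ f(1) _ f(2)] by simp
  then have "B # A # \<Gamma> \<turnstile> B\<up> \<doteq> ins 0 2 B (dfst A\<Up> ?p) \<Ztypecolon> \<T>"
    by (intro e_El[OF e_sym]) simp
  then have d: "B # A # \<Gamma> \<turnstile> v0 \<Ztypecolon> ins 0 2 ?P ?p"
    using t_conv[of "B # A # \<Gamma>" "v0" "B\<up>"] by simp
  note d' = d[folded inst_ins shift_lift, folded shift1_lift]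
  show "\<Gamma> \<turnstile> p \<Ztypecolon> Sig A B \<Longrightarrow> \<Gamma> \<turnstile> dsnd A B p \<Ztypecolon> ins 0 0 B (dfst A p)"
    using t_SigInd[OF AB P, of "v0" p] d by (simp add: dsnd_def inst_ins shift_lift shift1_lift)
  show "\<Gamma> \<turnstile> a \<Ztypecolon> A \<Longrightarrow> \<Gamma> \<turnstile> b \<Ztypecolon> ins 0 0 B a \<Longrightarrow> \<Gamma> \<turnstile> dsnd A B (Dpair A B a b) \<doteq> b \<Ztypecolon> ins 0 0 B (dfst A (Dpair A B a b))"
    using e_SigInd_Dpair[OF AB P, of "v0" a b] d by (simp add: dsnd_def inst_ins inst2_ins shift_lift shift1_lift)
qed

text \<open>There is no judgemental eta for \<open>Sig\<close>. Up to a path it holds by induction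
  on \<open>p\<close>, because both projections compute on a pair.\<close>

lemma Sig_ex:
  assumes A: "\<Gamma> \<turnstile> A \<Ztypecolon> \<U>" and B: "A # \<Gamma> \<turnstile> B \<Ztypecolon> \<U>" and p: "\<Gamma> \<turnstile> p \<Ztypecolon> Sig A B"
  shows "\<exists>a b. \<Gamma> \<turnstile> a \<Ztypecolon> A \<and> \<Gamma> \<turnstile> b \<Ztypecolon> ins 0 0 B a \<and> peq \<Gamma> (Sig A B) (Dpair A B a b) p"
proof (intro exI conjI)
  note [simp] = tyD[OF A] tyD1[OF B] typing_ctx(2)[OF A]
  note AB = ty_Univ[OF A] ty_Univ[OF B]
  show a: "\<Gamma> \<turnstile> dfst A p \<Ztypecolon> A" by (rule fst_ty(1)[OF A B p])
  show b: "\<Gamma> \<turnstile> dsnd A B p \<Ztypecolon> ins 0 0 B (dfst A p)" by (rule snd_ty(1)[OF A B p])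
  let ?S = "Sig A B"
  have a1: "?S # \<Gamma> \<turnstile> dfst A\<up> v0 \<Ztypecolon> A\<up>"
    by (rule fst_ty(1)[where B="lift 1 1 B"]) simp_all
  have b1: "?S # \<Gamma> \<turnstile> dsnd A\<up> (lift 1 1 B) v0 \<Ztypecolon> ins 0 1 B (dfst A\<up> v0)"
    using snd_ty(1)[of "?S # \<Gamma>" "A\<up>" "lift 1 1 B" "v0"] by simp
  let ?P = "Idt ?S\<up> (Dpair A\<up> (lift 1 1 B) (dfst A\<up> v0) (dsnd A\<up> (lift 1 1 B) v0)) v0"
  let ?A = "A\<Up>" and ?B = "lift 1 2 B"
  let ?p = "Dpair ?A ?B v1 v0"
  let ?\<Delta> = "B # A # \<Gamma>"
  have P: "?S # \<Gamma> \<turnstile> ?P \<Ztypecolon> \<T>" using a1 b1 by simp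
  have AB2: "?\<Delta> \<turnstile> ?A \<Ztypecolon> \<U>" "?A # ?\<Delta> \<turnstile> ?B \<Ztypecolon> \<U>" and p2: "?\<Delta> \<turnstile> ?p \<Ztypecolon> Sig ?A ?B"
    and v: "?\<Delta> \<turnstile> v1 \<Ztypecolon> ?A" "?\<Delta> \<turnstile> v0 \<Ztypecolon> ins 0 0 ?B v1" by simp_all
  have "?\<Delta> \<turnstile> Dpair ?A ?B (dfst ?A ?p) (dsnd ?A ?B ?p) \<doteq> ?p \<Ztypecolon> Sig ?A ?B"
    by (rule e_Dpair) (use fst_ty[OF AB2] snd_ty[OF AB2] p2 v AB2 in \<open>auto intro: e_refl ty_Univ simp: inst_ins simp del: lift_1\<close>)
  then have "peq ?\<Delta> (Sig ?A ?B) (Dpair ?A ?B (dfst ?A ?p) (dsnd ?A ?B ?p)) ?p"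
    using p2 AB2 fst_ty(1)[OF AB2 p2] snd_ty(1)[OF AB2 p2] by (intro peq_jeq) (simp add: jeqs_def)
  then obtain d where d: "?\<Delta> \<turnstile> d \<Ztypecolon> ins 0 2 ?P ?p" using peqD(4) by fastforce
  show "peq \<Gamma> (Sig A B) (Dpair A B (dfst A p) (dsnd A B p)) p"
    using t_SigInd[OF AB P _ p, of d] d a b p by (auto simp: peq_def inst_ins shift_lift shift1_lift)
qed

lemma lam_beta:
  assumes A: "\<Gamma> \<turnstile> A \<Ztypecolon> \<U>" and B: "A # \<Gamma> \<turnstile> B \<Ztypecolon> \<U>" and b: "A # \<Gamma> \<turnstile> b \<Ztypecolon> B"
  shows "\<Gamma> \<turnstile> Lam A b \<Ztypecolon> Pi A B"
    and "\<Delta> \<turnstile> ctx \<Longrightarrow> k \<le> length \<Delta> \<Longrightarrow> drop k \<Delta> = \<Gamma> \<Longrightarrow> \<Delta> \<turnstile> a \<Ztypecolon> lift 0 k A \<Longrightarrow>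
      jeqs \<Delta> (ins 0 k B a) ((lift 0 k (Lam A b)) $ a) (ins 0 k b a)"
proof -
  note [simp] = tyD[OF A] tyD1[OF B] tmD1[OF b] typing_ctx(2)[OF A]
  show f: "\<Gamma> \<turnstile> Lam A b \<Ztypecolon> Pi A B" by simp
  have P: "\<Gamma> \<turnstile> Pi A B \<Ztypecolon> \<T>" by simp
  assume *: "\<Delta> \<turnstile> ctx" "k \<le> length \<Delta>" "drop k \<Delta> = \<Gamma>" "\<Delta> \<turnstile> a \<Ztypecolon> lift 0 k A"
  have f': "\<Delta> \<turnstile> Lam (lift 0 k A) (lift 1 k b) \<Ztypecolon> Pi (lift 0 k A) (lift 1 k B)"
    using lift_ty[OF f *(1-3)] by (simp del: lift_1)
  have P': "\<Delta> \<turnstile> Pi (lift 0 k A) (lift 1 k B) \<Ztypecolon> \<T>"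
    using lift_ty[OF P *(1-3)] by (simp del: lift_1)
  have c: "lift 0 k A # \<Delta> \<turnstile> ctx" using * by simp
  have b': "lift 0 k A # \<Delta> \<turnstile> lift 1 k b \<Ztypecolon> lift 1 k B"
  proof (cases "k = 0")
    case False
    have "lift 0 k A # \<Delta> \<turnstile> ins 0 (k + 1) b v0 \<Ztypecolon> ins 0 (k + 1) B v0"
      by (rule ins_ty[OF b c]) (use * c in \<open>simp_all flip: Suc_eq_plus1\<close>)
    then show ?thesis using False by simp
  qed (use * b in simp)
  have e: "ins 0 0 (lift 1 k t) a = ins 0 k t a" for t by (cases "k = 0") simp_all
  show "jeqs \<Delta> (ins 0 k B a) ((lift 0 k (Lam A b)) $ a) (ins 0 k b a)"
    unfolding jeqs_def
  proof (intro conjI)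
    show "\<Delta> \<turnstile> ins 0 k B a \<Ztypecolon> \<U>" "\<Delta> \<turnstile> ins 0 k b a \<Ztypecolon> ins 0 k B a" using * by simp_all
    show "\<Delta> \<turnstile> (lift 0 k (Lam A b)) $ a \<Ztypecolon> ins 0 k B a"
      using App_ty[OF f' P' *(4)] e by (simp del: lift_1)
    show "\<Delta> \<turnstile> (lift 0 k (Lam A b)) $ a \<doteq> ins 0 k b a \<Ztypecolon> ins 0 k B a"
      using e_beta[OF Pi_inv[OF P'] b' *(4)] e by (simp add: inst_ins del: lift_1)
  qed
qed

text \<open>Only the computation rule is kept, for all extensions of the context. The abstraction
  itself becomes an opaque \<open>f\<close>, which \<open>lift\<close> and \<open>ins\<close> do not
  unfold.\<close>

lemma lam_ex:
  assumes A: "\<Gamma> \<turnstile> A \<Ztypecolon> \<U>" and B: "A # \<Gamma> \<turnstile> B \<Ztypecolon> \<U>" and b: "A # \<Gamma> \<turnstile> b \<Ztypecolon> B"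
  shows "\<exists>f. \<Gamma> \<turnstile> f \<Ztypecolon> Pi A B \<and> (\<forall>\<Delta> k a. \<Delta> \<turnstile> ctx \<longrightarrow> k \<le> length \<Delta> \<longrightarrow> drop k \<Delta> = \<Gamma> \<longrightarrow> \<Delta> \<turnstile> a \<Ztypecolon> lift 0 k A \<longrightarrow>
    jeqs \<Delta> (ins 0 k B a) ((lift 0 k f) $ a) (ins 0 k b a))"
  using lam_beta[OF assms] by blast

lemma peq_lift:
  assumes "peq \<Gamma> A a b" "\<Delta> \<turnstile> ctx" "k \<le> length \<Delta>" "drop k \<Delta> = \<Gamma>"
  shows "peq \<Delta> (lift 0 k A) (lift 0 k a) (lift 0 k b)"
proof -
  obtain p where p: "\<Gamma> \<turnstile> p \<Ztypecolon> Idt A a b" using peqD(4)[OF assms(1)] ..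
  show ?thesis
    by (rule peqI[where p="lift 0 k p"])
      (use assms lift_ty[OF p assms(2-)] lift_ty[OF peqD(1)[OF assms(1)] assms(2-)] lift_ty[OF peqD(2)[OF assms(1)] assms(2-)]
        lift_ty[OF peqD(3)[OF assms(1)] assms(2-)] in simp_all)
qed

lemma peq_ins:
  assumes "peq (A # \<Gamma>) B b b'" "\<Delta> \<turnstile> ctx" "k \<le> length \<Delta>" "drop k \<Delta> = \<Gamma>" "\<Delta> \<turnstile> a \<Ztypecolon> lift 0 k A"
  shows "peq \<Delta> (ins 0 k B a) (ins 0 k b a) (ins 0 k b' a)"
proof -
  obtain p where p: "A # \<Gamma> \<turnstile> p \<Ztypecolon> Idt B b b'" using peqD(4)[OF assms(1)] ..
  show ?thesis
    by (rule peqI[where p="ins 0 k p a"])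
      (use assms ins_ty[OF p assms(2-)] ins_ty[OF peqD(1)[OF assms(1)] assms(2-)] ins_ty[OF peqD(2)[OF assms(1)] assms(2-)]
        ins_ty[OF peqD(3)[OF assms(1)] assms(2-)] in simp_all)
qed

text \<open>Recording the type \<open>A\<close> and the left end \<open>a\<close> of the path in the
  name lets the simplifier check the type of a transport without searching for them.\<close>

definition tr :: "tm \<Rightarrow> tm \<Rightarrow> tm \<Rightarrow> tm \<Rightarrow> tm \<Rightarrow> tm \<Rightarrow> tm" where
  "tr A C a c b p = J C\<up> c b p"

lemma transport_simps [simp]:
  "lift j k (tr A C a c b p) = tr (lift j k A) (lift (j + 1) k C) (lift j k a) (lift j k c) (lift j k b) (lift j k p)"
  "ins j k (tr A C a c b p) x = tr (ins j k A x) (ins (j + 1) k C x) (ins j k a x) (ins j k c x) (ins j k b x) (ins j k p x)"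
  by (simp_all add: tr_def)

lemma tr_ty:
  assumes [simp]: "\<Gamma> \<turnstile> A \<Ztypecolon> \<U>" "A # \<Gamma> \<turnstile> C \<Ztypecolon> \<U>" "\<Gamma> \<turnstile> a \<Ztypecolon> A" "\<Gamma> \<turnstile> c \<Ztypecolon> ins 0 0 C a"
  shows "\<Gamma> \<turnstile> b \<Ztypecolon> A \<Longrightarrow> \<Gamma> \<turnstile> p \<Ztypecolon> Idt A a b \<Longrightarrow> T = ins 0 0 C b \<Longrightarrow> \<Gamma> \<turnstile> tr A C a c b p \<Ztypecolon> T"
    and "peq \<Gamma> (ins 0 0 C a) (tr A C a c a (Refl A a)) c"
proof -
  note [simp] = tyD[OF assms(1)] tyD1[OF assms(2)] tmD[OF assms(3)] typing_ctx(2)[OF assms(1)]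
  note J = J_ty[where P="C\<up>" and d=c and A=A and \<Gamma>=\<Gamma> and a=a]
  show 1: "\<Gamma> \<turnstile> b \<Ztypecolon> A \<Longrightarrow> \<Gamma> \<turnstile> p \<Ztypecolon> Idt A a b \<Longrightarrow> T = ins 0 0 C b \<Longrightarrow> \<Gamma> \<turnstile> tr A C a c b p \<Ztypecolon> T" for b p T
    using J(1)[of b p] by (simp add: tr_def)
  show "peq \<Gamma> (ins 0 0 C a) (tr A C a c a (Refl A a)) c"
    using J(2)[of a "Refl A a"] 1[of a "Refl A a"] by (intro peq_jeq) (simp add: jeqs_def tr_def)
qed

declare tr_ty(1) [simp]

lemma Sig_path_intro:
  assumes A: "\<Gamma> \<turnstile> A \<Ztypecolon> \<U>" and C: "A # \<Gamma> \<turnstile> C \<Ztypecolon> \<U>" and a: "\<Gamma> \<turnstile> a \<Ztypecolon> A" and c: "\<Gamma> \<turnstile> c \<Ztypecolon> ins 0 0 C a"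
    and b: "\<Gamma> \<turnstile> b \<Ztypecolon> A" and p: "\<Gamma> \<turnstile> p \<Ztypecolon> Idt A a b" and q: "peq \<Gamma> (ins 0 0 C b) (tr A C a c b p) c'"
  shows "peq \<Gamma> (Sig A C) (Dpair A C a c) (Dpair A C b c')"
proof -
  note [simp] = tyD[OF A] tyD1[OF C] tmD[OF a] tmD[OF b] tmD[OF c] p typing_ctx(2)[OF A] tmD[OF peqD(3)[OF q]]
  have Ca: "\<Gamma> \<turnstile> ins 0 0 C a \<Ztypecolon> \<U>" "\<Gamma> \<turnstile> ins 0 0 C b \<Ztypecolon> \<U>" by simp_all
  note [simp] = tyD[OF Ca(1)] tyD[OF Ca(2)]
  have "peq \<Gamma> (Sig A C) (Dpair A C a c) (Dpair A C a (tr A C a c a (Refl A a)))"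
    using peq_cong[of "ins 0 0 C a" \<Gamma> "Dpair A\<up> (lift 1 1 C) a\<up> v0" "Sig A C" c "tr A C a c a (Refl A a)"]
      tr_ty(2)[OF A C a c] by (simp add: peq_sym)
  then have "peq \<Gamma> (Sig A C) (Dpair A C a c) (Dpair A C b (tr A C a c b p))"
    using peq_J[of \<Gamma> A a b p "(Sig A C)\<Up>" "(Dpair A C a c)\<Up>"
      "Dpair A\<Up> (lift 1 2 C) v1 (tr A\<Up> (lift 1 2 C) a\<Up> c\<Up> v1 v0)"]
    by simp
  also have "peq \<Gamma> (Sig A C) \<dots> (Dpair A C b c')"
    using peq_cong[of "ins 0 0 C b" \<Gamma> "Dpair A\<up> (lift 1 1 C) b\<up> v0" "Sig A C" _ c'] q
    by simp
  finally show ?thesis .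
qed

text \<open>Path induction needs a family over all of \<open>Sig A C\<close>, while the claim speaks
  of the components of the end point. The family \<open>?cd\<close> is defined by recursion into the
  universe: on a pair it computes to the type of component paths, and over the left end it is
  inhabited by reflexivity.\<close>

lemma Sig_path_elim:
  assumes A: "\<Gamma> \<turnstile> A \<Ztypecolon> \<U>" and C: "A # \<Gamma> \<turnstile> C \<Ztypecolon> \<U>" and a: "\<Gamma> \<turnstile> a \<Ztypecolon> A" and c: "\<Gamma> \<turnstile> c \<Ztypecolon> ins 0 0 C a"
    and b: "\<Gamma> \<turnstile> b \<Ztypecolon> A" and c': "\<Gamma> \<turnstile> c' \<Ztypecolon> ins 0 0 C b"
    and q: "peq \<Gamma> (Sig A C) (Dpair A C a c) (Dpair A C b c')"
  shows "\<exists>p. \<Gamma> \<turnstile> p \<Ztypecolon> Idt A a b \<and> peq \<Gamma> (ins 0 0 C b) (tr A C a c b p) c'"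
proof -
  note [simp] = tyD[OF A] tyD1[OF C] tmD[OF a] tmD[OF b] tmD[OF c] tmD[OF c'] typing_ctx(2)[OF A]
  have Ca: "\<Gamma> \<turnstile> ins 0 0 C a \<Ztypecolon> \<U>" "\<Gamma> \<turnstile> ins 0 0 C b \<Ztypecolon> \<U>" by simp_all
  note [simp] = tyD[OF Ca(1)] tyD[OF Ca(2)]
  let ?S = "Sig (Idt A\<Up> a\<Up> v1) (Idt (ins 0 3 C v2)
    (tr (lift 0 3 A) (lift 1 3 C) (lift 0 3 a) (lift 0 3 c) v2 v0) v1)"
  let ?cd = "SigInd \<U> (lift 2 1 ?S) v0"
  let ?S' = "\<lambda>b c'. Sig (Idt A a b) (Idt (ins 0 1 C b\<up>)
    (tr A\<up> (lift 1 1 C) a\<up> c\<up> b\<up> v0) c'\<up>)"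
  have S: "C # A # \<Gamma> \<turnstile> ?S \<Ztypecolon> \<U>" by simp
  have U: "Sig A C # \<Gamma> \<turnstile> \<U> \<Ztypecolon> \<T>" by simp
  have e1: "ins 2 k \<U> x = \<U>" for k x by simp
  have cd: "Sig A C # \<Gamma> \<turnstile> ?cd \<Ztypecolon> \<U>"
    using t_SigInd[of "Sig A C # \<Gamma>" "A\<up>" "lift 1 1 C" "\<U>" "lift 2 1 ?S" "v0"] by (simp add: inst_ins)
  have beta: "\<Gamma> \<turnstile> SigInd \<U> ?S (Dpair A C b c') \<doteq> ?S' b c' \<Ztypecolon> \<U>"
    if "\<Gamma> \<turnstile> b \<Ztypecolon> A" "\<Gamma> \<turnstile> c' \<Ztypecolon> ins 0 0 C b" for b c'
    using e_SigInd_Dpair[OF ty_Univ[OF A] ty_Univ[OF C] U, of ?S b c'] that S by (simp add: inst_ins inst2_ins)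

  obtain r where r: "\<Gamma> \<turnstile> r \<Ztypecolon> Idt (ins 0 0 C a) (tr A C a c a (Refl A a)) c"
    using peqD(4)[OF tr_ty(2)[OF A C a c]] by blast
  have S': "\<Gamma> \<turnstile> ?S' b c' \<Ztypecolon> \<U>" if [simp]: "\<Gamma> \<turnstile> b \<Ztypecolon> A" "\<Gamma> \<turnstile> c' \<Ztypecolon> ins 0 0 C b" for b c'
  proof -
    note [simp] = tmD[OF that(1)] tmD[OF that(2)]
    show ?thesis by simp
  qed
  have "\<Gamma> \<turnstile> Dpair (Idt A a a) (Idt (ins 0 1 C a\<up>)
    (tr A\<up> (lift 1 1 C) a\<up> c\<up> a\<up> v0) c\<up>) (Refl A a) r \<Ztypecolon> ?S' a c"
    using r by simp
  then have "\<Gamma> \<turnstile> Dpair (Idt A a a) (Idt (ins 0 1 C a\<up>)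
    (tr A\<up> (lift 1 1 C) a\<up> c\<up> a\<up> v0) c\<up>) (Refl A a) r \<Ztypecolon>
    SigInd \<U> ?S (Dpair A C a c)"
    using t_conv[OF _ e_El[OF e_sym[OF beta[OF a c]]]] by blast
  then have d: "\<exists>d. \<Gamma> \<turnstile> d \<Ztypecolon> SigInd \<U> ?S (Dpair A C a c)" by blast
  obtain q where q: "\<Gamma> \<turnstile> q \<Ztypecolon> Idt (Sig A C) (Dpair A C a c) (Dpair A C b c')"
    using peqD(4)[OF assms(7)] by blast
  \<comment> \<open>The family is made opaque so that the two instantiations in the path induction
    act on it as on a variable and do not unfold its recursion.\<close>
  obtain cd' where cd': "?cd = cd'" by blast
  note [simp] = tyD1[OF cd[unfolded cd']]
  have ecd: "ins 0 0 cd' x = SigInd \<U> ?S x" for x unfolding cd'[symmetric] by simp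
  have "\<exists>d. \<Gamma> \<turnstile> d \<Ztypecolon> ins 0 0 (ins 1 0 cd'\<up> (Dpair A C b c')) q"
    by (rule inh_J[where A="Sig A C" and a="Dpair A C a c"]) (use q d in \<open>simp_all add: ecd\<close>)
  then obtain d where "\<Gamma> \<turnstile> d \<Ztypecolon> SigInd \<U> ?S (Dpair A C b c')" by (auto simp: ecd)
  then have "\<Gamma> \<turnstile> d \<Ztypecolon> ?S' b c'" by (rule t_conv[OF _ e_El[OF beta[OF b c']]])
  from Sig_ex[OF _ _ this] obtain p s where p: "\<Gamma> \<turnstile> p \<Ztypecolon> Idt A a b"
    and "\<Gamma> \<turnstile> s \<Ztypecolon> Idt (ins 0 0 C b) (tr A C a c b p) c'" by auto
  then show ?thesis by (intro exI[of _ p]) (auto intro: peqI)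
qed

lemma lam_ex0:
  assumes A: "\<Gamma> \<turnstile> A \<Ztypecolon> \<U>" and B: "A # \<Gamma> \<turnstile> B \<Ztypecolon> \<U>" and b: "A # \<Gamma> \<turnstile> b \<Ztypecolon> B"
  shows "\<exists>f. \<Gamma> \<turnstile> f \<Ztypecolon> Pi A B \<and> jeqs (A # \<Gamma>) B (f\<up> $ v0) b \<and>
    (\<forall>a. \<Gamma> \<turnstile> a \<Ztypecolon> A \<longrightarrow> jeqs \<Gamma> (ins 0 0 B a) (f $ a) (ins 0 0 b a))"
proof -
  note [simp] = tyD[OF A] typing_ctx(2)[OF A]
  obtain f where f: "\<Gamma> \<turnstile> f \<Ztypecolon> Pi A B" and *: "\<And>\<Delta> k a. \<Delta> \<turnstile> ctx \<Longrightarrow> k \<le> length \<Delta> \<Longrightarrow> drop k \<Delta> = \<Gamma> \<Longrightarrow>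
     \<Delta> \<turnstile> a \<Ztypecolon> lift 0 k A \<Longrightarrow> jeqs \<Delta> (ins 0 k B a) ((lift 0 k f) $ a) (ins 0 k b a)"
    using lam_ex[OF A B b] by blast
  have "jeqs (A # \<Gamma>) B (f\<up> $ v0) b" using *[of "A # \<Gamma>" 1 "v0"] by simp
  moreover have "jeqs \<Gamma> (ins 0 0 B a) (f $ a) (ins 0 0 b a)" if "\<Gamma> \<turnstile> a \<Ztypecolon> A" for a
    using *[of \<Gamma> 0 a] that by simp
  ultimately show ?thesis using f by blast
qed

section \<open>Equivalences and function extensionality\<close>

lemma arr_lift: "arr A B = Pi A B\<up>"
  by (simp only: arr_def shift_lift)

lemma is_equiv_lift: "is_equiv A B f =
  Sig (Sig (Pi B A\<up>) (Pi B\<up> (Idt B\<Up> (f\<Up> $ (v1 $ v0)) v0)))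
   (Sig (Pi B A\<up>) (Pi A\<up> (Idt A\<Up> (v1 $ (f\<Up> $ v0)) v0)))\<up>"
  by (simp only: is_equiv_def times_def has_section_def has_retraction_def arr_def shift_lift)

lemma htpy_lift: "htpy A B f g = Pi A (Idt B (f\<up> $ v0) (g\<up> $ v0))"
  by (simp only: htpy_def shift_lift)

lemma ctx_nth: "\<Gamma> \<turnstile> ctx \<Longrightarrow> n < length \<Gamma> \<Longrightarrow> \<Gamma> \<turnstile> lift 0 (n + 1) (\<Gamma> ! n) \<Ztypecolon> \<T>"
proof (induction \<Gamma> arbitrary: n)
  case (Cons A \<Gamma>)
  note c = ctx_ConsD[OF Cons.prems(1)]
  show ?case
  proof (cases n)
    case 0 then show ?thesis using lift_ty[OF c(1) Cons.prems(1), of 1] by simp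
  next
    case (Suc m)
    then have "\<Gamma> \<turnstile> lift 0 (m + 1) (\<Gamma> ! m) \<Ztypecolon> \<T>" using Cons c by simp
    from lift_ty[OF this Cons.prems(1), of 1] show ?thesis using Suc by (simp add: Suc_eq_plus1)
  qed
qed simp

text \<open>The type of a context variable often becomes a \<open>Pi\<close> only after
  \<open>lift\<close> has been pushed inwards. With these selectors a rewrite rule can name its
  domain and codomain before that happens.\<close>

definition pi_dom :: "tm \<Rightarrow> tm" where "pi_dom t = (case t of Pi A B \<Rightarrow> A | _ \<Rightarrow> t)"
definition pi_cod :: "tm \<Rightarrow> tm" where "pi_cod t = (case t of Pi A B \<Rightarrow> B | _ \<Rightarrow> t)"

lemma pi_sel [simp]: "pi_dom (Pi A B) = A" "pi_cod (Pi A B) = B"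
  by (simp_all add: pi_dom_def pi_cod_def)

lemma App_Var_ty [simp]:
  assumes "\<Gamma> \<turnstile> ctx" "n < length \<Gamma>" "lift 0 (n + 1) (\<Gamma> ! n) = Pi (pi_dom (lift 0 (n + 1) (\<Gamma> ! n))) (pi_cod (lift 0 (n + 1) (\<Gamma> ! n)))"
    "\<Gamma> \<turnstile> a \<Ztypecolon> pi_dom (lift 0 (n + 1) (\<Gamma> ! n))" "T = ins 0 0 (pi_cod (lift 0 (n + 1) (\<Gamma> ! n))) a"
  shows "\<Gamma> \<turnstile> (Var n) $ a \<Ztypecolon> T"
proof -
  have "\<Gamma> \<turnstile> Var n \<Ztypecolon> lift 0 (n + 1) (\<Gamma> ! n)" using assms(1,2) by simp
  with App_ty[of \<Gamma> "Var n" _ _ a] ctx_nth[OF assms(1,2)] assms(3-5) show ?thesis by metis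
qed

lemma equivD:
  assumes A: "\<Gamma> \<turnstile> A \<Ztypecolon> \<U>" and B: "\<Gamma> \<turnstile> B \<Ztypecolon> \<U>" and f: "\<Gamma> \<turnstile> f \<Ztypecolon> Pi A B\<up>" and e: "\<Gamma> \<turnstile> e \<Ztypecolon> is_equiv A B f"
  shows "\<exists>s \<sigma> r \<rho>. \<Gamma> \<turnstile> s \<Ztypecolon> Pi B A\<up> \<and> \<Gamma> \<turnstile> r \<Ztypecolon> Pi B A\<up> \<and>
    \<Gamma> \<turnstile> \<sigma> \<Ztypecolon> Pi B (Idt B\<up> (f\<up> $ (s\<up> $ v0)) v0) \<and>
    \<Gamma> \<turnstile> \<rho> \<Ztypecolon> Pi A (Idt A\<up> (r\<up> $ (f\<up> $ v0)) v0)"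
proof -
  note [simp] = tyD[OF A] tyD[OF B] typing_ctx(2)[OF A] funD[OF f Pi_arg_type[OF A B]]
  let ?HS = "Sig (Pi B A\<up>) (Pi B\<up> (Idt B\<Up> (f\<Up> $ (v1 $ v0)) v0))"
  let ?HR = "Sig (Pi B A\<up>) (Pi A\<up> (Idt A\<Up> (v1 $ (f\<Up> $ v0)) v0))"
  have HS: "\<Gamma> \<turnstile> ?HS \<Ztypecolon> \<U>" and HR: "\<Gamma> \<turnstile> ?HR \<Ztypecolon> \<U>" by simp_all
  have HR1: "?HS # \<Gamma> \<turnstile> ?HR\<up> \<Ztypecolon> \<U>" by (rule tyD(2)[OF HR]) (use HS in simp_all)
  obtain a b where ab: "\<Gamma> \<turnstile> a \<Ztypecolon> ?HS" "\<Gamma> \<turnstile> b \<Ztypecolon> ?HR"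
    using Sig_ex[OF HS HR1 e[unfolded is_equiv_lift]] by auto
  obtain s \<sigma> where "\<Gamma> \<turnstile> s \<Ztypecolon> Pi B A\<up>" "\<Gamma> \<turnstile> \<sigma> \<Ztypecolon> Pi B (Idt B\<up> (f\<up> $ (s\<up> $ v0)) v0)"
    using Sig_ex[OF _ _ ab(1)] by auto
  moreover obtain r \<rho> where "\<Gamma> \<turnstile> r \<Ztypecolon> Pi B A\<up>" "\<Gamma> \<turnstile> \<rho> \<Ztypecolon> Pi A (Idt A\<up> (r\<up> $ (f\<up> $ v0)) v0)"
    using Sig_ex[OF _ _ ab(2)] by auto
  ultimately show ?thesis by blast
qed

lemma equivI:
  assumes A: "\<Gamma> \<turnstile> A \<Ztypecolon> \<U>" and B: "\<Gamma> \<turnstile> B \<Ztypecolon> \<U>" and f: "\<Gamma> \<turnstile> f \<Ztypecolon> Pi A B\<up>"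
    and s: "\<Gamma> \<turnstile> s \<Ztypecolon> Pi B A\<up>"
    and S: "\<Gamma> \<turnstile> \<sigma> \<Ztypecolon> Pi B (Idt B\<up> (f\<up> $ (s\<up> $ v0)) v0)"
    and R: "\<Gamma> \<turnstile> \<rho> \<Ztypecolon> Pi A (Idt A\<up> (s\<up> $ (f\<up> $ v0)) v0)"
  shows "\<exists>e. \<Gamma> \<turnstile> e \<Ztypecolon> is_equiv A B f"
proof -
  note [simp] = tyD[OF A] tyD[OF B] typing_ctx(2)[OF A] funD[OF f Pi_arg_type[OF A B]] funD[OF s Pi_arg_type[OF B A]] S R
  let ?PS = "Pi B\<up> (Idt B\<Up> (f\<Up> $ (v1 $ v0)) v0)"
  let ?PR = "Pi A\<up> (Idt A\<Up> (v1 $ (f\<Up> $ v0)) v0)"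
  let ?HS = "Sig (Pi B A\<up>) ?PS" and ?HR = "Sig (Pi B A\<up>) ?PR"
  have HS: "\<Gamma> \<turnstile> ?HS \<Ztypecolon> \<U>" and HR: "\<Gamma> \<turnstile> ?HR \<Ztypecolon> \<U>" by simp_all
  have HR1: "?HS # \<Gamma> \<turnstile> ?HR\<up> \<Ztypecolon> \<U>" by (rule tyD(2)[OF HR]) (use HS in simp_all)
  have a: "\<Gamma> \<turnstile> Dpair (Pi B A\<up>) ?PS s \<sigma> \<Ztypecolon> ?HS" by simp
  have b: "\<Gamma> \<turnstile> Dpair (Pi B A\<up>) ?PR s \<rho> \<Ztypecolon> ins 0 0 ?HR\<up> t" for t by simp
  show ?thesis
    unfolding is_equiv_lift using t_Dpair[OF ty_Univ[OF HS] ty_Univ[OF HR1] a] b unfolding inst_ins by blast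
qed

definition hap_fun :: "tm \<Rightarrow> tm \<Rightarrow> tm \<Rightarrow> tm \<Rightarrow> tm \<Rightarrow> tm" where
  "hap_fun A B f g p = J (Pi A\<Up> (Idt (lift 1 2 B) ((lift 0 3 f) $ v0) (v2 $ v0)))
     (Lam A (Refl B (f\<up> $ v0))) g p"

lemma happly_lift: "happly A B f g = Lam (Idt (Pi A B) f g) (hap_fun A\<up> (lift 1 1 B) f\<up> g\<up> v0)"
  by (simp only: happly_def htpy_def hap_fun_def shift_lift shift1_lift) simp

lemma lift_binders3: "lift (j + 1 + 1 + 1) k (lift 0 3 t) = lift 0 3 (lift j k t)"
  "lift (j + 1 + 1 + 1) k (ins 0 3 B a) = ins 0 3 (lift (j + 1) k B) (lift (j + 1 + 1 + 1) k a)"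
  "ins (j + 1 + 1 + 1) k (lift 0 3 t) x = lift 0 3 (ins j k t x)"
  "ins (j + 1 + 1 + 1) k (ins 0 3 B a) x = ins 0 3 (ins (j + 1) k B x) (ins (j + 1 + 1 + 1) k a x)"
  by (auto simp: lift_def ins_def subst_algebra intro!: subst_cong)

lemma hap_fun_simps [simp]:
  "lift j k (hap_fun A B f g p) = hap_fun (lift j k A) (lift (j + 1) k B) (lift j k f) (lift j k g) (lift j k p)"
  "ins j k (hap_fun A B f g p) x = hap_fun (ins j k A x) (ins (j + 1) k B x) (ins j k f x) (ins j k g x) (ins j k p x)"
  by (simp_all add: hap_fun_def lift_binders3)

lemma hap_fun_ty:
  assumes "\<Gamma> \<turnstile> A \<Ztypecolon> \<U>" "A # \<Gamma> \<turnstile> B \<Ztypecolon> \<U>" "\<Gamma> \<turnstile> f \<Ztypecolon> Pi A B"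
  shows "\<Gamma> \<turnstile> g \<Ztypecolon> Pi A B \<Longrightarrow> \<Gamma> \<turnstile> p \<Ztypecolon> Idt (Pi A B) f g \<Longrightarrow> T = Pi A (Idt B (f\<up> $ v0) (g\<up> $ v0)) \<Longrightarrow>
      \<Gamma> \<turnstile> hap_fun A B f g p \<Ztypecolon> T"
    and "\<Gamma> \<turnstile> hap_fun A B f f (Refl (Pi A B) f) \<doteq> Lam A (Refl B (f\<up> $ v0)) \<Ztypecolon> Pi A (Idt B (f\<up> $ v0) (f\<up> $ v0))"
proof -
  note [simp] = tyD[OF assms(1)] tyD1[OF assms(2)] typing_ctx(2)[OF assms(1)]
  have P: "\<Gamma> \<turnstile> Pi A B \<Ztypecolon> \<U>" "\<Gamma> \<turnstile> Pi A B \<Ztypecolon> \<T>" by simp_all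
  note [simp] = funD[OF assms(3) P(2)] tyD[OF P(1), simplified]
  note J = J_ty[where P="Pi A\<Up> (Idt (lift 1 2 B) ((lift 0 3 f) $ v0) (v2 $ v0))" and
     d="Lam A (Refl B (f\<up> $ v0))" and A="Pi A B" and \<Gamma>=\<Gamma> and a=f]
  show "\<Gamma> \<turnstile> g \<Ztypecolon> Pi A B \<Longrightarrow> \<Gamma> \<turnstile> p \<Ztypecolon> Idt (Pi A B) f g \<Longrightarrow> T = Pi A (Idt B (f\<up> $ v0) (g\<up> $ v0)) \<Longrightarrow>
      \<Gamma> \<turnstile> hap_fun A B f g p \<Ztypecolon> T"
    using J(1)[of g p] by (simp add: hap_fun_def)
  show "\<Gamma> \<turnstile> hap_fun A B f f (Refl (Pi A B) f) \<doteq> Lam A (Refl B (f\<up> $ v0)) \<Ztypecolon> Pi A (Idt B (f\<up> $ v0) (f\<up> $ v0))"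
    using J(2)[of f "Refl (Pi A B) f"] by (simp add: hap_fun_def)
qed

declare hap_fun_ty(1) [simp]

lemma App_hap_fun_ty [simp]:
  assumes "\<Gamma> \<turnstile> A \<Ztypecolon> \<U>" "A # \<Gamma> \<turnstile> B \<Ztypecolon> \<U>" "\<Gamma> \<turnstile> f \<Ztypecolon> Pi A B"
    "\<Gamma> \<turnstile> g \<Ztypecolon> Pi A B" "\<Gamma> \<turnstile> p \<Ztypecolon> Idt (Pi A B) f g" "\<Gamma> \<turnstile> a \<Ztypecolon> A" "T = Idt (ins 0 0 B a) (f $ a) (g $ a)"
  shows "\<Gamma> \<turnstile> (hap_fun A B f g p) $ a \<Ztypecolon> T"
proof -
  note [simp] = tyD[OF assms(1)] tyD1[OF assms(2)] typing_ctx(2)[OF assms(1)]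
  have P: "\<Gamma> \<turnstile> Pi A B \<Ztypecolon> \<U>" "\<Gamma> \<turnstile> Pi A B \<Ztypecolon> \<T>" by simp_all
  note [simp] = funD[OF assms(3) P(2)] funD[OF assms(4) P(2)]
  show ?thesis unfolding assms(7)
    using App_ty[OF hap_fun_ty(1)[OF assms(1-5) refl] _ assms(6)] by simp
qed

text \<open>This links the map of the extensionality axiom, whose induction produces a whole
  function, to the pointwise \<open>hap\<close>. At reflexivity both are reflexivity, the former
  after a beta step.\<close>

lemma hap_fun_hap:
  assumes "\<Gamma> \<turnstile> A \<Ztypecolon> \<U>" "A # \<Gamma> \<turnstile> B \<Ztypecolon> \<U>" "\<Gamma> \<turnstile> f \<Ztypecolon> Pi A B"
    "\<Gamma> \<turnstile> g \<Ztypecolon> Pi A B" "\<Gamma> \<turnstile> p \<Ztypecolon> Idt (Pi A B) f g" "\<Gamma> \<turnstile> a \<Ztypecolon> A"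
  shows "peq \<Gamma> (Idt (ins 0 0 B a) (f $ a) (g $ a)) ((hap_fun A B f g p) $ a) (hap A B f g p a)"
proof -
  note [simp] = tyD[OF assms(1)] tyD1[OF assms(2)] tmD[OF assms(6)] assms(5) typing_ctx(2)[OF assms(1)]
  have P: "\<Gamma> \<turnstile> Pi A B \<Ztypecolon> \<U>" "\<Gamma> \<turnstile> Pi A B \<Ztypecolon> \<T>" by simp_all
  note [simp] = funD[OF assms(3) P(2)] funD[OF assms(4) P(2)] tyD[OF P(1), simplified]
  let ?B = "Idt B (f\<up> $ v0) (f\<up> $ v0)" and ?r = "Refl B (f\<up> $ v0)"
  let ?T = "Idt (ins 0 0 B a) (f $ a) (f $ a)"
  have Q: "A # \<Gamma> \<turnstile> ?B \<Ztypecolon> \<T>" and r: "A # \<Gamma> \<turnstile> ?r \<Ztypecolon> ?B" by simp_all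
  have h: "\<Gamma> \<turnstile> (hap_fun A B f f (Refl (Pi A B) f)) $ a \<Ztypecolon> ?T" by simp
  have "\<Gamma> \<turnstile> (hap_fun A B f f (Refl (Pi A B) f)) $ a \<doteq> (Lam A ?r) $ a \<Ztypecolon> ?T"
    using e_App[OF ty_Univ[OF assms(1)] Q hap_fun_ty(2)[OF assms(1-3)] e_refl[OF assms(6)]] by (simp add: inst_ins)
  moreover have "\<Gamma> \<turnstile> (Lam A ?r) $ a \<doteq> Refl (ins 0 0 B a) (f $ a) \<Ztypecolon> ?T"
    using e_beta[OF ty_Univ[OF assms(1)] Q r assms(6)] by (simp add: inst_ins)
  ultimately have "jeqs \<Gamma> ?T ((hap_fun A B f f (Refl (Pi A B) f)) $ a) (Refl (ins 0 0 B a) (f $ a))"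
    unfolding jeqs_def using e_trans h by auto
  from peq_trans[OF peq_jeq[OF this] peq_sym[OF hap_ty(2)[OF assms(1-3,6)]]] show ?thesis
    using peq_J[of \<Gamma> "Pi A B" f g p "Idt (ins 0 0 B a)\<Up> (f\<Up> $ a\<Up>) (v1 $ a\<Up>)"
      "(hap_fun A\<Up> (lift 1 2 B) f\<Up> v1 v0) $ a\<Up>"
      "hap A\<Up> (lift 1 2 B) f\<Up> v1 v0 a\<Up>"]
    by simp
qed

text \<open>The two halves of the axiom serve different purposes. The section \<open>s\<close>
  produces a path with prescribed pointwise values, as in \<open>funext_path\<close>; the retraction
  \<open>r\<close> shows that a path is determined by these values, as in
  \<open>hap_inj\<close>.\<close>

lemma funext_data:
  assumes A: "\<Gamma> \<turnstile> A \<Ztypecolon> \<U>" and B: "A # \<Gamma> \<turnstile> B \<Ztypecolon> \<U>" and f: "\<Gamma> \<turnstile> f \<Ztypecolon> Pi A B" and g: "\<Gamma> \<turnstile> g \<Ztypecolon> Pi A B"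
  defines "I \<equiv> Idt (Pi A B) f g" and "H \<equiv> Pi A (Idt B (f\<up> $ v0) (g\<up> $ v0))"
  shows "\<exists>s r. \<Gamma> \<turnstile> s \<Ztypecolon> Pi H I\<up> \<and> \<Gamma> \<turnstile> r \<Ztypecolon> Pi H I\<up> \<and>
    (\<forall>\<psi>. \<Gamma> \<turnstile> \<psi> \<Ztypecolon> H \<longrightarrow> peq \<Gamma> H (hap_fun A B f g (s $ \<psi>)) \<psi>) \<and>
    (\<forall>p. \<Gamma> \<turnstile> p \<Ztypecolon> I \<longrightarrow> peq \<Gamma> I (r $ (hap_fun A B f g p)) p)"
proof -
  note [simp] = tyD[OF A] tyD1[OF B] typing_ctx(2)[OF A]
  have P: "\<Gamma> \<turnstile> Pi A B \<Ztypecolon> \<U>" "\<Gamma> \<turnstile> Pi A B \<Ztypecolon> \<T>" by simp_all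
  note [simp] = funD[OF f P(2)] funD[OF g P(2)] tyD[OF P(1), simplified]
  have I: "\<Gamma> \<turnstile> I \<Ztypecolon> \<U>" and H: "\<Gamma> \<turnstile> H \<Ztypecolon> \<U>" unfolding I_def H_def by simp_all
  note IH = tyD[OF I] tyD[OF H]
  let ?b = "hap_fun A\<up> (lift 1 1 B) f\<up> g\<up> v0"
  have b: "I # \<Gamma> \<turnstile> ?b \<Ztypecolon> H\<up>" unfolding I_def H_def by simp
  have H1: "I # \<Gamma> \<turnstile> H\<up> \<Ztypecolon> \<U>" using IH by simp
  have beta: "jeqs \<Gamma> H ((happly A B f g) $ p) (hap_fun A B f g p)" if p: "\<Gamma> \<turnstile> p \<Ztypecolon> I" for p
  proof -
    have i: "ins 0 0 ?b p = hap_fun A B f g p" by simp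
    have "\<Gamma> \<turnstile> (happly A B f g) $ p \<doteq> hap_fun A B f g p \<Ztypecolon> H"
      using e_beta[OF IH(1) ty_Univ[OF H1] b p, folded I_def, unfolded inst_ins i] unfolding happly_lift I_def by simp
    moreover have "\<Gamma> \<turnstile> (happly A B f g) $ p \<Ztypecolon> H"
      using App_ty[OF t_Lam[OF IH(1) ty_Univ[OF H1] b] _ p] IH H1 unfolding happly_lift I_def[symmetric] by simp
    moreover have "\<Gamma> \<turnstile> hap_fun A B f g p \<Ztypecolon> H" using p unfolding I_def H_def by simp
    ultimately show ?thesis unfolding jeqs_def using H by simp
  qed
  have hT: "\<Gamma> \<turnstile> happly A B f g \<Ztypecolon> Pi I H\<up>"
    using t_Lam[OF IH(1) ty_Univ[OF H1] b] unfolding happly_lift I_def[symmetric] .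
  have e: "\<Gamma> \<turnstile> Funext A B f g \<Ztypecolon> is_equiv I H (happly A B f g)"
    unfolding I_def H_def htpy_lift[symmetric] by (rule t_Funext) (simp_all add: f g)
  \<comment> \<open>The canonical map is made opaque, since rewriting would otherwise push
    \<open>lift\<close> and \<open>ins\<close> through its binders. From here on it enters only
    through its computation rule \<open>beta\<close>.\<close>
  obtain h where h: "happly A B f g = h" by blast
  note [simp] = IH funD[OF hT[unfolded h] Pi_arg_type[OF I H]]
  obtain s \<sigma> r \<rho> where *: "\<Gamma> \<turnstile> s \<Ztypecolon> Pi H I\<up>" "\<Gamma> \<turnstile> r \<Ztypecolon> Pi H I\<up>"
    "\<Gamma> \<turnstile> \<sigma> \<Ztypecolon> Pi H (Idt H\<up> (h\<up> $ (s\<up> $ v0)) v0)"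
    "\<Gamma> \<turnstile> \<rho> \<Ztypecolon> Pi I (Idt I\<up> (r\<up> $ (h\<up> $ v0)) v0)"
    using equivD[OF I H hT e] unfolding h by blast
  note [simp] = funD[OF *(1) Pi_arg_type[OF H I]] funD[OF *(2) Pi_arg_type[OF H I]]
  have "peq \<Gamma> H (hap_fun A B f g (s $ \<psi>)) \<psi>" if \<psi>: "\<Gamma> \<turnstile> \<psi> \<Ztypecolon> H" for \<psi>
  proof -
    have "\<Gamma> \<turnstile> \<sigma> $ \<psi> \<Ztypecolon> Idt H (h $ (s $ \<psi>)) \<psi>" using App_ty[OF *(3) _ \<psi>] by simp
    then have "peq \<Gamma> H (h $ (s $ \<psi>)) \<psi>" using \<psi> by (intro peqI) simp_all
    then show ?thesis using peq_sym[OF peq_jeq[OF beta[of "s $ \<psi>"]]] \<psi> peq_trans by (simp add: h)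
  qed
  moreover have "peq \<Gamma> I (r $ (hap_fun A B f g p)) p" if p: "\<Gamma> \<turnstile> p \<Ztypecolon> I" for p
  proof -
    have "\<Gamma> \<turnstile> \<rho> $ p \<Ztypecolon> Idt I (r $ (h $ p)) p" using App_ty[OF *(4) _ p] by simp
    then have 1: "peq \<Gamma> I (r $ (h $ p)) p" using p by (intro peqI) simp_all
    have "peq \<Gamma> I (r $ (hap_fun A B f g p)) (r $ (h $ p))"
      using peq_cong[of H \<Gamma> "r\<up> $ v0" I] peq_sym[OF peq_jeq[OF beta[OF p]]] h by simp
    from peq_trans[OF this 1] show ?thesis .
  qed
  ultimately show ?thesis using * by blast
qed

lemma funext_path:
  assumes A: "\<Gamma> \<turnstile> A \<Ztypecolon> \<U>" and B: "A # \<Gamma> \<turnstile> B \<Ztypecolon> \<U>" and f: "\<Gamma> \<turnstile> f \<Ztypecolon> Pi A B" and g: "\<Gamma> \<turnstile> g \<Ztypecolon> Pi A B"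
    and \<psi>: "A # \<Gamma> \<turnstile> \<psi> \<Ztypecolon> Idt B (f\<up> $ v0) (g\<up> $ v0)"
  shows "\<exists>p. \<Gamma> \<turnstile> p \<Ztypecolon> Idt (Pi A B) f g \<and> peq (A # \<Gamma>) (Idt B (f\<up> $ v0) (g\<up> $ v0))
    (hap A\<up> (lift 1 1 B) f\<up> g\<up> p\<up> v0) \<psi>"
proof -
  note [simp] = tyD[OF A] tyD1[OF B] typing_ctx(2)[OF A]
  have P: "\<Gamma> \<turnstile> Pi A B \<Ztypecolon> \<U>" "\<Gamma> \<turnstile> Pi A B \<Ztypecolon> \<T>" by simp_all
  note [simp] = funD[OF f P(2)] funD[OF g P(2)] tyD[OF P(1), simplified]
  let ?I = "Idt (Pi A B) f g" and ?B = "Idt B (f\<up> $ v0) (g\<up> $ v0)"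
  have B': "A # \<Gamma> \<turnstile> ?B \<Ztypecolon> \<U>" by simp
  obtain l where l: "\<Gamma> \<turnstile> l \<Ztypecolon> Pi A ?B" and lb: "jeqs (A # \<Gamma>) ?B (l\<up> $ v0) \<psi>"
    using lam_ex0[OF A B' \<psi>] by blast
  obtain s where s: "\<Gamma> \<turnstile> s \<Ztypecolon> Pi (Pi A ?B) ?I\<up>" and e: "peq \<Gamma> (Pi A ?B) (hap_fun A B f g (s $ l)) l"
    using funext_data[OF A B f g] l by blast
  have I: "\<Gamma> \<turnstile> ?I \<Ztypecolon> \<U>" "\<Gamma> \<turnstile> Pi A ?B \<Ztypecolon> \<U>" by simp_all
  have p: "\<Gamma> \<turnstile> s $ l \<Ztypecolon> ?I" using App_ty[OF s Pi_arg_type[OF I(2,1)] l] by simp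
  obtain p' where p': "s $ l = p'" by blast
  note [simp] = tmD[OF p[unfolded p']] funD[OF l ty_Univ[OF I(2)]]
  have "peq (A # \<Gamma>) (Pi A ?B)\<up> (hap_fun A B f g p')\<up> l\<up>"
    using e unfolding p' by (rule peq_lift) simp_all
  then have "peq (A # \<Gamma>) ?B ((hap_fun A B f g p')\<up> $ v0) (l\<up> $ v0)"
    using peq_cong[of "(Pi A ?B)\<up>" "A # \<Gamma>" "v0 $ v1" ?B] by simp
  also have "peq (A # \<Gamma>) ?B (l\<up> $ v0) \<psi>" using peq_jeq[OF lb] by simp
  finally have 1: "peq (A # \<Gamma>) ?B ((hap_fun A B f g p')\<up> $ v0) \<psi>" .
  have "peq (A # \<Gamma>) ?B ((hap_fun A B f g p')\<up> $ v0) (hap A\<up> (lift 1 1 B) f\<up> g\<up> p'\<up> v0)"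
    using hap_fun_hap[of "A # \<Gamma>" "A\<up>" "lift 1 1 B" "f\<up>" "g\<up>" "p'\<up>" "v0"] by simp
  from peq_trans[OF peq_sym[OF this] 1] show ?thesis using p unfolding p' by blast
qed

lemma funext:
  assumes A: "\<Gamma> \<turnstile> A \<Ztypecolon> \<U>" and B: "A # \<Gamma> \<turnstile> B \<Ztypecolon> \<U>" and f: "\<Gamma> \<turnstile> f \<Ztypecolon> Pi A B" and g: "\<Gamma> \<turnstile> g \<Ztypecolon> Pi A B"
    and e: "peq (A # \<Gamma>) B (f\<up> $ v0) (g\<up> $ v0)"
  shows "peq \<Gamma> (Pi A B) f g"
  using peqD(4)[OF e] funext_path[OF A B f g] ty_simps(3)[OF A B] f g by (auto intro: peqI)

lemma hap_inj:
  assumes A: "\<Gamma> \<turnstile> A \<Ztypecolon> \<U>" and B: "A # \<Gamma> \<turnstile> B \<Ztypecolon> \<U>" and f: "\<Gamma> \<turnstile> f \<Ztypecolon> Pi A B" and g: "\<Gamma> \<turnstile> g \<Ztypecolon> Pi A B"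
    and p: "\<Gamma> \<turnstile> p \<Ztypecolon> Idt (Pi A B) f g" and q: "\<Gamma> \<turnstile> q \<Ztypecolon> Idt (Pi A B) f g"
    and e: "peq (A # \<Gamma>) (Idt B (f\<up> $ v0) (g\<up> $ v0))
      (hap A\<up> (lift 1 1 B) f\<up> g\<up> p\<up> v0)
      (hap A\<up> (lift 1 1 B) f\<up> g\<up> q\<up> v0)"
  shows "peq \<Gamma> (Idt (Pi A B) f g) p q"
proof -
  note [simp] = tyD[OF A] tyD1[OF B] typing_ctx(2)[OF A]
  have P: "\<Gamma> \<turnstile> Pi A B \<Ztypecolon> \<U>" "\<Gamma> \<turnstile> Pi A B \<Ztypecolon> \<T>" by simp_all
  note [simp] = funD[OF f P(2)] funD[OF g P(2)] tyD[OF P(1), simplified] tmD[OF p] tmD[OF q]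
  let ?I = "Idt (Pi A B) f g" and ?B = "Idt B (f\<up> $ v0) (g\<up> $ v0)"
  have h: "peq (A # \<Gamma>) ?B ((hap_fun A B f g p)\<up> $ v0) (hap A\<up> (lift 1 1 B) f\<up> g\<up> p\<up> v0)"
    if "\<Gamma> \<turnstile> p \<Ztypecolon> Idt (Pi A B) f g" for p
    using hap_fun_hap[of "A # \<Gamma>" "A\<up>" "lift 1 1 B" "f\<up>" "g\<up>" "p\<up>" "v0"] tmD[OF that] by simp
  have "peq (A # \<Gamma>) ?B ((hap_fun A B f g p)\<up> $ v0) ((hap_fun A B f g q)\<up> $ v0)"
    using peq_trans[OF peq_trans[OF h[OF p] e] peq_sym[OF h[OF q]]] .
  then have h': "peq \<Gamma> (Pi A ?B) (hap_fun A B f g p) (hap_fun A B f g q)" by (intro funext) simp_all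
  obtain r where r: "\<Gamma> \<turnstile> r \<Ztypecolon> Pi (Pi A ?B) ?I\<up>" and e: "\<And>p. \<Gamma> \<turnstile> p \<Ztypecolon> ?I \<Longrightarrow> peq \<Gamma> ?I (r $ (hap_fun A B f g p)) p"
    using funext_data[OF A B f g] by blast
  have I: "\<Gamma> \<turnstile> ?I \<Ztypecolon> \<U>" "\<Gamma> \<turnstile> Pi A ?B \<Ztypecolon> \<U>" by simp_all
  have "peq \<Gamma> ?I (r $ (hap_fun A B f g p)) (r $ (hap_fun A B f g q))"
    using peq_cong[of "Pi A ?B" \<Gamma> "r\<up> $ v0" ?I, OF _ I(1) h'] funD[OF r Pi_arg_type[OF I(2,1)]] by simp
  then show ?thesis using e[OF p] e[OF q] peq_sym peq_trans by blast
qed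

text \<open>The instances of the motive appear as equations. The motive can then be given
  explicitly, and matching its instances with the goal is left to the simplifier.\<close>

lemma peq_J':
  assumes "peq \<Gamma> T0 l0 r0" "\<Gamma> \<turnstile> A \<Ztypecolon> \<U>" "\<Gamma> \<turnstile> a \<Ztypecolon> A" "\<Gamma> \<turnstile> b \<Ztypecolon> A" "\<Gamma> \<turnstile> p \<Ztypecolon> Idt A a b"
    and "Idt A\<up> a\<up> v0 # A # \<Gamma> \<turnstile> ctx \<Longrightarrow>
      Idt A\<up> a\<up> v0 # A # \<Gamma> \<turnstile> T \<Ztypecolon> \<U>"
    and "Idt A\<up> a\<up> v0 # A # \<Gamma> \<turnstile> ctx \<Longrightarrow>
      Idt A\<up> a\<up> v0 # A # \<Gamma> \<turnstile> l \<Ztypecolon> T"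
    and "Idt A\<up> a\<up> v0 # A # \<Gamma> \<turnstile> ctx \<Longrightarrow>
      Idt A\<up> a\<up> v0 # A # \<Gamma> \<turnstile> r \<Ztypecolon> T"
    and "ins 0 0 (ins 1 0 T a) (Refl A a) = T0" "ins 0 0 (ins 1 0 l a) (Refl A a) = l0" "ins 0 0 (ins 1 0 r a) (Refl A a) = r0"
    and "ins 0 0 (ins 1 0 T b) p = T1" "ins 0 0 (ins 1 0 l b) p = l1" "ins 0 0 (ins 1 0 r b) p = r1"
  shows "peq \<Gamma> T1 l1 r1"
  using peq_J[OF assms(2-5), of T l r] assms(1,6-) by blast

section \<open>Conjugation of paths and the action of equivalences on paths\<close>

lemma trR_trR_inv:
  assumes "\<Gamma> \<turnstile> A \<Ztypecolon> \<U>" "\<Gamma> \<turnstile> c \<Ztypecolon> A" "\<Gamma> \<turnstile> a \<Ztypecolon> A" "\<Gamma> \<turnstile> b \<Ztypecolon> A"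
    "\<Gamma> \<turnstile> q \<Ztypecolon> Idt A c a" "\<Gamma> \<turnstile> p \<Ztypecolon> Idt A a b"
  shows "peq \<Gamma> (Idt A c a) (trR A c b (trR A c a q b p) a (pinv A a b p)) q"
proof -
  note [simp] = assms assms[THEN tmD(2)] tyD[OF assms(1)] typing_ctx(2)[OF assms(1)]
  have "peq \<Gamma> (Idt A c a) (trR A c a (trR A c a q a (Refl A a)) a (pinv A a a (Refl A a))) (trR A c a q a (Refl A a))"
    by (intro trR_cong trR_ty(2) trL_ty(2) peq_refl) simp_all
  also have "peq \<Gamma> (Idt A c a) \<dots> q" by (intro trR_ty(2)) simp_all
  finally show ?thesis
    using peq_J[of \<Gamma> A a b p "Idt A\<Up> c\<Up> a\<Up>"
      "trR A\<Up> c\<Up> v1 (trR A\<Up> c\<Up> a\<Up> q\<Up> v1 v0) a\<Up> (pinv A\<Up> a\<Up> v1 v0)"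
      "q\<Up>"]
    by simp
qed

lemma trR_inv:
  assumes "\<Gamma> \<turnstile> A \<Ztypecolon> \<U>" "\<Gamma> \<turnstile> a \<Ztypecolon> A" "\<Gamma> \<turnstile> b \<Ztypecolon> A" "\<Gamma> \<turnstile> p \<Ztypecolon> Idt A a b"
  shows "peq \<Gamma> (Idt A b b) (trR A b a (pinv A a b p) b p) (Refl A b)"
proof -
  note [simp] = assms assms[THEN tmD(2)] tyD[OF assms(1)] typing_ctx(2)[OF assms(1)]
  have "peq \<Gamma> (Idt A a a) (trR A a a (pinv A a a (Refl A a)) a (Refl A a)) (pinv A a a (Refl A a))"
    by (intro trR_ty(2)) simp_all
  also have "peq \<Gamma> (Idt A a a) \<dots> (Refl A a)" by (intro trL_ty(2)) simp_all
  finally show ?thesis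
    using peq_J[of \<Gamma> A a b p "Idt A\<Up> v1 v1"
      "trR A\<Up> v1 a\<Up> (pinv A\<Up> a\<Up> v1 v0) v1 v0"
      "Refl A\<Up> v1"]
    by simp
qed

text \<open>The composite \<open>e\<inverse> \<cdot> q \<cdot> e'\<close>. It occurs with
  \<open>e\<close> and \<open>e'\<close> taken from the homotopy between a round trip and the
  identity.\<close>

definition path_conj :: "tm \<Rightarrow> tm \<Rightarrow> tm \<Rightarrow> tm \<Rightarrow> tm \<Rightarrow> tm \<Rightarrow> tm \<Rightarrow> tm \<Rightarrow> tm" where
  "path_conj A a b x y e e' q = trR A x b (trL A b a q x e) y e'"

lemma path_conj_cong:
  assumes "\<Gamma> \<turnstile> A \<Ztypecolon> \<U>" "\<Gamma> \<turnstile> a \<Ztypecolon> A" "\<Gamma> \<turnstile> b \<Ztypecolon> A" "\<Gamma> \<turnstile> x \<Ztypecolon> A" "\<Gamma> \<turnstile> y \<Ztypecolon> A"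
    "\<Gamma> \<turnstile> e \<Ztypecolon> Idt A a x" "\<Gamma> \<turnstile> e' \<Ztypecolon> Idt A b y" "peq \<Gamma> (Idt A a b) q q'"
  shows "peq \<Gamma> (Idt A x y) (path_conj A a b x y e e' q) (path_conj A a b x y e e' q')"
proof -
  note [simp] = assms(1-7) tyD[OF assms(1)] peqD(2)[OF assms(8)]
  show ?thesis unfolding path_conj_def by (intro trR_cong trL_cong peq_refl assms(8)) simp_all
qed

text \<open>Composing with the inverse of \<open>e'\<close> on the right and then with
  \<open>e\<close> on the left recovers the original path, each by a cancellation law.\<close>

lemma path_conj_inj:
  assumes "\<Gamma> \<turnstile> A \<Ztypecolon> \<U>" "\<Gamma> \<turnstile> a \<Ztypecolon> A" "\<Gamma> \<turnstile> b \<Ztypecolon> A" "\<Gamma> \<turnstile> x \<Ztypecolon> A" "\<Gamma> \<turnstile> y \<Ztypecolon> A"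
    "\<Gamma> \<turnstile> e \<Ztypecolon> Idt A a x" "\<Gamma> \<turnstile> e' \<Ztypecolon> Idt A b y" "\<Gamma> \<turnstile> q \<Ztypecolon> Idt A a b" "\<Gamma> \<turnstile> q' \<Ztypecolon> Idt A a b"
    and eq: "peq \<Gamma> (Idt A x y) (path_conj A a b x y e e' q) (path_conj A a b x y e e' q')"
  shows "peq \<Gamma> (Idt A a b) q q'"
proof -
  note [simp] = assms(1-9) tyD[OF assms(1)]
  have 1: "peq \<Gamma> (Idt A x b) (trL A b a q x e) (trR A x y (path_conj A a b x y e e' q) b (pinv A b y e'))"
    if [simp]: "\<Gamma> \<turnstile> q \<Ztypecolon> Idt A a b" for q
    unfolding path_conj_def by (intro peq_sym[OF trR_trR_inv]) simp_all
  have "peq \<Gamma> (Idt A x b) (trR A x y (path_conj A a b x y e e' q) b (pinv A b y e')) (trR A x y (path_conj A a b x y e e' q') b (pinv A b y e'))"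
    by (intro trR_cong eq peq_refl) simp_all
  then have 2: "peq \<Gamma> (Idt A x b) (trL A b a q x e) (trL A b a q' x e)"
    using 1[OF assms(8)] peq_sym[OF 1[OF assms(9)]] peq_trans by blast
  have 3: "peq \<Gamma> (Idt A a b) (trR A a x e b (trL A b a q x e)) q" if [simp]: "\<Gamma> \<turnstile> q \<Ztypecolon> Idt A a b" for q
    by (intro trR_trL[of \<Gamma> A a x b e q]) simp_all
  have "peq \<Gamma> (Idt A a b) (trR A a x e b (trL A b a q x e)) (trR A a x e b (trL A b a q' x e))"
    by (intro trR_cong 2 peq_refl) simp_all
  then show ?thesis using peq_sym[OF 3[OF assms(8)]] 3[OF assms(9)] peq_trans by blast
qed

lemma ap_cong:
  assumes A: "\<Gamma> \<turnstile> A \<Ztypecolon> \<U>" and B: "\<Gamma> \<turnstile> B \<Ztypecolon> \<U>" and f: "\<Gamma> \<turnstile> f \<Ztypecolon> Pi A B\<up>" and a: "\<Gamma> \<turnstile> a \<Ztypecolon> A" and b: "\<Gamma> \<turnstile> b \<Ztypecolon> A"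
    and p: "peq \<Gamma> (Idt A a b) p p'"
  shows "peq \<Gamma> (Idt B (f $ a) (f $ b)) (ap A B f a b p) (ap A B f a b p')"
proof -
  note [simp] = tyD[OF A] tyD[OF B] tmD[OF a] tmD[OF b] funD[OF f Pi_arg_type[OF A B]] typing_ctx(2)[OF A]
  show ?thesis
    using peq_cong[of "Idt A a b" \<Gamma> "ap A\<up> B\<up> f\<up> a\<up> b\<up> v0" "Idt B (f $ a) (f $ b)", OF _ _ p]
    by simp
qed

lemma hap_cong:
  assumes A: "\<Gamma> \<turnstile> A \<Ztypecolon> \<U>" and B: "A # \<Gamma> \<turnstile> B \<Ztypecolon> \<U>" and f: "\<Gamma> \<turnstile> f \<Ztypecolon> Pi A B" and g: "\<Gamma> \<turnstile> g \<Ztypecolon> Pi A B" and a: "\<Gamma> \<turnstile> a \<Ztypecolon> A"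
    and p: "peq \<Gamma> (Idt (Pi A B) f g) p p'"
  shows "peq \<Gamma> (Idt (ins 0 0 B a) (f $ a) (g $ a)) (hap A B f g p a) (hap A B f g p' a)"
proof -
  note [simp] = tyD[OF A] tyD1[OF B] typing_ctx(2)[OF A] tmD[OF a]
  have P: "\<Gamma> \<turnstile> Pi A B \<Ztypecolon> \<U>" "\<Gamma> \<turnstile> Pi A B \<Ztypecolon> \<T>" by simp_all
  note [simp] = funD[OF f P(2)] funD[OF g P(2)] tyD[OF P(1), simplified]
  show ?thesis
    using peq_cong[of "Idt (Pi A B) f g" \<Gamma> "hap A\<up> (lift 1 1 B) f\<up> g\<up> v0 a\<up>" "Idt (ins 0 0 B a) (f $ a) (g $ a)", OF _ _ p]
    by simp
qed

text \<open>Naturality of the homotopy \<open>e\<close> from the round trip to the identity. By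
  induction on \<open>p\<close> it reduces to \<open>e\<inverse> \<cdot> e\<close> being
  reflexivity.\<close>

lemma path_conj_ap_ap:
  assumes A: "\<Gamma> \<turnstile> A \<Ztypecolon> \<U>" and B: "\<Gamma> \<turnstile> B \<Ztypecolon> \<U>" and j: "\<Gamma> \<turnstile> j \<Ztypecolon> Pi A B\<up>" and i: "\<Gamma> \<turnstile> i \<Ztypecolon> Pi B A\<up>"
    and e: "\<Gamma> \<turnstile> e \<Ztypecolon> Pi A (Idt A\<up> (i\<up> $ (j\<up> $ v0)) v0)"
    and x: "\<Gamma> \<turnstile> x \<Ztypecolon> A" and y: "\<Gamma> \<turnstile> y \<Ztypecolon> A" and p: "\<Gamma> \<turnstile> p \<Ztypecolon> Idt A x y"
  shows "peq \<Gamma> (Idt A x y) (path_conj A (i $ (j $ x)) (i $ (j $ y)) x y (e $ x) (e $ y)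
    (ap B A i (j $ x) (j $ y) (ap A B j x y p))) p"
proof -
  note [simp] = tyD[OF A] tyD[OF B] tmD[OF x] tmD[OF y] p typing_ctx(2)[OF A] funD[OF j Pi_arg_type[OF A B]] funD[OF i Pi_arg_type[OF B A]]
  have P: "\<Gamma> \<turnstile> Pi A (Idt A\<up> (i\<up> $ (j\<up> $ v0)) v0) \<Ztypecolon> \<T>" by simp
  note [simp] = funD[OF e P]
  let ?jx = "j $ x" and ?ijx = "i $ (j $ x)"
  have "peq \<Gamma> (Idt A ?ijx ?ijx) (ap B A i ?jx ?jx (ap A B j x x (Refl A x))) (ap B A i ?jx ?jx (Refl B ?jx))"
    by (intro ap_cong ap_ty(2)) simp_all
  also have "peq \<Gamma> (Idt A ?ijx ?ijx) \<dots> (Refl A ?ijx)" by (intro ap_ty(2)) simp_all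
  finally have "peq \<Gamma> (Idt A x x) (path_conj A ?ijx ?ijx x x (e $ x) (e $ x) (ap B A i ?jx ?jx (ap A B j x x (Refl A x))))
    (path_conj A ?ijx ?ijx x x (e $ x) (e $ x) (Refl A ?ijx))"
    by (intro path_conj_cong) simp_all
  also have "peq \<Gamma> (Idt A x x) \<dots> (Refl A x)" unfolding path_conj_def by (intro trR_inv) simp_all
  finally show ?thesis
    by (rule peq_J'[where A=A and a=x and b=y and p=p and T="Idt A\<Up> x\<Up> v1"
      and l="path_conj A\<Up> (i\<Up> $ (j\<Up> $ x\<Up>)) (i\<Up> $ (j\<Up> $ v1)) x\<Up> v1
        (e\<Up> $ x\<Up>) (e\<Up> $ v1)
        (ap B\<Up> A\<Up> i\<Up> (j\<Up> $ x\<Up>) (j\<Up> $ v1)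
          (ap A\<Up> B\<Up> j\<Up> x\<Up> v1 v0))" and r="v0"])
      (simp_all (no_asm_simp) add: path_conj_def)
qed

text \<open>By naturality \<open>p\<close> is a conjugate of its image under the round trip through
  \<open>j\<close> and \<open>i\<close>, and this image depends only on the action of
  \<open>j\<close> on \<open>p\<close>. A left inverse on points thus suffices for injectivity on
  paths.\<close>

lemma ap_inj:
  assumes A: "\<Gamma> \<turnstile> A \<Ztypecolon> \<U>" and B: "\<Gamma> \<turnstile> B \<Ztypecolon> \<U>" and j: "\<Gamma> \<turnstile> j \<Ztypecolon> Pi A B\<up>" and i: "\<Gamma> \<turnstile> i \<Ztypecolon> Pi B A\<up>"
    and e: "\<Gamma> \<turnstile> e \<Ztypecolon> Pi A (Idt A\<up> (i\<up> $ (j\<up> $ v0)) v0)"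
    and x: "\<Gamma> \<turnstile> x \<Ztypecolon> A" and y: "\<Gamma> \<turnstile> y \<Ztypecolon> A" and p: "\<Gamma> \<turnstile> p \<Ztypecolon> Idt A x y" and q: "\<Gamma> \<turnstile> q \<Ztypecolon> Idt A x y"
    and pq: "peq \<Gamma> (Idt B (j $ x) (j $ y)) (ap A B j x y p) (ap A B j x y q)"
  shows "peq \<Gamma> (Idt A x y) p q"
proof -
  note [simp] = tyD[OF A] tyD[OF B] tmD[OF x] tmD[OF y] p typing_ctx(2)[OF A] funD[OF j Pi_arg_type[OF A B]] funD[OF i Pi_arg_type[OF B A]]
  have P: "\<Gamma> \<turnstile> Pi A (Idt A\<up> (i\<up> $ (j\<up> $ v0)) v0) \<Ztypecolon> \<T>" by simp
  note [simp] = funD[OF e P]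
  have "peq \<Gamma> (Idt A x y) (path_conj A (i $ (j $ x)) (i $ (j $ y)) x y (e $ x) (e $ y) (ap B A i (j $ x) (j $ y) (ap A B j x y p)))
    (path_conj A (i $ (j $ x)) (i $ (j $ y)) x y (e $ x) (e $ y) (ap B A i (j $ x) (j $ y) (ap A B j x y q)))"
    by (rule path_conj_cong[OF _ _ _ _ _ _ _ ap_cong[OF B A i _ _ pq]]) simp_all
  from peq_trans[OF peq_sym[OF path_conj_ap_ap[OF A B j i e x y p]] peq_trans[OF this path_conj_ap_ap[OF A B j i e x y q]]] show ?thesis .
qed

text \<open>As \<open>s\<close> is injective on paths and conjugation is injective, no coherence between \<open>\<rho>\<close> and \<open>\<sigma>\<close> is needed.\<close>

lemma ap_surj:
  assumes A: "\<Gamma> \<turnstile> A \<Ztypecolon> \<U>" and B: "\<Gamma> \<turnstile> B \<Ztypecolon> \<U>" and j: "\<Gamma> \<turnstile> j \<Ztypecolon> Pi A B\<up>" and s: "\<Gamma> \<turnstile> s \<Ztypecolon> Pi B A\<up>"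
    and \<rho>: "\<Gamma> \<turnstile> \<rho> \<Ztypecolon> Pi A (Idt A\<up> (s\<up> $ (j\<up> $ v0)) v0)"
    and \<sigma>: "\<Gamma> \<turnstile> \<sigma> \<Ztypecolon> Pi B (Idt B\<up> (j\<up> $ (s\<up> $ v0)) v0)"
    and x: "\<Gamma> \<turnstile> x \<Ztypecolon> A" and y: "\<Gamma> \<turnstile> y \<Ztypecolon> A" and p: "\<Gamma> \<turnstile> p \<Ztypecolon> Idt B (j $ x) (j $ y)"
  shows "\<exists>q. \<Gamma> \<turnstile> q \<Ztypecolon> Idt A x y \<and> peq \<Gamma> (Idt B (j $ x) (j $ y)) (ap A B j x y q) p"
proof -
  note [simp] = tyD[OF A] tyD[OF B] tmD[OF x] tmD[OF y] tmD[OF p] typing_ctx(2)[OF A] funD[OF j Pi_arg_type[OF A B]] funD[OF s Pi_arg_type[OF B A]]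
  have P: "\<Gamma> \<turnstile> Pi A (Idt A\<up> (s\<up> $ (j\<up> $ v0)) v0) \<Ztypecolon> \<T>"
    "\<Gamma> \<turnstile> Pi B (Idt B\<up> (j\<up> $ (s\<up> $ v0)) v0) \<Ztypecolon> \<T>" by simp_all
  note [simp] = funD[OF \<rho> P(1)] funD[OF \<sigma> P(2)]
  let ?c = "path_conj A (s $ (j $ x)) (s $ (j $ y)) x y (\<rho> $ x) (\<rho> $ y)"
  let ?q = "?c (ap B A s (j $ x) (j $ y) p)"
  have q: "\<Gamma> \<turnstile> ?q \<Ztypecolon> Idt A x y" by (simp add: path_conj_def)
  have "peq \<Gamma> (Idt A x y) (?c (ap B A s (j $ x) (j $ y) (ap A B j x y ?q))) ?q"
    by (rule path_conj_ap_ap[OF A B j s \<rho> x y q])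
  \<comment> \<open>The path \<open>?q\<close> is by definition the conjugate of the action of
    \<open>s\<close> on \<open>p\<close>, so naturality compares two conjugates by the same
    homotopy, and the conjugation can be cancelled.\<close>
  then have "peq \<Gamma> (Idt A (s $ (j $ x)) (s $ (j $ y))) (ap B A s (j $ x) (j $ y) (ap A B j x y ?q)) (ap B A s (j $ x) (j $ y) p)"
    by (rule path_conj_inj[rotated 9]) (use q in simp_all)
  then have "peq \<Gamma> (Idt B (j $ x) (j $ y)) (ap A B j x y ?q) p"
    by (intro ap_inj[OF B A s j \<sigma>]) (use q in simp_all)
  then show ?thesis using q by blast
qed

section \<open>Local types\<close>

lemma Idt_conv:
  assumes "\<Gamma> \<turnstile> p \<Ztypecolon> Idt A a b" "jeqs \<Gamma> A a a'" "jeqs \<Gamma> A b b'"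
  shows "\<Gamma> \<turnstile> p \<Ztypecolon> Idt A a' b'"
proof -
  have "\<Gamma> \<turnstile> Idt A a b \<doteq> Idt A a' b' \<Ztypecolon> \<U>"
    using assms(2,3) by (intro e_Idt e_refl) (auto simp: jeqs_def)
  then show ?thesis using t_conv[OF assms(1)] by (blast intro: e_El)
qed

lemma peq_conv:
  assumes "peq \<Gamma> (Idt A a b) p q" "jeqs \<Gamma> A a a'" "jeqs \<Gamma> A b b'"
  shows "peq \<Gamma> (Idt A a' b') p q"
proof -
  note * = assms(2,3)[unfolded jeqs_def]
  have e: "\<Gamma> \<turnstile> Idt A a b \<doteq> Idt A a' b' \<Ztypecolon> \<U>"
    using * by (intro e_Idt e_refl) auto
  have t: "\<Gamma> \<turnstile> Idt A a' b' \<Ztypecolon> \<U>" using * by auto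
  obtain r where "\<Gamma> \<turnstile> r \<Ztypecolon> Idt (Idt A a b) p q" using peqD(4)[OF assms(1)] ..
  then have "\<Gamma> \<turnstile> r \<Ztypecolon> Idt (Idt A a' b') p q"
    by (rule t_conv) (intro e_El e_Idt e e_refl peqD[OF assms(1)])
  then show ?thesis
    using t Idt_conv[OF peqD(2)[OF assms(1)] assms(2,3)] Idt_conv[OF peqD(3)[OF assms(1)] assms(2,3)] by (intro peqI)
qed

lemma jeqs_refl: "\<Gamma> \<turnstile> A \<Ztypecolon> \<U> \<Longrightarrow> \<Gamma> \<turnstile> a \<Ztypecolon> A \<Longrightarrow> jeqs \<Gamma> A a a"
  by (auto simp: jeqs_def intro: e_refl)

text \<open>
  Only the computation rule of \<open>\<lambda>a x. a\<close> is used. Keeping the map itself opaque prevents rewriting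
  from pushing \<open>lift\<close> and \<open>ins\<close> into it.
\<close>

definition cst :: "tm list \<Rightarrow> tm \<Rightarrow> tm \<Rightarrow> tm \<Rightarrow> bool" where
  "cst \<Gamma> K T d \<longleftrightarrow> \<Gamma> \<turnstile> K \<Ztypecolon> \<U> \<and> \<Gamma> \<turnstile> T \<Ztypecolon> \<U> \<and> \<Gamma> \<turnstile> d \<Ztypecolon> Pi T (Pi K\<up> T\<Up>) \<and>
    (\<forall>\<Delta> k t x. \<Delta> \<turnstile> ctx \<longrightarrow> k \<le> length \<Delta> \<longrightarrow> drop k \<Delta> = \<Gamma> \<longrightarrow> \<Delta> \<turnstile> t \<Ztypecolon> lift 0 k T \<longrightarrow> \<Delta> \<turnstile> x \<Ztypecolon> lift 0 k K \<longrightarrow>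
      jeqs \<Delta> (lift 0 k T) ((lift 0 k d) $ t $ x) t)"

lemma cstD:
  assumes "cst \<Gamma> K T d"
  shows "\<Gamma> \<turnstile> K \<Ztypecolon> \<U>" "\<Gamma> \<turnstile> T \<Ztypecolon> \<U>" "\<Gamma> \<turnstile> d \<Ztypecolon> Pi T (Pi K\<up> T\<Up>)"
    "\<Gamma> \<turnstile> t \<Ztypecolon> T \<Longrightarrow> \<Gamma> \<turnstile> x \<Ztypecolon> K \<Longrightarrow> jeqs \<Gamma> T (d $ t $ x) t"
    "\<Gamma> \<turnstile> t \<Ztypecolon> T \<Longrightarrow> \<Gamma> \<turnstile> x \<Ztypecolon> K \<Longrightarrow> \<Gamma> \<turnstile> d $ t $ x \<Ztypecolon> T"
    "\<Delta> \<turnstile> ctx \<Longrightarrow> k \<le> length \<Delta> \<Longrightarrow> drop k \<Delta> = \<Gamma> \<Longrightarrow> \<Delta> \<turnstile> t \<Ztypecolon> lift 0 k T \<Longrightarrow> \<Delta> \<turnstile> x \<Ztypecolon> lift 0 k K \<Longrightarrow>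
      jeqs \<Delta> (lift 0 k T) ((lift 0 k d) $ t $ x) t"
    "\<Delta> \<turnstile> ctx \<Longrightarrow> k \<le> length \<Delta> \<Longrightarrow> drop k \<Delta> = \<Gamma> \<Longrightarrow> \<Delta> \<turnstile> t \<Ztypecolon> lift 0 k T \<Longrightarrow> \<Delta> \<turnstile> x \<Ztypecolon> lift 0 k K \<Longrightarrow>
      S = lift 0 k T \<Longrightarrow> \<Delta> \<turnstile> (lift 0 k d) $ t $ x \<Ztypecolon> S"
proof -
  note * = assms[unfolded cst_def]
  show K: "\<Gamma> \<turnstile> K \<Ztypecolon> \<U>" "\<Gamma> \<turnstile> T \<Ztypecolon> \<U>" "\<Gamma> \<turnstile> d \<Ztypecolon> Pi T (Pi K\<up> T\<Up>)" using * by auto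
  show 1: "\<Delta> \<turnstile> ctx \<Longrightarrow> k \<le> length \<Delta> \<Longrightarrow> drop k \<Delta> = \<Gamma> \<Longrightarrow> \<Delta> \<turnstile> t \<Ztypecolon> lift 0 k T \<Longrightarrow> \<Delta> \<turnstile> x \<Ztypecolon> lift 0 k K \<Longrightarrow>
      jeqs \<Delta> (lift 0 k T) ((lift 0 k d) $ t $ x) t" for \<Delta> k t x using * by blast
  show "\<Delta> \<turnstile> ctx \<Longrightarrow> k \<le> length \<Delta> \<Longrightarrow> drop k \<Delta> = \<Gamma> \<Longrightarrow> \<Delta> \<turnstile> t \<Ztypecolon> lift 0 k T \<Longrightarrow> \<Delta> \<turnstile> x \<Ztypecolon> lift 0 k K \<Longrightarrow>
      S = lift 0 k T \<Longrightarrow> \<Delta> \<turnstile> (lift 0 k d) $ t $ x \<Ztypecolon> S" for \<Delta> k t x using 1[of \<Delta> k t x] by (simp add: jeqs_def)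
  have c: "\<Gamma> \<turnstile> ctx" using typing_ctx(2)[OF K(1)] .
  show 2: "\<Gamma> \<turnstile> t \<Ztypecolon> T \<Longrightarrow> \<Gamma> \<turnstile> x \<Ztypecolon> K \<Longrightarrow> jeqs \<Gamma> T (d $ t $ x) t" for t x
    using 1[OF c, of 0 t x] by simp
  show "\<Gamma> \<turnstile> t \<Ztypecolon> T \<Longrightarrow> \<Gamma> \<turnstile> x \<Ztypecolon> K \<Longrightarrow> \<Gamma> \<turnstile> d $ t $ x \<Ztypecolon> T" for t x
    using 2[of t x] by (simp add: jeqs_def)
qed

lemma cst_lift:
  assumes d: "cst \<Gamma> K T d" and \<Delta>: "\<Delta> \<turnstile> ctx" "k \<le> length \<Delta>" "drop k \<Delta> = \<Gamma>"
  shows "cst \<Delta> (lift 0 k K) (lift 0 k T) (lift 0 k d)"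
  unfolding cst_def
proof (intro conjI allI impI)
  show "\<Delta> \<turnstile> lift 0 k K \<Ztypecolon> \<U>" "\<Delta> \<turnstile> lift 0 k T \<Ztypecolon> \<U>"
    using lift_ty[OF cstD(1)[OF d] \<Delta>] lift_ty[OF cstD(2)[OF d] \<Delta>] by simp_all
  show "\<Delta> \<turnstile> lift 0 k d \<Ztypecolon> Pi (lift 0 k T) (Pi (lift 0 k K)\<up> (lift 0 k T)\<Up>)"
    using lift_ty[OF cstD(3)[OF d] \<Delta>] \<Delta>(2) by (cases "k = 0") (simp_all add: add.commute)
  fix \<Delta>' k' t x
  assume *: "\<Delta>' \<turnstile> ctx" "k' \<le> length \<Delta>'" "drop k' \<Delta>' = \<Delta>" "\<Delta>' \<turnstile> t \<Ztypecolon> lift 0 k' (lift 0 k T)" "\<Delta>' \<turnstile> x \<Ztypecolon> lift 0 k' (lift 0 k K)"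
  show "jeqs \<Delta>' (lift 0 k' (lift 0 k T)) ((lift 0 k' (lift 0 k d)) $ t $ x) t"
    using cstD(6)[OF d, of \<Delta>' "k + k'" t x] * \<Delta> by (auto simp: add.commute)
qed

text \<open>Evaluation at \<open>k\<close> undoes \<open>d\<close>, so on paths the action of
  \<open>d\<close> followed by evaluation is the identity. The two path types have ends that agree
  by computation only; conversions make the induction on \<open>p\<close> well typed.\<close>

lemma hap_cst:
  assumes d: "cst \<Gamma> K T d" and a: "\<Gamma> \<turnstile> a \<Ztypecolon> T" and b: "\<Gamma> \<turnstile> b \<Ztypecolon> T" and k: "\<Gamma> \<turnstile> k \<Ztypecolon> K" and p: "\<Gamma> \<turnstile> p \<Ztypecolon> Idt T a b"
  shows "peq \<Gamma> (Idt T (d $ a $ k) (d $ b $ k))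
    (hap K T\<up> (d $ a) (d $ b) (ap T (Pi K T\<up>) d a b p) k) p"
proof -
  note [simp] = tyD[OF cstD(1)[OF d]] tyD[OF cstD(2)[OF d]] tmD[OF a] tmD[OF b] tmD[OF k] p typing_ctx(2)[OF a] cstD(5,7)[OF d]
  have P: "\<Gamma> \<turnstile> Pi T (Pi K\<up> T\<Up>) \<Ztypecolon> \<T>" by simp
  note [simp] = funD[OF cstD(3)[OF d] P]
  let ?G = "Pi K T\<up>"
  let ?D = "Idt T\<up> a\<up> v0 # T # \<Gamma>"
  have C[simp]: "?D \<turnstile> ctx" by simp
  \<comment> \<open>The path variable has the original ends, while the family in the induction asks
    for \<open>d\<close> of these ends evaluated at \<open>k\<close>. The latter compute to the
    former.\<close>
  have v: "?D \<turnstile> v0 \<Ztypecolon> Idt T\<Up> (d\<Up> $ a\<Up> $ k\<Up>) (d\<Up> $ v1 $ k\<Up>)"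
    using Idt_conv[OF _ jeqs_sym[OF cstD(6)[OF d, of ?D 2 "a\<Up>" "k\<Up>"]] jeqs_sym[OF cstD(6)[OF d, of ?D 2 "v1" "k\<Up>"]],
      of "v0"] by simp
  have da: "jeqs \<Gamma> T (d $ a $ k) a" using cstD(4)[OF d a k] .
  have "peq \<Gamma> (Idt T (d $ a $ k) (d $ a $ k)) (hap K T\<up> (d $ a) (d $ a) (ap T ?G d a a (Refl T a)) k)
    (hap K T\<up> (d $ a) (d $ a) (Refl ?G (d $ a)) k)"
    using hap_cong[of \<Gamma> K "T\<up>" "d $ a" "d $ a" k] ap_ty(2)[of \<Gamma> T ?G d a] by simp
  also have "peq \<Gamma> (Idt T (d $ a $ k) (d $ a $ k)) \<dots> (Refl T (d $ a $ k))"
    using hap_ty(2)[of \<Gamma> K "T\<up>" "d $ a" k] by simp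
  also have "peq \<Gamma> (Idt T (d $ a $ k) (d $ a $ k)) \<dots> (Refl T a)"
  proof (rule peq_jeq)
    have "\<Gamma> \<turnstile> Refl T (d $ a $ k) \<doteq> Refl T a \<Ztypecolon> Idt T (d $ a $ k) (d $ a $ k)"
      using da by (intro e_Refl e_refl) (simp_all add: jeqs_def)
    moreover have "\<Gamma> \<turnstile> Refl T a \<Ztypecolon> Idt T (d $ a $ k) (d $ a $ k)"
      by (rule Idt_conv[of _ _ _ a a]) (simp_all add: jeqs_sym[OF da])
    ultimately show "jeqs \<Gamma> (Idt T (d $ a $ k) (d $ a $ k)) (Refl T (d $ a $ k)) (Refl T a)"
      by (simp add: jeqs_def)
  qed
  finally show ?thesis
    by (rule peq_J'[where A=T and a=a and b=b and p=p and
      T="Idt T\<Up> (d\<Up> $ a\<Up> $ k\<Up>) (d\<Up> $ v1 $ k\<Up>)"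
      and l="hap K\<Up> (lift 0 3 T) (d\<Up> $ a\<Up>) (d\<Up> $ v1)
         (ap T\<Up> (Pi K\<Up> (lift 0 3 T)) d\<Up> a\<Up> v1 v0) k\<Up>"
      and r="v0"]) (simp_all add: v)
qed

lemma is_local_lift: "is_local K T = is_equiv T (Pi K T\<up>) (Lam T (Lam K\<up> v1))"
  by (simp only: is_local_def shift_lift arr_def)

lemma cst_Lam:
  assumes K: "\<Gamma> \<turnstile> K \<Ztypecolon> \<U>" and T: "\<Gamma> \<turnstile> T \<Ztypecolon> \<U>"
  shows "cst \<Gamma> K T (Lam T (Lam K\<up> v1))"
  unfolding cst_def
proof (intro conjI allI impI)
  note [simp] = tyD[OF K] tyD[OF T] typing_ctx(2)[OF T]
  show "\<Gamma> \<turnstile> K \<Ztypecolon> \<U>" "\<Gamma> \<turnstile> T \<Ztypecolon> \<U>" by simp_all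
  show "\<Gamma> \<turnstile> Lam T (Lam K\<up> v1) \<Ztypecolon> Pi T (Pi K\<up> T\<Up>)" by simp
  fix \<Delta> k t x
  assume *[simp]: "\<Delta> \<turnstile> ctx" "k \<le> length \<Delta>" "drop k \<Delta> = \<Gamma>" "\<Delta> \<turnstile> t \<Ztypecolon> lift 0 k T" "\<Delta> \<turnstile> x \<Ztypecolon> lift 0 k K"
  have KT: "\<Delta> \<turnstile> lift 0 k K \<Ztypecolon> \<U>" "\<Delta> \<turnstile> lift 0 k T \<Ztypecolon> \<U>" by simp_all
  obtain K' T' where e: "lift 0 k K = K'" "lift 0 k T = T'" by blast
  note [simp] = tyD[OF KT(1)[unfolded e]] tyD[OF KT(2)[unfolded e]] tmD[OF *(4)[unfolded e]] tmD[OF *(5)[unfolded e]]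
  let ?d = "Lam T' (Lam K'\<up> v1)"
  have d: "lift 0 k (Lam T (Lam K\<up> v1)) = ?d"
    unfolding e[symmetric] by (cases "k = 0") (simp_all add: add.commute)
  have 1: "\<Delta> \<turnstile> ?d $ t \<doteq> Lam K' t\<up> \<Ztypecolon> Pi K' T'\<up>"
    using e_beta[of \<Delta> T' "Pi K'\<up> T'\<Up>" "Lam K'\<up> v1" t] by (simp add: inst_ins)
  have K1: "K' # \<Delta> \<turnstile> T'\<up> \<Ztypecolon> \<T>" by simp
  have 2: "\<Delta> \<turnstile> ?d $ t $ x \<doteq> (Lam K' t\<up>) $ x \<Ztypecolon> T'"
    using e_App[OF _ K1 1, of x x] e_refl[of \<Delta> x K'] by (simp add: inst_ins)
  have 3: "\<Delta> \<turnstile> (Lam K' t\<up>) $ x \<doteq> t \<Ztypecolon> T'"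
    using e_beta[OF _ K1, of "t\<up>" x] by (simp add: inst_ins)
  have f: "\<Delta> \<turnstile> ?d $ t \<Ztypecolon> Pi K' T'\<up>"
    using App_ty[of \<Delta> ?d T' "Pi K'\<up> T'\<Up>" t] by simp
  have "\<Delta> \<turnstile> ?d $ t $ x \<Ztypecolon> T'" using App_ty[OF f, of x] by simp
  then show "jeqs \<Delta> (lift 0 k T) ((lift 0 k (Lam T (Lam K\<up> v1))) $ t $ x) t"
    unfolding d jeqs_def e using e_trans[OF 2 3] by simp
qed

text \<open>An equivalence comes with a section \<open>s\<close> and an independent retraction
  \<open>r\<close>. Since \<open>s (d t) = r (d (s (d t))) = r (d t) = t\<close>, the section is
  inverse to \<open>d\<close> on both sides, and a single inverse can be used afterwards.\<close>

lemma local_data: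
  assumes K: "\<Gamma> \<turnstile> K \<Ztypecolon> \<U>" and T: "\<Gamma> \<turnstile> T \<Ztypecolon> \<U>" and e: "\<Gamma> \<turnstile> e \<Ztypecolon> is_local K T"
  shows "\<exists>d s \<sigma> \<rho>. cst \<Gamma> K T d \<and> \<Gamma> \<turnstile> s \<Ztypecolon> Pi (Pi K T\<up>) T\<up> \<and>
    \<Gamma> \<turnstile> \<sigma> \<Ztypecolon> Pi (Pi K T\<up>) (Idt (Pi K\<up> T\<Up>) (d\<up> $ (s\<up> $ v0)) v0) \<and>
    \<Gamma> \<turnstile> \<rho> \<Ztypecolon> Pi T (Idt T\<up> (s\<up> $ (d\<up> $ v0)) v0)"
proof -
  note [simp] = tyD[OF K] tyD[OF T] typing_ctx(2)[OF T]
  obtain d where d: "Lam T (Lam K\<up> v1) = d" by blast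
  let ?G = "Pi K T\<up>"
  have c: "cst \<Gamma> K T d" using cst_Lam[OF K T] d by simp
  have e': "\<Gamma> \<turnstile> e \<Ztypecolon> is_equiv T ?G d" using e d unfolding is_local_lift by simp
  have G: "\<Gamma> \<turnstile> ?G \<Ztypecolon> \<U>" by simp
  have dT: "\<Gamma> \<turnstile> d \<Ztypecolon> Pi T ?G\<up>" using cstD(3)[OF c] by simp
  obtain s \<sigma> r \<rho> where *: "\<Gamma> \<turnstile> s \<Ztypecolon> Pi ?G T\<up>" "\<Gamma> \<turnstile> r \<Ztypecolon> Pi ?G T\<up>"
    "\<Gamma> \<turnstile> \<sigma> \<Ztypecolon> Pi ?G (Idt ?G\<up> (d\<up> $ (s\<up> $ v0)) v0)"
    "\<Gamma> \<turnstile> \<rho> \<Ztypecolon> Pi T (Idt T\<up> (r\<up> $ (d\<up> $ v0)) v0)"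
    using equivD[OF T G dT e'] by blast
  note [simp] = funD[OF dT Pi_arg_type[OF T G], simplified] funD[OF *(1) Pi_arg_type[OF G T]] funD[OF *(2) Pi_arg_type[OF G T]]
  note P = *(3,4)[simplified]
  have PT: "\<Gamma> \<turnstile> Pi ?G (Idt ?G\<up> (d\<up> $ (s\<up> $ v0)) v0) \<Ztypecolon> \<T>"
    "\<Gamma> \<turnstile> Pi T (Idt T\<up> (r\<up> $ (d\<up> $ v0)) v0) \<Ztypecolon> \<T>" by simp_all
  note [simp] = funD[OF *(3) PT(1), simplified] funD[OF *(4) PT(2)]
  let ?u = "d\<up> $ v0" and ?T = "T\<up>" and ?G1 = "?G\<up>"
  have "peq (T # \<Gamma>) ?T (r\<up> $ (d\<up> $ (s\<up> $ ?u))) (s\<up> $ ?u)"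
    by (rule peqI[where p="\<rho>\<up> $ (s\<up> $ ?u)"]) simp_all
  moreover have "peq (T # \<Gamma>) ?G1 (d\<up> $ (s\<up> $ ?u)) ?u"
    by (rule peqI[where p="\<sigma>\<up> $ ?u"]) simp_all
  then have "peq (T # \<Gamma>) ?T (r\<up> $ (d\<up> $ (s\<up> $ ?u))) (r\<up> $ ?u)"
    using peq_cong[of ?G1 "T # \<Gamma>" "r\<Up> $ v0" ?T] by simp
  moreover have "peq (T # \<Gamma>) ?T (r\<up> $ ?u) v0"
    by (rule peqI[where p="\<rho>\<up> $ v0"]) simp_all
  ultimately have "peq (T # \<Gamma>) ?T (s\<up> $ ?u) v0"
    by (rule peq_trans[OF peq_sym peq_trans])
  then obtain p where p: "T # \<Gamma> \<turnstile> p \<Ztypecolon> Idt ?T (s\<up> $ ?u) v0" using peqD(4) by blast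
  have "\<Gamma> \<turnstile> Lam T p \<Ztypecolon> Pi T (Idt ?T (s\<up> $ ?u) v0)"
    by (rule t_Lam) (use p in simp_all)
  then show ?thesis using c *(1) P(1)
    by (intro exI[of _ d] exI[of _ s] exI[of _ \<sigma>] exI[of _ "Lam T p"] conjI)
qed

lemma funD_cst:
  assumes "cst \<Gamma> K T d"
  shows "\<Gamma> \<turnstile> d \<Ztypecolon> Pi T (Pi K T\<up>)\<up>" "\<Gamma> \<turnstile> Pi K T\<up> \<Ztypecolon> \<U>" "\<Gamma> \<turnstile> Pi T (Pi K\<up> T\<Up>) \<Ztypecolon> \<T>"
  using tyD[OF cstD(1)[OF assms]] tyD[OF cstD(2)[OF assms]] cstD(3)[OF assms] typing_ctx(2)[OF cstD(1)[OF assms]] by simp_all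

lemma local_ext:
  assumes K: "\<Gamma> \<turnstile> K \<Ztypecolon> \<U>" and T: "\<Gamma> \<turnstile> T \<Ztypecolon> \<U>" and e: "\<Gamma> \<turnstile> e \<Ztypecolon> is_local K T"
    and u: "K # \<Gamma> \<turnstile> u \<Ztypecolon> T\<up>"
  shows "\<exists>t. \<Gamma> \<turnstile> t \<Ztypecolon> T \<and> peq (K # \<Gamma>) T\<up> u t\<up>"
proof -
  note [simp] = tyD[OF K] tyD[OF T] typing_ctx(2)[OF T]
  let ?G = "Pi K T\<up>"
  obtain d s \<sigma> \<rho> where c: "cst \<Gamma> K T d" and s: "\<Gamma> \<turnstile> s \<Ztypecolon> Pi ?G T\<up>"
    and \<sigma>: "\<Gamma> \<turnstile> \<sigma> \<Ztypecolon> Pi ?G (Idt (Pi K\<up> T\<Up>) (d\<up> $ (s\<up> $ v0)) v0)"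
    using local_data[OF K T e] by blast
  have G: "\<Gamma> \<turnstile> ?G \<Ztypecolon> \<U>" by simp
  note [simp] = funD[OF s Pi_arg_type[OF G T]] funD[OF cstD(3)[OF c] funD_cst(3)[OF c]] cstD(5,7)[OF c]
  have P: "\<Gamma> \<turnstile> Pi ?G (Idt (Pi K\<up> T\<Up>) (d\<up> $ (s\<up> $ v0)) v0) \<Ztypecolon> \<T>"
    by simp
  note [simp] = funD[OF \<sigma> P]
  obtain f where f: "\<Gamma> \<turnstile> f \<Ztypecolon> ?G" and fu: "jeqs (K # \<Gamma>) T\<up> (f\<up> $ v0) u"
    using lam_ex0[OF K _ u] by auto
  have GT: "\<Gamma> \<turnstile> ?G \<Ztypecolon> \<T>" by simp
  note [simp] = funD[OF f GT]
  have t: "\<Gamma> \<turnstile> s $ f \<Ztypecolon> T" by simp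
  obtain t where te: "s $ f = t" by blast
  note [simp] = tmD[OF t[unfolded te]]
  have p: "\<Gamma> \<turnstile> \<sigma> $ f \<Ztypecolon> Idt ?G (d $ t) f" using te by simp
  have "peq \<Gamma> ?G f (d $ t)" by (rule peq_sym[OF peqI[OF _ _ _ p]]) simp_all
  from peq_lift[OF this, of "K # \<Gamma>" 1]
  have "peq (K # \<Gamma>) T\<up> (f\<up> $ v0) (d\<up> $ t\<up> $ v0)"
    using peq_cong[of "?G\<up>" "K # \<Gamma>" "v0 $ v1" "T\<up>"] by simp
  from peq_trans[OF peq_sym[OF peq_jeq[OF fu]] peq_trans[OF this peq_jeq[OF cstD(6)[OF c, of "K # \<Gamma>" 1]]]] show ?thesis
    using t unfolding te by (intro exI[of _ t]) simp
qed

text \<open>The hypothesis \<open>E\<close>, at a generic function, yields a section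
  \<open>s\<close> of the constant map \<open>d\<close>. Then \<open>d (s (d t)) = d t\<close>, so
  \<open>s (d t)\<close> and \<open>t\<close> agree under the hypothesis \<open>K\<close>, and
  \<open>I\<close> makes them equal. Nothing has to be known about how the path supplied by
  \<open>I\<close> relates to the given one over \<open>K\<close>.\<close>

lemma local_intro:
  assumes K: "\<Gamma> \<turnstile> K \<Ztypecolon> \<U>" and T: "\<Gamma> \<turnstile> T \<Ztypecolon> \<U>"
    and E: "\<exists>t. Pi K T\<up> # \<Gamma> \<turnstile> t \<Ztypecolon> T\<up> \<and>
      peq (K\<up> # Pi K T\<up> # \<Gamma>) T\<Up> (v1 $ v0) t\<up>"
    and I: "\<And>x y. T # \<Gamma> \<turnstile> x \<Ztypecolon> T\<up> \<Longrightarrow> T # \<Gamma> \<turnstile> y \<Ztypecolon> T\<up> \<Longrightarrow>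
      peq (K\<up> # T # \<Gamma>) T\<Up> x\<up> y\<up> \<Longrightarrow> peq (T # \<Gamma>) T\<up> x y"
  shows "\<exists>e. \<Gamma> \<turnstile> e \<Ztypecolon> is_local K T"
proof -
  note [simp] = tyD[OF K] tyD[OF T] typing_ctx(2)[OF T]
  let ?G = "Pi K T\<up>" and ?d = "Lam T (Lam K\<up> v1)"
  have G: "\<Gamma> \<turnstile> ?G \<Ztypecolon> \<U>" by simp
  obtain d where d: "?d = d" by blast
  have c: "cst \<Gamma> K T d" using cst_Lam[OF K T] d by simp
  note [simp] = funD[OF cstD(3)[OF c] funD_cst(3)[OF c]] cstD(5,7)[OF c]
  obtain t where t: "?G # \<Gamma> \<turnstile> t \<Ztypecolon> T\<up>"
    and te: "peq (K\<up> # ?G # \<Gamma>) T\<Up> (v1 $ v0) t\<up>" using E by blast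
  note [simp] = tmD1[OF t]
  obtain s where s: "\<Gamma> \<turnstile> s \<Ztypecolon> Pi ?G T\<up>"
    and sb: "\<And>\<Delta> k a. \<Delta> \<turnstile> ctx \<Longrightarrow> k \<le> length \<Delta> \<Longrightarrow> drop k \<Delta> = \<Gamma> \<Longrightarrow> \<Delta> \<turnstile> a \<Ztypecolon> lift 0 k ?G \<Longrightarrow>
       jeqs \<Delta> (ins 0 k T\<up> a) ((lift 0 k s) $ a) (ins 0 k t a)"
    using lam_ex[OF G _ t] by auto
  note [simp] = funD[OF s Pi_arg_type[OF G T]]
  let ?D = "K\<up> # ?G # \<Gamma>"
  have "peq ?D T\<Up> (s\<Up> $ v1) t\<up>"
    using peq_jeq[OF sb[of ?D 2 "v1"]] by simp
  from peq_trans[OF this peq_sym[OF te]]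
  have st: "peq ?D T\<Up> (s\<Up> $ v1) (v1 $ v0)" .
  from peq_trans[OF peq_jeq[OF cstD(6)[OF c, of ?D 2 "s\<Up> $ v1" "v0"]]]
  have 1: "peq ?D T\<Up> (d\<Up> $ (s\<Up> $ v1) $ v0) (v1 $ v0)"
    using st by simp
  have "peq (?G # \<Gamma>) ?G\<up> (d\<up> $ (s\<up> $ v0)) v0"
    using funext[of "?G # \<Gamma>" "K\<up>" "T\<Up>" "d\<up> $ (s\<up> $ v0)" "v0"] 1 by simp
  then obtain \<sigma> where "?G # \<Gamma> \<turnstile> \<sigma> \<Ztypecolon> Idt ?G\<up> (d\<up> $ (s\<up> $ v0)) v0"
    using peqD(4) by blast
  then have \<sigma>: "\<Gamma> \<turnstile> Lam ?G \<sigma> \<Ztypecolon> Pi ?G (Idt ?G\<up> (d\<up> $ (s\<up> $ v0)) v0)"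
    by (intro t_Lam) simp_all
  obtain \<sigma>f where \<sigma>f: "Lam ?G \<sigma> = \<sigma>f" by blast
  have P: "\<Gamma> \<turnstile> Pi ?G (Idt ?G\<up> (d\<up> $ (s\<up> $ v0)) v0) \<Ztypecolon> \<T>" by simp
  note [simp] = funD[OF \<sigma>[unfolded \<sigma>f] P, simplified]
  have "peq (K\<up> # T # \<Gamma>) T\<Up> (s\<up> $ (d\<up> $ v0))\<up> v0\<up>"
  proof -
    let ?D = "K\<up> # T # \<Gamma>" and ?u = "d\<Up> $ v1"
    have 2: "peq ?D ?G\<Up> (d\<Up> $ (s\<Up> $ ?u)) ?u"
      by (rule peqI[where p="\<sigma>f\<Up> $ ?u"]) simp_all
    have "peq ?D T\<Up> (d\<Up> $ (s\<Up> $ ?u) $ v0) (?u $ v0)"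
      using peq_cong[of "?G\<Up>" ?D "v0 $ v1" "T\<Up>", OF _ _ 2] by simp
    then have "peq ?D T\<Up> (s\<Up> $ ?u) (?u $ v0)"
      by (rule peq_trans[OF peq_sym[OF peq_jeq[OF cstD(6)[OF c, of ?D 2]], simplified], rotated -1]) simp_all
    moreover have "peq ?D T\<Up> (?u $ v0) v1"
      using peq_jeq[OF cstD(6)[OF c, of ?D 2 "v1" "v0"]] by simp
    ultimately show ?thesis using peq_trans[of ?D "T\<Up>" _ "?u $ v0"] by simp
  qed
  then have "peq (T # \<Gamma>) T\<up> (s\<up> $ (d\<up> $ v0)) v0"
    by (intro I) simp_all
  then obtain \<rho> where "T # \<Gamma> \<turnstile> \<rho> \<Ztypecolon> Idt T\<up> (s\<up> $ (d\<up> $ v0)) v0"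
    using peqD(4) by blast
  then have \<rho>: "\<Gamma> \<turnstile> Lam T \<rho> \<Ztypecolon> Pi T (Idt T\<up> (s\<up> $ (d\<up> $ v0)) v0)"
    by (intro t_Lam) simp_all
  show ?thesis unfolding is_local_lift d
    by (rule equivI[OF T G funD_cst(1)[OF c] s \<sigma> \<rho>])
qed

text \<open>An equivalence acts surjectively on paths. A family of paths over \<open>K\<close>
  becomes, by function extensionality, a path between the constant functions \<open>d a\<close> and
  \<open>d b\<close>; \<open>ap_surj\<close> lifts it to a path from \<open>a\<close> to
  \<open>b\<close>, and \<open>hap_cst\<close> shows that the lift has the prescribed
  values.\<close>

lemma local_Id_ext:
  assumes K: "\<Gamma> \<turnstile> K \<Ztypecolon> \<U>" and T: "\<Gamma> \<turnstile> T \<Ztypecolon> \<U>" and e: "\<Gamma> \<turnstile> e \<Ztypecolon> is_local K T"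
    and a: "\<Gamma> \<turnstile> a \<Ztypecolon> T" and b: "\<Gamma> \<turnstile> b \<Ztypecolon> T"
    and u: "K # \<Gamma> \<turnstile> u \<Ztypecolon> Idt T\<up> a\<up> b\<up>"
  shows "\<exists>t. \<Gamma> \<turnstile> t \<Ztypecolon> Idt T a b \<and> peq (K # \<Gamma>) (Idt T\<up> a\<up> b\<up>) u t\<up>"
proof -
  note [simp] = tyD[OF K] tyD[OF T] typing_ctx(2)[OF T] tmD[OF a] tmD[OF b]
  let ?G = "Pi K T\<up>" and ?K1 = "K\<up>" and ?T1 = "T\<up>" and ?G1 = "Pi K\<up> T\<Up>"
  obtain d s \<sigma> \<rho> where c: "cst \<Gamma> K T d" and s: "\<Gamma> \<turnstile> s \<Ztypecolon> Pi ?G T\<up>"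
    and \<sigma>: "\<Gamma> \<turnstile> \<sigma> \<Ztypecolon> Pi ?G (Idt (Pi K\<up> T\<Up>) (d\<up> $ (s\<up> $ v0)) v0)"
    and \<rho>: "\<Gamma> \<turnstile> \<rho> \<Ztypecolon> Pi T (Idt T\<up> (s\<up> $ (d\<up> $ v0)) v0)"
    using local_data[OF K T e] by blast
  have G: "\<Gamma> \<turnstile> ?G \<Ztypecolon> \<U>" by simp
  note [simp] = funD[OF cstD(3)[OF c] funD_cst(3)[OF c]] cstD(5,7)[OF c]
  let ?I = "Idt ?T1 (d\<up> $ a\<up> $ v0) (d\<up> $ b\<up> $ v0)"
  have ja: "jeqs (K # \<Gamma>) ?T1 (d\<up> $ a\<up> $ v0) a\<up>"
    "jeqs (K # \<Gamma>) ?T1 (d\<up> $ b\<up> $ v0) b\<up>"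
    by (rule cstD(6)[OF c]; simp)+
  have u': "K # \<Gamma> \<turnstile> u \<Ztypecolon> ?I" by (rule Idt_conv[OF u jeqs_sym[OF ja(1)] jeqs_sym[OF ja(2)]])
  have *: "\<Gamma> \<turnstile> d $ a \<Ztypecolon> Pi K T\<up>" "\<Gamma> \<turnstile> d $ b \<Ztypecolon> Pi K T\<up>" "K # \<Gamma> \<turnstile> T\<up> \<Ztypecolon> \<U>" by simp_all
  obtain p where p: "\<Gamma> \<turnstile> p \<Ztypecolon> Idt ?G (d $ a) (d $ b)" and pu: "peq (K # \<Gamma>) ?I
      (hap K\<up> (lift 1 1 ?T1) (d $ a)\<up> (d $ b)\<up> p\<up> v0) u"
    using funext_path[OF K *(3,1,2), of u] u' by auto
  have \<sigma>': "\<Gamma> \<turnstile> \<sigma> \<Ztypecolon> Pi ?G (Idt ?G\<up> (d\<up> $ (s\<up> $ v0)) v0)" using \<sigma> by simp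
  obtain q where q: "\<Gamma> \<turnstile> q \<Ztypecolon> Idt T a b" and qp: "peq \<Gamma> (Idt ?G (d $ a) (d $ b)) (ap T ?G d a b q) p"
    using ap_surj[OF T G funD_cst(1)[OF c] s \<rho> \<sigma>' a b p] by blast
  note [simp] = tmD[OF p] tmD[OF q]
  have "peq (K # \<Gamma>) ?I (hap ?K1 T\<Up> (d\<up> $ a\<up>) (d\<up> $ b\<up>)
       (ap ?T1 ?G1 d\<up> a\<up> b\<up> q\<up>) v0)
     (hap ?K1 T\<Up> (d\<up> $ a\<up>) (d\<up> $ b\<up>) p\<up> v0)"
    using hap_cong[of "K # \<Gamma>" ?K1 "T\<Up>" "d\<up> $ a\<up>" "d\<up> $ b\<up>" "v0"]
      peq_lift[OF qp, of "K # \<Gamma>" 1] by simp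
  from peq_trans[OF this] have "peq (K # \<Gamma>) ?I (hap ?K1 T\<Up> (d\<up> $ a\<up>) (d\<up> $ b\<up>)
       (ap ?T1 ?G1 d\<up> a\<up> b\<up> q\<up>) v0) u" using pu by simp
  moreover have "peq (K # \<Gamma>) ?I (hap ?K1 T\<Up> (d\<up> $ a\<up>) (d\<up> $ b\<up>)
       (ap ?T1 ?G1 d\<up> a\<up> b\<up> q\<up>) v0) q\<up>"
    using hap_cst[OF cst_lift[OF c, of "K # \<Gamma>" 1], of "a\<up>" "b\<up>" "v0" "q\<up>"] by simp
  ultimately have "peq (K # \<Gamma>) ?I u q\<up>" by (rule peq_trans[OF peq_sym])
  from peq_conv[OF this ja] show ?thesis using q by blast
qed

text \<open>By \<open>hap_cst\<close> the images of \<open>p\<close> and \<open>q\<close> in the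
  function type have equal values at each point of \<open>K\<close>. Hence these images are equal by
  \<open>hap_inj\<close>, and \<open>d\<close> is injective on paths because it has a left
  inverse.\<close>

lemma local_Id_inj:
  assumes K: "\<Gamma> \<turnstile> K \<Ztypecolon> \<U>" and T: "\<Gamma> \<turnstile> T \<Ztypecolon> \<U>" and e: "\<Gamma> \<turnstile> e \<Ztypecolon> is_local K T"
    and a: "\<Gamma> \<turnstile> a \<Ztypecolon> T" and b: "\<Gamma> \<turnstile> b \<Ztypecolon> T" and p: "\<Gamma> \<turnstile> p \<Ztypecolon> Idt T a b" and q: "\<Gamma> \<turnstile> q \<Ztypecolon> Idt T a b"
    and pq: "peq (K # \<Gamma>) (Idt T\<up> a\<up> b\<up>) p\<up> q\<up>"
  shows "peq \<Gamma> (Idt T a b) p q"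
proof -
  note [simp] = tyD[OF K] tyD[OF T] typing_ctx(2)[OF T] tmD[OF a] tmD[OF b] tmD[OF p] tmD[OF q]
  let ?G = "Pi K T\<up>" and ?K1 = "K\<up>" and ?T1 = "T\<up>" and ?G1 = "Pi K\<up> T\<Up>"
  obtain d s \<sigma> \<rho> where c: "cst \<Gamma> K T d" and s: "\<Gamma> \<turnstile> s \<Ztypecolon> Pi ?G T\<up>"
    and \<rho>: "\<Gamma> \<turnstile> \<rho> \<Ztypecolon> Pi T (Idt T\<up> (s\<up> $ (d\<up> $ v0)) v0)"
    using local_data[OF K T e] by blast
  have G: "\<Gamma> \<turnstile> ?G \<Ztypecolon> \<U>" by simp
  note [simp] = funD[OF cstD(3)[OF c] funD_cst(3)[OF c]] cstD(5,7)[OF c]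
  let ?I = "Idt ?T1 (d\<up> $ a\<up> $ v0) (d\<up> $ b\<up> $ v0)"
  let ?h = "\<lambda>q. hap ?K1 T\<Up> (d\<up> $ a\<up>) (d\<up> $ b\<up>)
       (ap ?T1 ?G1 d\<up> a\<up> b\<up> q\<up>) v0"
  have ja: "jeqs (K # \<Gamma>) ?T1 (d\<up> $ a\<up> $ v0) a\<up>"
    "jeqs (K # \<Gamma>) ?T1 (d\<up> $ b\<up> $ v0) b\<up>"
    by (rule cstD(6)[OF c]; simp)+
  have h: "peq (K # \<Gamma>) ?I (?h q) q\<up>" if "\<Gamma> \<turnstile> q \<Ztypecolon> Idt T a b" for q
    using hap_cst[OF cst_lift[OF c, of "K # \<Gamma>" 1], of "a\<up>" "b\<up>" "v0" "q\<up>"] tmD[OF that] by simp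
  from peq_trans[OF h[OF p] peq_trans[OF peq_conv[OF pq jeqs_sym[OF ja(1)] jeqs_sym[OF ja(2)]] peq_sym[OF h[OF q]]]]
  have "peq \<Gamma> (Idt ?G (d $ a) (d $ b)) (ap T ?G d a b p) (ap T ?G d a b q)"
    by (intro hap_inj) simp_all
  then show ?thesis by (rule ap_inj[OF T G funD_cst(1)[OF c] s \<rho> a b p q])
qed

lemma is_local_simps [simp]:
  "lift j k (is_local K T) = is_local (lift j k K) (lift j k T)"
  "ins j k (is_local K T) x = is_local (ins j k K x) (ins j k T x)"
proof -
  have "lift (j + 1 + 1 + 1 + 1) k (lift 0 4 t) = lift 0 4 (lift j k t)" "ins (j + 1 + 1 + 1 + 1) k (lift 0 4 t) x = lift 0 4 (ins j k t x)" for t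
    by (auto simp: lift_def ins_def subst_algebra intro!: subst_cong)
  then show "lift j k (is_local K T) = is_local (lift j k K) (lift j k T)"
    "ins j k (is_local K T) x = is_local (ins j k K x) (ins j k T x)"
    by (simp_all only: is_local_lift is_equiv_lift) (simp_all add: lift_binders3)
qed

lemma local_Id:
  assumes K: "\<Gamma> \<turnstile> K \<Ztypecolon> \<U>" and T: "\<Gamma> \<turnstile> T \<Ztypecolon> \<U>" and e: "\<Gamma> \<turnstile> e \<Ztypecolon> is_local K T"
    and a: "\<Gamma> \<turnstile> a \<Ztypecolon> T" and b: "\<Gamma> \<turnstile> b \<Ztypecolon> T"
  shows "\<exists>e. \<Gamma> \<turnstile> e \<Ztypecolon> is_local K (Idt T a b)"
proof (rule local_intro)
  note [simp] = tyD[OF K] tyD[OF T] typing_ctx(2)[OF T] tmD[OF a] tmD[OF b] tmD[OF e]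
  show "\<Gamma> \<turnstile> K \<Ztypecolon> \<U>" "\<Gamma> \<turnstile> Idt T a b \<Ztypecolon> \<U>" by simp_all
  let ?D = "Pi K (Idt T a b)\<up> # \<Gamma>"
  show "\<exists>t. ?D \<turnstile> t \<Ztypecolon> (Idt T a b)\<up> \<and>
      peq (K\<up> # ?D) (Idt T a b)\<Up> (v1 $ v0) t\<up>"
    using local_Id_ext[of ?D "K\<up>" "T\<up>" "e\<up>" "a\<up>" "b\<up>" "v1 $ v0"] by simp
  fix x y assume *: "Idt T a b # \<Gamma> \<turnstile> x \<Ztypecolon> (Idt T a b)\<up>" "Idt T a b # \<Gamma> \<turnstile> y \<Ztypecolon> (Idt T a b)\<up>"
    "peq (K\<up> # Idt T a b # \<Gamma>) (Idt T a b)\<Up> x\<up> y\<up>"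
  then show "peq (Idt T a b # \<Gamma>) (Idt T a b)\<up> x y"
    using local_Id_inj[of "Idt T a b # \<Gamma>" "K\<up>" "T\<up>" "e\<up>" "a\<up>" "b\<up>" x y] by simp
qed

section \<open>Pushouts\<close>

lemma PushInd_simps [simp]:
  "lift j k (PushInd P u v w z) = PushInd (lift (j + 1) k P) (lift (j + 1) k u) (lift (j + 1) k v) (lift (j + 1) k w) (lift j k z)"
  "ins j k (PushInd P u v w z) x = PushInd (ins (j + 1) k P x) (ins (j + 1) k u x) (ins (j + 1) k v x) (ins (j + 1) k w x) (ins j k z x)"
  by (simp add: lift_def up_ren_lift) (simp only: ins_def subst.simps up_ins)

lemma Push_ty [simp]:
  assumes "\<Gamma> \<turnstile> C \<Ztypecolon> \<U>" "\<Gamma> \<turnstile> A \<Ztypecolon> \<U>" "\<Gamma> \<turnstile> B \<Ztypecolon> \<U>" "\<Gamma> \<turnstile> f \<Ztypecolon> Pi C A\<up>" "\<Gamma> \<turnstile> g \<Ztypecolon> Pi C B\<up>"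
  shows "\<Gamma> \<turnstile> Push C A B f g \<Ztypecolon> Univ l"
    and "\<Gamma> \<turnstile> a \<Ztypecolon> A \<Longrightarrow> T = Push C A B f g \<Longrightarrow> \<Gamma> \<turnstile> PInl C A B f g a \<Ztypecolon> T"
    and "\<Gamma> \<turnstile> b \<Ztypecolon> B \<Longrightarrow> T = Push C A B f g \<Longrightarrow> \<Gamma> \<turnstile> PInr C A B f g b \<Ztypecolon> T"
    and "\<Gamma> \<turnstile> c \<Ztypecolon> C \<Longrightarrow> T = Idt (Push C A B f g) (PInl C A B f g (f $ c)) (PInr C A B f g (g $ c)) \<Longrightarrow> \<Gamma> \<turnstile> Glue C A B f g c \<Ztypecolon> T"
  using assms unfolding arr_lift[symmetric] by (auto intro: ty_Univ t_Push t_PInl t_PInr t_Glue)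

text \<open>The path rule of pushouts is stated with \<open>apd\<close>, also when the motive is a
  fixed type \<open>T\<close>. This form of \<open>apd\<close> keeps the transport in the constant
  family visible; the transport is cancelled later by comparing with a constant function.\<close>

definition apdc :: "tm \<Rightarrow> tm \<Rightarrow> tm \<Rightarrow> tm \<Rightarrow> tm \<Rightarrow> tm \<Rightarrow> tm" where
  "apdc K T d z z' e = J (Idt T\<Up> (tr K\<Up> (lift 0 3 T) z\<Up> (ins 0 0 d z)\<Up> v1 v0) d\<up>)
     (Refl T (ins 0 0 d z)) z' e"

lemma apd_lift: "apd T\<up> d z z' e = apdc K T d z z' e"
  by (simp only: apd_def transport_def apdc_def tr_def shift_lift shift1_lift inst_ins) simp

lemma apdc_simps [simp]:
  "lift j k (apdc K T d z z' e) = apdc (lift j k K) (lift j k T) (lift (j + 1) k d) (lift j k z) (lift j k z') (lift j k e)"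
  "ins j k (apdc K T d z z' e) x = apdc (ins j k K x) (ins j k T x) (ins (j + 1) k d x) (ins j k z x) (ins j k z' x) (ins j k e x)"
  using lift_ins_gen[of 0 j k d z] ins_ins_gen[of 0 j k d z x]
  by (simp_all add: apdc_def lift_ins2 ins_ins2 lift_binders3)

lemma tr_jeqs:
  assumes "\<Gamma> \<turnstile> A \<Ztypecolon> \<U>" "A # \<Gamma> \<turnstile> C \<Ztypecolon> \<U>" "\<Gamma> \<turnstile> a \<Ztypecolon> A" "\<Gamma> \<turnstile> c \<Ztypecolon> ins 0 0 C a"
  shows "jeqs \<Gamma> (ins 0 0 C a) (tr A C a c a (Refl A a)) c"
proof -
  note [simp] = assms tyD[OF assms(1)] tyD1[OF assms(2)] tmD[OF assms(3)] typing_ctx(2)[OF assms(1)]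
  show ?thesis
    using J_ty(2)[where P="C\<up>" and d=c and A=A and \<Gamma>=\<Gamma> and a=a and b=a and p="Refl A a"]
      tr_ty(1)[OF assms, of a "Refl A a"]
    by (simp add: jeqs_def tr_def)
qed

lemma apdc_ty:
  assumes K: "\<Gamma> \<turnstile> K \<Ztypecolon> \<U>" and T: "\<Gamma> \<turnstile> T \<Ztypecolon> \<U>" and d: "K # \<Gamma> \<turnstile> d \<Ztypecolon> T\<up>" and z: "\<Gamma> \<turnstile> z \<Ztypecolon> K"
  shows "\<Gamma> \<turnstile> z' \<Ztypecolon> K \<Longrightarrow> \<Gamma> \<turnstile> e \<Ztypecolon> Idt K z z' \<Longrightarrow> S = Idt T (tr K T\<up> z (ins 0 0 d z) z' e) (ins 0 0 d z') \<Longrightarrow>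
      \<Gamma> \<turnstile> apdc K T d z z' e \<Ztypecolon> S"
    and "jeqs \<Gamma> (Idt T (ins 0 0 d z) (ins 0 0 d z)) (apdc K T d z z (Refl K z)) (Refl T (ins 0 0 d z))"
proof -
  note [simp] = tyD[OF K] tyD[OF T] tmD1[OF d] tmD[OF z] typing_ctx(2)[OF K]
  have dz: "\<Gamma> \<turnstile> ins 0 0 d z \<Ztypecolon> T" by simp
  note [simp] = tmD[OF dz]
  have j: "jeqs \<Gamma> T (tr K T\<up> z (ins 0 0 d z) z (Refl K z)) (ins 0 0 d z)"
    using tr_jeqs[of \<Gamma> K "T\<up>" z "ins 0 0 d z"] by simp
  \<comment> \<open>At reflexivity the transport disappears by computation only, so the base case of
    \<open>J\<close> receives its type by conversion.\<close>
  have r: "\<Gamma> \<turnstile> Refl T (ins 0 0 d z) \<Ztypecolon> Idt T (tr K T\<up> z (ins 0 0 d z) z (Refl K z)) (ins 0 0 d z)"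
    by (rule Idt_conv[OF _ jeqs_sym[OF j] jeqs_refl]) simp_all
  let ?P = "Idt T\<Up> (tr K\<Up> (lift 0 3 T) z\<Up> (ins 0 0 d z)\<Up> v1 v0) d\<up>"
  have P: "Idt K\<up> z\<up> v0 # K # \<Gamma> \<turnstile> ?P \<Ztypecolon> \<T>" if "Idt K\<up> z\<up> v0 # K # \<Gamma> \<turnstile> ctx"
    using that by simp
  note J = J_ty[OF ty_Univ[OF K] z _ _ P, of _ _ "Refl T (ins 0 0 d z)"]
  show 1: "\<Gamma> \<turnstile> z' \<Ztypecolon> K \<Longrightarrow> \<Gamma> \<turnstile> e \<Ztypecolon> Idt K z z' \<Longrightarrow> S = Idt T (tr K T\<up> z (ins 0 0 d z) z' e) (ins 0 0 d z') \<Longrightarrow>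
      \<Gamma> \<turnstile> apdc K T d z z' e \<Ztypecolon> S" for z' e S
    using J(1)[of z' e] r by (simp add: apdc_def)
  have 2: "jeqs \<Gamma> (Idt T (tr K T\<up> z (ins 0 0 d z) z (Refl K z)) (ins 0 0 d z)) (apdc K T d z z (Refl K z)) (Refl T (ins 0 0 d z))"
    using J(2)[of z "Refl K z"] r 1[of z "Refl K z"] by (simp add: apdc_def jeqs_def)
  have "\<Gamma> \<turnstile> Idt T (tr K T\<up> z (ins 0 0 d z) z (Refl K z)) (ins 0 0 d z) \<doteq> Idt T (ins 0 0 d z) (ins 0 0 d z) \<Ztypecolon> \<T>"
    using j by (intro e_El[OF e_Idt] e_refl) (simp_all add: jeqs_def)
  then show "jeqs \<Gamma> (Idt T (ins 0 0 d z) (ins 0 0 d z)) (apdc K T d z z (Refl K z)) (Refl T (ins 0 0 d z))"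
    using 2 unfolding jeqs_def by (auto intro: e_conv t_conv)
qed

declare apdc_ty(1) [simp]

lemma jeqs_ins:
  assumes "jeqs (A # \<Gamma>) B b b'" "\<Delta> \<turnstile> ctx" "k \<le> length \<Delta>" "drop k \<Delta> = \<Gamma>" "\<Delta> \<turnstile> a \<Ztypecolon> lift 0 k A"
  shows "jeqs \<Delta> (ins 0 k B a) (ins 0 k b a) (ins 0 k b' a)"
  using assms(1) ins_ty[OF _ assms(2-)] ins_jeq[OF _ assms(2-)] unfolding jeqs_def by force

text \<open>Applying the eliminator to a generic point of the pushout gives a term
  \<open>\<phi>\<close> whose instances are the values of the recursor. The judgemental rules are
  proved at a generic point of \<open>A\<close> or \<open>B\<close> and carried to all contexts by
  \<open>jeqs_ins\<close>; the path rule is \<open>PushComp\<close>.\<close>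

lemma push_rec:
  assumes C: "\<Gamma> \<turnstile> C \<Ztypecolon> \<U>" and A: "\<Gamma> \<turnstile> A \<Ztypecolon> \<U>" and B: "\<Gamma> \<turnstile> B \<Ztypecolon> \<U>"
    and f: "\<Gamma> \<turnstile> f \<Ztypecolon> Pi C A\<up>" and g: "\<Gamma> \<turnstile> g \<Ztypecolon> Pi C B\<up>" and T: "\<Gamma> \<turnstile> T \<Ztypecolon> \<U>"
    and u: "A # \<Gamma> \<turnstile> u \<Ztypecolon> T\<up>" and v: "B # \<Gamma> \<turnstile> v \<Ztypecolon> T\<up>"
    and w: "C # \<Gamma> \<turnstile> w \<Ztypecolon> Idt T\<up>
      (tr (Push C A B f g)\<up> T\<Up> (PInl C\<up> A\<up> B\<up> f\<up> g\<up> (f\<up> $ v0))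
        (ins 0 1 u (f\<up> $ v0)) (PInr C\<up> A\<up> B\<up> f\<up> g\<up> (g\<up> $ v0))
        (Glue C\<up> A\<up> B\<up> f\<up> g\<up> v0))
      (ins 0 1 v (g\<up> $ v0))"
  shows "\<exists>\<phi>. Push C A B f g # \<Gamma> \<turnstile> \<phi> \<Ztypecolon> T\<up> \<and>
    (\<forall>\<Delta> k a. \<Delta> \<turnstile> ctx \<longrightarrow> k \<le> length \<Delta> \<longrightarrow> drop k \<Delta> = \<Gamma> \<longrightarrow> \<Delta> \<turnstile> a \<Ztypecolon> lift 0 k A \<longrightarrow>
       jeqs \<Delta> (lift 0 k T) (ins 0 k \<phi> (PInl (lift 0 k C) (lift 0 k A) (lift 0 k B) (lift 0 k f) (lift 0 k g) a)) (ins 0 k u a)) \<and>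
    (\<forall>\<Delta> k b. \<Delta> \<turnstile> ctx \<longrightarrow> k \<le> length \<Delta> \<longrightarrow> drop k \<Delta> = \<Gamma> \<longrightarrow> \<Delta> \<turnstile> b \<Ztypecolon> lift 0 k B \<longrightarrow>
       jeqs \<Delta> (lift 0 k T) (ins 0 k \<phi> (PInr (lift 0 k C) (lift 0 k A) (lift 0 k B) (lift 0 k f) (lift 0 k g) b)) (ins 0 k v b)) \<and>
    (\<exists>r. C # \<Gamma> \<turnstile> r \<Ztypecolon> Idt (Idt T\<up>
      (tr (Push C A B f g)\<up> T\<Up> (PInl C\<up> A\<up> B\<up> f\<up> g\<up> (f\<up> $ v0))
        (ins 0 1 u (f\<up> $ v0)) (PInr C\<up> A\<up> B\<up> f\<up> g\<up> (g\<up> $ v0))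
        (Glue C\<up> A\<up> B\<up> f\<up> g\<up> v0))
      (ins 0 1 v (g\<up> $ v0)))
      (apdc (Push C A B f g)\<up> T\<up> (lift 1 1 \<phi>)
         (PInl C\<up> A\<up> B\<up> f\<up> g\<up> (f\<up> $ v0))
         (PInr C\<up> A\<up> B\<up> f\<up> g\<up> (g\<up> $ v0))
         (Glue C\<up> A\<up> B\<up> f\<up> g\<up> v0)) w)"
proof -
  note [simp] = tyD[OF C] tyD[OF A] tyD[OF B] tyD[OF T] typing_ctx(2)[OF T] funD[OF f Pi_arg_type[OF C A]]
    funD[OF g Pi_arg_type[OF C B]] tmD1[OF u] tmD1[OF v] tmD1[OF w, simplified]
  let ?K = "Push C A B f g"
  let ?\<phi> = "PushInd (lift 1 1 T\<up>) (lift 1 1 u) (lift 1 1 v) (lift 1 1 w) v0"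
  let ?l = "PInl C\<up> A\<up> B\<up> f\<up> g\<up>"
  let ?r = "PInr C\<up> A\<up> B\<up> f\<up> g\<up>"
  let ?fc = "f\<up> $ v0" and ?gc = "g\<up> $ v0"
  let ?G = "Glue C\<up> A\<up> B\<up> f\<up> g\<up> v0"
  note defs = glue_datum_def transport_def shift_lift shift1_lift inst_ins arr_lift
  have \<phi>: "?K # \<Gamma> \<turnstile> ?\<phi> \<Ztypecolon> T\<up>"
    using t_PushInd[of "?K # \<Gamma>" "C\<up>" "A\<up>" "B\<up>" "f\<up>" "g\<up>" "T\<Up>"
       "lift 1 1 u" "lift 1 1 v" "lift 1 1 w" "v0"]
    unfolding defs by (simp add: tr_def)
  note [simp] = tmD1[OF \<phi>, simplified]
  have L: "jeqs (A # \<Gamma>) T\<up> (ins 0 1 ?\<phi> (?l v0)) u"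
    using ins_ty[OF \<phi>, of "A # \<Gamma>" 1 "?l v0"] e_PushInd_PInl[of "A # \<Gamma>" "C\<up>" "A\<up>" "B\<up>" "f\<up>" "g\<up>" "T\<Up>"
       "lift 1 1 u" "lift 1 1 v" "lift 1 1 w" "v0"]
    unfolding defs jeqs_def by (simp add: tr_def)
  have R: "jeqs (B # \<Gamma>) T\<up> (ins 0 1 ?\<phi> (?r v0)) v"
    using ins_ty[OF \<phi>, of "B # \<Gamma>" 1 "?r v0"] e_PushInd_PInr[of "B # \<Gamma>" "C\<up>" "A\<up>" "B\<up>" "f\<up>" "g\<up>" "T\<Up>"
       "lift 1 1 u" "lift 1 1 v" "lift 1 1 w" "v0"]
    unfolding defs jeqs_def by (simp add: tr_def)
  have "C # \<Gamma> \<turnstile> PushComp C\<up> A\<up> B\<up> f\<up> g\<up> T\<Up>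
       (lift 1 1 u) (lift 1 1 v) (lift 1 1 w) v0 \<Ztypecolon> Idt (Idt T\<up> (tr ?K\<up> T\<Up> (?l ?fc) (ins 0 1 u ?fc) (?r ?gc) ?G)
      (ins 0 1 v ?gc)) (apd T\<Up> (lift 1 1 ?\<phi>) (?l ?fc) (?r ?gc) ?G) w"
    using t_PushComp[of "C # \<Gamma>" "C\<up>" "A\<up>" "B\<up>" "f\<up>" "g\<up>" "T\<Up>"
       "lift 1 1 u" "lift 1 1 v" "lift 1 1 w" "v0"]
    unfolding defs by (simp add: tr_def)
  moreover have "apd T\<Up> d a b p = apdc ?K\<up> T\<up> d a b p" for d a b p
    using apd_lift[of "T\<up>"] by simp
  ultimately show ?thesis
    using \<phi> jeqs_ins[OF L] jeqs_ins[OF R] by (intro exI[of _ ?\<phi>]) (auto simp del: lift_1 PushInd_simps)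
qed

lemma jeqs_trans: "jeqs \<Gamma> A a b \<Longrightarrow> jeqs \<Gamma> A b c \<Longrightarrow> jeqs \<Gamma> A a c"
  by (auto simp: jeqs_def intro: e_trans)

lemma jeqs_conv:
  assumes "jeqs \<Gamma> (Idt A a b) p q" "jeqs \<Gamma> A a a'" "jeqs \<Gamma> A b b'"
  shows "jeqs \<Gamma> (Idt A a' b') p q"
proof -
  note * = assms[unfolded jeqs_def]
  have "\<Gamma> \<turnstile> Idt A a b \<doteq> Idt A a' b' \<Ztypecolon> \<T>"
    using * by (intro e_El[OF e_Idt] e_refl) auto
  moreover have "\<Gamma> \<turnstile> Idt A a' b' \<Ztypecolon> \<U>" using * by auto
  ultimately show ?thesis using * unfolding jeqs_def by (auto intro: e_conv t_conv)
qed

lemma jeqs_Refl: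
  assumes "jeqs \<Gamma> A a b"
  shows "jeqs \<Gamma> (Idt A a a) (Refl A a) (Refl A b)"
proof -
  note * = assms[unfolded jeqs_def]
  have "\<Gamma> \<turnstile> Refl A a \<doteq> Refl A b \<Ztypecolon> Idt A a a"
    using * by (intro e_Refl e_El[OF e_refl]) auto
  moreover have "\<Gamma> \<turnstile> Refl A b \<Ztypecolon> Idt A a a"
    by (rule Idt_conv[OF _ jeqs_sym[OF assms] jeqs_sym[OF assms]]) (use * in \<open>auto intro: ty_Univ t_Refl\<close>)
  ultimately show ?thesis using * unfolding jeqs_def by (auto intro: ty_Univ t_Refl)
qed

text \<open>The end point \<open>c\<close> occurs in the motive of the underlying \<open>J\<close>,
  so the congruence rule \<open>e_J\<close> is used with a changing motive.\<close>

lemma trL_jeqs: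
  assumes A: "\<Gamma> \<turnstile> A \<Ztypecolon> \<U>" and c: "jeqs \<Gamma> A c c'" and a: "\<Gamma> \<turnstile> a \<Ztypecolon> A" and b: "\<Gamma> \<turnstile> b \<Ztypecolon> A"
    and q: "\<Gamma> \<turnstile> q \<Ztypecolon> Idt A a c" and p: "\<Gamma> \<turnstile> p \<Ztypecolon> Idt A a b"
  shows "jeqs \<Gamma> (Idt A b c) (trL A c a q b p) (trL A c' a q b p)"
proof -
  note c' = c[unfolded jeqs_def]
  note [simp] = A tyD[OF A] tmD[OF conjunct1[OF conjunct2[OF c']]] tmD[OF conjunct1[OF conjunct2[OF conjunct2[OF c']]]] tmD[OF a] tmD[OF b] q p typing_ctx(2)[OF A]
  let ?D = "Idt A\<up> a\<up> v0 # A # \<Gamma>"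
  have D[simp]: "?D \<turnstile> ctx" by simp
  have cc: "?D \<turnstile> c\<Up> \<doteq> c'\<Up> \<Ztypecolon> A\<Up>"
    by (rule lift_jeq[OF conjunct2[OF conjunct2[OF conjunct2[OF c']]]]) simp_all
  have P: "?D \<turnstile> Idt A\<Up> v1 c\<Up> \<Ztypecolon> \<T>" by simp
  have PP: "?D \<turnstile> Idt A\<Up> v1 c\<Up> \<doteq> Idt A\<Up> v1 c'\<Up> \<Ztypecolon> \<T>"
    using cc by (intro e_Idt e_refl) simp_all
  have "\<Gamma> \<turnstile> trL A c a q b p \<doteq> trL A c' a q b p \<Ztypecolon> Idt A b c"
    using e_J[OF _ _ P[folded shift_lift] PP[folded shift_lift], of q q b b p p]
    unfolding trL_def inst2_ins shift_lift by (simp add: e_refl)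
  moreover have "\<Gamma> \<turnstile> trL A c' a q b p \<Ztypecolon> Idt A b c"
    by (rule Idt_conv[OF _ jeqs_refl jeqs_sym[OF c]]) (use Idt_conv[OF q jeqs_refl c] in simp_all)
  ultimately show ?thesis unfolding jeqs_def by simp
qed

lemma trR_arg: "trR A c a q b p = trR A c a' q b p"
  by (simp add: trR_def)

lemma trL_arg: "trL A c a q b p = trL A c a' q b p"
  by (simp add: trL_def)

lemma trR_inv_cancel:
  assumes "\<Gamma> \<turnstile> A \<Ztypecolon> \<U>" "\<Gamma> \<turnstile> x \<Ztypecolon> A" "\<Gamma> \<turnstile> y \<Ztypecolon> A" "\<Gamma> \<turnstile> b \<Ztypecolon> A"
    "\<Gamma> \<turnstile> k \<Ztypecolon> Idt A y x" "\<Gamma> \<turnstile> p \<Ztypecolon> Idt A y b"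
  shows "peq \<Gamma> (Idt A y b) (trR A y x k b (trR A x y (pinv A y x k) b p)) p"
proof -
  note [simp] = assms assms[THEN tmD(2)] tyD[OF assms(1)] typing_ctx(2)[OF assms(1)]
  have "peq \<Gamma> (Idt A y b) (trR A y y (Refl A y) b (trR A y y (pinv A y y (Refl A y)) b p)) (trR A y y (pinv A y y (Refl A y)) b p)"
    by (intro trR_Refl_left) simp_all
  also have "peq \<Gamma> (Idt A y b) \<dots> (trR A y y (Refl A y) b p)"
    by (intro trR_cong trL_ty(2) peq_refl) simp_all
  also have "peq \<Gamma> (Idt A y b) \<dots> p" by (intro trR_Refl_left) simp_all
  finally show ?thesis
    by (rule peq_J'[where A=A and a=y and b=x and p=k and T="Idt A\<Up> y\<Up> b\<Up>"
      and l="trR A\<Up> y\<Up> v1 v0 b\<Up> (trR A\<Up> v1 y\<Up> (pinv A\<Up> y\<Up> v1 v0) b\<Up> p\<Up>)"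
      and r="p\<Up>"]) simp_all
qed

lemma apdc_conv:
  assumes K: "\<Gamma> \<turnstile> K \<Ztypecolon> \<U>" and T: "\<Gamma> \<turnstile> T \<Ztypecolon> \<U>" and d: "K # \<Gamma> \<turnstile> d \<Ztypecolon> T\<up>" and z: "\<Gamma> \<turnstile> z \<Ztypecolon> K"
    and z': "\<Gamma> \<turnstile> z' \<Ztypecolon> K" and e: "\<Gamma> \<turnstile> e \<Ztypecolon> Idt K z z'" and x: "jeqs \<Gamma> T (ins 0 0 d z) x" and y: "jeqs \<Gamma> T (ins 0 0 d z') y"
  shows "\<Gamma> \<turnstile> apdc K T d z z' e \<Ztypecolon> Idt T (tr K T\<up> z x z' e) y"
proof (rule Idt_conv)
  note [simp] = tyD[OF K] tyD[OF T] tmD1[OF d] tmD[OF z] tmD[OF z'] tmD[OF e] typing_ctx(2)[OF K]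
  have x': "\<Gamma> \<turnstile> x \<Ztypecolon> T" using x by (simp add: jeqs_def)
  note [simp] = x'
  show "\<Gamma> \<turnstile> apdc K T d z z' e \<Ztypecolon> Idt T (tr K T\<up> z (ins 0 0 d z) z' e) (ins 0 0 d z')" by simp
  show "jeqs \<Gamma> T (ins 0 0 d z') y" by (rule y)
  show "jeqs \<Gamma> T (tr K T\<up> z (ins 0 0 d z) z' e) (tr K T\<up> z x z' e)"
    using jeq_cong[of T \<Gamma> "tr K\<up> T\<Up> z\<up> v0 z'\<up> e\<up>" "T\<up>" "ins 0 0 d z" x] x
    by (simp add: jeqs_def)
qed

text \<open>This is naturality along \<open>e\<close> of the homotopy \<open>\<pi>\<close> from
  \<open>\<phi>\<close> to a constant. The action of \<open>\<phi>\<close> starts at a transport of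
  \<open>x\<close>; composing with the inverse of the action of the function that is constantly
  \<open>x\<close> removes this transport. By induction on \<open>e\<close> both actions become
  reflexivity. The point \<open>x\<close> is kept apart from the instance of \<open>\<phi>\<close>,
  with which it agrees judgementally, to match the types produced by
  \<open>push_rec\<close>.\<close>

lemma glue_square:
  assumes K: "\<Gamma> \<turnstile> K \<Ztypecolon> \<U>" and T: "\<Gamma> \<turnstile> T \<Ztypecolon> \<U>" and \<phi>: "K # \<Gamma> \<turnstile> \<phi> \<Ztypecolon> T\<up>" and b: "\<Gamma> \<turnstile> b \<Ztypecolon> T"
    and \<pi>: "K # \<Gamma> \<turnstile> \<pi> \<Ztypecolon> Idt T\<up> \<phi> b\<up>"
    and z: "\<Gamma> \<turnstile> z \<Ztypecolon> K" and z': "\<Gamma> \<turnstile> z' \<Ztypecolon> K" and e: "\<Gamma> \<turnstile> e \<Ztypecolon> Idt K z z'" and x: "jeqs \<Gamma> T (ins 0 0 \<phi> z) x"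
  shows "peq \<Gamma> (Idt T x b) (trR T x (ins 0 0 \<phi> z') (trL T (ins 0 0 \<phi> z') (tr K T\<up> z x z' e) (apdc K T \<phi> z z' e) x (apdc K T x\<up> z z' e)) b (ins 0 0 \<pi> z'))
     (ins 0 0 \<pi> z)"
proof -
  note [simp] = tyD[OF K] tyD[OF T] tmD1[OF \<phi>] tmD1[OF \<pi>] tmD[OF z] tmD[OF z'] tmD[OF b] tmD[OF e] typing_ctx(2)[OF K]
  have x': "\<Gamma> \<turnstile> x \<Ztypecolon> T" using x by (simp add: jeqs_def)
  note [simp] = tmD[OF x']
  have fz: "\<Gamma> \<turnstile> ins 0 0 \<phi> z \<Ztypecolon> T" by simp
  have pz: "\<Gamma> \<turnstile> ins 0 0 \<pi> z \<Ztypecolon> Idt T x b" by (rule Idt_conv[OF _ x jeqs_refl]) simp_all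
  note [simp] = tmD[OF pz]
  let ?D = "Idt K\<up> z\<up> v0 # K # \<Gamma>"
  have D[simp]: "?D \<turnstile> ctx" by simp
  have xD: "jeqs ?D T\<Up> (ins 0 2 \<phi> z\<Up>) x\<Up>"
    using x lift_jeq[of \<Gamma> "ins 0 0 \<phi> z" x T ?D 2] unfolding jeqs_def by simp
  have a: "?D \<turnstile> apdc K\<Up> T\<Up> (lift 1 2 \<phi>) z\<Up> v1 v0 \<Ztypecolon>
    Idt T\<Up> (tr K\<Up> (lift 0 3 T) z\<Up> x\<Up> v1 v0) \<phi>\<up>"
  proof -
    have "?D \<turnstile> apdc K\<Up> T\<Up> (lift 1 2 \<phi>) z\<Up> v1 v0 \<Ztypecolon>
      Idt T\<Up> (tr K\<Up> T\<Up>\<up> z\<Up> x\<Up> v1 v0) \<phi>\<up>"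
      by (rule apdc_conv) (use xD in \<open>simp_all add: jeqs_refl\<close>)
    then show ?thesis by simp
  qed
  have pz2: "?D \<turnstile> ins 0 2 \<pi> z\<Up> \<Ztypecolon> Idt T\<Up> x\<Up> b\<Up>"
    using lift_ty[OF pz, of ?D 2] by simp
  have j1: "jeqs \<Gamma> T (tr K T\<up> z x z (Refl K z)) x"
    using tr_jeqs[of \<Gamma> K "T\<up>" z x] by simp
  let ?a = "apdc K T \<phi> z z (Refl K z)" and ?c = "apdc K T x\<up> z z (Refl K z)" and ?f = "ins 0 0 \<phi> z"
  have ja: "jeqs \<Gamma> (Idt T x ?f) ?a (Refl T ?f)"
    by (rule jeqs_conv[OF apdc_ty(2)[OF K T \<phi> z] x jeqs_refl]) simp_all
  have jc: "jeqs \<Gamma> (Idt T x x) ?c (Refl T x)"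
    using apdc_ty(2)[OF K T _ z, of "x\<up>"] by simp
  have jr: "jeqs \<Gamma> (Idt T x ?f) (Refl T ?f) (Refl T x)"
    by (rule jeqs_conv[OF jeqs_Refl[OF x] x jeqs_refl]) simp_all
  have aT[simp]: "\<Gamma> \<turnstile> ?a \<Ztypecolon> Idt T x ?f" and cT[simp]: "\<Gamma> \<turnstile> ?c \<Ztypecolon> Idt T x x" and rT[simp]: "\<Gamma> \<turnstile> Refl T x \<Ztypecolon> Idt T x ?f"
    using ja jc jr by (simp_all add: jeqs_def)
  have "peq \<Gamma> (Idt T x ?f) (trL T ?f x ?a x ?c) (trL T ?f x ?a x (Refl T x))"
    by (intro trL_cong peq_jeq[OF jc] peq_refl) simp_all
  also have "peq \<Gamma> (Idt T x ?f) \<dots> ?a" by (intro trL_ty(2)) simp_all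
  also have "peq \<Gamma> (Idt T x ?f) \<dots> (Refl T x)" by (rule peq_jeq[OF jeqs_trans[OF ja jr]])
  finally have "peq \<Gamma> (Idt T x b) (trR T x ?f (trL T ?f x ?a x ?c) b (ins 0 0 \<pi> z)) (trR T x ?f (Refl T x) b (ins 0 0 \<pi> z))"
    by (intro trR_cong peq_refl) simp_all
  \<comment> \<open>The middle point \<open>?f\<close> agrees with \<open>x\<close> judgementally;
    read as \<open>x\<close>, it lets the left unit law apply.\<close>
  also have "trR T x ?f (Refl T x) b (ins 0 0 \<pi> z) = trR T x x (Refl T x) b (ins 0 0 \<pi> z)" by (rule trR_arg)
  also have "peq \<Gamma> (Idt T x b) \<dots> (ins 0 0 \<pi> z)" by (intro trR_Refl_left pz) simp_all
  finally have "peq \<Gamma> (Idt T x b) (trR T x ?f (trL T ?f (tr K T\<up> z x z (Refl K z)) ?a x ?c) b (ins 0 0 \<pi> z)) (ins 0 0 \<pi> z)"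
    by (simp only: trL_arg[of T ?f "tr K T\<up> z x z (Refl K z)" ?a x ?c x])
  then show ?thesis
    by (rule peq_J'[where A=K and a=z and b=z' and p=e and T="Idt T\<Up> x\<Up> b\<Up>"
      and l="trR T\<Up> x\<Up> \<phi>\<up> (trL T\<Up> \<phi>\<up> (tr K\<Up> (lift 0 3 T) z\<Up> x\<Up> v1 v0)
        (apdc K\<Up> T\<Up> (lift 1 2 \<phi>) z\<Up> v1 v0) x\<Up> (apdc K\<Up> T\<Up> (lift 0 3 x) z\<Up> v1 v0))
        b\<Up> (lift 0 1 \<pi>)"
      and r="(ins 0 0 \<pi> z)\<Up>"]) (use a pz2 in simp_all)
qed

text \<open>The cocone formed by \<open>u\<close>, \<open>v\<close> and \<open>k\<close> defines a
  function on the pushout, which locality makes constant with value \<open>b\<close>. The paths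
  \<open>p\<close> and \<open>q\<close> are the homotopy to this constant at the two kinds of
  points, and their compatibility over \<open>C\<close> is its naturality along the glue
  path.\<close>

lemma push_ext:
  assumes C: "\<Gamma> \<turnstile> C \<Ztypecolon> \<U>" and A: "\<Gamma> \<turnstile> A \<Ztypecolon> \<U>" and B: "\<Gamma> \<turnstile> B \<Ztypecolon> \<U>"
    and f: "\<Gamma> \<turnstile> f \<Ztypecolon> Pi C A\<up>" and g: "\<Gamma> \<turnstile> g \<Ztypecolon> Pi C B\<up>" and T: "\<Gamma> \<turnstile> T \<Ztypecolon> \<U>"
    and l: "\<Gamma> \<turnstile> l \<Ztypecolon> is_local (Push C A B f g) T"
    and u: "A # \<Gamma> \<turnstile> u \<Ztypecolon> T\<up>" and v: "B # \<Gamma> \<turnstile> v \<Ztypecolon> T\<up>"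
    and k: "C # \<Gamma> \<turnstile> k \<Ztypecolon> Idt T\<up> (ins 0 1 v (g\<up> $ v0)) (ins 0 1 u (f\<up> $ v0))"
  shows "\<exists>b p q. \<Gamma> \<turnstile> b \<Ztypecolon> T \<and> A # \<Gamma> \<turnstile> p \<Ztypecolon> Idt T\<up> u b\<up> \<and> B # \<Gamma> \<turnstile> q \<Ztypecolon> Idt T\<up> v b\<up> \<and>
    peq (C # \<Gamma>) (Idt T\<up> (ins 0 1 v (g\<up> $ v0)) b\<up>)
      (trR T\<up> (ins 0 1 v (g\<up> $ v0)) (ins 0 1 u (f\<up> $ v0)) k b\<up> (ins 0 1 p (f\<up> $ v0)))
      (ins 0 1 q (g\<up> $ v0))"
proof -
  note [simp] = tyD[OF C] tyD[OF A] tyD[OF B] tyD[OF T] typing_ctx(2)[OF T] funD[OF f Pi_arg_type[OF C A]]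
    funD[OF g Pi_arg_type[OF C B]] tmD1[OF u] tmD1[OF v] k
  let ?K = "Push C A B f g" and ?K1 = "(Push C A B f g)\<up>" and ?T1 = "T\<up>"
  have K: "\<Gamma> \<turnstile> ?K \<Ztypecolon> \<U>" by simp
  let ?l = "PInl C\<up> A\<up> B\<up> f\<up> g\<up>"
  let ?r = "PInr C\<up> A\<up> B\<up> f\<up> g\<up>"
  let ?fc = "f\<up> $ v0" and ?gc = "g\<up> $ v0"
  let ?z = "?l ?fc" and ?z' = "?r ?gc"
  let ?G = "Glue C\<up> A\<up> B\<up> f\<up> g\<up> v0"
  let ?x = "ins 0 1 u ?fc" and ?y = "ins 0 1 v ?gc"
  let ?t = "tr ?K1 T\<Up> ?z ?x ?z' ?G" and ?c = "apdc ?K1 ?T1 ?x\<up> ?z ?z' ?G"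
  \<comment> \<open>The glue datum must run from a transport of \<open>?x\<close> to
    \<open>?y\<close>. The path \<open>?c\<close> leads from the transport back to
    \<open>?x\<close>; as \<open>k\<close> is directed from \<open>?y\<close> to \<open>?x\<close>,
    its inverse follows.\<close>
  let ?w = "trR ?T1 ?t ?x ?c ?y (pinv ?T1 ?y ?x k)"
  have w: "C # \<Gamma> \<turnstile> ?w \<Ztypecolon> Idt ?T1 ?t ?y" by simp
  obtain \<phi> where \<phi>: "?K # \<Gamma> \<turnstile> \<phi> \<Ztypecolon> T\<up>"
    and L: "\<And>\<Delta> k a. \<Delta> \<turnstile> ctx \<Longrightarrow> k \<le> length \<Delta> \<Longrightarrow> drop k \<Delta> = \<Gamma> \<Longrightarrow> \<Delta> \<turnstile> a \<Ztypecolon> lift 0 k A \<Longrightarrow>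
       jeqs \<Delta> (lift 0 k T) (ins 0 k \<phi> (PInl (lift 0 k C) (lift 0 k A) (lift 0 k B) (lift 0 k f) (lift 0 k g) a)) (ins 0 k u a)"
    and R: "\<And>\<Delta> k b. \<Delta> \<turnstile> ctx \<Longrightarrow> k \<le> length \<Delta> \<Longrightarrow> drop k \<Delta> = \<Gamma> \<Longrightarrow> \<Delta> \<turnstile> b \<Ztypecolon> lift 0 k B \<Longrightarrow>
       jeqs \<Delta> (lift 0 k T) (ins 0 k \<phi> (PInr (lift 0 k C) (lift 0 k A) (lift 0 k B) (lift 0 k f) (lift 0 k g) b)) (ins 0 k v b)"
    and r: "\<exists>r. C # \<Gamma> \<turnstile> r \<Ztypecolon> Idt (Idt ?T1 ?t ?y) (apdc ?K1 ?T1 (lift 1 1 \<phi>) ?z ?z' ?G) ?w"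
    using push_rec[OF C A B f g T u v w] by blast
  obtain b where b: "\<Gamma> \<turnstile> b \<Ztypecolon> T" and "peq (?K # \<Gamma>) T\<up> \<phi> b\<up>"
    using local_ext[OF K T l \<phi>] by blast
  then obtain \<pi> where \<pi>: "?K # \<Gamma> \<turnstile> \<pi> \<Ztypecolon> Idt T\<up> \<phi> b\<up>" using peqD(4) by blast
  note [simp] = tmD[OF b] tmD1[OF \<phi>, simplified] tmD1[OF \<pi>, simplified]
  let ?p = "ins 0 1 \<pi> (?l v0)" and ?q = "ins 0 1 \<pi> (?r v0)"
  have p: "A # \<Gamma> \<turnstile> ?p \<Ztypecolon> Idt ?T1 u b\<up>"
    by (rule Idt_conv[OF _ _ jeqs_refl, of _ _ _ "ins 0 1 \<phi> (?l v0)"]) (use L[of "A # \<Gamma>" 1 "v0"] in simp_all)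
  have q: "B # \<Gamma> \<turnstile> ?q \<Ztypecolon> Idt ?T1 v b\<up>"
    by (rule Idt_conv[OF _ _ jeqs_refl, of _ _ _ "ins 0 1 \<phi> (?r v0)"]) (use R[of "B # \<Gamma>" 1 "v0"] in simp_all)
  have jx: "jeqs (C # \<Gamma>) ?T1 (ins 0 1 \<phi> ?z) ?x" using L[of "C # \<Gamma>" 1 ?fc] by simp
  have jy: "jeqs (C # \<Gamma>) ?T1 (ins 0 1 \<phi> ?z') ?y" using R[of "C # \<Gamma>" 1 ?gc] by simp
  let ?a = "apdc ?K1 ?T1 (lift 1 1 \<phi>) ?z ?z' ?G"
  have e2: "T\<Up> = ?T1\<up>" by simp
  have aT: "C # \<Gamma> \<turnstile> ?a \<Ztypecolon> Idt ?T1 ?t ?y"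
    unfolding e2 by (rule apdc_conv) (use jx jy in simp_all)
  have aT': "C # \<Gamma> \<turnstile> ?a \<Ztypecolon> Idt ?T1 ?t (ins 0 1 \<phi> ?z')"
    unfolding e2 by (rule apdc_conv) (use jx in \<open>simp_all add: jeqs_refl\<close>)
  have aw: "peq (C # \<Gamma>) (Idt ?T1 ?t ?y) ?a ?w" using r aT by (auto intro: peqI)
  have gs: "peq (C # \<Gamma>) (Idt ?T1 ?x b\<up>) (trR ?T1 ?x (ins 0 1 \<phi> ?z') (trL ?T1 (ins 0 1 \<phi> ?z') ?t ?a ?x ?c) b\<up> (ins 0 1 \<pi> ?z')) (ins 0 1 \<pi> ?z)"
    using glue_square[of "C # \<Gamma>" ?K1 ?T1 "lift 1 1 \<phi>" "b\<up>" "lift 1 1 \<pi>" ?z ?z' ?G ?x] jx by simp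
  have piz: "C # \<Gamma> \<turnstile> ins 0 1 \<pi> ?z \<Ztypecolon> Idt ?T1 ?x b\<up>"
    by (rule Idt_conv[OF _ jx jeqs_refl]) simp_all
  have piz': "C # \<Gamma> \<turnstile> ins 0 1 \<pi> ?z' \<Ztypecolon> Idt ?T1 ?y b\<up>"
    by (rule Idt_conv[OF _ jy jeqs_refl]) simp_all
  have [simp]: "C # \<Gamma> \<turnstile> ?x \<Ztypecolon> ?T1" "C # \<Gamma> \<turnstile> ?y \<Ztypecolon> ?T1" "C # \<Gamma> \<turnstile> ?t \<Ztypecolon> ?T1" "C # \<Gamma> \<turnstile> ?c \<Ztypecolon> Idt ?T1 ?t ?x"
    "C # \<Gamma> \<turnstile> pinv ?T1 ?y ?x k \<Ztypecolon> Idt ?T1 ?x ?y" by simp_all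
  have T1: "C # \<Gamma> \<turnstile> ?T1 \<Ztypecolon> \<U>" by simp
  \<comment> \<open>Replacing the action on the glue path by the datum \<open>?w\<close> cancels
    \<open>?c\<close>, and the inverse of \<open>k\<close> remains.\<close>
  have "peq (C # \<Gamma>) (Idt ?T1 ?x ?y) (trL ?T1 ?y ?t ?a ?x ?c) (trL ?T1 ?y ?t ?w ?x ?c)"
    by (rule trL_cong[OF T1 _ _ _ aw peq_refl]) simp_all
  also have "peq (C # \<Gamma>) (Idt ?T1 ?x ?y) \<dots> (pinv ?T1 ?y ?x k)"
    by (rule trL_trR[OF T1]) simp_all
  finally have 1: "peq (C # \<Gamma>) (Idt ?T1 ?x ?y) (trL ?T1 ?y ?t ?a ?x ?c) (pinv ?T1 ?y ?x k)" .
  have "jeqs (C # \<Gamma>) (Idt ?T1 ?x (ins 0 1 \<phi> ?z')) (trL ?T1 (ins 0 1 \<phi> ?z') ?t ?a ?x ?c) (trL ?T1 ?y ?t ?a ?x ?c)"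
    by (rule trL_jeqs[OF T1 jy _ _ aT']) simp_all
  then have "jeqs (C # \<Gamma>) (Idt ?T1 ?x ?y) (trL ?T1 (ins 0 1 \<phi> ?z') ?t ?a ?x ?c) (trL ?T1 ?y ?t ?a ?x ?c)"
    by (rule jeqs_conv[OF _ jeqs_refl jy]) simp_all
  note 2 = peq_trans[OF peq_jeq[OF this] 1]
  have "peq (C # \<Gamma>) (Idt ?T1 ?x b\<up>) (trR ?T1 ?x ?y (trL ?T1 (ins 0 1 \<phi> ?z') ?t ?a ?x ?c) b\<up> (ins 0 1 \<pi> ?z'))
    (trR ?T1 ?x ?y (pinv ?T1 ?y ?x k) b\<up> (ins 0 1 \<pi> ?z'))"
    by (rule trR_cong[OF T1 _ _ _ 2 peq_refl[OF _ piz']]) simp_all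
  note 3 = peq_trans[OF peq_sym[OF this] gs[unfolded trR_arg[of ?T1 ?x "ins 0 1 \<phi> ?z'" _ _ _ ?y]]]
  \<comment> \<open>Composing with \<open>k\<close> on the left clears its inverse and turns the
    naturality square into the asserted compatibility.\<close>
  have "peq (C # \<Gamma>) (Idt ?T1 ?y b\<up>) (trR ?T1 ?y ?x k b\<up> (trR ?T1 ?x ?y (pinv ?T1 ?y ?x k) b\<up> (ins 0 1 \<pi> ?z')))
     (trR ?T1 ?y ?x k b\<up> (ins 0 1 \<pi> ?z))"
    by (rule trR_cong[OF T1 _ _ _ peq_refl 3]) simp_all
  from peq_trans[OF peq_sym[OF this] trR_inv_cancel[OF T1 _ _ _ _ piz']]
  have "peq (C # \<Gamma>) (Idt ?T1 ?y b\<up>) (trR ?T1 ?y ?x k b\<up> (ins 0 1 \<pi> ?z)) (ins 0 1 \<pi> ?z')" by simp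
  then show ?thesis using b p q by (intro exI[of _ b] exI[of _ ?p] exI[of _ ?q]) simp
qed

section \<open>Joins\<close>

lemma join_lift: "join M N = Push (Sig M N\<up>) M N
    (Lam (Sig M N\<up>) (dfst M\<up> v0)) (Lam (Sig M N\<up>) (dsnd M\<up> N\<Up> v0))"
  by (simp only: join_def times_def proj1_def proj2_def dfst_def dsnd_def shift_lift) simp

text \<open>Of the projections of the span only their values on pairs are kept, for all extensions
  of the context. The projections themselves then stay opaque under rewriting.\<close>

lemma proj_data:
  assumes M: "\<Gamma> \<turnstile> M \<Ztypecolon> \<U>" and N: "\<Gamma> \<turnstile> N \<Ztypecolon> \<U>"
  shows "\<exists>p1 p2. join M N = Push (Sig M N\<up>) M N p1 p2 \<and>
    \<Gamma> \<turnstile> p1 \<Ztypecolon> Pi (Sig M N\<up>) M\<up> \<and> \<Gamma> \<turnstile> p2 \<Ztypecolon> Pi (Sig M N\<up>) N\<up> \<and>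
    (\<forall>\<Delta> k m n. \<Delta> \<turnstile> ctx \<longrightarrow> k \<le> length \<Delta> \<longrightarrow> drop k \<Delta> = \<Gamma> \<longrightarrow> \<Delta> \<turnstile> m \<Ztypecolon> lift 0 k M \<longrightarrow> \<Delta> \<turnstile> n \<Ztypecolon> lift 0 k N \<longrightarrow>
      jeqs \<Delta> (lift 0 k M) ((lift 0 k p1) $ (Dpair (lift 0 k M) (lift 0 (k + 1) N) m n)) m \<and>
      jeqs \<Delta> (lift 0 k N) ((lift 0 k p2) $ (Dpair (lift 0 k M) (lift 0 (k + 1) N) m n)) n)"
proof -
  note [simp] = tyD[OF M] tyD[OF N] typing_ctx(2)[OF M]
  let ?C = "Sig M N\<up>"
  have C: "\<Gamma> \<turnstile> ?C \<Ztypecolon> \<U>" by simp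
  have 1: "?C # \<Gamma> \<turnstile> M\<up> \<Ztypecolon> \<U>" "?C # \<Gamma> \<turnstile> N\<up> \<Ztypecolon> \<U>" by simp_all
  have p1: "?C # \<Gamma> \<turnstile> dfst M\<up> v0 \<Ztypecolon> M\<up>"
    by (rule fst_ty(1)[where B="N\<Up>"]) simp_all
  have p2: "?C # \<Gamma> \<turnstile> dsnd M\<up> N\<Up> v0 \<Ztypecolon> N\<up>"
    using snd_ty(1)[of "?C # \<Gamma>" "M\<up>" "N\<Up>" "v0"] by simp
  show ?thesis
  proof (intro exI conjI allI impI)
    show "join M N = Push ?C M N (Lam ?C (dfst M\<up> v0)) (Lam ?C (dsnd M\<up> N\<Up> v0))"
      by (rule join_lift)
    show "\<Gamma> \<turnstile> Lam ?C (dfst M\<up> v0) \<Ztypecolon> Pi ?C M\<up>"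
      "\<Gamma> \<turnstile> Lam ?C (dsnd M\<up> N\<Up> v0) \<Ztypecolon> Pi ?C N\<up>"
      by (rule lam_beta(1)[OF C 1(1) p1] lam_beta(1)[OF C 1(2) p2])+
    fix \<Delta> k m n
    assume *: "\<Delta> \<turnstile> ctx" "k \<le> length \<Delta>" "drop k \<Delta> = \<Gamma>" and m: "\<Delta> \<turnstile> m \<Ztypecolon> lift 0 k M" and n: "\<Delta> \<turnstile> n \<Ztypecolon> lift 0 k N"
    let ?M = "lift 0 k M" and ?N = "lift 0 (k + 1) N"
    let ?c = "Dpair ?M ?N m n"
    have e: "lift 0 k ?C = Sig ?M ?N" by (cases "k = 0") (simp_all add: add.commute)
    have M': "\<Delta> \<turnstile> ?M \<Ztypecolon> \<U>" using * by simp
    have N': "?M # \<Delta> \<turnstile> ?N \<Ztypecolon> \<U>" using * M' by (intro tyD(2)[OF N]) (simp_all add: ty_Univ flip: Suc_eq_plus1)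
    have n': "\<Delta> \<turnstile> n \<Ztypecolon> ins 0 0 ?N m" using n by simp
    have c: "\<Delta> \<turnstile> ?c \<Ztypecolon> lift 0 k ?C" unfolding e using t_Dpair[OF ty_Univ[OF M'] ty_Univ[OF N'] m n'[folded inst_ins]] .
    have "jeqs \<Delta> ?M ((lift 0 k (Lam ?C (dfst M\<up> v0))) $ ?c) (dfst ?M ?c)"
      using lam_beta(2)[OF C 1(1) p1 * c] by simp
    moreover have "jeqs \<Delta> ?M (dfst ?M ?c) m"
      unfolding jeqs_def using fst_ty(2)[OF M' N' m n'] fst_ty(1)[OF M' N' c[unfolded e]] M' m by simp
    ultimately show "jeqs \<Delta> ?M ((lift 0 k (Lam ?C (dfst M\<up> v0))) $ ?c) m" by (rule jeqs_trans)
    have "jeqs \<Delta> (lift 0 k N) ((lift 0 k (Lam ?C (dsnd M\<up> N\<Up> v0))) $ ?c) (dsnd ?M ?N ?c)"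
      using lam_beta(2)[OF C 1(2) p2 * c] by (simp add: add.commute)
    moreover have "jeqs \<Delta> (lift 0 k N) (dsnd ?M ?N ?c) n"
      unfolding jeqs_def using snd_ty(2)[OF M' N' m n'] snd_ty(1)[OF M' N' c[unfolded e]] * n by simp
    ultimately show "jeqs \<Delta> (lift 0 k N) ((lift 0 k (Lam ?C (dsnd M\<up> N\<Up> v0))) $ ?c) n" by (rule jeqs_trans)
  qed
qed

lemma join_ty [simp]:
  assumes M: "\<Gamma> \<turnstile> M \<Ztypecolon> \<U>" and N: "\<Gamma> \<turnstile> N \<Ztypecolon> \<U>"
  shows "\<Gamma> \<turnstile> join M N \<Ztypecolon> Univ l"
proof -
  note [simp] = tyD[OF M] tyD[OF N] typing_ctx(2)[OF M]
  obtain p1 p2 where "join M N = Push (Sig M N\<up>) M N p1 p2" "\<Gamma> \<turnstile> p1 \<Ztypecolon> Pi (Sig M N\<up>) M\<up>"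
    "\<Gamma> \<turnstile> p2 \<Ztypecolon> Pi (Sig M N\<up>) N\<up>"
    using proj_data[OF M N] by blast
  then show ?thesis by simp
qed

lemma join_simps [simp]:
  "lift j k (join M N) = join (lift j k M) (lift j k N)"
  "ins j k (join M N) x = join (ins j k M x) (ins j k N x)"
  by (simp_all add: join_lift)

text \<open>The span of the join has a type of pairs as vertex, so \<open>push_ext\<close> gives a
  compatibility over a generic pair. Instantiating it at the pair of two variables, where the
  projections compute, yields the curried form over \<open>N\<close> and \<open>M\<close>.\<close>

lemma join_ext:
  assumes M: "\<Gamma> \<turnstile> M \<Ztypecolon> \<U>" and N: "\<Gamma> \<turnstile> N \<Ztypecolon> \<U>" and T: "\<Gamma> \<turnstile> T \<Ztypecolon> \<U>"
    and l: "\<Gamma> \<turnstile> l \<Ztypecolon> is_local (join M N) T"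
    and g: "M # \<Gamma> \<turnstile> g \<Ztypecolon> T\<up>" and h: "N # \<Gamma> \<turnstile> h \<Ztypecolon> T\<up>"
    and k: "M # \<Gamma> \<turnstile> k \<Ztypecolon> Pi N\<up> (Idt T\<Up> (ins 0 2 h v0) g\<up>)"
  shows "\<exists>b p q. \<Gamma> \<turnstile> b \<Ztypecolon> T \<and> M # \<Gamma> \<turnstile> p \<Ztypecolon> Idt T\<up> g b\<up> \<and> N # \<Gamma> \<turnstile> q \<Ztypecolon> Idt T\<up> h b\<up> \<and>
    peq (N\<up> # M # \<Gamma>) (Idt T\<Up> (ins 0 2 h v0) b\<Up>)
      (trR T\<Up> (ins 0 2 h v0) g\<up> (k\<up> $ v0) b\<Up> p\<up>) (ins 0 2 q v0)"
proof -
  note [simp] = tyD[OF M] tyD[OF N] tyD[OF T] typing_ctx(2)[OF T] tmD1[OF g] tmD1[OF h]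
  let ?C = "Sig M N\<up>"
  have C: "\<Gamma> \<turnstile> ?C \<Ztypecolon> \<U>" by simp
  obtain p1 p2 where J: "join M N = Push ?C M N p1 p2" and p1: "\<Gamma> \<turnstile> p1 \<Ztypecolon> Pi ?C M\<up>" and p2: "\<Gamma> \<turnstile> p2 \<Ztypecolon> Pi ?C N\<up>"
    and j: "\<And>\<Delta> k m n. \<Delta> \<turnstile> ctx \<Longrightarrow> k \<le> length \<Delta> \<Longrightarrow> drop k \<Delta> = \<Gamma> \<Longrightarrow> \<Delta> \<turnstile> m \<Ztypecolon> lift 0 k M \<Longrightarrow> \<Delta> \<turnstile> n \<Ztypecolon> lift 0 k N \<Longrightarrow>
      jeqs \<Delta> (lift 0 k M) ((lift 0 k p1) $ (Dpair (lift 0 k M) (lift 0 (k + 1) N) m n)) m"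
      "\<And>\<Delta> k m n. \<Delta> \<turnstile> ctx \<Longrightarrow> k \<le> length \<Delta> \<Longrightarrow> drop k \<Delta> = \<Gamma> \<Longrightarrow> \<Delta> \<turnstile> m \<Ztypecolon> lift 0 k M \<Longrightarrow> \<Delta> \<turnstile> n \<Ztypecolon> lift 0 k N \<Longrightarrow>
      jeqs \<Delta> (lift 0 k N) ((lift 0 k p2) $ (Dpair (lift 0 k M) (lift 0 (k + 1) N) m n)) n"
    using proj_data[OF M N] by blast
  note [simp] = funD[OF p1 Pi_arg_type[OF C M]] funD[OF p2 Pi_arg_type[OF C N]]
  have kP: "M # \<Gamma> \<turnstile> Pi N\<up> (Idt T\<Up> (ins 0 2 h v0) g\<up>) \<Ztypecolon> \<T>" by simp
  note [simp] = funD[OF k kP] funD1[OF k kP]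
  let ?m = "p1\<up> $ v0" and ?n = "p2\<up> $ v0"
  let ?k = "(ins 0 1 k ?m) $ ?n"
  have k': "?C # \<Gamma> \<turnstile> ?k \<Ztypecolon> Idt T\<up> (ins 0 1 h ?n) (ins 0 1 g ?m)" by simp
  obtain b p q where b: "\<Gamma> \<turnstile> b \<Ztypecolon> T" and p: "M # \<Gamma> \<turnstile> p \<Ztypecolon> Idt T\<up> g b\<up>"
    and q: "N # \<Gamma> \<turnstile> q \<Ztypecolon> Idt T\<up> h b\<up>"
    and e: "peq (?C # \<Gamma>) (Idt T\<up> (ins 0 1 h ?n) b\<up>)
      (trR T\<up> (ins 0 1 h ?n) (ins 0 1 g ?m) ?k b\<up> (ins 0 1 p ?m)) (ins 0 1 q ?n)"
    using push_ext[OF C M N p1 p2 T l[unfolded J] g h k'] by blast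
  note [simp] = tmD[OF b] tmD1[OF p] tmD1[OF q]
  let ?D = "N\<up> # M # \<Gamma>"
  let ?c = "Dpair M\<Up> (lift 0 3 N) v1 v0"
  let ?pm = "p1\<Up> $ ?c" and ?pn = "p2\<Up> $ ?c"
  let ?F = "\<lambda>j m n. Idt (Idt (lift 0 j T) (ins 0 j h n) (lift 0 j b))
     (trR (lift 0 j T) (ins 0 j h n) (ins 0 j g m) ((ins 0 j k m) $ n) (lift 0 j b) (ins 0 j p m)) (ins 0 j q n)"
  obtain r where "?D \<turnstile> r \<Ztypecolon> ?F 2 ?pm ?pn"
    using peqD(4)[OF peq_ins[OF e, of ?D 2 ?c]] by auto
  moreover have jm: "jeqs ?D M\<Up> ?pm v1" and jn: "jeqs ?D N\<Up> ?pn v0"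
    using j[of ?D 2 "v1" "v0"] by simp_all
  have pm[simp]: "?D \<turnstile> ?pm \<Ztypecolon> M\<Up>" and pn: "?D \<turnstile> ?pn \<Ztypecolon> N\<Up>" by simp_all
  obtain n' where n': "?pn = n'" by blast
  note [simp] = tmD[OF pn[unfolded n']]
  \<comment> \<open>The projections are replaced by the variables one at a time, since congruence of
    judgemental equality handles a single instantiated variable. Meanwhile \<open>n'\<close> hides
    the other projection from rewriting.\<close>
  have "?D \<turnstile> ?F 2 ?pm ?pn \<doteq> ?F 2 v1 ?pn \<Ztypecolon> \<U>" unfolding n'
    using jeq_cong_type[of "M\<Up>" ?D "?F 3 v0 n'\<up>" ?pm "v1"] jm
    by (simp add: jeqs_def)
  moreover have "?D \<turnstile> ?F 2 v1 ?pn \<doteq> ?F 2 v1 v0 \<Ztypecolon> \<U>" unfolding n'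
    using jeq_cong_type[of "N\<Up>" ?D "?F 3 v2 v0" n' "v0"] jn
    by (simp add: jeqs_def n')
  ultimately have "?D \<turnstile> r \<Ztypecolon> ?F 2 v1 v0"
    using t_conv[OF t_conv] e_El by blast
  then have "peq ?D (Idt T\<Up> (ins 0 2 h v0) b\<Up>)
      (trR T\<Up> (ins 0 2 h v0) g\<up> (k\<up> $ v0) b\<Up> p\<up>) (ins 0 2 q v0)"
    by (intro peqI[where p=r]) simp_all
  then show ?thesis using b p q by blast
qed

section \<open>Spaces of extensions\<close>

text \<open>\<open>Sig B (ext_fam B N h)\<close> is the fibre over \<open>h\<close> of the map \<open>B \<rightarrow> (N \<rightarrow> B)\<close>, with the function space path made pointwise.\<close>

definition ext_fam :: "tm \<Rightarrow> tm \<Rightarrow> tm \<Rightarrow> tm" where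
  "ext_fam B N h = Pi N\<up> (Idt B\<Up> (ins 0 2 h v0) v1)"

lemma App_tr_ty [simp]:
  assumes "\<Gamma> \<turnstile> tr A C a c b p \<Ztypecolon> ins 0 0 C b" "\<Gamma> \<turnstile> ins 0 0 C b \<Ztypecolon> \<T>"
    "ins 0 0 C b = Pi (pi_dom (ins 0 0 C b)) (pi_cod (ins 0 0 C b))"
    "\<Gamma> \<turnstile> n \<Ztypecolon> pi_dom (ins 0 0 C b)" "T = ins 0 0 (pi_cod (ins 0 0 C b)) n"
  shows "\<Gamma> \<turnstile> (tr A C a c b p) $ n \<Ztypecolon> T"
  using App_ty[of \<Gamma> "tr A C a c b p" _ _ n] assms by metis

text \<open>Transport in a family of paths with moving end point is composition. The family here
  consists of functions into such paths, hence the evaluation at \<open>n\<close>.\<close>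

lemma tr_ext_fam:
  assumes N: "\<Gamma> \<turnstile> N \<Ztypecolon> \<U>" and B: "\<Gamma> \<turnstile> B \<Ztypecolon> \<U>" and h: "N # \<Gamma> \<turnstile> h \<Ztypecolon> B\<up>"
    and b: "\<Gamma> \<turnstile> b \<Ztypecolon> B" and b': "\<Gamma> \<turnstile> b' \<Ztypecolon> B" and q: "\<Gamma> \<turnstile> q \<Ztypecolon> Pi N (Idt B\<up> h b\<up>)"
    and p: "\<Gamma> \<turnstile> p \<Ztypecolon> Idt B b b'" and n: "\<Gamma> \<turnstile> n \<Ztypecolon> N"
  shows "peq \<Gamma> (Idt B (ins 0 0 h n) b') ((tr B (ext_fam B N h) b q b' p) $ n) (trR B (ins 0 0 h n) b (q $ n) b' p)"
proof -
  note [simp] = tyD[OF N] tyD[OF B] tmD1[OF h] tmD[OF b] tmD[OF b'] tmD[OF n] p typing_ctx(2)[OF N]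
  have P: "\<Gamma> \<turnstile> Pi N (Idt B\<up> h b\<up>) \<Ztypecolon> \<U>" by simp
  note [simp] = funD[OF q ty_Univ[OF P]]
  have F: "B # \<Gamma> \<turnstile> ext_fam B N h \<Ztypecolon> \<U>" by (simp add: ext_fam_def)
  have q': "\<Gamma> \<turnstile> q \<Ztypecolon> ins 0 0 (ext_fam B N h) b" by (simp add: ext_fam_def)
  have "peq \<Gamma> (Pi N (Idt B\<up> h b\<up>)) (tr B (ext_fam B N h) b q b (Refl B b)) q"
    using tr_ty(2)[OF B F b q'] by (simp add: ext_fam_def)
  then have "peq \<Gamma> (Idt B (ins 0 0 h n) b) ((tr B (ext_fam B N h) b q b (Refl B b)) $ n) (q $ n)"
    using peq_cong[of "Pi N (Idt B\<up> h b\<up>)" \<Gamma> "v0 $ n\<up>" "Idt B (ins 0 0 h n) b"] by simp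
  also have "peq \<Gamma> (Idt B (ins 0 0 h n) b) \<dots> (trR B (ins 0 0 h n) b (q $ n) b (Refl B b))"
    by (rule peq_sym[OF trR_ty(2)]) simp_all
  finally show ?thesis
    by (rule peq_J'[where A=B and a=b and b=b' and p=p and T="Idt B\<Up> (ins 0 2 h n\<Up>) v1"
      and l="(tr B\<Up> (lift 1 2 (ext_fam B N h)) b\<Up> q\<Up> v1 v0) $ n\<Up>"
      and r="trR B\<Up> (ins 0 2 h n\<Up>) b\<Up> (q\<Up> $ n\<Up>) v1 v0"])
      (simp_all add: ext_fam_def)
qed

text \<open>A path of pairs is a path \<open>p\<close> of first components over which the second
  components correspond. By \<open>tr_ext_fam\<close> and function extensionality the latter amounts
  to \<open>q n \<cdot> p = q' n\<close> for a generic \<open>n\<close>.\<close>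

lemma ext_path_intro:
  assumes N: "\<Gamma> \<turnstile> N \<Ztypecolon> \<U>" and B: "\<Gamma> \<turnstile> B \<Ztypecolon> \<U>" and h: "N # \<Gamma> \<turnstile> h \<Ztypecolon> B\<up>"
    and b: "\<Gamma> \<turnstile> b \<Ztypecolon> B" and b': "\<Gamma> \<turnstile> b' \<Ztypecolon> B" and q: "\<Gamma> \<turnstile> q \<Ztypecolon> Pi N (Idt B\<up> h b\<up>)"
    and q': "\<Gamma> \<turnstile> q' \<Ztypecolon> Pi N (Idt B\<up> h b'\<up>)" and p: "\<Gamma> \<turnstile> p \<Ztypecolon> Idt B b b'"
    and e: "peq (N # \<Gamma>) (Idt B\<up> h b'\<up>) (trR B\<up> h b\<up> (q\<up> $ v0) b'\<up> p\<up>) (q'\<up> $ v0)"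
  shows "peq \<Gamma> (Sig B (ext_fam B N h)) (Dpair B (ext_fam B N h) b q) (Dpair B (ext_fam B N h) b' q')"
proof -
  note [simp] = tyD[OF N] tyD[OF B] tmD1[OF h] tmD[OF b] tmD[OF b'] tmD[OF p] typing_ctx(2)[OF N]
  have P: "\<Gamma> \<turnstile> Pi N (Idt B\<up> h b\<up>) \<Ztypecolon> \<U>" "\<Gamma> \<turnstile> Pi N (Idt B\<up> h b'\<up>) \<Ztypecolon> \<U>" by simp_all
  note [simp] = funD[OF q ty_Univ[OF P(1)]] funD[OF q' ty_Univ[OF P(2)]]
  have F: "B # \<Gamma> \<turnstile> ext_fam B N h \<Ztypecolon> \<U>" by (simp add: ext_fam_def)
  have qF: "\<Gamma> \<turnstile> q \<Ztypecolon> ins 0 0 (ext_fam B N h) b" by (simp add: ext_fam_def)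
  have t: "\<Gamma> \<turnstile> tr B (ext_fam B N h) b q b' p \<Ztypecolon> Pi N (Idt B\<up> h b'\<up>)"
    using tr_ty(1)[OF B F b qF b' p refl] by (simp add: ext_fam_def)
  have "peq (N # \<Gamma>) (Idt B\<up> h b'\<up>) ((tr B (ext_fam B N h) b q b' p)\<up> $ v0)
      (trR B\<up> h b\<up> (q\<up> $ v0) b'\<up> p\<up>)"
    using tr_ext_fam[of "N # \<Gamma>" "N\<up>" "B\<up>" "lift 1 1 h" "b\<up>" "b'\<up>" "q\<up>" "p\<up>" "v0"]
    by (simp add: ext_fam_def)
  from peq_trans[OF this e] have "peq \<Gamma> (Pi N (Idt B\<up> h b'\<up>)) (tr B (ext_fam B N h) b q b' p) q'"
    by (intro funext) (simp_all add: t)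
  then show ?thesis
    by (intro Sig_path_intro[OF B F b qF b' p]) (simp add: ext_fam_def)
qed

lemma ext_path_elim:
  assumes N: "\<Gamma> \<turnstile> N \<Ztypecolon> \<U>" and B: "\<Gamma> \<turnstile> B \<Ztypecolon> \<U>" and h: "N # \<Gamma> \<turnstile> h \<Ztypecolon> B\<up>"
    and b: "\<Gamma> \<turnstile> b \<Ztypecolon> B" and b': "\<Gamma> \<turnstile> b' \<Ztypecolon> B" and q: "\<Gamma> \<turnstile> q \<Ztypecolon> Pi N (Idt B\<up> h b\<up>)"
    and q': "\<Gamma> \<turnstile> q' \<Ztypecolon> Pi N (Idt B\<up> h b'\<up>)"
    and e: "peq \<Gamma> (Sig B (ext_fam B N h)) (Dpair B (ext_fam B N h) b q) (Dpair B (ext_fam B N h) b' q')"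
  shows "\<exists>p. \<Gamma> \<turnstile> p \<Ztypecolon> Idt B b b' \<and>
    peq (N # \<Gamma>) (Idt B\<up> h b'\<up>) (trR B\<up> h b\<up> (q\<up> $ v0) b'\<up> p\<up>) (q'\<up> $ v0)"
proof -
  note [simp] = tyD[OF N] tyD[OF B] tmD1[OF h] tmD[OF b] tmD[OF b'] typing_ctx(2)[OF N]
  have P: "\<Gamma> \<turnstile> Pi N (Idt B\<up> h b\<up>) \<Ztypecolon> \<U>" "\<Gamma> \<turnstile> Pi N (Idt B\<up> h b'\<up>) \<Ztypecolon> \<U>" by simp_all
  note [simp] = funD[OF q ty_Univ[OF P(1)]] funD[OF q' ty_Univ[OF P(2)]]
  have F: "B # \<Gamma> \<turnstile> ext_fam B N h \<Ztypecolon> \<U>" by (simp add: ext_fam_def)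
  have qF: "\<Gamma> \<turnstile> q \<Ztypecolon> ins 0 0 (ext_fam B N h) b" "\<Gamma> \<turnstile> q' \<Ztypecolon> ins 0 0 (ext_fam B N h) b'" by (simp_all add: ext_fam_def)
  obtain p where p: "\<Gamma> \<turnstile> p \<Ztypecolon> Idt B b b'" and pq: "peq \<Gamma> (ins 0 0 (ext_fam B N h) b') (tr B (ext_fam B N h) b q b' p) q'"
    using Sig_path_elim[OF B F b qF(1) b' qF(2) e] by blast
  note [simp] = tmD[OF p]
  let ?t = "tr B (ext_fam B N h) b q b' p" and ?P = "Pi N\<up> (Idt B\<Up> (ins 0 2 h v0) b'\<Up>)"
  have "peq (N # \<Gamma>) ?P ?t\<up> q'\<up>"
    using peq_lift[OF pq, of "N # \<Gamma>" 1] by (simp add: ext_fam_def)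
  then have 1: "peq (N # \<Gamma>) (Idt B\<up> h b'\<up>) (?t\<up> $ v0) (q'\<up> $ v0)"
    using peq_cong[of ?P "N # \<Gamma>" "v0 $ v1" "Idt B\<up> h b'\<up>"] by simp
  have "peq (N # \<Gamma>) (Idt B\<up> h b'\<up>) (?t\<up> $ v0)
      (trR B\<up> h b\<up> (q\<up> $ v0) b'\<up> p\<up>)"
    using tr_ext_fam[of "N # \<Gamma>" "N\<up>" "B\<up>" "lift 1 1 h" "b\<up>" "b'\<up>" "q\<up>" "p\<up>" "v0"]
    by (simp add: ext_fam_def)
  from peq_trans[OF peq_sym[OF this] 1] p show ?thesis by blast
qed

text \<open>A family over \<open>M\<close> of extensions of \<open>h\<close> consists of a map
  \<open>g\<close> on \<open>M\<close> and paths \<open>h n = g m\<close>, that is, of a cocone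
  under the span of the join. \<open>join_ext\<close> makes this cocone constant, and its
  compatibility clause is exactly what \<open>ext_path_intro\<close> requires of the path to the
  constant pair.\<close>

lemma ext_local_ext:
  assumes M: "\<Gamma> \<turnstile> M \<Ztypecolon> \<U>" and N: "\<Gamma> \<turnstile> N \<Ztypecolon> \<U>" and B: "\<Gamma> \<turnstile> B \<Ztypecolon> \<U>" and l: "\<Gamma> \<turnstile> l \<Ztypecolon> is_local (join M N) B"
    and h: "N # \<Gamma> \<turnstile> h \<Ztypecolon> B\<up>" and u: "M # \<Gamma> \<turnstile> u \<Ztypecolon> (Sig B (ext_fam B N h))\<up>"
  shows "\<exists>t. \<Gamma> \<turnstile> t \<Ztypecolon> Sig B (ext_fam B N h) \<and> peq (M # \<Gamma>) (Sig B (ext_fam B N h))\<up> u t\<up>"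
proof -
  note [simp] = tyD[OF M] tyD[OF N] tyD[OF B] tmD1[OF h] typing_ctx(2)[OF N]
  let ?B1 = "B\<up>" and ?N1 = "N\<up>" and ?F = "Sig B (ext_fam B N h)"
  let ?E1 = "ext_fam ?B1 ?N1 (lift 1 1 h)"
  have E: "lift 1 1 (ext_fam B N h) = ?E1" by (simp add: ext_fam_def)
  have F1: "?F\<up> = Sig ?B1 ?E1" using E by simp
  have E1: "?B1 # M # \<Gamma> \<turnstile> ?E1 \<Ztypecolon> \<U>" by (simp add: ext_fam_def)
  obtain g k where g: "M # \<Gamma> \<turnstile> g \<Ztypecolon> ?B1" and k0: "M # \<Gamma> \<turnstile> k \<Ztypecolon> ins 0 0 ?E1 g" and gk: "peq (M # \<Gamma>) (Sig ?B1 ?E1) (Dpair ?B1 ?E1 g k) u"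
    using Sig_ex[OF _ E1 u[unfolded F1]] by auto
  note [simp] = tmD1[OF g]
  have k: "M # \<Gamma> \<turnstile> k \<Ztypecolon> Pi ?N1 (Idt B\<Up> (ins 0 2 h v0) g\<up>)"
    using k0 by (simp add: ext_fam_def)
  obtain b p q where b: "\<Gamma> \<turnstile> b \<Ztypecolon> B" and p: "M # \<Gamma> \<turnstile> p \<Ztypecolon> Idt ?B1 g b\<up>" and q: "N # \<Gamma> \<turnstile> q \<Ztypecolon> Idt ?B1 h b\<up>"
    and e: "peq (N\<up> # M # \<Gamma>) (Idt B\<Up> (ins 0 2 h v0) b\<Up>)
      (trR B\<Up> (ins 0 2 h v0) g\<up> (k\<up> $ v0) b\<Up> p\<up>) (ins 0 2 q v0)"
    using join_ext[OF M N B l g h k] by blast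
  note [simp] = tmD[OF b] tmD1[OF p] tmD1[OF q]
  have I: "N # \<Gamma> \<turnstile> Idt ?B1 h b\<up> \<Ztypecolon> \<U>" by simp
  obtain Q where Q: "\<Gamma> \<turnstile> Q \<Ztypecolon> Pi N (Idt ?B1 h b\<up>)" and Qb: "\<And>\<Delta> k a. \<Delta> \<turnstile> ctx \<Longrightarrow> k \<le> length \<Delta> \<Longrightarrow> drop k \<Delta> = \<Gamma> \<Longrightarrow>
    \<Delta> \<turnstile> a \<Ztypecolon> lift 0 k N \<Longrightarrow> jeqs \<Delta> (ins 0 k (Idt ?B1 h b\<up>) a) ((lift 0 k Q) $ a) (ins 0 k q a)"
    using lam_ex[OF N I q] by blast
  have P: "\<Gamma> \<turnstile> Pi N (Idt ?B1 h b\<up>) \<Ztypecolon> \<U>" by simp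
  note [simp] = funD[OF Q ty_Univ[OF P]]
  have t: "\<Gamma> \<turnstile> Dpair B (ext_fam B N h) b Q \<Ztypecolon> ?F" by (simp add: ext_fam_def)
  have "jeqs (?N1 # M # \<Gamma>) (Idt B\<Up> (ins 0 2 h v0) b\<Up>) (Q\<Up> $ v0) (ins 0 2 q v0)"
    using Qb[of "?N1 # M # \<Gamma>" 2 "v0"] by simp
  from peq_trans[OF e peq_sym[OF peq_jeq[OF this]]]
  have "peq (M # \<Gamma>) (Sig ?B1 ?E1) (Dpair ?B1 ?E1 g k) (Dpair ?B1 ?E1 b\<up> Q\<up>)"
    using k by (intro ext_path_intro[where p=p]) simp_all
  from peq_trans[OF peq_sym[OF gk] this] show ?thesis
    using t by (intro exI[of _ "Dpair B (ext_fam B N h) b Q"]) (simp add: ext_fam_def)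
qed

text \<open>An equality between the pairs \<open>(b, q)\<close> and \<open>(b', q')\<close> is a
  path \<open>\<beta> : b = b'\<close> that equals \<open>(q n)\<inverse> \<cdot> q' n\<close> for
  all \<open>n\<close>. So it is an extension problem for the type \<open>b = b'\<close>, which is
  local for the join by \<open>local_Id\<close>. The equality assumed over \<open>M\<close> supplies
  the part of the cocone on \<open>M\<close>.\<close>

lemma ext_local_inj:
  assumes M: "\<Gamma> \<turnstile> M \<Ztypecolon> \<U>" and N: "\<Gamma> \<turnstile> N \<Ztypecolon> \<U>" and B: "\<Gamma> \<turnstile> B \<Ztypecolon> \<U>" and l: "\<Gamma> \<turnstile> l \<Ztypecolon> is_local (join M N) B"
    and h: "N # \<Gamma> \<turnstile> h \<Ztypecolon> B\<up>" and x: "\<Gamma> \<turnstile> x \<Ztypecolon> Sig B (ext_fam B N h)" and y: "\<Gamma> \<turnstile> y \<Ztypecolon> Sig B (ext_fam B N h)"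
    and e: "peq (M # \<Gamma>) (Sig B (ext_fam B N h))\<up> x\<up> y\<up>"
  shows "peq \<Gamma> (Sig B (ext_fam B N h)) x y"
proof -
  note [simp] = tyD[OF M] tyD[OF N] tyD[OF B] tmD1[OF h] typing_ctx(2)[OF N]
  let ?B1 = "B\<up>" and ?N1 = "N\<up>" and ?F = "Sig B (ext_fam B N h)"
  let ?E1 = "ext_fam ?B1 ?N1 (lift 1 1 h)"
  have E: "lift 1 1 (ext_fam B N h) = ?E1" by (simp add: ext_fam_def)
  have F1: "?F\<up> = Sig ?B1 ?E1" using E by simp
  have F: "B # \<Gamma> \<turnstile> ext_fam B N h \<Ztypecolon> \<U>" by (simp add: ext_fam_def)
  obtain b q where b: "\<Gamma> \<turnstile> b \<Ztypecolon> B" and q0: "\<Gamma> \<turnstile> q \<Ztypecolon> ins 0 0 (ext_fam B N h) b" and bq: "peq \<Gamma> ?F (Dpair B (ext_fam B N h) b q) x"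
    using Sig_ex[OF B F x] by blast
  obtain b' q' where b': "\<Gamma> \<turnstile> b' \<Ztypecolon> B" and q'0: "\<Gamma> \<turnstile> q' \<Ztypecolon> ins 0 0 (ext_fam B N h) b'" and bq': "peq \<Gamma> ?F (Dpair B (ext_fam B N h) b' q') y"
    using Sig_ex[OF B F y] by blast
  note [simp] = tmD[OF b] tmD[OF b']
  have q: "\<Gamma> \<turnstile> q \<Ztypecolon> Pi N (Idt ?B1 h b\<up>)" and q': "\<Gamma> \<turnstile> q' \<Ztypecolon> Pi N (Idt ?B1 h b'\<up>)"
    using q0 q'0 by (simp_all add: ext_fam_def)
  have P: "\<Gamma> \<turnstile> Pi N (Idt ?B1 h b\<up>) \<Ztypecolon> \<U>" "\<Gamma> \<turnstile> Pi N (Idt ?B1 h b'\<up>) \<Ztypecolon> \<U>" by simp_all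
  note [simp] = funD[OF q ty_Univ[OF P(1)]] funD[OF q' ty_Univ[OF P(2)]]
  have c: "M # \<Gamma> \<turnstile> ctx" by simp
  have "peq (M # \<Gamma>) ?F\<up> (Dpair B (ext_fam B N h) b q)\<up> (Dpair B (ext_fam B N h) b' q')\<up>"
    by (rule peq_trans[OF peq_trans[OF peq_lift[OF bq c] e] peq_sym[OF peq_lift[OF bq' c]]]) simp_all
  then have "peq (M # \<Gamma>) (Sig ?B1 ?E1) (Dpair ?B1 ?E1 b\<up> q\<up>) (Dpair ?B1 ?E1 b'\<up> q'\<up>)"
    by (simp add: ext_fam_def)
  then obtain a where a: "M # \<Gamma> \<turnstile> a \<Ztypecolon> Idt ?B1 b\<up> b'\<up>" and
    aq: "peq (?N1 # M # \<Gamma>) (Idt B\<Up> (ins 0 2 h v0) b'\<Up>) (trR B\<Up> (ins 0 2 h v0) b\<Up> (q\<Up> $ v0) b'\<Up> a\<up>) (q'\<Up> $ v0)"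
    using ext_path_elim[of "M # \<Gamma>" ?N1 ?B1 "lift 1 1 h" "b\<up>" "b'\<up>" "q\<up>" "q'\<up>"] by auto
  note [simp] = tmD1[OF a]
  let ?T = "Idt B b b'"
  obtain l' where l': "\<Gamma> \<turnstile> l' \<Ztypecolon> is_local (join M N) ?T"
    using local_Id[OF join_ty[OF M N] B l b b'] by blast
  \<comment> \<open>The only possible value of \<open>\<beta>\<close> under the hypothesis
    \<open>n : N\<close>, obtained by solving \<open>q n \<cdot> \<beta> = q' n\<close>. The path
    \<open>a\<close>, given over \<open>M\<close>, solves the same equation, whence the cocone on
    the join.\<close>
  let ?H = "trL ?B1 b'\<up> h (q'\<up> $ v0) b\<up> (q\<up> $ v0)"
  let ?H2 = "trL B\<Up> b'\<Up> (ins 0 2 h v0) (q'\<Up> $ v0) b\<Up> (q\<Up> $ v0)"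
  have "peq (?N1 # M # \<Gamma>) ?T\<Up> ?H2 (trL B\<Up> b'\<Up> (ins 0 2 h v0)
     (trR B\<Up> (ins 0 2 h v0) b\<Up> (q\<Up> $ v0) b'\<Up> a\<up>) b\<Up> (q\<Up> $ v0))"
    using trL_cong[OF _ _ _ _ peq_sym[OF aq] peq_refl, of "b\<Up>" "q\<Up> $ v0"] by simp
  also have "peq (?N1 # M # \<Gamma>) ?T\<Up> \<dots> a\<up>"
    using trL_trR[of "?N1 # M # \<Gamma>" "B\<Up>" "ins 0 2 h v0" "b\<Up>" "b'\<Up>" "q\<Up> $ v0" "a\<up>"] by simp
  finally obtain r where "?N1 # M # \<Gamma> \<turnstile> r \<Ztypecolon> Idt ?T\<Up> ?H2 a\<up>" using peqD(4) by blast
  then have k: "M # \<Gamma> \<turnstile> Lam ?N1 r \<Ztypecolon> Pi ?N1 (Idt ?T\<Up> (ins 0 2 ?H v0) a\<up>)"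
    by (intro t_Lam) simp_all
  have T: "\<Gamma> \<turnstile> ?T \<Ztypecolon> \<U>" and H: "N # \<Gamma> \<turnstile> ?H \<Ztypecolon> ?T\<up>" and a': "M # \<Gamma> \<turnstile> a \<Ztypecolon> ?T\<up>" using a by simp_all
  obtain \<beta> s where \<beta>: "\<Gamma> \<turnstile> \<beta> \<Ztypecolon> ?T" and s: "N # \<Gamma> \<turnstile> s \<Ztypecolon> Idt ?T\<up> ?H \<beta>\<up>"
    using join_ext[OF M N T l' a' H k] by blast
  note [simp] = tmD[OF \<beta>]
  have "peq (N # \<Gamma>) ?T\<up> \<beta>\<up> ?H" using H s by (intro peq_sym[OF peqI]) simp_all
  then have "peq (N # \<Gamma>) (Idt ?B1 h b'\<up>) (trR ?B1 h b\<up> (q\<up> $ v0) b'\<up> \<beta>\<up>)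
    (trR ?B1 h b\<up> (q\<up> $ v0) b'\<up> ?H)"
    by (intro trR_cong peq_refl) simp_all
  also have "peq (N # \<Gamma>) (Idt ?B1 h b'\<up>) \<dots> (q'\<up> $ v0)"
    by (rule trR_trL) simp_all
  finally have "peq \<Gamma> ?F (Dpair B (ext_fam B N h) b q) (Dpair B (ext_fam B N h) b' q')"
    by (intro ext_path_intro[OF N B h b b' q q' \<beta>])
  from peq_trans[OF peq_trans[OF peq_sym[OF bq] this] bq'] show ?thesis .
qed

lemma ext_local:
  assumes M: "\<Gamma> \<turnstile> M \<Ztypecolon> \<U>" and N: "\<Gamma> \<turnstile> N \<Ztypecolon> \<U>" and B: "\<Gamma> \<turnstile> B \<Ztypecolon> \<U>" and l: "\<Gamma> \<turnstile> l \<Ztypecolon> is_local (join M N) B"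
    and h: "N # \<Gamma> \<turnstile> h \<Ztypecolon> B\<up>"
  shows "\<exists>e. \<Gamma> \<turnstile> e \<Ztypecolon> is_local M (Sig B (ext_fam B N h))"
proof (rule local_intro)
  note [simp] = tyD[OF M] tyD[OF N] tyD[OF B] tmD1[OF h] tmD[OF l] typing_ctx(2)[OF N]
  let ?F = "Sig B (ext_fam B N h)"
  show "\<Gamma> \<turnstile> M \<Ztypecolon> \<U>" by simp
  show F: "\<Gamma> \<turnstile> ?F \<Ztypecolon> \<U>" by (simp add: ext_fam_def)
  let ?D = "Pi M ?F\<up> # \<Gamma>"
  let ?F1 = "Sig B\<up> (ext_fam B\<up> N\<up> (lift 1 1 h))"
  have F1: "?F\<up> = ?F1" by (simp add: ext_fam_def)
  have "M\<up> # ?D \<turnstile> v1 $ v0 \<Ztypecolon> ?F1\<up>" by (simp add: ext_fam_def)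
  then show "\<exists>t. ?D \<turnstile> t \<Ztypecolon> ?F\<up> \<and> peq (M\<up> # ?D) ?F\<Up> (v1 $ v0) t\<up>"
    using ext_local_ext[of ?D "M\<up>" "N\<up>" "B\<up>" "l\<up>" "lift 1 1 h" "v1 $ v0"]
    by (simp add: ext_fam_def)
  fix x y assume *: "?F # \<Gamma> \<turnstile> x \<Ztypecolon> ?F\<up>" "?F # \<Gamma> \<turnstile> y \<Ztypecolon> ?F\<up>"
    "peq (M\<up> # ?F # \<Gamma>) ?F\<Up> x\<up> y\<up>"
  then show "peq (?F # \<Gamma>) ?F\<up> x y"
    using ext_local_inj[of "?F # \<Gamma>" "M\<up>" "N\<up>" "B\<up>" "l\<up>" "lift 1 1 h" x y] F
    by (simp add: ext_fam_def)
qed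

section \<open>Sections along a connected map\<close>

lemma is_equiv_ty:
  assumes A: "\<Gamma> \<turnstile> A \<Ztypecolon> \<U>" and B: "\<Gamma> \<turnstile> B \<Ztypecolon> \<U>" and f: "\<Gamma> \<turnstile> f \<Ztypecolon> Pi A B\<up>"
  shows "\<Gamma> \<turnstile> is_equiv A B f \<Ztypecolon> Univ l"
proof -
  note [simp] = tyD[OF A] tyD[OF B] typing_ctx(2)[OF A] funD[OF f Pi_arg_type[OF A B]]
  let ?HS = "Sig (Pi B A\<up>) (Pi B\<up> (Idt B\<Up> (f\<Up> $ (v1 $ v0)) v0))"
  let ?HR = "Sig (Pi B A\<up>) (Pi A\<up> (Idt A\<Up> (v1 $ (f\<Up> $ v0)) v0))"
  have HS: "\<Gamma> \<turnstile> ?HS \<Ztypecolon> \<U>" and HR: "\<Gamma> \<turnstile> ?HR \<Ztypecolon> \<U>" by simp_all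
  have HR1: "?HS # \<Gamma> \<turnstile> ?HR\<up> \<Ztypecolon> \<U>" by (rule tyD(2)[OF HR]) (use HS in simp_all)
  show ?thesis unfolding is_equiv_lift by (rule ty_Univ[OF t_Sig[OF HS HR1]])
qed

lemma is_local_ty [simp]:
  assumes K: "\<Gamma> \<turnstile> K \<Ztypecolon> \<U>" and T: "\<Gamma> \<turnstile> T \<Ztypecolon> \<U>"
  shows "\<Gamma> \<turnstile> is_local K T \<Ztypecolon> Univ l"
  unfolding is_local_lift by (rule is_equiv_ty[OF T funD_cst(2,1)[OF cst_Lam[OF K T]]])

lemma fib_lift: "fib A B f b = Sig A (Idt B\<up> (f\<up> $ v0) b\<up>)"
  by (simp only: fib_def shift_lift)

lemma is_connected_lift: "is_connected M A = Pi \<U> (Pi (is_local M\<up> v0) (is_local A\<Up> v1))"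
  by (simp only: is_connected_def arr_lift shift_lift) simp

lemma is_connected_map_lift: "is_connected_map M A B f =
   Pi B (is_connected M\<up> (Sig A\<up> (Idt B\<Up> (f\<Up> $ v0) v1)))"
  by (simp only: is_connected_map_def fib_lift shift_lift) simp

lemma connected_local:
  assumes M: "\<Gamma> \<turnstile> M \<Ztypecolon> \<U>" and A: "\<Gamma> \<turnstile> A \<Ztypecolon> \<U>" and T: "\<Gamma> \<turnstile> T \<Ztypecolon> \<U>"
    and c: "\<Gamma> \<turnstile> c \<Ztypecolon> is_connected M A" and l: "\<Gamma> \<turnstile> l \<Ztypecolon> is_local M T"
  shows "\<Gamma> \<turnstile> c $ T $ l \<Ztypecolon> is_local A T"
proof -
  note [simp] = tyD[OF M] tyD[OF A] tyD[OF T] typing_ctx(2)[OF M]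
  have 1: "\<Gamma> \<turnstile> Pi \<U> (Pi (is_local M\<up> v0) (is_local A\<Up> v1)) \<Ztypecolon> \<T>" by simp
  have 2: "\<Gamma> \<turnstile> c $ T \<Ztypecolon> Pi (is_local M T) (is_local A\<up> T\<up>)"
    using App_ty[OF c[unfolded is_connected_lift] 1 T] by simp
  show ?thesis using App_ty[OF 2 _ l] by simp
qed

lemma connected_map_fib:
  assumes M: "\<Gamma> \<turnstile> M \<Ztypecolon> \<U>" and X: "\<Gamma> \<turnstile> X \<Ztypecolon> \<U>" and Y: "\<Gamma> \<turnstile> Y \<Ztypecolon> \<U>" and f: "\<Gamma> \<turnstile> f \<Ztypecolon> Pi X Y\<up>"
    and c: "\<Gamma> \<turnstile> c \<Ztypecolon> is_connected_map M X Y f"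
  shows "Y # \<Gamma> \<turnstile> c\<up> $ v0 \<Ztypecolon> is_connected M\<up> (Sig X\<up> (Idt Y\<Up> (f\<Up> $ v0) v1))"
proof -
  note [simp] = tyD[OF M] tyD[OF X] tyD[OF Y] funD[OF f Pi_arg_type[OF X Y]] typing_ctx(2)[OF M]
  let ?C = "is_connected M\<up> (Sig X\<up> (Idt Y\<Up> (f\<Up> $ v0) v1))"
  have P: "\<Gamma> \<turnstile> Pi Y ?C \<Ztypecolon> \<T>" by (simp add: is_connected_lift)
  show ?thesis using funD(4)[OF c[unfolded is_connected_map_lift] P, of "Y # \<Gamma>" 1 "v0"] by (simp add: is_connected_lift)
qed

text \<open>Over \<open>y\<close> the fibre of \<open>f\<close> maps to \<open>C\<close> by sending
  \<open>(x, p)\<close> to the transport of \<open>d x\<close> along \<open>p : f x = y\<close>.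
  Connectedness makes the \<open>M\<close>-local type \<open>C\<close> local for this fibre, so the
  map is constant, and \<open>e\<close> is its value. At \<open>y = f x\<close> and the point
  \<open>(x, refl)\<close> of the fibre this gives \<open>d x = e (f x)\<close>.\<close>

lemma section_ext:
  assumes M: "\<Gamma> \<turnstile> M \<Ztypecolon> \<U>" and X: "\<Gamma> \<turnstile> X \<Ztypecolon> \<U>" and Y: "\<Gamma> \<turnstile> Y \<Ztypecolon> \<U>" and f: "\<Gamma> \<turnstile> f \<Ztypecolon> Pi X Y\<up>"
    and c: "\<Gamma> \<turnstile> c \<Ztypecolon> is_connected_map M X Y f"
    and C: "Y # \<Gamma> \<turnstile> C \<Ztypecolon> \<U>" and l: "Y # \<Gamma> \<turnstile> l \<Ztypecolon> is_local M\<up> C"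
    and d: "X # \<Gamma> \<turnstile> d \<Ztypecolon> ins 0 1 C (f\<up> $ v0)"
  shows "\<exists>e. Y # \<Gamma> \<turnstile> e \<Ztypecolon> C \<and> peq (X # \<Gamma>) (ins 0 1 C (f\<up> $ v0)) d (ins 0 1 e (f\<up> $ v0))"
proof -
  note [simp] = tyD[OF M] tyD[OF X] tyD[OF Y] funD[OF f Pi_arg_type[OF X Y]] tyD1[OF C] tmD1[OF d] typing_ctx(2)[OF M]
  let ?I = "Idt Y\<Up> (f\<Up> $ v0) v1"
  let ?A = "Sig X\<up> ?I"
  have A: "Y # \<Gamma> \<turnstile> ?A \<Ztypecolon> \<U>" by simp
  have M1: "Y # \<Gamma> \<turnstile> M\<up> \<Ztypecolon> \<U>" by simp
  note l' = connected_local[OF M1 A C connected_map_fib[OF M X Y f c] l]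
  \<comment> \<open>Here \<open>v1\<close> and \<open>v0\<close> are the point of \<open>X\<close>
    and the path of the fibre, and \<open>v3\<close> is the base point \<open>y\<close>; the branch
    is the transport of \<open>d\<close> along this path.\<close>
  let ?b = "tr (lift 0 4 Y) (lift 1 4 C) ((lift 0 4 f) $ v1) (ins 0 4 d v1) v3 v0"
  let ?u = "SigInd C\<Up> ?b v0"
  have u: "?A # Y # \<Gamma> \<turnstile> ?u \<Ztypecolon> C\<up>"
    using t_SigInd[of "?A # Y # \<Gamma>" "X\<Up>" "lift 1 1 ?I" "C\<Up>" ?b "v0"] by (simp add: inst_ins)
  obtain e where e: "Y # \<Gamma> \<turnstile> e \<Ztypecolon> C" and ue: "peq (?A # Y # \<Gamma>) C\<up> ?u e\<up>"
    using local_ext[OF A C l' u] by blast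
  note [simp] = tmD1[OF e]
  let ?D = "?I # X\<up> # Y # \<Gamma>"
  let ?z = "Dpair (lift 0 3 X) (lift 1 2 ?I) v1 v0"
  let ?t = "tr (lift 0 3 Y) (lift 1 3 C) ((lift 0 3 f) $ v1) (ins 0 3 d v1) v2 v0"
  have uT: "?D \<turnstile> ins 0 2 ?u ?z \<Ztypecolon> C\<Up>" using ins_ty[OF u, of ?D 2 ?z] by simp
  have "?D \<turnstile> ins 0 2 ?u ?z \<doteq> ?t \<Ztypecolon> C\<Up>"
    using e_SigInd_Dpair[of ?D "lift 0 3 X" "lift 1 2 ?I" "lift 0 3 C" "ins 2 2 ?b ?z" "v1" "v0"] by (simp add: inst_ins inst2_ins)
  then have j: "jeqs ?D C\<Up> (ins 0 2 ?u ?z) ?t" using uT unfolding jeqs_def by simp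
  have e2: "peq ?D C\<Up> (ins 0 2 ?u ?z) e\<Up>" using peq_ins[OF ue, of ?D 2 ?z] by simp
  have "peq ?D C\<Up> ?t e\<Up>" by (rule peq_trans[OF peq_sym[OF peq_jeq[OF j]] e2])
  then obtain r where r: "?D \<turnstile> r \<Ztypecolon> Idt C\<Up> ?t e\<Up>" using peqD(4) by blast
  \<comment> \<open>The homotopy is known over a generic \<open>y\<close> that stands behind
    \<open>x\<close> and the path in the context. Abstracting all three turns it into a closed
    function over \<open>\<Gamma>\<close>, which can be weakened and applied to \<open>f x\<close>,
    \<open>x\<close> and reflexivity in turn.\<close>
  let ?R = "Lam Y (Lam X\<up> (Lam ?I r))" and ?T = "Pi Y (Pi X\<up> (Pi ?I (Idt C\<Up> ?t e\<Up>)))"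
  have R: "\<Gamma> \<turnstile> ?R \<Ztypecolon> ?T" using r by simp
  have R1: "X # \<Gamma> \<turnstile> ?R\<up> \<Ztypecolon> ?T\<up>" by (rule lift_ty[OF R]) simp_all
  obtain R' where R': "?R\<up> = R'" by blast
  let ?y = "f\<up> $ v0"
  let ?d = "tr Y\<up> (lift 1 1 C) ?y d ?y (Refl Y\<up> ?y)"
  let ?I1 = "Idt (lift 0 3 Y) ((lift 0 3 f) $ v0) v1"
  let ?K1 = "Idt (ins 0 4 C v2) (tr (lift 0 4 Y) (lift 1 4 C) ((lift 0 4 f) $ v1) (ins 0 4 d v1) v2 v0) (ins 0 4 e v2)"
  have T1: "X # \<Gamma> \<turnstile> Pi Y\<up> (Pi X\<Up> (Pi ?I1 ?K1)) \<Ztypecolon> \<T>" by simp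
  have R2: "X # \<Gamma> \<turnstile> R' \<Ztypecolon> Pi Y\<up> (Pi X\<Up> (Pi ?I1 ?K1))"
    using R1 unfolding R' by simp
  let ?I2 = "Idt Y\<Up> (f\<Up> $ v0) (f\<Up> $ v1)"
  let ?f2 = "(lift 0 3 f) $ v2"
  let ?K2 = "Idt (ins 0 3 C ?f2) (tr (lift 0 3 Y) (lift 1 3 C) ((lift 0 3 f) $ v1) (ins 0 3 d v1) ?f2 v0) (ins 0 3 e ?f2)"
  have T2: "X # \<Gamma> \<turnstile> Pi X\<up> (Pi ?I2 ?K2) \<Ztypecolon> \<T>" by simp
  have R3: "X # \<Gamma> \<turnstile> R' $ ?y \<Ztypecolon> Pi X\<up> (Pi ?I2 ?K2)"
    using App_ty[OF R2 T1, of ?y] by simp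
  let ?I3 = "Idt Y\<up> ?y ?y"
  let ?f3 = "f\<Up> $ v1"
  let ?K3 = "Idt (ins 0 2 C ?f3) (tr Y\<Up> (lift 1 2 C) ?f3 (ins 0 2 d v1) ?f3 v0) (ins 0 2 e ?f3)"
  have T3: "X # \<Gamma> \<turnstile> Pi ?I3 ?K3 \<Ztypecolon> \<T>" by simp
  have R4: "X # \<Gamma> \<turnstile> R' $ ?y $ v0 \<Ztypecolon> Pi ?I3 ?K3"
    using App_ty[OF R3 T2, of "v0"] by simp
  have R5: "X # \<Gamma> \<turnstile> R' $ ?y $ v0 $ (Refl Y\<up> ?y) \<Ztypecolon> Idt (ins 0 1 C ?y) ?d (ins 0 1 e ?y)"
    using App_ty[OF R4 T3, of "Refl Y\<up> ?y"] by simp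
  have "peq (X # \<Gamma>) (ins 0 1 C ?y) ?d (ins 0 1 e ?y)" by (rule peqI[OF _ _ _ R5]) simp_all
  moreover have "peq (X # \<Gamma>) (ins 0 1 C ?y) ?d d"
    using tr_ty(2)[of "X # \<Gamma>" "Y\<up>" "lift 1 1 C" ?y d] by simp
  ultimately have "peq (X # \<Gamma>) (ins 0 1 C ?y) d (ins 0 1 e ?y)" using peq_trans[OF peq_sym] by blast
  with e show ?thesis by blast
qed

section \<open>Extension of sections over a join\<close>

text \<open>Paths in extension types produce their homotopies over \<open>N\<close> inside the
  context of a point of \<open>X\<close>, whereas equality in the fibres of precomposition is
  studied over \<open>N\<close> first. The nested \<open>ins\<close> and \<open>lift\<close> in the
  conclusion just exchange the variables \<open>0\<close> and \<open>1\<close>.\<close>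

lemma peq_swap:
  assumes X: "\<Gamma> \<turnstile> X \<Ztypecolon> \<U>" and N: "\<Gamma> \<turnstile> N \<Ztypecolon> \<U>" and e: "peq (N\<up> # X # \<Gamma>) A a b"
  shows "peq (X\<up> # N # \<Gamma>) (ins 0 0 (ins 1 0 (lift 2 2 A) v0) v1)
    (ins 0 0 (ins 1 0 (lift 2 2 a) v0) v1) (ins 0 0 (ins 1 0 (lift 2 2 b) v0) v1)"
proof -
  note [simp] = tyD[OF X] tyD[OF N] typing_ctx(2)[OF X]
  let ?r = "\<lambda>n::nat. if n = 0 then 1::nat else if n = 1 then 0 else n" and ?\<Delta> = "X\<up> # N # \<Gamma>"
  have eq: "ins 0 0 (ins 1 0 (lift 2 2 t) v0) v1 = subst (Var \<circ> ?r) t" for t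
    by (auto simp: lift_def ins_def subst_algebra intro!: subst_cong)
  have c: "?\<Delta> \<turnstile> ctx" by simp
  have "rsub ?\<Delta> (Var \<circ> ?r) (N\<up> # X # \<Gamma>)" unfolding rsub_def
  proof (intro conjI exI allI impI c refl)
    fix n assume n: "n < length (N\<up> # X # \<Gamma>)"
    then show "?r n < length ?\<Delta>" by auto
    consider "n = 0" | "n = 1" | m where "n = m + 1 + 1" by (metis add.commute add_2_eq_Suc' nat.exhaust One_nat_def Suc_eq_plus1)
    then show "subst (Var \<circ> ?r) (shift (Suc n) ((N\<up> # X # \<Gamma>) ! n)) = shift (Suc (?r n)) (?\<Delta> ! ?r n)"
      by cases (auto simp: lift_def subst_algebra intro!: subst_cong)
  qed (rule refl)
  note s = rsub_has_type[OF _ this]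
  obtain p where p: "N\<up> # X # \<Gamma> \<turnstile> p \<Ztypecolon> Idt A a b" using peqD(4)[OF e] ..
  show ?thesis unfolding eq
    by (rule peqI[where p="subst (Var \<circ> ?r) p"]) (use s[OF p] s[OF peqD(1)[OF e]] s[OF peqD(2)[OF e]] s[OF peqD(3)[OF e]] in simp_all)
qed

text \<open>The last conjunct is the point. Along \<open>f\<close> the path \<open>q\<close> from
  the section \<open>t\<close> to \<open>b\<close> is the composite of \<open>w\<close> and
  \<open>a\<close>; this is what makes \<open>b\<close> equal to the given extensions as elements of
  the fibre, homotopies included. It is read off from the equality in the type of extensions that
  \<open>section_ext\<close> provides at \<open>f x\<close>.\<close>

lemma join_section_ext:
  assumes M: "\<Gamma> \<turnstile> M \<Ztypecolon> \<U>" and N: "\<Gamma> \<turnstile> N \<Ztypecolon> \<U>" and X: "\<Gamma> \<turnstile> X \<Ztypecolon> \<U>" and Y: "\<Gamma> \<turnstile> Y \<Ztypecolon> \<U>" and f: "\<Gamma> \<turnstile> f \<Ztypecolon> Pi X Y\<up>"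
    and c: "\<Gamma> \<turnstile> c \<Ztypecolon> is_connected_map M X Y f"
    and P: "Y # \<Gamma> \<turnstile> P \<Ztypecolon> \<U>" and l: "Y # \<Gamma> \<turnstile> l \<Ztypecolon> is_local (join M\<up> N\<up>) P"
    and t: "N # \<Gamma> \<turnstile> t \<Ztypecolon> Pi Y\<up> (ins 0 2 P v0)"
    and s: "\<Gamma> \<turnstile> s \<Ztypecolon> Pi X (ins 0 1 P (f\<up> $ v0))"
    and w: "N # \<Gamma> \<turnstile> w \<Ztypecolon> Pi X\<up> (Idt (ins 0 2 P (f\<Up> $ v0)) (t\<up> $ (f\<Up> $ v0)) (s\<Up> $ v0))"
  shows "\<exists>b a q. Y # \<Gamma> \<turnstile> b \<Ztypecolon> P \<and> X # \<Gamma> \<turnstile> a \<Ztypecolon> Idt (ins 0 1 P (f\<up> $ v0)) (s\<up> $ v0) (ins 0 1 b (f\<up> $ v0)) \<and>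
    Y\<up> # N # \<Gamma> \<turnstile> q \<Ztypecolon> Idt (ins 0 2 P v0) (t\<up> $ v0) (ins 0 2 b v0) \<and>
    peq (X\<up> # N # \<Gamma>) (Idt (ins 0 2 P (f\<Up> $ v0)) (t\<up> $ (f\<Up> $ v0)) (ins 0 2 b (f\<Up> $ v0)))
      (trR (ins 0 2 P (f\<Up> $ v0)) (t\<up> $ (f\<Up> $ v0)) (s\<Up> $ v0) (w\<up> $ v0) (ins 0 2 b (f\<Up> $ v0)) (ins 0 2 a v0))
      (ins 0 1 q (f\<Up> $ v0))"
proof -
  note [simp] = tyD[OF M] tyD[OF N] tyD[OF X] tyD[OF Y] funD[OF f Pi_arg_type[OF X Y]] tyD1[OF P] typing_ctx(2)[OF M]
  have PT: "N # \<Gamma> \<turnstile> Pi Y\<up> (ins 0 2 P v0) \<Ztypecolon> \<T>" by simp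
  note [simp] = funD[OF t PT] funD1[OF t PT]
  have PS: "\<Gamma> \<turnstile> Pi X (ins 0 1 P (f\<up> $ v0)) \<Ztypecolon> \<T>" by simp
  note [simp] = funD[OF s PS]
  have PW: "N # \<Gamma> \<turnstile> Pi X\<up> (Idt (ins 0 2 P (f\<Up> $ v0)) (t\<up> $ (f\<Up> $ v0)) (s\<Up> $ v0)) \<Ztypecolon> \<T>"
    by simp
  note [simp] = funD[OF w PW] funD1[OF w PW]
  let ?h = "(ins 0 2 t v0) $ v1" and ?N = "N\<up>" and ?fx = "f\<up> $ v0"
  let ?E = "ext_fam P ?N ?h"
  have h: "?N # Y # \<Gamma> \<turnstile> ?h \<Ztypecolon> P\<up>" by simp
  have N1: "Y # \<Gamma> \<turnstile> ?N \<Ztypecolon> \<U>" and M1: "Y # \<Gamma> \<turnstile> M\<up> \<Ztypecolon> \<U>" by simp_all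
  obtain l' where l': "Y # \<Gamma> \<turnstile> l' \<Ztypecolon> is_local M\<up> (Sig P ?E)"
    using ext_local[OF M1 N1 P l h] by blast
  have E: "P # Y # \<Gamma> \<turnstile> ?E \<Ztypecolon> \<U>" by (simp add: ext_fam_def)
  have C: "Y # \<Gamma> \<turnstile> Sig P ?E \<Ztypecolon> \<U>" using E by simp
  let ?Px = "ins 0 1 P ?fx" and ?fx2 = "f\<Up> $ v1" and ?sx = "s\<up> $ v0"
  let ?hx = "(ins 0 2 t v0) $ ?fx2" and ?s2 = "s\<Up> $ v1"
  have hx: "?N # X # \<Gamma> \<turnstile> ?hx \<Ztypecolon> ?Px\<up>" by simp
  have Px: "X # \<Gamma> \<turnstile> ?Px \<Ztypecolon> \<U>" and Nx: "X # \<Gamma> \<turnstile> ?N \<Ztypecolon> \<U>" by simp_all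
  let ?I = "Idt (ins 0 2 P ?fx2) ?hx ?s2"
  have I: "?N # X # \<Gamma> \<turnstile> ?I \<Ztypecolon> \<U>" by simp
  have wI: "?N # X # \<Gamma> \<turnstile> (ins 0 2 w v0) $ v1 \<Ztypecolon> ?I" by simp
  \<comment> \<open>The homotopy \<open>w\<close> takes \<open>n\<close> before \<open>x\<close>,
    but an element of the extension type at a fixed \<open>x\<close> needs a function of
    \<open>n\<close>. So the two variables are exchanged before abstracting.\<close>
  obtain Q where Q: "X # \<Gamma> \<turnstile> Q \<Ztypecolon> Pi ?N ?I" and Qw: "jeqs (?N # X # \<Gamma>) ?I (Q\<up> $ v0) ((ins 0 2 w v0) $ v1)"
    using lam_ex0[OF Nx I wI] by blast
  let ?Ex = "ext_fam ?Px ?N ?hx"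
  have PQ: "X # \<Gamma> \<turnstile> Pi ?N ?I \<Ztypecolon> \<T>" by simp
  note [simp] = funD[OF Q PQ]
  have Cx: "ins 0 1 (Sig P ?E) ?fx = Sig ?Px ?Ex" by (simp add: ext_fam_def)
  have d: "X # \<Gamma> \<turnstile> Dpair ?Px ?Ex ?sx Q \<Ztypecolon> ins 0 1 (Sig P ?E) ?fx" by (simp add: ext_fam_def)
  obtain e where e: "Y # \<Gamma> \<turnstile> e \<Ztypecolon> Sig P ?E" and de: "peq (X # \<Gamma>) (Sig ?Px ?Ex) (Dpair ?Px ?Ex ?sx Q) (ins 0 1 e ?fx)"
    using section_ext[OF M X Y f c C l' d] unfolding Cx by blast
  obtain b q where b: "Y # \<Gamma> \<turnstile> b \<Ztypecolon> P" and q0: "Y # \<Gamma> \<turnstile> q \<Ztypecolon> ins 0 0 ?E b" and bq: "peq (Y # \<Gamma>) (Sig P ?E) (Dpair P ?E b q) e"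
    using Sig_ex[OF P E e] by blast
  note [simp] = tmD1[OF b]
  have q: "Y # \<Gamma> \<turnstile> q \<Ztypecolon> Pi ?N (Idt P\<up> ?h b\<up>)" using q0 by (simp add: ext_fam_def)
  have Pq: "Y # \<Gamma> \<turnstile> Pi ?N (Idt P\<up> ?h b\<up>) \<Ztypecolon> \<T>" by simp
  note [simp] = funD1[OF q Pq]
  let ?bx = "ins 0 1 b ?fx" and ?qx = "ins 0 1 q ?fx"
  have "peq (X # \<Gamma>) (Sig ?Px ?Ex) (Dpair ?Px ?Ex ?bx ?qx) (ins 0 1 e ?fx)"
    using peq_ins[OF bq, of "X # \<Gamma>" 1 ?fx] by (simp add: ext_fam_def)
  from peq_trans[OF de peq_sym[OF this]]
  have "peq (X # \<Gamma>) (Sig ?Px ?Ex) (Dpair ?Px ?Ex ?sx Q) (Dpair ?Px ?Ex ?bx ?qx)" .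
  then obtain a where a: "X # \<Gamma> \<turnstile> a \<Ztypecolon> Idt ?Px ?sx ?bx" and
    aq: "peq (?N # X # \<Gamma>) (Idt ?Px\<up> ?hx ?bx\<up>) (trR ?Px\<up> ?hx ?sx\<up> (Q\<up> $ v0) ?bx\<up> a\<up>) (?qx\<up> $ v0)"
    using ext_path_elim[OF Nx Px hx, of ?sx ?bx Q ?qx] by auto
  note [simp] = tmD1[OF a]
  have T1: "?N # X # \<Gamma> \<turnstile> ?Px\<up> \<Ztypecolon> \<U>" "?N # X # \<Gamma> \<turnstile> ?hx \<Ztypecolon> ?Px\<up>" "?N # X # \<Gamma> \<turnstile> ?sx\<up> \<Ztypecolon> ?Px\<up>"
    "?N # X # \<Gamma> \<turnstile> ?bx\<up> \<Ztypecolon> ?Px\<up>" by simp_all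
  have T2: "?N # X # \<Gamma> \<turnstile> Idt ?Px\<up> ?sx\<up> ?bx\<up> \<Ztypecolon> \<U>"
    "?N # X # \<Gamma> \<turnstile> a\<up> \<Ztypecolon> Idt ?Px\<up> ?sx\<up> ?bx\<up>" by simp_all
  have "peq (?N # X # \<Gamma>) (Idt ?Px\<up> ?hx ?sx\<up>) (Q\<up> $ v0) ((ins 0 2 w v0) $ v1)"
    using peq_jeq[OF Qw] by simp
  from peq_trans[OF peq_sym[OF trR_cong[OF T1 this peq_refl[OF T2]]] aq]
  have "peq (?N # X # \<Gamma>) (Idt ?Px\<up> ?hx ?bx\<up>) (trR ?Px\<up> ?hx ?sx\<up> ((ins 0 2 w v0) $ v1) ?bx\<up> a\<up>)
     (?qx\<up> $ v0)" .
  from peq_swap[OF X N this] show ?thesis using a b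
    by (intro exI[of _ b] exI[of _ a] exI[of _ "(ins 0 2 q v0) $ v1"]) simp
qed

section \<open>Fibres of precomposition\<close>

text \<open>As with \<open>cst\<close>, only the typing and the computation rule are recorded, for
  all extensions of the context. The precomposition map \<open>c\<close> then remains opaque, and
  \<open>P\<close> is a type over the variable of \<open>Y\<close>.\<close>

definition is_precomp :: "tm list \<Rightarrow> tm \<Rightarrow> tm \<Rightarrow> tm \<Rightarrow> tm \<Rightarrow> tm \<Rightarrow> bool" where
  "is_precomp \<Gamma> X Y f P c \<longleftrightarrow> \<Gamma> \<turnstile> X \<Ztypecolon> \<U> \<and> \<Gamma> \<turnstile> Y \<Ztypecolon> \<U> \<and> \<Gamma> \<turnstile> f \<Ztypecolon> Pi X Y\<up> \<and> Y # \<Gamma> \<turnstile> P \<Ztypecolon> \<U> \<and>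
    \<Gamma> \<turnstile> c \<Ztypecolon> Pi (Pi Y P) (Pi X\<up> (ins 0 2 P (f\<Up> $ v0))) \<and>
    (\<forall>\<Delta> k t x. \<Delta> \<turnstile> ctx \<longrightarrow> k \<le> length \<Delta> \<longrightarrow> drop k \<Delta> = \<Gamma> \<longrightarrow> \<Delta> \<turnstile> t \<Ztypecolon> lift 0 k (Pi Y P) \<longrightarrow> \<Delta> \<turnstile> x \<Ztypecolon> lift 0 k X \<longrightarrow>
      jeqs \<Delta> (ins 0 k P ((lift 0 k f) $ x)) ((lift 0 k c) $ t $ x) (t $ ((lift 0 k f) $ x)))"

lemma is_precompD:
  assumes "is_precomp \<Gamma> X Y f P c"
  shows "\<Gamma> \<turnstile> X \<Ztypecolon> \<U>" "\<Gamma> \<turnstile> Y \<Ztypecolon> \<U>" "\<Gamma> \<turnstile> f \<Ztypecolon> Pi X Y\<up>" "Y # \<Gamma> \<turnstile> P \<Ztypecolon> \<U>"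
    "\<Gamma> \<turnstile> c \<Ztypecolon> Pi (Pi Y P) (Pi X\<up> (ins 0 2 P (f\<Up> $ v0)))"
    "\<Delta> \<turnstile> ctx \<Longrightarrow> k \<le> length \<Delta> \<Longrightarrow> drop k \<Delta> = \<Gamma> \<Longrightarrow> \<Delta> \<turnstile> t \<Ztypecolon> lift 0 k (Pi Y P) \<Longrightarrow> \<Delta> \<turnstile> x \<Ztypecolon> lift 0 k X \<Longrightarrow>
      jeqs \<Delta> (ins 0 k P ((lift 0 k f) $ x)) ((lift 0 k c) $ t $ x) (t $ ((lift 0 k f) $ x))"
    "\<Delta> \<turnstile> ctx \<Longrightarrow> k \<le> length \<Delta> \<Longrightarrow> drop k \<Delta> = \<Gamma> \<Longrightarrow> \<Delta> \<turnstile> t \<Ztypecolon> lift 0 k (Pi Y P) \<Longrightarrow> \<Delta> \<turnstile> x \<Ztypecolon> lift 0 k X \<Longrightarrow>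
      T = ins 0 k P ((lift 0 k f) $ x) \<Longrightarrow> \<Delta> \<turnstile> (lift 0 k c) $ t $ x \<Ztypecolon> T"
  using assms unfolding is_precomp_def jeqs_def by blast+

lemma is_precomp_lift:
  assumes p: "is_precomp \<Gamma> X Y f P c" and \<Delta>: "\<Delta> \<turnstile> ctx" "k \<le> length \<Delta>" "drop k \<Delta> = \<Gamma>"
  shows "is_precomp \<Delta> (lift 0 k X) (lift 0 k Y) (lift 0 k f) (lift 1 k P) (lift 0 k c)"
proof (cases "k = 0")
  case True then show ?thesis using p \<Delta> by simp
next
  case False
  then have "0 < k" by simp
  note [simp] = tyD[OF is_precompD(1)[OF p]] tyD[OF is_precompD(2)[OF p]] tyD1[OF is_precompD(4)[OF p]] \<Delta> \<open>0 < k\<close>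
  show ?thesis unfolding is_precomp_def
  proof (intro conjI allI impI)
    show "\<Delta> \<turnstile> lift 0 k X \<Ztypecolon> \<U>" "\<Delta> \<turnstile> lift 0 k Y \<Ztypecolon> \<U>" by simp_all
    show "\<Delta> \<turnstile> lift 0 k f \<Ztypecolon> Pi (lift 0 k X) (lift 0 k Y)\<up>"
      using lift_ty[OF is_precompD(3)[OF p] \<Delta>] by (simp add: add.commute)
    have "drop (k + 1) (lift 0 k Y # \<Delta>) = \<Gamma>" "k + 1 \<le> length (lift 0 k Y # \<Delta>)"
      using \<Delta> unfolding Suc_eq_plus1[symmetric] by simp_all
    moreover have "lift 0 k Y # \<Delta> \<turnstile> v0 \<Ztypecolon> lift 0 (k + 1) Y" by simp
    ultimately show "lift 0 k Y # \<Delta> \<turnstile> lift 1 k P \<Ztypecolon> \<U>"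
      using tyD1(2)[OF is_precompD(4)[OF p], of "lift 0 k Y # \<Delta>" "k + 1" "v0"] by simp
    show "\<Delta> \<turnstile> lift 0 k c \<Ztypecolon> Pi (Pi (lift 0 k Y) (lift 1 k P)) (Pi (lift 0 k X)\<up> (ins 0 2 (lift 1 k P) ((lift 0 k f)\<Up> $ v0)))"
      using lift_ty[OF is_precompD(5)[OF p] \<Delta>] by (simp add: add.commute)
    fix \<Delta>' k' t x
    assume *: "\<Delta>' \<turnstile> ctx" "k' \<le> length \<Delta>'" "drop k' \<Delta>' = \<Delta>" "\<Delta>' \<turnstile> t \<Ztypecolon> lift 0 k' (Pi (lift 0 k Y) (lift 1 k P))" "\<Delta>' \<turnstile> x \<Ztypecolon> lift 0 k' (lift 0 k X)"
    have "drop (k + k') \<Delta>' = drop k (drop k' \<Delta>')" "length (drop k' \<Delta>') = length \<Delta>' - k'" by simp_all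
    with *(2) \<Delta>(2,3) have d: "drop (k + k') \<Delta>' = \<Gamma>" "k + k' \<le> length \<Delta>'" unfolding *(3) by (simp, arith)
    have t: "\<Delta>' \<turnstile> t \<Ztypecolon> lift 0 (k + k') (Pi Y P)" using *(4) \<open>0 < k\<close> by (cases "k' = 0") (simp_all add: ac_simps)
    show "jeqs \<Delta>' (ins 0 k' (lift 1 k P) ((lift 0 k' (lift 0 k f)) $ x)) ((lift 0 k' (lift 0 k c)) $ t $ x) (t $ ((lift 0 k' (lift 0 k f)) $ x))"
      using is_precompD(6)[OF p *(1) d(2,1) t, of x] *(5) by simp
  qed
qed

text \<open>The left end \<open>c $ t $ x\<close> agrees judgementally with
  \<open>t $ (f $ x)\<close>. Pointwise paths can thus be typed as homotopies along
  \<open>f\<close>, without mentioning \<open>c\<close>.\<close>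

lemma hap_precomp_ty:
  assumes p: "is_precomp \<Gamma> X Y f P c" and t: "\<Gamma> \<turnstile> t \<Ztypecolon> Pi Y P" and s: "\<Gamma> \<turnstile> s \<Ztypecolon> Pi X (ins 0 1 P (f\<up> $ v0))"
    and w: "\<Gamma> \<turnstile> w \<Ztypecolon> Idt (Pi X (ins 0 1 P (f\<up> $ v0))) (c $ t) s" and x: "\<Gamma> \<turnstile> x \<Ztypecolon> X"
    and T: "T = Idt (ins 0 0 P (f $ x)) (t $ (f $ x)) (s $ x)"
  shows "\<Gamma> \<turnstile> hap X (ins 0 1 P (f\<up> $ v0)) (c $ t) s w x \<Ztypecolon> T"
proof -
  note [simp] = tyD[OF is_precompD(1)[OF p]] tyD[OF is_precompD(2)[OF p]] tyD1[OF is_precompD(4)[OF p]] typing_ctx(2)[OF x] x w t s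
    funD[OF is_precompD(3)[OF p] Pi_arg_type[OF is_precompD(1)[OF p] is_precompD(2)[OF p]]]
  have P: "\<Gamma> \<turnstile> Pi (Pi Y P) (Pi X\<up> (ins 0 2 P (f\<Up> $ v0))) \<Ztypecolon> \<T>" by simp
  note [simp] = funD[OF is_precompD(5)[OF p] P]
  have PS: "\<Gamma> \<turnstile> Pi X (ins 0 1 P (f\<up> $ v0)) \<Ztypecolon> \<T>" by simp
  note [simp] = funD[OF s PS]
  have "\<Gamma> \<turnstile> hap X (ins 0 1 P (f\<up> $ v0)) (c $ t) s w x \<Ztypecolon> Idt (ins 0 0 P (f $ x)) (c $ t $ x) (s $ x)"
    by (rule hap_ty(1)) simp_all
  from Idt_conv[OF this, of "t $ (f $ x)" "s $ x"] show ?thesis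
    using is_precompD(6)[OF p, of \<Gamma> 0 t x] jeqs_refl[of \<Gamma> "ins 0 0 P (f $ x)" "s $ x"] unfolding T by simp
qed

text \<open>The fibre family varies in the left end of its path, so transport along \<open>r\<close>
  composes with an inverse. Pointwise the result is \<open>(r (f x))\<inverse> \<cdot> w x\<close>,
  by induction on \<open>r\<close>.\<close>

lemma tr_hap_precomp:
  assumes p: "is_precomp \<Gamma> X Y f P c" and t: "\<Gamma> \<turnstile> t \<Ztypecolon> Pi Y P" and t': "\<Gamma> \<turnstile> t' \<Ztypecolon> Pi Y P" and s: "\<Gamma> \<turnstile> s \<Ztypecolon> Pi X (ins 0 1 P (f\<up> $ v0))"
    and w: "\<Gamma> \<turnstile> w \<Ztypecolon> Idt (Pi X (ins 0 1 P (f\<up> $ v0))) (c $ t) s" and x: "\<Gamma> \<turnstile> x \<Ztypecolon> X"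
    and r: "\<Gamma> \<turnstile> r \<Ztypecolon> Idt (Pi Y P) t t'"
  defines "S \<equiv> Pi X (ins 0 1 P (f\<up> $ v0))"
  shows "peq \<Gamma> (Idt (ins 0 0 P (f $ x)) (t' $ (f $ x)) (s $ x))
    (hap X (ins 0 1 P (f\<up> $ v0)) (c $ t') s (tr (Pi Y P) (Idt S\<up> (c\<up> $ v0) s\<up>) t w t' r) x)
    (trL (ins 0 0 P (f $ x)) (s $ x) (t $ (f $ x)) (hap X (ins 0 1 P (f\<up> $ v0)) (c $ t) s w x) (t' $ (f $ x)) (hap Y P t t' r (f $ x)))"
proof -
  note [simp] = tyD[OF is_precompD(1)[OF p]] tyD[OF is_precompD(2)[OF p]] tyD1[OF is_precompD(4)[OF p]] typing_ctx(2)[OF x] tmD[OF x] tmD[OF w] r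
    funD[OF is_precompD(3)[OF p] Pi_arg_type[OF is_precompD(1)[OF p] is_precompD(2)[OF p]]]
  have P: "\<Gamma> \<turnstile> Pi (Pi Y P) (Pi X\<up> (ins 0 2 P (f\<Up> $ v0))) \<Ztypecolon> \<T>" by simp
  note [simp] = funD[OF is_precompD(5)[OF p] P]
  have PS: "\<Gamma> \<turnstile> Pi X (ins 0 1 P (f\<up> $ v0)) \<Ztypecolon> \<T>" and PY: "\<Gamma> \<turnstile> Pi Y P \<Ztypecolon> \<T>" by simp_all
  note [simp] = funD[OF s PS] funD[OF t PY] funD[OF t' PY]
  let ?SY = "Pi Y P" and ?C = "Idt S\<up> (c\<up> $ v0) s\<up>" and ?Px = "ins 0 1 P (f\<up> $ v0)"
  let ?I = "Idt (ins 0 0 P (f $ x)) (t $ (f $ x)) (s $ x)"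
  let ?D = "Idt ?SY\<up> t\<up> v0 # ?SY # \<Gamma>"
  have D[simp]: "?D \<turnstile> ctx" by simp
  have p2: "is_precomp ?D X\<Up> Y\<Up> f\<Up> (lift 1 2 P) c\<Up>"
    by (rule is_precomp_lift[OF p D]) simp_all
  note h = hap_precomp_ty[OF p2, simplified]
  have j: "jeqs \<Gamma> (ins 0 0 P (f $ x)) (c $ t $ x) (t $ (f $ x))" "jeqs \<Gamma> (ins 0 0 P (f $ x)) (s $ x) (s $ x)"
    using is_precompD(6)[OF p, of \<Gamma> 0 t x] jeqs_refl[of \<Gamma> "ins 0 0 P (f $ x)" "s $ x"] by simp_all
  have SY: "\<Gamma> \<turnstile> ?SY \<Ztypecolon> \<U>" and C: "?SY # \<Gamma> \<turnstile> ?C \<Ztypecolon> \<U>" unfolding S_def by simp_all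
  have w': "\<Gamma> \<turnstile> w \<Ztypecolon> ins 0 0 ?C t" unfolding S_def by simp
  have "peq \<Gamma> (Idt S (c $ t) s) (tr ?SY ?C t w t (Refl ?SY t)) w"
    using tr_ty(2)[OF SY C t w'] by simp
  then have "peq \<Gamma> (Idt (ins 0 0 P (f $ x)) (c $ t $ x) (s $ x)) (hap X ?Px (c $ t) s (tr ?SY ?C t w t (Refl ?SY t)) x) (hap X ?Px (c $ t) s w x)"
    using hap_cong[of \<Gamma> X ?Px "c $ t" s x] unfolding S_def by simp
  from peq_conv[OF this j]
  have "peq \<Gamma> ?I (hap X ?Px (c $ t) s (tr ?SY ?C t w t (Refl ?SY t)) x) (hap X ?Px (c $ t) s w x)" .
  moreover have hw: "\<Gamma> \<turnstile> hap X ?Px (c $ t) s w x \<Ztypecolon> ?I"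
    by (rule hap_precomp_ty[OF p t s w x refl])
  have Pf: "\<Gamma> \<turnstile> ins 0 0 P (f $ x) \<Ztypecolon> \<U>" "\<Gamma> \<turnstile> s $ x \<Ztypecolon> ins 0 0 P (f $ x)" "\<Gamma> \<turnstile> t $ (f $ x) \<Ztypecolon> ins 0 0 P (f $ x)" "\<Gamma> \<turnstile> ?I \<Ztypecolon> \<U>"
    by simp_all
  have "peq \<Gamma> (Idt (ins 0 0 P (f $ x)) (t $ (f $ x)) (t $ (f $ x))) (hap Y P t t (Refl ?SY t) (f $ x)) (Refl (ins 0 0 P (f $ x)) (t $ (f $ x)))"
    using hap_ty(2)[of \<Gamma> Y P t "f $ x"] by simp
  from peq_trans[OF trL_cong[OF Pf(1,2,3,3) peq_refl[OF Pf(4) hw] this] trL_ty(2)[OF Pf(1,2,3) hw]]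
  have "peq \<Gamma> ?I (trL (ins 0 0 P (f $ x)) (s $ x) (t $ (f $ x)) (hap X ?Px (c $ t) s w x) (t $ (f $ x)) (hap Y P t t (Refl ?SY t) (f $ x)))
     (hap X ?Px (c $ t) s w x)" .
  ultimately have 1: "peq \<Gamma> ?I (hap X ?Px (c $ t) s (tr ?SY ?C t w t (Refl ?SY t)) x)
     (trL (ins 0 0 P (f $ x)) (s $ x) (t $ (f $ x)) (hap X ?Px (c $ t) s w x) (t $ (f $ x)) (hap Y P t t (Refl ?SY t) (f $ x)))"
    using peq_trans[OF _ peq_sym] by blast
  then show ?thesis
    by (rule peq_J'[where A="?SY" and a=t and b=t' and p=r and
      T="Idt (ins 0 2 P (f\<Up> $ x\<Up>)) (v1 $ (f\<Up> $ x\<Up>)) (s\<Up> $ x\<Up>)"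
      and l="hap X\<Up> (lift 1 2 ?Px) (c\<Up> $ v1) s\<Up> (tr ?SY\<Up> (lift 1 2 ?C) t\<Up> w\<Up> v1 v0) x\<Up>"
      and r="trL (ins 0 2 P (f\<Up> $ x\<Up>)) (s\<Up> $ x\<Up>) (t\<Up> $ (f\<Up> $ x\<Up>))
         (hap X\<Up> (lift 1 2 ?Px) (c\<Up> $ t\<Up>) s\<Up> w\<Up> x\<Up>) (v1 $ (f\<Up> $ x\<Up>))
         (hap Y\<Up> (lift 1 2 P) t\<Up> v1 v0 (f\<Up> $ x\<Up>))"])
      (simp_all add: S_def h)
qed

definition precomp_fib :: "tm \<Rightarrow> tm \<Rightarrow> tm \<Rightarrow> tm \<Rightarrow> tm \<Rightarrow> tm \<Rightarrow> tm" where
  "precomp_fib X Y f P c s = Sig (Pi Y P) (Idt (Pi X\<up> (ins 0 2 P (f\<Up> $ v0))) (c\<up> $ v0) s\<up>)"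

text \<open>
  \<open>\<delta>\<close> is the section \<open>t\<close> with the path obtained from the homotopy \<open>w x : t (f x) = s x\<close>.
\<close>

definition fib_rep :: "tm list \<Rightarrow> tm \<Rightarrow> tm \<Rightarrow> tm \<Rightarrow> tm \<Rightarrow> tm \<Rightarrow> tm \<Rightarrow> tm \<Rightarrow> tm \<Rightarrow> tm \<Rightarrow> bool" where
  "fib_rep \<Gamma> X Y f P c s \<delta> t w \<longleftrightarrow> \<Gamma> \<turnstile> t \<Ztypecolon> Pi Y P \<and>
    (\<exists>u. \<Gamma> \<turnstile> u \<Ztypecolon> Idt (Pi X (ins 0 1 P (f\<up> $ v0))) (c $ t) s \<and>
      peq \<Gamma> (precomp_fib X Y f P c s) (Dpair (Pi Y P) (Idt (Pi X\<up> (ins 0 2 P (f\<Up> $ v0))) (c\<up> $ v0) s\<up>) t u) \<delta> \<and>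
      peq (X # \<Gamma>) (Idt (ins 0 1 P (f\<up> $ v0)) (t\<up> $ (f\<up> $ v0)) (s\<up> $ v0))
        (hap X\<up> (ins 0 2 P (f\<Up> $ v0)) (c\<up> $ t\<up>) s\<up> u\<up> v0) w)"

lemma fib_rep_intro:
  assumes p: "is_precomp \<Gamma> X Y f P c" and t: "\<Gamma> \<turnstile> t \<Ztypecolon> Pi Y P" and s: "\<Gamma> \<turnstile> s \<Ztypecolon> Pi X (ins 0 1 P (f\<up> $ v0))"
    and w: "X # \<Gamma> \<turnstile> w \<Ztypecolon> Idt (ins 0 1 P (f\<up> $ v0)) (t\<up> $ (f\<up> $ v0)) (s\<up> $ v0)"
  shows "\<exists>\<delta>. \<Gamma> \<turnstile> \<delta> \<Ztypecolon> precomp_fib X Y f P c s \<and> fib_rep \<Gamma> X Y f P c s \<delta> t w"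
proof -
  note [simp] = tyD[OF is_precompD(1)[OF p]] tyD[OF is_precompD(2)[OF p]] tyD1[OF is_precompD(4)[OF p]] typing_ctx(2)[OF t]
    funD[OF is_precompD(3)[OF p] Pi_arg_type[OF is_precompD(1)[OF p] is_precompD(2)[OF p]]]
  have P: "\<Gamma> \<turnstile> Pi (Pi Y P) (Pi X\<up> (ins 0 2 P (f\<Up> $ v0))) \<Ztypecolon> \<T>" by simp
  note [simp] = funD[OF is_precompD(5)[OF p] P]
  have PS: "\<Gamma> \<turnstile> Pi X (ins 0 1 P (f\<up> $ v0)) \<Ztypecolon> \<T>" and PY: "\<Gamma> \<turnstile> Pi Y P \<Ztypecolon> \<T>" by simp_all
  note [simp] = funD[OF s PS] funD[OF t PY]
  let ?Px = "ins 0 1 P (f\<up> $ v0)"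
  have j: "jeqs (X # \<Gamma>) ?Px (c\<up> $ t\<up> $ v0) (t\<up> $ (f\<up> $ v0))"
    "jeqs (X # \<Gamma>) ?Px (s\<up> $ v0) (s\<up> $ v0)"
    using is_precompD(6)[OF p, of "X # \<Gamma>" 1 "t\<up>" "v0"] jeqs_refl[of "X # \<Gamma>" ?Px "s\<up> $ v0"] by simp_all
  have w': "X # \<Gamma> \<turnstile> w \<Ztypecolon> Idt ?Px ((c $ t)\<up> $ v0) (s\<up> $ v0)"
    using Idt_conv[OF w jeqs_sym[OF j(1)] jeqs_sym[OF j(2)]] by simp
  have Px: "X # \<Gamma> \<turnstile> ?Px \<Ztypecolon> \<U>" and ct: "\<Gamma> \<turnstile> c $ t \<Ztypecolon> Pi X ?Px" by simp_all
  obtain u where u: "\<Gamma> \<turnstile> u \<Ztypecolon> Idt (Pi X ?Px) (c $ t) s" and uw: "peq (X # \<Gamma>) (Idt ?Px (c\<up> $ t\<up> $ v0) (s\<up> $ v0))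
     (hap X\<up> (ins 0 2 P (f\<Up> $ v0)) (c\<up> $ t\<up>) s\<up> u\<up> v0) w"
    using funext_path[OF is_precompD(1)[OF p] Px ct s w'] by auto
  note uw' = peq_conv[OF uw j]
  let ?\<delta> = "Dpair (Pi Y P) (Idt (Pi X\<up> (ins 0 2 P (f\<Up> $ v0))) (c\<up> $ v0) s\<up>) t u"
  have \<delta>: "\<Gamma> \<turnstile> ?\<delta> \<Ztypecolon> precomp_fib X Y f P c s" using u by (simp add: precomp_fib_def)
  have "\<Gamma> \<turnstile> precomp_fib X Y f P c s \<Ztypecolon> \<U>" by (simp add: precomp_fib_def)
  have "fib_rep \<Gamma> X Y f P c s ?\<delta> t w" unfolding fib_rep_def
    by (intro conjI t exI[of _ u] u uw' peq_refl[OF \<open>\<Gamma> \<turnstile> precomp_fib X Y f P c s \<Ztypecolon> \<U>\<close> \<delta>])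
  then show ?thesis using \<delta> by blast
qed

lemma fib_rep_ex:
  assumes p: "is_precomp \<Gamma> X Y f P c" and s: "\<Gamma> \<turnstile> s \<Ztypecolon> Pi X (ins 0 1 P (f\<up> $ v0))"
    and \<delta>: "\<Gamma> \<turnstile> \<delta> \<Ztypecolon> precomp_fib X Y f P c s"
  shows "\<exists>t w. \<Gamma> \<turnstile> t \<Ztypecolon> Pi Y P \<and>
    X # \<Gamma> \<turnstile> w \<Ztypecolon> Idt (ins 0 1 P (f\<up> $ v0)) (t\<up> $ (f\<up> $ v0)) (s\<up> $ v0) \<and>
    fib_rep \<Gamma> X Y f P c s \<delta> t w"
proof -
  note [simp] = tyD[OF is_precompD(1)[OF p]] tyD[OF is_precompD(2)[OF p]] tyD1[OF is_precompD(4)[OF p]] typing_ctx(2)[OF s]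
    funD[OF is_precompD(3)[OF p] Pi_arg_type[OF is_precompD(1)[OF p] is_precompD(2)[OF p]]]
  have P: "\<Gamma> \<turnstile> Pi (Pi Y P) (Pi X\<up> (ins 0 2 P (f\<Up> $ v0))) \<Ztypecolon> \<T>" by simp
  note [simp] = funD[OF is_precompD(5)[OF p] P]
  have PS: "\<Gamma> \<turnstile> Pi X (ins 0 1 P (f\<up> $ v0)) \<Ztypecolon> \<T>" and PY: "\<Gamma> \<turnstile> Pi Y P \<Ztypecolon> \<U>" by simp_all
  note [simp] = funD[OF s PS]
  let ?C = "Idt (Pi X\<up> (ins 0 2 P (f\<Up> $ v0))) (c\<up> $ v0) s\<up>"
  have C: "Pi Y P # \<Gamma> \<turnstile> ?C \<Ztypecolon> \<U>" by simp
  obtain t u where t: "\<Gamma> \<turnstile> t \<Ztypecolon> Pi Y P" and u0: "\<Gamma> \<turnstile> u \<Ztypecolon> ins 0 0 ?C t" and tu: "peq \<Gamma> (Sig (Pi Y P) ?C) (Dpair (Pi Y P) ?C t u) \<delta>"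
    using Sig_ex[OF PY C] \<delta> unfolding precomp_fib_def by blast
  note [simp] = funD[OF t ty_Univ[OF PY]]
  have u: "\<Gamma> \<turnstile> u \<Ztypecolon> Idt (Pi X (ins 0 1 P (f\<up> $ v0))) (c $ t) s" using u0 by simp
  note [simp] = tmD[OF u]
  let ?w = "hap X\<up> (ins 0 2 P (f\<Up> $ v0)) (c\<up> $ t\<up>) s\<up> u\<up> v0"
  let ?I = "Idt (ins 0 1 P (f\<up> $ v0)) (t\<up> $ (f\<up> $ v0)) (s\<up> $ v0)"
  have p1: "is_precomp (X # \<Gamma>) X\<up> Y\<up> f\<up> (lift 1 1 P) c\<up>" by (rule is_precomp_lift[OF p]) simp_all
  have w: "X # \<Gamma> \<turnstile> ?w \<Ztypecolon> ?I"
  proof -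
    have 1: "X # \<Gamma> \<turnstile> t\<up> \<Ztypecolon> Pi Y\<up> (lift 1 1 P)" by simp
    have 2: "X # \<Gamma> \<turnstile> s\<up> \<Ztypecolon> Pi X\<up> (ins 0 1 (lift 1 1 P) (f\<up>\<up> $ v0))" by simp
    have 3: "X # \<Gamma> \<turnstile> u\<up> \<Ztypecolon> Idt (Pi X\<up> (ins 0 1 (lift 1 1 P) (f\<up>\<up> $ v0))) (c\<up> $ t\<up>) s\<up>" by simp
    have 4: "X # \<Gamma> \<turnstile> v0 \<Ztypecolon> X\<up>" by simp
    from hap_precomp_ty[OF p1 1 2 3 4 refl] show ?thesis by simp
  qed
  have I: "X # \<Gamma> \<turnstile> ?I \<Ztypecolon> \<U>" by simp
  have "fib_rep \<Gamma> X Y f P c s \<delta> t ?w" unfolding fib_rep_def precomp_fib_def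
    by (intro conjI t exI[of _ u] u tu peq_refl[OF I w])
  then show ?thesis using t w by blast
qed

lemma fib_rep_lift:
  assumes p: "is_precomp \<Gamma> X Y f P c" and s: "\<Gamma> \<turnstile> s \<Ztypecolon> Pi X (ins 0 1 P (f\<up> $ v0))"
    and r: "fib_rep \<Gamma> X Y f P c s \<delta> t w" and N: "\<Gamma> \<turnstile> N \<Ztypecolon> \<U>"
  shows "fib_rep (N # \<Gamma>) X\<up> Y\<up> f\<up> (lift 1 1 P) c\<up> s\<up> \<delta>\<up> t\<up> (ins 0 2 w v0)"
proof -
  note [simp] = tyD[OF is_precompD(1)[OF p]] tyD[OF is_precompD(2)[OF p]] tyD1[OF is_precompD(4)[OF p]] typing_ctx(2)[OF s] tyD[OF N]
  have PY: "\<Gamma> \<turnstile> Pi Y P \<Ztypecolon> \<T>" by simp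
  let ?C = "Idt (Pi X\<up> (ins 0 2 P (f\<Up> $ v0))) (c\<up> $ v0) s\<up>"
  obtain u where t: "\<Gamma> \<turnstile> t \<Ztypecolon> Pi Y P" and u: "\<Gamma> \<turnstile> u \<Ztypecolon> Idt (Pi X (ins 0 1 P (f\<up> $ v0))) (c $ t) s"
    and a: "peq \<Gamma> (precomp_fib X Y f P c s) (Dpair (Pi Y P) ?C t u) \<delta>"
    and b: "peq (X # \<Gamma>) (Idt (ins 0 1 P (f\<up> $ v0)) (t\<up> $ (f\<up> $ v0)) (s\<up> $ v0))
        (hap X\<up> (ins 0 2 P (f\<Up> $ v0)) (c\<up> $ t\<up>) s\<up> u\<up> v0) w"
    using r unfolding fib_rep_def by blast
  have c: "N # \<Gamma> \<turnstile> ctx" and c2: "X\<up> # N # \<Gamma> \<turnstile> ctx" by simp_all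
  show ?thesis unfolding fib_rep_def
  proof (intro conjI exI)
    show "N # \<Gamma> \<turnstile> t\<up> \<Ztypecolon> Pi Y\<up> (lift 1 1 P)" using lift_ty[OF t c, of 1] by simp
    show "N # \<Gamma> \<turnstile> u\<up> \<Ztypecolon> Idt (Pi X\<up> (ins 0 1 (lift 1 1 P) (f\<up>\<up> $ v0))) (c\<up> $ t\<up>) s\<up>"
      using lift_ty[OF u c, of 1] by simp
    show "peq (N # \<Gamma>) (precomp_fib X\<up> Y\<up> f\<up> (lift 1 1 P) c\<up> s\<up>)
       (Dpair (Pi Y\<up> (lift 1 1 P)) (Idt (Pi X\<up>\<up> (ins 0 2 (lift 1 1 P) (f\<up>\<Up> $ v0))) (c\<up>\<up> $ v0) s\<up>\<up>) t\<up> u\<up>) \<delta>\<up>"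
      using peq_lift[OF a c, of 1] by (simp add: precomp_fib_def)
    show "peq (X\<up> # N # \<Gamma>) (Idt (ins 0 1 (lift 1 1 P) (f\<up>\<up> $ v0)) (t\<up>\<up> $ (f\<up>\<up> $ v0)) (s\<up>\<up> $ v0))
        (hap X\<up>\<up> (ins 0 2 (lift 1 1 P) (f\<up>\<Up> $ v0)) (c\<up>\<up> $ t\<up>\<up>) s\<up>\<up> u\<up>\<up> v0) (ins 0 2 w v0)"
      using peq_ins[OF b c2, of 2 "v0"] by simp
  qed
qed

text \<open>The pointwise computation at a generic \<open>x\<close>: it is applied in the context
  extended by \<open>X\<close>, where the transport of the weakened data is the weakened
  transport.\<close>

lemma tr_hap_precomp_var:
  assumes p: "is_precomp \<Gamma> X Y f P c" and t: "\<Gamma> \<turnstile> t \<Ztypecolon> Pi Y P" and t': "\<Gamma> \<turnstile> t' \<Ztypecolon> Pi Y P" and s: "\<Gamma> \<turnstile> s \<Ztypecolon> Pi X (ins 0 1 P (f\<up> $ v0))"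
    and u: "\<Gamma> \<turnstile> u \<Ztypecolon> Idt (Pi X (ins 0 1 P (f\<up> $ v0))) (c $ t) s" and q: "\<Gamma> \<turnstile> q \<Ztypecolon> Idt (Pi Y P) t t'"
  defines "Px \<equiv> ins 0 1 P (f\<up> $ v0)" and "fx \<equiv> f\<up> $ v0"
    and "Px2 \<equiv> ins 0 2 P (f\<Up> $ v0)"
    and "C \<equiv> Idt (Pi X\<up> (ins 0 2 P (f\<Up> $ v0))) (c\<up> $ v0) s\<up>"
  shows "peq (X # \<Gamma>) (Idt Px (t'\<up> $ fx) (s\<up> $ v0))
    (hap X\<up> Px2 (c\<up> $ t'\<up>) s\<up> (tr (Pi Y P) C t u t' q)\<up> v0)
    (trL Px (s\<up> $ v0) (t\<up> $ fx) (hap X\<up> Px2 (c\<up> $ t\<up>) s\<up> u\<up> v0)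
      (t'\<up> $ fx) (hap Y\<up> (ins 0 2 P v0) t\<up> t'\<up> q\<up> fx))"
proof -
  note [simp] = tyD[OF is_precompD(1)[OF p]] tyD[OF is_precompD(2)[OF p]] tyD1[OF is_precompD(4)[OF p]] typing_ctx(2)[OF s]
  have c: "X # \<Gamma> \<turnstile> ctx" by simp
  have p1: "is_precomp (X # \<Gamma>) X\<up> Y\<up> f\<up> (lift 1 1 P) c\<up>" by (rule is_precomp_lift[OF p]) simp_all
  have 1: "X # \<Gamma> \<turnstile> t\<up> \<Ztypecolon> Pi Y\<up> (lift 1 1 P)" "X # \<Gamma> \<turnstile> t'\<up> \<Ztypecolon> Pi Y\<up> (lift 1 1 P)"
    using lift_ty[OF t c, of 1] lift_ty[OF t' c, of 1] by simp_all
  have 2: "X # \<Gamma> \<turnstile> s\<up> \<Ztypecolon> Pi X\<up> (ins 0 1 (lift 1 1 P) (f\<up>\<up> $ v0))"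
    using lift_ty[OF s c, of 1] by simp
  have 3: "X # \<Gamma> \<turnstile> u\<up> \<Ztypecolon> Idt (Pi X\<up> (ins 0 1 (lift 1 1 P) (f\<up>\<up> $ v0))) (c\<up> $ t\<up>) s\<up>"
    using lift_ty[OF u c, of 1] by simp
  have 4: "X # \<Gamma> \<turnstile> v0 \<Ztypecolon> X\<up>" by simp
  have 5: "X # \<Gamma> \<turnstile> q\<up> \<Ztypecolon> Idt (Pi Y\<up> (lift 1 1 P)) t\<up> t'\<up>" using lift_ty[OF q c, of 1] by simp
  show ?thesis using tr_hap_precomp[OF p1 1 2 3 4 5] by (simp add: Px_def fx_def Px2_def C_def)
qed

text \<open>Function extensionality turns the homotopy \<open>r\<close> into a path of sections.
  Over it the second components have to correspond; by \<open>hap_inj\<close> this may be checked at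
  points, where the transported path is \<open>(r (f x))\<inverse> \<cdot> w x\<close>.\<close>

lemma fib_path_intro:
  assumes p: "is_precomp \<Gamma> X Y f P c" and s: "\<Gamma> \<turnstile> s \<Ztypecolon> Pi X (ins 0 1 P (f\<up> $ v0))"
    and d: "fib_rep \<Gamma> X Y f P c s \<delta> t w" and d': "fib_rep \<Gamma> X Y f P c s \<delta>' t' w'"
    and r: "Y # \<Gamma> \<turnstile> r \<Ztypecolon> Idt P (t\<up> $ v0) (t'\<up> $ v0)"
    and e: "peq (X # \<Gamma>) (Idt (ins 0 1 P (f\<up> $ v0)) (t'\<up> $ (f\<up> $ v0)) (s\<up> $ v0))
      (trL (ins 0 1 P (f\<up> $ v0)) (s\<up> $ v0) (t\<up> $ (f\<up> $ v0)) w (t'\<up> $ (f\<up> $ v0))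
         (ins 0 1 r (f\<up> $ v0))) w'"
  shows "peq \<Gamma> (precomp_fib X Y f P c s) \<delta> \<delta>'"
proof -
  note [simp] = tyD[OF is_precompD(1)[OF p]] tyD[OF is_precompD(2)[OF p]] tyD1[OF is_precompD(4)[OF p]] typing_ctx(2)[OF s]
    funD[OF is_precompD(3)[OF p] Pi_arg_type[OF is_precompD(1)[OF p] is_precompD(2)[OF p]]]
  have P: "\<Gamma> \<turnstile> Pi (Pi Y P) (Pi X\<up> (ins 0 2 P (f\<Up> $ v0))) \<Ztypecolon> \<T>" by simp
  note [simp] = funD[OF is_precompD(5)[OF p] P]
  have PS: "\<Gamma> \<turnstile> Pi X (ins 0 1 P (f\<up> $ v0)) \<Ztypecolon> \<T>" and PY: "\<Gamma> \<turnstile> Pi Y P \<Ztypecolon> \<U>" by simp_all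
  note [simp] = funD[OF s PS]
  let ?C = "Idt (Pi X\<up> (ins 0 2 P (f\<Up> $ v0))) (c\<up> $ v0) s\<up>"
  let ?fx = "f\<up> $ v0" and ?sx = "s\<up> $ v0" and ?tx = "t\<up> $ (f\<up> $ v0)" and ?tx' = "t'\<up> $ (f\<up> $ v0)"
  let ?Px = "ins 0 1 P ?fx" and ?Px2 = "ins 0 2 P (f\<Up> $ v0)"
  let ?S = "Pi X ?Px"
  obtain u where t: "\<Gamma> \<turnstile> t \<Ztypecolon> Pi Y P" and u: "\<Gamma> \<turnstile> u \<Ztypecolon> Idt ?S (c $ t) s" and a: "peq \<Gamma> (precomp_fib X Y f P c s) (Dpair (Pi Y P) ?C t u) \<delta>"
    and b: "peq (X # \<Gamma>) (Idt ?Px ?tx ?sx) (hap X\<up> ?Px2 (c\<up> $ t\<up>) s\<up> u\<up> v0) w"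
    using d unfolding fib_rep_def by blast
  obtain u' where t': "\<Gamma> \<turnstile> t' \<Ztypecolon> Pi Y P" and u': "\<Gamma> \<turnstile> u' \<Ztypecolon> Idt ?S (c $ t') s" and a': "peq \<Gamma> (precomp_fib X Y f P c s) (Dpair (Pi Y P) ?C t' u') \<delta>'"
    and b': "peq (X # \<Gamma>) (Idt ?Px ?tx' ?sx) (hap X\<up> ?Px2 (c\<up> $ t'\<up>) s\<up> u'\<up> v0) w'"
    using d' unfolding fib_rep_def by blast
  note [simp] = funD[OF t ty_Univ[OF PY]] funD[OF t' ty_Univ[OF PY]]
  obtain q where q: "\<Gamma> \<turnstile> q \<Ztypecolon> Idt (Pi Y P) t t'" and qr: "peq (Y # \<Gamma>) (Idt P (t\<up> $ v0) (t'\<up> $ v0))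
    (hap Y\<up> (lift 1 1 P) t\<up> t'\<up> q\<up> v0) r"
    using funext_path[OF is_precompD(2)[OF p] is_precompD(4)[OF p] t t' r] by blast
  have qx: "peq (X # \<Gamma>) (Idt ?Px ?tx ?tx') (hap Y\<up> (ins 0 2 P v0) t\<up> t'\<up> q\<up> ?fx) (ins 0 1 r ?fx)"
    using peq_ins[OF qr, of "X # \<Gamma>" 1 ?fx] by simp
  have T: "X # \<Gamma> \<turnstile> ?Px \<Ztypecolon> \<U>" "X # \<Gamma> \<turnstile> ?sx \<Ztypecolon> ?Px" "X # \<Gamma> \<turnstile> ?tx \<Ztypecolon> ?Px" "X # \<Gamma> \<turnstile> ?tx' \<Ztypecolon> ?Px" by simp_all
  let ?tr = "tr (Pi Y P) ?C t u t' q"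
  have h: "peq (X # \<Gamma>) (Idt ?Px ?tx' ?sx) (hap X\<up> ?Px2 (c\<up> $ t'\<up>) s\<up> ?tr\<up> v0)
     (hap X\<up> ?Px2 (c\<up> $ t'\<up>) s\<up> u'\<up> v0)"
    by (rule peq_trans[OF tr_hap_precomp_var[OF p t t' s u q] peq_trans[OF trL_cong[OF T b qx] peq_trans[OF e peq_sym[OF b']]]])
  have j: "jeqs (X # \<Gamma>) ?Px (c\<up> $ t'\<up> $ v0) ?tx'" "jeqs (X # \<Gamma>) ?Px ?sx ?sx"
    using is_precompD(6)[OF p, of "X # \<Gamma>" 1 "t'\<up>" "v0"] jeqs_refl[OF T(1,2)] by simp_all
  have C: "Pi Y P # \<Gamma> \<turnstile> ?C \<Ztypecolon> \<U>" by simp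
  have u0: "\<Gamma> \<turnstile> u \<Ztypecolon> ins 0 0 ?C t" using u by simp
  have tT: "\<Gamma> \<turnstile> ?tr \<Ztypecolon> Idt ?S (c $ t') s"
    using tr_ty(1)[OF PY C t u0 t' q refl] by simp
  have ct: "\<Gamma> \<turnstile> c $ t' \<Ztypecolon> ?S" by simp
  have "peq \<Gamma> (Idt ?S (c $ t') s) ?tr u'"
    by (rule hap_inj[OF is_precompD(1)[OF p] T(1) ct s tT u']) (use peq_conv[OF h jeqs_sym[OF j(1)] jeqs_sym[OF j(2)]] in simp)
  then have "peq \<Gamma> (precomp_fib X Y f P c s) (Dpair (Pi Y P) ?C t u) (Dpair (Pi Y P) ?C t' u')"
    unfolding precomp_fib_def by (intro Sig_path_intro[OF PY C t u0 t' q]) simp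
  from peq_trans[OF peq_sym[OF a] peq_trans[OF this a']] show ?thesis .
qed

text \<open>The homotopy is the pointwise form of the path of sections contained in a path of pairs,
  and its compatibility is the pointwise form of the correspondence of second components.\<close>

lemma fib_path_elim:
  assumes p: "is_precomp \<Gamma> X Y f P c" and s: "\<Gamma> \<turnstile> s \<Ztypecolon> Pi X (ins 0 1 P (f\<up> $ v0))"
    and d: "fib_rep \<Gamma> X Y f P c s \<delta> t w" and d': "fib_rep \<Gamma> X Y f P c s \<delta>' t' w'" and e: "peq \<Gamma> (precomp_fib X Y f P c s) \<delta> \<delta>'"
  shows "\<exists>r. Y # \<Gamma> \<turnstile> r \<Ztypecolon> Idt P (t\<up> $ v0) (t'\<up> $ v0) \<and>
    peq (X # \<Gamma>) (Idt (ins 0 1 P (f\<up> $ v0)) (t'\<up> $ (f\<up> $ v0)) (s\<up> $ v0))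
      (trL (ins 0 1 P (f\<up> $ v0)) (s\<up> $ v0) (t\<up> $ (f\<up> $ v0)) w (t'\<up> $ (f\<up> $ v0))
         (ins 0 1 r (f\<up> $ v0))) w'"
proof -
  note [simp] = tyD[OF is_precompD(1)[OF p]] tyD[OF is_precompD(2)[OF p]] tyD1[OF is_precompD(4)[OF p]] typing_ctx(2)[OF s]
    funD[OF is_precompD(3)[OF p] Pi_arg_type[OF is_precompD(1)[OF p] is_precompD(2)[OF p]]]
  have P: "\<Gamma> \<turnstile> Pi (Pi Y P) (Pi X\<up> (ins 0 2 P (f\<Up> $ v0))) \<Ztypecolon> \<T>" by simp
  note [simp] = funD[OF is_precompD(5)[OF p] P]
  have PS: "\<Gamma> \<turnstile> Pi X (ins 0 1 P (f\<up> $ v0)) \<Ztypecolon> \<T>" and PY: "\<Gamma> \<turnstile> Pi Y P \<Ztypecolon> \<U>" by simp_all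
  note [simp] = funD[OF s PS]
  let ?C = "Idt (Pi X\<up> (ins 0 2 P (f\<Up> $ v0))) (c\<up> $ v0) s\<up>"
  let ?fx = "f\<up> $ v0" and ?sx = "s\<up> $ v0" and ?tx = "t\<up> $ (f\<up> $ v0)" and ?tx' = "t'\<up> $ (f\<up> $ v0)"
  let ?Px = "ins 0 1 P ?fx" and ?Px2 = "ins 0 2 P (f\<Up> $ v0)"
  let ?S = "Pi X ?Px"
  obtain u where t: "\<Gamma> \<turnstile> t \<Ztypecolon> Pi Y P" and u: "\<Gamma> \<turnstile> u \<Ztypecolon> Idt ?S (c $ t) s" and a: "peq \<Gamma> (precomp_fib X Y f P c s) (Dpair (Pi Y P) ?C t u) \<delta>"
    and b: "peq (X # \<Gamma>) (Idt ?Px ?tx ?sx) (hap X\<up> ?Px2 (c\<up> $ t\<up>) s\<up> u\<up> v0) w"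
    using d unfolding fib_rep_def by blast
  obtain u' where t': "\<Gamma> \<turnstile> t' \<Ztypecolon> Pi Y P" and u': "\<Gamma> \<turnstile> u' \<Ztypecolon> Idt ?S (c $ t') s" and a': "peq \<Gamma> (precomp_fib X Y f P c s) (Dpair (Pi Y P) ?C t' u') \<delta>'"
    and b': "peq (X # \<Gamma>) (Idt ?Px ?tx' ?sx) (hap X\<up> ?Px2 (c\<up> $ t'\<up>) s\<up> u'\<up> v0) w'"
    using d' unfolding fib_rep_def by blast
  note [simp] = funD[OF t ty_Univ[OF PY]] funD[OF t' ty_Univ[OF PY]]
  have C: "Pi Y P # \<Gamma> \<turnstile> ?C \<Ztypecolon> \<U>" by simp
  have u0: "\<Gamma> \<turnstile> u \<Ztypecolon> ins 0 0 ?C t" "\<Gamma> \<turnstile> u' \<Ztypecolon> ins 0 0 ?C t'" using u u' by simp_all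
  have "peq \<Gamma> (Sig (Pi Y P) ?C) (Dpair (Pi Y P) ?C t u) (Dpair (Pi Y P) ?C t' u')"
    using peq_trans[OF a peq_trans[OF e peq_sym[OF a']]] unfolding precomp_fib_def .
  then obtain q where q: "\<Gamma> \<turnstile> q \<Ztypecolon> Idt (Pi Y P) t t'" and qu: "peq \<Gamma> (ins 0 0 ?C t') (tr (Pi Y P) ?C t u t' q) u'"
    using Sig_path_elim[OF PY C t u0(1) t' u0(2)] by blast
  note [simp] = tmD[OF q] tmD[OF u] tmD[OF u']
  have T: "X # \<Gamma> \<turnstile> ?Px \<Ztypecolon> \<U>" "X # \<Gamma> \<turnstile> ?sx \<Ztypecolon> ?Px" "X # \<Gamma> \<turnstile> ?tx \<Ztypecolon> ?Px" "X # \<Gamma> \<turnstile> ?tx' \<Ztypecolon> ?Px" by simp_all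
  let ?tr = "tr (Pi Y P) ?C t u t' q"
  let ?r = "hap Y\<up> (ins 0 2 P v0) t\<up> t'\<up> q\<up> v0"
  have r: "Y # \<Gamma> \<turnstile> ?r \<Ztypecolon> Idt P (t\<up> $ v0) (t'\<up> $ v0)" by simp
  have rx: "ins 0 1 ?r ?fx = hap Y\<up> (ins 0 2 P v0) t\<up> t'\<up> q\<up> ?fx" by simp
  have rxT: "X # \<Gamma> \<turnstile> ins 0 1 ?r ?fx \<Ztypecolon> Idt ?Px ?tx ?tx'" "X # \<Gamma> \<turnstile> Idt ?Px ?tx ?tx' \<Ztypecolon> \<U>" by simp_all
  have j: "jeqs (X # \<Gamma>) ?Px (c\<up> $ t'\<up> $ v0) ?tx'" "jeqs (X # \<Gamma>) ?Px ?sx ?sx"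
    using is_precompD(6)[OF p, of "X # \<Gamma>" 1 "t'\<up>" "v0"] jeqs_refl[OF T(1,2)] by simp_all
  have c: "X # \<Gamma> \<turnstile> ctx" by simp
  have "peq (X # \<Gamma>) (Idt (Pi X\<up> ?Px2) (c\<up> $ t'\<up>) s\<up>) ?tr\<up> u'\<up>"
    using peq_lift[OF qu c, of 1] by simp
  then have "peq (X # \<Gamma>) (Idt ?Px (c\<up> $ t'\<up> $ v0) ?sx) (hap X\<up> ?Px2 (c\<up> $ t'\<up>) s\<up> ?tr\<up> v0)
     (hap X\<up> ?Px2 (c\<up> $ t'\<up>) s\<up> u'\<up> v0)"
    using hap_cong[of "X # \<Gamma>" "X\<up>" ?Px2 "c\<up> $ t'\<up>" "s\<up>" "v0" "?tr\<up>" "u'\<up>"] by simp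
  note h = peq_conv[OF this j]
  note k = tr_hap_precomp_var[OF p t t' s u q, folded rx]
  from peq_trans[OF trL_cong[OF T peq_sym[OF b] peq_refl[OF rxT(2,1)]] peq_trans[OF peq_sym[OF k] peq_trans[OF h b']]] r show ?thesis by blast
qed

lemma trL_jeqs_end:
  assumes A: "\<Gamma> \<turnstile> A \<Ztypecolon> \<U>" and c: "\<Gamma> \<turnstile> c \<Ztypecolon> A" and a: "\<Gamma> \<turnstile> a \<Ztypecolon> A" and b: "jeqs \<Gamma> A b b'"
    and q: "\<Gamma> \<turnstile> q \<Ztypecolon> Idt A a c" and p: "\<Gamma> \<turnstile> p \<Ztypecolon> Idt A a b"
  shows "jeqs \<Gamma> (Idt A b c) (trL A c a q b p) (trL A c a q b' p)"
proof -
  note b' = b[unfolded jeqs_def]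
  note [simp] = A tyD[OF A] tmD[OF conjunct1[OF conjunct2[OF b']]] tmD[OF conjunct1[OF conjunct2[OF conjunct2[OF b']]]] tmD[OF a] tmD[OF c] q p typing_ctx(2)[OF A]
  let ?D = "Idt A\<up> a\<up> v0 # A # \<Gamma>"
  have D[simp]: "?D \<turnstile> ctx" by simp
  have P: "?D \<turnstile> Idt A\<Up> v1 c\<Up> \<Ztypecolon> \<T>" by simp
  have p': "\<Gamma> \<turnstile> p \<Ztypecolon> Idt A a b'" by (rule Idt_conv[OF p jeqs_refl b]) simp_all
  have "\<Gamma> \<turnstile> trL A c a q b p \<doteq> trL A c a q b' p \<Ztypecolon> Idt A b c"
    using e_J[OF _ _ P[folded shift_lift] e_refl[OF P[folded shift_lift]], of q q b b' p p] b'
    unfolding trL_def inst2_ins shift_lift by (simp add: e_refl)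
  moreover have "\<Gamma> \<turnstile> trL A c a q b' p \<Ztypecolon> Idt A b c"
    by (rule Idt_conv[OF _ jeqs_sym[OF b] jeqs_refl]) (use p' in simp_all)
  ultimately show ?thesis unfolding jeqs_def by simp
qed

text \<open>The constant element is the section \<open>t'\<close> given by \<open>b\<close>, with
  the inverse of \<open>a\<close> as homotopy to \<open>s\<close>. It equals the given extension
  through \<open>q\<close>: the clause \<open>q = w \<cdot> a\<close> of
  \<open>join_section_ext\<close> turns into the condition
  \<open>q\<inverse> \<cdot> w = a\<inverse>\<close> of \<open>fib_path_intro\<close>.\<close>

lemma fib_ext:
  assumes M: "\<Gamma> \<turnstile> M \<Ztypecolon> \<U>" and N: "\<Gamma> \<turnstile> N \<Ztypecolon> \<U>" and p: "is_precomp \<Gamma> X Y f P g"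
    and c: "\<Gamma> \<turnstile> c \<Ztypecolon> is_connected_map M X Y f"
    and l: "Y # \<Gamma> \<turnstile> l \<Ztypecolon> is_local (join M\<up> N\<up>) P"
    and s: "\<Gamma> \<turnstile> s \<Ztypecolon> Pi X (ins 0 1 P (f\<up> $ v0))"
    and u: "N # \<Gamma> \<turnstile> u \<Ztypecolon> (precomp_fib X Y f P g s)\<up>"
  shows "\<exists>\<delta>. \<Gamma> \<turnstile> \<delta> \<Ztypecolon> precomp_fib X Y f P g s \<and> peq (N # \<Gamma>) (precomp_fib X Y f P g s)\<up> u \<delta>\<up>"
proof -
  note X = is_precompD(1)[OF p] and Y = is_precompD(2)[OF p] and f = is_precompD(3)[OF p] and P = is_precompD(4)[OF p]
  note [simp] = tyD[OF M] tyD[OF N] tyD[OF X] tyD[OF Y] tyD1[OF P] typing_ctx(2)[OF s] funD[OF f Pi_arg_type[OF X Y]]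
  have PS: "\<Gamma> \<turnstile> Pi X (ins 0 1 P (f\<up> $ v0)) \<Ztypecolon> \<T>" by simp
  note [simp] = funD[OF s PS]
  let ?X = "X\<up>" and ?Y = "Y\<up>" and ?f = "f\<up>" and ?P = "lift 1 1 P" and ?g = "g\<up>" and ?s = "s\<up>"
  have D: "(precomp_fib X Y f P g s)\<up> = precomp_fib ?X ?Y ?f ?P ?g ?s" by (simp add: precomp_fib_def)
  have p1: "is_precomp (N # \<Gamma>) ?X ?Y ?f ?P ?g" by (rule is_precomp_lift[OF p]) simp_all
  have s1: "N # \<Gamma> \<turnstile> ?s \<Ztypecolon> Pi ?X (ins 0 1 ?P (?f\<up> $ v0))" by simp
  obtain t w where t: "N # \<Gamma> \<turnstile> t \<Ztypecolon> Pi ?Y ?P" and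
    w0: "?X # N # \<Gamma> \<turnstile> w \<Ztypecolon> Idt (ins 0 1 ?P (?f\<up> $ v0)) (t\<up> $ (?f\<up> $ v0)) (?s\<up> $ v0)"
    and ut: "fib_rep (N # \<Gamma>) ?X ?Y ?f ?P ?g ?s u t w"
    using fib_rep_ex[OF p1 s1 u[unfolded D]] by blast
  have tP: "N # \<Gamma> \<turnstile> Pi ?Y ?P \<Ztypecolon> \<T>" by simp
  note [simp] = funD[OF t tP, simplified]
  let ?fx = "f\<up> $ v0" and ?sx = "s\<up> $ v0"
  let ?Px = "ins 0 1 P ?fx" and ?f2 = "f\<Up> $ v0" and ?s2 = "s\<Up> $ v0"
  let ?P2 = "ins 0 2 P ?f2" and ?t2 = "t\<up> $ ?f2"
  have w: "?X # N # \<Gamma> \<turnstile> w \<Ztypecolon> Idt ?P2 ?t2 ?s2" using w0 by simp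
  have I: "?X # N # \<Gamma> \<turnstile> Idt ?P2 ?t2 ?s2 \<Ztypecolon> \<U>" and X1: "N # \<Gamma> \<turnstile> ?X \<Ztypecolon> \<U>" by simp_all
  obtain W where W: "N # \<Gamma> \<turnstile> W \<Ztypecolon> Pi ?X (Idt ?P2 ?t2 ?s2)" and Ww: "jeqs (?X # N # \<Gamma>) (Idt ?P2 ?t2 ?s2) (W\<up> $ v0) w"
    using lam_ex0[OF X1 I w] by blast
  obtain b a q where b: "Y # \<Gamma> \<turnstile> b \<Ztypecolon> P" and a: "X # \<Gamma> \<turnstile> a \<Ztypecolon> Idt ?Px ?sx (ins 0 1 b ?fx)"
    and q: "?Y # N # \<Gamma> \<turnstile> q \<Ztypecolon> Idt (ins 0 2 P v0) (t\<up> $ v0) (ins 0 2 b v0)"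
    and e: "peq (?X # N # \<Gamma>) (Idt ?P2 ?t2 (ins 0 2 b ?f2)) (trR ?P2 ?t2 ?s2 (W\<up> $ v0) (ins 0 2 b ?f2) (ins 0 2 a v0)) (ins 0 1 q ?f2)"
    using join_section_ext[OF M N X Y f c P l _ s W] t by auto
  note [simp] = tmD1[OF b] tmD1[OF a]
  obtain t' where t': "\<Gamma> \<turnstile> t' \<Ztypecolon> Pi Y P" and tb: "\<And>\<Delta> k a. \<Delta> \<turnstile> ctx \<Longrightarrow> k \<le> length \<Delta> \<Longrightarrow> drop k \<Delta> = \<Gamma> \<Longrightarrow> \<Delta> \<turnstile> a \<Ztypecolon> lift 0 k Y \<Longrightarrow>
    jeqs \<Delta> (ins 0 k P a) ((lift 0 k t') $ a) (ins 0 k b a)"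
    using lam_ex[OF Y P b] by blast
  have PY: "\<Gamma> \<turnstile> Pi Y P \<Ztypecolon> \<T>" by simp
  note [simp] = funD[OF t' PY]
  have tbx: "jeqs (X # \<Gamma>) ?Px (t'\<up> $ ?fx) (ins 0 1 b ?fx)" by (rule tb) simp_all
  have sx: "jeqs (X # \<Gamma>) ?Px ?sx ?sx" by (rule jeqs_refl) simp_all
  \<comment> \<open>Elements of the fibre carry homotopies towards \<open>s\<close>, while
    \<open>a\<close> leads away from \<open>s\<close>.\<close>
  let ?w = "pinv ?Px ?sx (ins 0 1 b ?fx) a"
  have "X # \<Gamma> \<turnstile> ?w \<Ztypecolon> Idt ?Px (ins 0 1 b ?fx) ?sx" by simp
  from Idt_conv[OF this jeqs_sym[OF tbx] sx]
  have w': "X # \<Gamma> \<turnstile> ?w \<Ztypecolon> Idt ?Px (t'\<up> $ ?fx) ?sx" .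
  obtain \<delta> where \<delta>: "\<Gamma> \<turnstile> \<delta> \<Ztypecolon> precomp_fib X Y f P g s" and \<delta>t: "fib_rep \<Gamma> X Y f P g s \<delta> t' ?w"
    using fib_rep_intro[OF p t' s w'] by blast
  note \<delta>t1 = fib_rep_lift[OF p s \<delta>t N]
  have r: "?Y # N # \<Gamma> \<turnstile> q \<Ztypecolon> Idt (ins 0 2 P v0) (t\<up> $ v0) (t'\<Up> $ v0)"
  proof (rule Idt_conv[OF q])
    show "jeqs (?Y # N # \<Gamma>) (ins 0 2 P v0) (t\<up> $ v0) (t\<up> $ v0)" by (rule jeqs_refl) simp_all
    show "jeqs (?Y # N # \<Gamma>) (ins 0 2 P v0) (ins 0 2 b v0) (t'\<Up> $ v0)" by (rule jeqs_sym[OF tb]) simp_all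
  qed
  let ?D = "?X # N # \<Gamma>" and ?b2 = "ins 0 2 b ?f2" and ?a2 = "ins 0 2 a v0" and ?q2 = "ins 0 1 q ?f2"
  have [simp]: "?D \<turnstile> ctx" by simp
  have T: "?D \<turnstile> ?P2 \<Ztypecolon> \<U>" "?D \<turnstile> ?s2 \<Ztypecolon> ?P2" "?D \<turnstile> ?t2 \<Ztypecolon> ?P2" "?D \<turnstile> ?b2 \<Ztypecolon> ?P2" "?D \<turnstile> ?a2 \<Ztypecolon> Idt ?P2 ?s2 ?b2" by simp_all
  have II: "?D \<turnstile> Idt ?P2 ?s2 ?b2 \<Ztypecolon> \<U>" by simp
  have e': "peq ?D (Idt ?P2 ?t2 ?b2) ?q2 (trR ?P2 ?t2 ?s2 w ?b2 ?a2)"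
    by (rule peq_trans[OF peq_sym[OF e] trR_cong[OF T(1,3,2,4) peq_jeq[OF Ww] peq_refl[OF II T(5)]]])
  have q2: "?D \<turnstile> ?q2 \<Ztypecolon> Idt ?P2 ?t2 ?b2" using peqD(2)[OF e'] .
  \<comment> \<open>With \<open>?q2 = w \<cdot> ?a2\<close> the composite
    \<open>?q2\<inverse> \<cdot> w\<close> is the inverse of \<open>?a2\<close>. The value of
    \<open>b\<close> is then exchanged for the judgementally equal value of
    \<open>t'\<close>.\<close>
  have 1: "peq ?D (Idt ?P2 ?b2 ?s2) (trL ?P2 ?s2 ?t2 w ?b2 ?q2) (pinv ?P2 ?s2 ?b2 ?a2)"
    by (rule peq_trans[OF trL_cong[OF T(1,2,3,4) peq_refl[OF I w] e'] trL_trR_inv[OF T(1,3,2,4) w T(5)]])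
  have j: "jeqs ?D ?P2 ?b2 (t'\<Up> $ ?f2)" by (rule jeqs_sym[OF tb]) simp_all
  have 2: "peq ?D (Idt ?P2 (t'\<Up> $ ?f2) ?s2) (trL ?P2 ?s2 ?t2 w (t'\<Up> $ ?f2) ?q2) (pinv ?P2 ?s2 ?b2 ?a2)"
    by (rule peq_conv[OF peq_trans[OF peq_sym[OF peq_jeq[OF trL_jeqs_end[OF T(1,2,3) j w q2]]] 1] j jeqs_refl[OF T(1,2)]])
  have "peq (N # \<Gamma>) (precomp_fib ?X ?Y ?f ?P ?g ?s) u \<delta>\<up>"
    by (rule fib_path_intro[OF p1 s1 ut \<delta>t1, of q]) (use r 2 in simp_all)
  then show ?thesis using \<delta> unfolding D by blast
qed

text \<open>An equality of the two extensions is a homotopy \<open>r\<close> of sections with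
  \<open>(r (f x))\<inverse> \<cdot> w x = w' x\<close>, that is, an extension along
  \<open>f\<close> of \<open>x \<mapsto> w x \<cdot> (w' x)\<inverse>\<close>. The identity types of
  \<open>P\<close> are local for the join, and the equality assumed over \<open>N\<close> yields
  such extensions for a generic \<open>n\<close>, so \<open>join_section_ext\<close> applies to
  these identity types.\<close>

lemma fib_inj:
  assumes M: "\<Gamma> \<turnstile> M \<Ztypecolon> \<U>" and N: "\<Gamma> \<turnstile> N \<Ztypecolon> \<U>" and p: "is_precomp \<Gamma> X Y f P g"
    and c: "\<Gamma> \<turnstile> c \<Ztypecolon> is_connected_map M X Y f"
    and l: "Y # \<Gamma> \<turnstile> l \<Ztypecolon> is_local (join M\<up> N\<up>) P"
    and s: "\<Gamma> \<turnstile> s \<Ztypecolon> Pi X (ins 0 1 P (f\<up> $ v0))"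
    and x: "\<Gamma> \<turnstile> x \<Ztypecolon> precomp_fib X Y f P g s" and y: "\<Gamma> \<turnstile> y \<Ztypecolon> precomp_fib X Y f P g s"
    and e: "peq (N # \<Gamma>) (precomp_fib X Y f P g s)\<up> x\<up> y\<up>"
  shows "peq \<Gamma> (precomp_fib X Y f P g s) x y"
proof -
  note X = is_precompD(1)[OF p] and Y = is_precompD(2)[OF p] and f = is_precompD(3)[OF p] and P = is_precompD(4)[OF p]
  note [simp] = tyD[OF M] tyD[OF N] tyD[OF X] tyD[OF Y] tyD1[OF P] typing_ctx(2)[OF s] funD[OF f Pi_arg_type[OF X Y]]
  have PS: "\<Gamma> \<turnstile> Pi X (ins 0 1 P (f\<up> $ v0)) \<Ztypecolon> \<T>" and PY: "\<Gamma> \<turnstile> Pi Y P \<Ztypecolon> \<T>" by simp_all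
  note [simp] = funD[OF s PS]
  let ?X = "X\<up>" and ?Y = "Y\<up>" and ?f = "f\<up>" and ?P = "lift 1 1 P" and ?g = "g\<up>" and ?s = "s\<up>"
  have D: "(precomp_fib X Y f P g s)\<up> = precomp_fib ?X ?Y ?f ?P ?g ?s" by (simp add: precomp_fib_def)
  have p1: "is_precomp (N # \<Gamma>) ?X ?Y ?f ?P ?g" by (rule is_precomp_lift[OF p]) simp_all
  have s1: "N # \<Gamma> \<turnstile> ?s \<Ztypecolon> Pi ?X (ins 0 1 ?P (?f\<up> $ v0))" by simp
  let ?fx = "f\<up> $ v0" and ?sx = "s\<up> $ v0"
  let ?Px = "ins 0 1 P ?fx" and ?f2 = "f\<Up> $ v0" and ?s2 = "s\<Up> $ v0"
  let ?P2 = "ins 0 2 P ?f2"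
  obtain t w where t: "\<Gamma> \<turnstile> t \<Ztypecolon> Pi Y P" and w: "X # \<Gamma> \<turnstile> w \<Ztypecolon> Idt ?Px (t\<up> $ ?fx) ?sx" and xt: "fib_rep \<Gamma> X Y f P g s x t w"
    using fib_rep_ex[OF p s x] by blast
  obtain t' w' where t': "\<Gamma> \<turnstile> t' \<Ztypecolon> Pi Y P" and w': "X # \<Gamma> \<turnstile> w' \<Ztypecolon> Idt ?Px (t'\<up> $ ?fx) ?sx" and yt: "fib_rep \<Gamma> X Y f P g s y t' w'"
    using fib_rep_ex[OF p s y] by blast
  note [simp] = funD[OF t PY] funD[OF t' PY]
  let ?tx = "t\<up> $ ?fx" and ?tx' = "t'\<up> $ ?fx" and ?t2 = "t\<Up> $ ?f2" and ?t2' = "t'\<Up> $ ?f2"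
  let ?w2 = "ins 0 2 w v0" and ?w2' = "ins 0 2 w' v0"
  let ?D = "?X # N # \<Gamma>"
  have [simp]: "?D \<turnstile> ctx" "?Y # N # \<Gamma> \<turnstile> ctx" by simp_all
  note [simp] = tmD1[OF w] tmD1[OF w']
  obtain r where r: "?Y # N # \<Gamma> \<turnstile> r \<Ztypecolon> Idt (ins 0 2 P v0) (t\<Up> $ v0) (t'\<Up> $ v0)"
    and re: "peq ?D (Idt ?P2 ?t2' ?s2) (trL ?P2 ?s2 ?t2 ?w2 ?t2' (ins 0 1 r ?f2)) ?w2'"
    using fib_path_elim[OF p1 s1 fib_rep_lift[OF p s xt N] fib_rep_lift[OF p s yt N] e[unfolded D]] by auto
  let ?Q = "Idt P (t\<up> $ v0) (t'\<up> $ v0)" and ?Q1 = "Idt (ins 0 2 P v0) (t\<Up> $ v0) (t'\<Up> $ v0)"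
  have Q: "Y # \<Gamma> \<turnstile> ?Q \<Ztypecolon> \<U>" by simp
  have j: "Y # \<Gamma> \<turnstile> join M\<up> N\<up> \<Ztypecolon> \<U>" by (rule join_ty) simp_all
  obtain l' where l': "Y # \<Gamma> \<turnstile> l' \<Ztypecolon> is_local (join M\<up> N\<up>) ?Q"
    using local_Id[OF j P l, of "t\<up> $ v0" "t'\<up> $ v0"] by auto
  have Y1: "N # \<Gamma> \<turnstile> ?Y \<Ztypecolon> \<U>" and Q1: "?Y # N # \<Gamma> \<turnstile> ?Q1 \<Ztypecolon> \<U>" by simp_all
  note [simp] = tmD1[OF r]
  obtain T where T: "N # \<Gamma> \<turnstile> T \<Ztypecolon> Pi ?Y ?Q1" and Tr: "\<And>\<Delta> k a. \<Delta> \<turnstile> ctx \<Longrightarrow> k \<le> length \<Delta> \<Longrightarrow> drop k \<Delta> = N # \<Gamma> \<Longrightarrow> \<Delta> \<turnstile> a \<Ztypecolon> lift 0 k ?Y \<Longrightarrow>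
    jeqs \<Delta> (ins 0 k ?Q1 a) ((lift 0 k T) $ a) (ins 0 k r a)"
    using lam_ex[OF Y1 Q1 r] by blast
  have TP: "N # \<Gamma> \<turnstile> Pi ?Y ?Q1 \<Ztypecolon> \<T>" by simp
  note [simp] = funD[OF T TP]
  \<comment> \<open>The section to be extended, forced by solving the compatibility condition for
    the value of the homotopy at \<open>f x\<close>.\<close>
  let ?S = "trR ?Px ?tx ?sx w ?tx' (pinv ?Px ?tx' ?sx w')" and ?Qx = "Idt ?Px ?tx ?tx'" and ?Q2 = "Idt ?P2 ?t2 ?t2'"
  have Qx: "X # \<Gamma> \<turnstile> ?Qx \<Ztypecolon> \<U>" and S: "X # \<Gamma> \<turnstile> ?S \<Ztypecolon> ?Qx" by simp_all
  obtain s' where s': "\<Gamma> \<turnstile> s' \<Ztypecolon> Pi X ?Qx" and sS: "\<And>\<Delta> k a. \<Delta> \<turnstile> ctx \<Longrightarrow> k \<le> length \<Delta> \<Longrightarrow> drop k \<Delta> = \<Gamma> \<Longrightarrow> \<Delta> \<turnstile> a \<Ztypecolon> lift 0 k X \<Longrightarrow>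
    jeqs \<Delta> (ins 0 k ?Qx a) ((lift 0 k s') $ a) (ins 0 k ?S a)"
    using lam_ex[OF X Qx S] by blast
  have sP: "\<Gamma> \<turnstile> Pi X ?Qx \<Ztypecolon> \<T>" by simp
  note [simp] = funD[OF s' sP]
  let ?S2 = "trR ?P2 ?t2 ?s2 ?w2 ?t2' (pinv ?P2 ?t2' ?s2 ?w2')"
  have T2: "?D \<turnstile> ?P2 \<Ztypecolon> \<U>" "?D \<turnstile> ?t2 \<Ztypecolon> ?P2" "?D \<turnstile> ?t2' \<Ztypecolon> ?P2" "?D \<turnstile> ?s2 \<Ztypecolon> ?P2" "?D \<turnstile> ins 0 1 r ?f2 \<Ztypecolon> Idt ?P2 ?t2 ?t2'" "?D \<turnstile> ?w2 \<Ztypecolon> Idt ?P2 ?t2 ?s2"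
    "?D \<turnstile> Idt ?P2 ?t2' ?t2' \<Ztypecolon> \<U>" "?D \<turnstile> Refl ?P2 ?t2' \<Ztypecolon> Idt ?P2 ?t2' ?t2'" "?D \<turnstile> Idt ?P2 ?t2 ?s2 \<Ztypecolon> \<U>" by simp_all
  \<comment> \<open>The homotopy obtained from the equality over \<open>N\<close> satisfies the same
    compatibility condition. Solving it there shows that this homotopy restricts along
    \<open>f\<close> to the prescribed section.\<close>
  have "peq ?D (Idt ?P2 ?t2 ?t2') (trR ?P2 ?t2 ?s2 ?w2 ?t2' (pinv ?P2 ?t2' ?s2 (trL ?P2 ?s2 ?t2 ?w2 ?t2' (ins 0 1 r ?f2)))) ?S2"
    by (rule trR_cong[OF T2(1,2,4,3) peq_refl[OF T2(9,6)] trL_cong[OF T2(1,3,3,4) peq_refl[OF T2(7,8)] re]])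
  from peq_trans[OF eq_trR_inv_trL[OF T2(1,2,3,4,5,6)] this]
  have 1: "peq ?D ?Q2 (ins 0 1 r ?f2) ?S2" .
  have Tj: "jeqs ?D ?Q2 (T\<up> $ ?f2) (ins 0 1 r ?f2)" using Tr[of ?D 1 ?f2] by simp
  have Sj: "jeqs ?D ?Q2 (s'\<Up> $ v0) ?S2" using sS[of ?D 2 "v0"] by simp
  obtain W where W: "?D \<turnstile> W \<Ztypecolon> Idt ?Q2 (T\<up> $ ?f2) (s'\<Up> $ v0)"
    using peqD(4)[OF peq_trans[OF peq_jeq[OF Tj] peq_trans[OF 1 peq_sym[OF peq_jeq[OF Sj]]]]] by blast
  have W': "N # \<Gamma> \<turnstile> Lam ?X W \<Ztypecolon> Pi ?X (Idt ?Q2 (T\<up> $ ?f2) (s'\<Up> $ v0))"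
    using W by simp
  obtain b a where b: "Y # \<Gamma> \<turnstile> b \<Ztypecolon> ?Q" and a: "X # \<Gamma> \<turnstile> a \<Ztypecolon> Idt ?Qx (s'\<up> $ v0) (ins 0 1 b ?fx)"
    using join_section_ext[OF M N X Y f c Q l', of T s' "Lam ?X W"] T s' W' by auto
  note [simp] = tmD1[OF b]
  have sj: "jeqs (X # \<Gamma>) ?Qx (s'\<up> $ v0) ?S" using sS[of "X # \<Gamma>" 1 "v0"] by simp
  have "peq (X # \<Gamma>) ?Qx (s'\<up> $ v0) (ins 0 1 b ?fx)" by (rule peqI[OF _ _ _ a]) simp_all
  from peq_trans[OF peq_sym[OF this] peq_jeq[OF sj]] have bS: "peq (X # \<Gamma>) ?Qx (ins 0 1 b ?fx) ?S" .
  have T1: "X # \<Gamma> \<turnstile> ?Px \<Ztypecolon> \<U>" "X # \<Gamma> \<turnstile> ?tx \<Ztypecolon> ?Px" "X # \<Gamma> \<turnstile> ?tx' \<Ztypecolon> ?Px" "X # \<Gamma> \<turnstile> ?sx \<Ztypecolon> ?Px" "X # \<Gamma> \<turnstile> Idt ?Px ?tx ?sx \<Ztypecolon> \<U>"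
    "X # \<Gamma> \<turnstile> pinv ?Px ?tx' ?sx w' \<Ztypecolon> Idt ?Px ?sx ?tx'" by simp_all
  \<comment> \<open>Substituting \<open>w \<cdot> w'\<inverse>\<close> for the value of
    \<open>b\<close> at \<open>f x\<close> gives
    \<open>(w \<cdot> w'\<inverse>)\<inverse> \<cdot> w\<close>, which is the double inverse of
    \<open>w'\<close>.\<close>
  have 2: "peq (X # \<Gamma>) (Idt ?Px ?tx' ?sx) (trL ?Px ?sx ?tx w ?tx' (ins 0 1 b ?fx)) w'"
    by (rule peq_trans[OF trL_cong[OF T1(1,4,2,3) peq_refl[OF T1(5) w] bS] peq_trans[OF trL_trR_inv[OF T1(1,2,4,3) w T1(6)] pinv_pinv[OF T1(1,3,4) w']]])
  show ?thesis by (rule fib_path_intro[OF p s xt yt b 2])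
qed

lemma precomp_fib_ty:
  assumes p: "is_precomp \<Gamma> X Y f P g" and s: "\<Gamma> \<turnstile> s \<Ztypecolon> Pi X (ins 0 1 P (f\<up> $ v0))"
  shows "\<Gamma> \<turnstile> precomp_fib X Y f P g s \<Ztypecolon> \<U>"
proof -
  note [simp] = tyD[OF is_precompD(1)[OF p]] tyD[OF is_precompD(2)[OF p]] tyD1[OF is_precompD(4)[OF p]] typing_ctx(2)[OF s]
    funD[OF is_precompD(3)[OF p] Pi_arg_type[OF is_precompD(1)[OF p] is_precompD(2)[OF p]]]
  have P: "\<Gamma> \<turnstile> Pi (Pi Y P) (Pi X\<up> (ins 0 2 P (f\<Up> $ v0))) \<Ztypecolon> \<T>" by simp
  note [simp] = funD[OF is_precompD(5)[OF p] P]
  have PS: "\<Gamma> \<turnstile> Pi X (ins 0 1 P (f\<up> $ v0)) \<Ztypecolon> \<T>" by simp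
  note [simp] = funD[OF s PS]
  show ?thesis by (simp add: precomp_fib_def)
qed

lemma fib_local:
  assumes M: "\<Gamma> \<turnstile> M \<Ztypecolon> \<U>" and N: "\<Gamma> \<turnstile> N \<Ztypecolon> \<U>" and p: "is_precomp \<Gamma> X Y f P g"
    and c: "\<Gamma> \<turnstile> c \<Ztypecolon> is_connected_map M X Y f"
    and l: "Y # \<Gamma> \<turnstile> l \<Ztypecolon> is_local (join M\<up> N\<up>) P"
    and s: "\<Gamma> \<turnstile> s \<Ztypecolon> Pi X (ins 0 1 P (f\<up> $ v0))"
  shows "\<exists>e. \<Gamma> \<turnstile> e \<Ztypecolon> is_local N (precomp_fib X Y f P g s)"
proof (rule local_intro[OF N])
  note X = is_precompD(1)[OF p] and Y = is_precompD(2)[OF p] and f = is_precompD(3)[OF p] and P = is_precompD(4)[OF p]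
  note [simp] = tyD[OF M] tyD[OF N] tyD[OF X] tyD[OF Y] tyD1[OF P] tmD1[OF l] typing_ctx(2)[OF s] funD[OF f Pi_arg_type[OF X Y]]
  have Pg: "\<Gamma> \<turnstile> Pi (Pi Y P) (Pi X\<up> (ins 0 2 P (f\<Up> $ v0))) \<Ztypecolon> \<T>" by simp
  note [simp] = funD[OF is_precompD(5)[OF p] Pg]
  have PS: "\<Gamma> \<turnstile> Pi X (ins 0 1 P (f\<up> $ v0)) \<Ztypecolon> \<T>" by simp
  note [simp] = funD[OF s PS]
  let ?X = "X\<up>" and ?Y = "Y\<up>" and ?f = "f\<up>" and ?P = "lift 1 1 P" and ?g = "g\<up>" and ?s = "s\<up>"
  let ?F = "precomp_fib X Y f P g s"
  have D: "?F\<up> = precomp_fib ?X ?Y ?f ?P ?g ?s" by (simp add: precomp_fib_def)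
  have D2: "?F\<Up> = (precomp_fib ?X ?Y ?f ?P ?g ?s)\<up>" by (simp add: precomp_fib_def)
  show F: "\<Gamma> \<turnstile> ?F \<Ztypecolon> \<U>" by (simp add: precomp_fib_def)
  note [simp] = tyD[OF F]
  \<comment> \<open>The two requirements of \<open>local_intro\<close> live over one additional
    variable, of different types. All data are weakened at once for a variable of an arbitrary type
    \<open>M'\<close>.\<close>
  have ext: "M' # \<Gamma> \<turnstile> M\<up> \<Ztypecolon> \<U>" "M' # \<Gamma> \<turnstile> N\<up> \<Ztypecolon> \<U>" "is_precomp (M' # \<Gamma>) ?X ?Y ?f ?P ?g" "M' # \<Gamma> \<turnstile> c\<up> \<Ztypecolon> is_connected_map M\<up> ?X ?Y ?f"
    "?Y # M' # \<Gamma> \<turnstile> ins 0 2 l v0 \<Ztypecolon> is_local (join M\<up>\<up> N\<up>\<up>) ?P"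
    "M' # \<Gamma> \<turnstile> ?s \<Ztypecolon> Pi ?X (ins 0 1 ?P (?f\<up> $ v0))" if c': "M' # \<Gamma> \<turnstile> ctx" for M'
  proof -
    show "M' # \<Gamma> \<turnstile> M\<up> \<Ztypecolon> \<U>" "M' # \<Gamma> \<turnstile> N\<up> \<Ztypecolon> \<U>" using c' by simp_all
    show "is_precomp (M' # \<Gamma>) ?X ?Y ?f ?P ?g" by (rule is_precomp_lift[OF p c']) simp_all
    show "M' # \<Gamma> \<turnstile> c\<up> \<Ztypecolon> is_connected_map M\<up> ?X ?Y ?f"
      using lift_ty[OF c c', of 1] by (simp add: is_connected_map_lift is_connected_lift)
    show "?Y # M' # \<Gamma> \<turnstile> ins 0 2 l v0 \<Ztypecolon> is_local (join M\<up>\<up> N\<up>\<up>) ?P"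
      using c' by simp
    show "M' # \<Gamma> \<turnstile> ?s \<Ztypecolon> Pi ?X (ins 0 1 ?P (?f\<up> $ v0))" using c' by simp
  qed
  have G: "Pi N ?F\<up> # \<Gamma> \<turnstile> ctx" and G2: "?F # \<Gamma> \<turnstile> ctx" by simp_all
  have u: "N\<up> # Pi N ?F\<up> # \<Gamma> \<turnstile> v1 $ v0 \<Ztypecolon> (precomp_fib ?X ?Y ?f ?P ?g ?s)\<up>"
    unfolding D2[symmetric] by simp
  show "\<exists>t. Pi N ?F\<up> # \<Gamma> \<turnstile> t \<Ztypecolon> ?F\<up> \<and>
      peq (N\<up> # Pi N ?F\<up> # \<Gamma>) ?F\<Up> (v1 $ v0) t\<up>"
    unfolding D2 using fib_ext[OF ext[OF G] u] unfolding D .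
  fix x y assume xy: "?F # \<Gamma> \<turnstile> x \<Ztypecolon> ?F\<up>" "?F # \<Gamma> \<turnstile> y \<Ztypecolon> ?F\<up>"
    "peq (N\<up> # ?F # \<Gamma>) ?F\<Up> x\<up> y\<up>"
  show "peq (?F # \<Gamma>) ?F\<up> x y"
    using fib_inj[OF ext[OF G2], of x y] xy unfolding D2 unfolding D .
qed

lemma precomp_beta:
  assumes X: "\<Gamma> \<turnstile> X \<Ztypecolon> \<U>" and Y: "\<Gamma> \<turnstile> Y \<Ztypecolon> \<U>" and f: "\<Gamma> \<turnstile> f \<Ztypecolon> Pi X Y\<up>" and P: "Y # \<Gamma> \<turnstile> P \<Ztypecolon> \<U>"
  defines "g \<equiv> Lam (Pi Y P) (Lam X\<up> (v1 $ (f\<Up> $ v0)))"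
  shows "\<Gamma> \<turnstile> g \<Ztypecolon> Pi (Pi Y P) (Pi X\<up> (ins 0 2 P (f\<Up> $ v0)))"
    and "\<Gamma> \<turnstile> t \<Ztypecolon> Pi Y P \<Longrightarrow> \<Gamma> \<turnstile> x \<Ztypecolon> X \<Longrightarrow> jeqs \<Gamma> (ins 0 0 P (f $ x)) (g $ t $ x) (t $ (f $ x))"
proof -
  note [simp] = tyD[OF X] tyD[OF Y] tyD1[OF P] typing_ctx(2)[OF f] funD[OF f Pi_arg_type[OF X Y]]
  let ?b = "Lam X\<up> (v1 $ (f\<Up> $ v0))" and ?B = "Pi X\<up> (ins 0 2 P (f\<Up> $ v0))"
  let ?Px = "ins 0 1 P (f\<up> $ v0)"
  have S: "\<Gamma> \<turnstile> Pi Y P \<Ztypecolon> \<T>" and B: "Pi Y P # \<Gamma> \<turnstile> ?B \<Ztypecolon> \<T>" by simp_all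
  have b: "Pi Y P # \<Gamma> \<turnstile> ?b \<Ztypecolon> ?B" by simp
  show g: "\<Gamma> \<turnstile> g \<Ztypecolon> Pi (Pi Y P) ?B" unfolding g_def using b by simp
  assume t: "\<Gamma> \<turnstile> t \<Ztypecolon> Pi Y P" and x: "\<Gamma> \<turnstile> x \<Ztypecolon> X"
  note [simp] = funD[OF t S] tmD[OF x]
  have Px: "X # \<Gamma> \<turnstile> ?Px \<Ztypecolon> \<T>" and tf: "X # \<Gamma> \<turnstile> t\<up> $ (f\<up> $ v0) \<Ztypecolon> ?Px" by simp_all
  have 1: "\<Gamma> \<turnstile> g $ t \<doteq> Lam X (t\<up> $ (f\<up> $ v0)) \<Ztypecolon> Pi X ?Px"
    unfolding g_def using e_beta[OF S B b t] by (simp add: inst_ins)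
  have 2: "\<Gamma> \<turnstile> g $ t $ x \<doteq> (Lam X (t\<up> $ (f\<up> $ v0))) $ x \<Ztypecolon> ins 0 0 P (f $ x)"
    using e_App[OF ty_Univ[OF X] Px 1 e_refl[OF x]] by (simp add: inst_ins)
  have 3: "\<Gamma> \<turnstile> (Lam X (t\<up> $ (f\<up> $ v0))) $ x \<doteq> t $ (f $ x) \<Ztypecolon> ins 0 0 P (f $ x)"
    using e_beta[OF ty_Univ[OF X] Px tf x] by (simp add: inst_ins)
  have gt: "\<Gamma> \<turnstile> g $ t \<Ztypecolon> Pi X ?Px" using App_ty[OF g _ t] by simp
  have "\<Gamma> \<turnstile> g $ t $ x \<Ztypecolon> ins 0 0 P (f $ x)" using App_ty[OF gt _ x] by simp
  with e_trans[OF 2 3] show "jeqs \<Gamma> (ins 0 0 P (f $ x)) (g $ t $ x) (t $ (f $ x))"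
    unfolding jeqs_def by simp
qed

lemma is_precomp_Lam:
  assumes X: "\<Gamma> \<turnstile> X \<Ztypecolon> \<U>" and Y: "\<Gamma> \<turnstile> Y \<Ztypecolon> \<U>" and f: "\<Gamma> \<turnstile> f \<Ztypecolon> Pi X Y\<up>" and P: "Y # \<Gamma> \<turnstile> P \<Ztypecolon> \<U>"
  shows "is_precomp \<Gamma> X Y f P (Lam (Pi Y P) (Lam X\<up> (v1 $ (f\<Up> $ v0))))"
  unfolding is_precomp_def
proof (intro conjI allI impI X Y f P precomp_beta(1))
  fix \<Delta> k t x
  assume d: "\<Delta> \<turnstile> ctx" "k \<le> length \<Delta>" "drop k \<Delta> = \<Gamma>" "\<Delta> \<turnstile> t \<Ztypecolon> lift 0 k (Pi Y P)" "\<Delta> \<turnstile> x \<Ztypecolon> lift 0 k X"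
  let ?g = "Lam (Pi Y P) (Lam X\<up> (v1 $ (f\<Up> $ v0)))"
  show "jeqs \<Delta> (ins 0 k P ((lift 0 k f) $ x)) ((lift 0 k ?g) $ t $ x) (t $ ((lift 0 k f) $ x))"
  \<comment> \<open>The normal form of \<open>lift 1 k P\<close> as an instance of \<open>P\<close>
    holds for positive \<open>k\<close>, so the trivial extension is treated separately.\<close>
  proof (cases "k = 0")
    case True then show ?thesis using precomp_beta(2)[OF X Y f P, of t x] d by simp
  next
    case False
    then have k: "0 < k" by simp
    note [simp] = tyD[OF X] tyD[OF Y] d(1-3) k
    have "drop (k + 1) (lift 0 k Y # \<Delta>) = \<Gamma>" "k + 1 \<le> length (lift 0 k Y # \<Delta>)"
      using d unfolding Suc_eq_plus1[symmetric] by simp_all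
    moreover have "lift 0 k Y # \<Delta> \<turnstile> v0 \<Ztypecolon> lift 0 (k + 1) Y" by simp
    ultimately have P': "lift 0 k Y # \<Delta> \<turnstile> lift 1 k P \<Ztypecolon> \<U>"
      using tyD1(2)[OF P, of "lift 0 k Y # \<Delta>" "k + 1" "v0"] by simp
    have f': "\<Delta> \<turnstile> lift 0 k f \<Ztypecolon> Pi (lift 0 k X) (lift 0 k Y)\<up>"
      using lift_ty[OF f d(1-3)] by (simp add: add.commute)
    have "\<Delta> \<turnstile> t \<Ztypecolon> Pi (lift 0 k Y) (lift 1 k P)" using d(4) by simp
    from precomp_beta(2)[OF _ _ f' P' this d(5)] show ?thesis by (simp add: add.commute)
  qed
qed

theorem theorem6p7:
  fixes \<Gamma> :: "tm list" and M N X Y f P c l :: tm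
  assumes "\<Gamma> \<turnstile> M \<Ztypecolon> \<U>" and "\<Gamma> \<turnstile> N \<Ztypecolon> \<U>" and "\<Gamma> \<turnstile> X \<Ztypecolon> \<U>" and "\<Gamma> \<turnstile> Y \<Ztypecolon> \<U>"
    and "\<Gamma> \<turnstile> f \<Ztypecolon> arr X Y"
    and "\<Gamma> \<turnstile> c \<Ztypecolon> is_connected_map M X Y f"
    and "\<Gamma> \<turnstile> P \<Ztypecolon> arr Y \<U>"
    and "\<Gamma> \<turnstile> l \<Ztypecolon> is_local_family (join M N) Y P"
  shows "\<exists>t. \<Gamma> \<turnstile> t \<Ztypecolon>
           is_local_map N (sections Y P) (sections_along X f P) (precomp X Y f P)"
proof -
  note M = assms(1) and N = assms(2) and X = assms(3) and Y = assms(4) and c = assms(6)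
  have f: "\<Gamma> \<turnstile> f \<Ztypecolon> Pi X Y\<up>" and P: "\<Gamma> \<turnstile> P \<Ztypecolon> Pi Y \<U>" using assms(5,7) by (simp_all add: arr_lift)
  note [simp] = tyD[OF M] tyD[OF N] tyD[OF X] tyD[OF Y] typing_ctx(2)[OF f] funD[OF f Pi_arg_type[OF X Y]]
  have PT: "\<Gamma> \<turnstile> Pi Y \<U> \<Ztypecolon> \<T>" by simp
  note [simp] = funD[OF P PT]
  \<comment> \<open>The function \<open>P\<close> into the universe is replaced by the open type
    \<open>P y\<close> over \<open>Y # \<Gamma>\<close>, the form in which families occur in the
    preceding lemmas.\<close>
  let ?P = "P\<up> $ v0"
  have P1: "Y # \<Gamma> \<turnstile> ?P \<Ztypecolon> \<U>" by simp
  have l: "\<Gamma> \<turnstile> l \<Ztypecolon> Pi Y (is_local (join M\<up> N\<up>) ?P)"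
    using assms(8) by (simp add: is_local_family_def shift_lift)
  have LT: "\<Gamma> \<turnstile> Pi Y (is_local (join M\<up> N\<up>) ?P) \<Ztypecolon> \<T>" by simp
  have l1: "Y # \<Gamma> \<turnstile> l\<up> $ v0 \<Ztypecolon> is_local (join M\<up> N\<up>) ?P"
    using funD(4)[OF l LT, of "Y # \<Gamma>" 1 "v0"] by simp
  let ?g = "precomp X Y f P" and ?S = "sections_along X f P"
  have g: "?g = Lam (Pi Y ?P) (Lam X\<up> (v1 $ (f\<Up> $ v0)))"
    by (simp add: precomp_def sections_def shift_lift)
  have p: "is_precomp \<Gamma> X Y f ?P ?g" unfolding g by (rule is_precomp_Lam[OF X Y f P1])
  have S: "?S = Pi X (P\<up> $ (f\<up> $ v0))"
    by (simp add: sections_along_def shift_lift)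
  have ST: "\<Gamma> \<turnstile> ?S \<Ztypecolon> \<U>" unfolding S by simp
  have c1: "?S # \<Gamma> \<turnstile> ctx" using ctx_ConsI[OF ty_Univ[OF ST]] .
  have l2: "Y\<up> # ?S # \<Gamma> \<turnstile> ctx" using c1 by simp
  have p1: "is_precomp (?S # \<Gamma>) X\<up> Y\<up> f\<up> (lift 1 1 ?P) ?g\<up>"
    by (rule is_precomp_lift[OF p c1]) simp_all
  have s1: "?S # \<Gamma> \<turnstile> v0 \<Ztypecolon> Pi X\<up> (ins 0 1 (lift 1 1 ?P) (f\<up>\<up> $ v0))"
    using c1 by (simp add: S)
  \<comment> \<open>The fibre is taken over a generic section, the variable \<open>0\<close> of type
    \<open>?S\<close>. Its locality is then abstracted over this variable, which gives the statement
    for all fibres.\<close>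
  let ?F = "precomp_fib X\<up> Y\<up> f\<up> (lift 1 1 ?P) ?g\<up> v0"
  have F: "?F = fib (sections Y P)\<up> ?S\<up> ?g\<up> v0"
    by (simp add: precomp_fib_def fib_lift S sections_def shift_lift g)
  have M1: "?S # \<Gamma> \<turnstile> M\<up> \<Ztypecolon> \<U>" and N1: "?S # \<Gamma> \<turnstile> N\<up> \<Ztypecolon> \<U>" using c1 by simp_all
  have c': "?S # \<Gamma> \<turnstile> c\<up> \<Ztypecolon> is_connected_map M\<up> X\<up> Y\<up> f\<up>"
    using lift_ty[OF c c1, of 1] by (simp add: is_connected_map_lift is_connected_lift)
  have l': "Y\<up> # ?S # \<Gamma> \<turnstile> ins 0 2 (l\<up> $ v0) v0 \<Ztypecolon> is_local (join M\<up>\<up> N\<up>\<up>) (lift 1 1 ?P)"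
    using tmD1(2)[OF l1 l2, of 2 "v0"] l2 by simp
  obtain e where "?S # \<Gamma> \<turnstile> e \<Ztypecolon> is_local N\<up> ?F"
    using fib_local[OF M1 N1 p1 c' l' s1] by blast
  from t_Lam[OF ty_Univ[OF ST] is_local_ty[OF N1 precomp_fib_ty[OF p1 s1]] this]
  show ?thesis unfolding is_local_map_def shift_lift F by blast
qed

end
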